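(* Let $(X,d)$ be a metric space. Then $X$ is rectifiable (that is, there are a set $E\subset\mathbb{R}$ and a Lipschitz function $f:E\to X$ with $\mathcal{H}^1(X\setminus f(E))=0$) if and only if $X$ can be written as $$X=\bigcup_{i=1}^\infty X_i$$ with Borel sets $X_i\subset X$ such that $\beta(X_i)<\infty$ for all $i$.
   Context: $\mathcal{H}^1$ denotes the 1-dimensional Hausdorff measure on $X$, and $d(\{z_1,z_2,z_3\})$ denotes the diameter of the set $\{z_1,z_2,z_3\}$. For $z_1,z_2,z_3\in X$, $$\partial(z_1,z_2,z_3)=\min_{\sigma\in S_3}\left(d(z_{\sigma(1)},z_{\sigma(2)})+d(z_{\sigma(2)},z_{\sigma(3)})-d(z_{\sigma(1)},z_{\sigma(3)})\right),$$ where $S_3$ is the set of permutations of $\{1,2,3\}$. For a Borel set $Z\subset X$, $$\beta(Z)=\int_{Z^3}\frac{\partial(z_1,z_2,z_3)}{d(\{z_1,z_2,z_3\})^3}\,d(\mathcal{H}^1)^3(z_1,z_2,z_3).$$ The integrand is taken to be $0$ when $z_1=z_2=z_3$. The integral with respect to $(\mathcal{H}^1)^3$ is understood as the iterated integral in $z_1,z_2,z_3$; no $\sigma$-finiteness of $\mathcal{H}^1$ is assumed. *)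

theory Defs
  imports "HOL-Analysis.Analysis" "HOL-Combinatorics.Permutations"
begin

section \<open>One-dimensional Hausdorff measure\<close>

text \<open>The library function \<^const>\<open>diameter\<close> is real-valued and unspecified on unbounded sets.\<close>

definition ediam :: "'a::metric_space set \<Rightarrow> ennreal" where
  "ediam S = (SUP x\<in>S. SUP y\<in>S. ennreal (dist x y))"

definition hausdorff1_content :: "real \<Rightarrow> 'a::metric_space set \<Rightarrow> ennreal" where
  "hausdorff1_content \<delta> S =
     (INF C\<in>{C :: nat \<Rightarrow> 'a set. S \<subseteq> (\<Union>i. C i) \<and> (\<forall>i. ediam (C i) \<le> ennreal \<delta>)}. \<Sum>i. ediam (C i))"

text \<open>The contents increase as \<open>\<delta>\<close> decreases, so the supremum is the limit for \<open>\<delta> \<rightarrow> 0\<close>.\<close>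

definition hausdorff1_outer :: "'a::metric_space set \<Rightarrow> ennreal" where
  "hausdorff1_outer S = (SUP \<delta>\<in>{0<..}. hausdorff1_content \<delta> S)"

text \<open>\<^const>\<open>measure_of\<close> returns the zero measure unless its argument is countably additive; that
  it is so here is shown in \<open>emeasure_hausdorff1\<close> below.\<close>

definition hausdorff1 :: "'a::metric_space measure" where
  "hausdorff1 = measure_of UNIV (sets borel) hausdorff1_outer"

lemma ediam_empty [simp]: "ediam {} = 0"
  by (simp add: ediam_def bot_ennreal)

lemma ediam_mono: "S \<subseteq> T \<Longrightarrow> ediam S \<le> ediam T"
  unfolding ediam_def by (intro SUP_subset_mono) (auto intro: SUP_subset_mono)

lemma dist_le_ediam: "x \<in> S \<Longrightarrow> y \<in> S \<Longrightarrow> ennreal (dist x y) \<le> ediam S"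
  unfolding ediam_def by (meson SUP_upper2 order_refl)

lemma hausdorff1_content_eq_outer_measure:
  "hausdorff1_content \<delta> S =
     outer_measure UNIV (\<lambda>C. if ediam C \<le> ennreal \<delta> then ediam C else \<infinity>) S"
  (is "_ = outer_measure _ ?f _")
proof (rule antisym)
  interpret ring_of_sets "UNIV :: 'a set" "UNIV :: 'a set set"
    using ring_of_sets_Pow[of UNIV] by simp
  have pos: "positive UNIV ?f" by (simp add: positive_def)
  have inc: "increasing UNIV ?f"
    by (auto simp: increasing_def ediam_mono intro: order_trans[OF ediam_mono])
  show "outer_measure UNIV ?f S \<le> hausdorff1_content \<delta> S"
    unfolding hausdorff1_content_def
  proof (rule INF_greatest, clarify)
    fix C :: "nat \<Rightarrow> 'a set" assume C: "S \<subseteq> (\<Union>i. C i)" "\<forall>i. ediam (C i) \<le> ennreal \<delta>"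
    show "outer_measure UNIV ?f S \<le> (\<Sum>i. ediam (C i))"
      using outer_measure_le[OF pos inc _ C(1)] C(2) by simp
  qed
  show "hausdorff1_content \<delta> S \<le> outer_measure UNIV ?f S"
    unfolding outer_measure_def
  proof (rule INF_greatest, clarify)
    fix C :: "nat \<Rightarrow> 'a set" assume C: "S \<subseteq> (\<Union>i. C i)"
    show "hausdorff1_content \<delta> S \<le> (\<Sum>i. ?f (C i))"
    proof (cases "\<forall>i. ediam (C i) \<le> ennreal \<delta>")
      case True
      then show ?thesis using C unfolding hausdorff1_content_def by (intro INF_lower2[of C]) auto
    next
      case False
      then obtain j where "\<not> ediam (C j) \<le> ennreal \<delta>" by blast
      then have "\<infinity> \<le> (\<Sum>i. ?f (C i))"
        using sum_le_suminf[of "\<lambda>i. ?f (C i)" "{j}"] by simp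
      then show ?thesis by (simp add: top.extremum_unique)
    qed
  qed
qed

lemma outer_measure_space_hausdorff1_content:
  "outer_measure_space UNIV (hausdorff1_content \<delta>)"
proof -
  interpret ring_of_sets "UNIV :: 'a set" "UNIV :: 'a set set"
    using ring_of_sets_Pow[of UNIV] by simp
  have "outer_measure_space (Pow UNIV)
          (outer_measure UNIV (\<lambda>C :: 'a set. if ediam C \<le> ennreal \<delta> then ediam C else \<infinity>))"
    by (intro outer_measure_space_outer_measure)
      (auto simp: positive_def increasing_def ediam_mono intro: order_trans[OF ediam_mono])
  moreover have "hausdorff1_content \<delta> =
          outer_measure UNIV (\<lambda>C :: 'a set. if ediam C \<le> ennreal \<delta> then ediam C else \<infinity>)"
    by (rule ext) (rule hausdorff1_content_eq_outer_measure)
  ultimately show ?thesis by simp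
qed

lemma outer_measure_space_hausdorff1_outer:
  "outer_measure_space UNIV (hausdorff1_outer :: 'a::metric_space set \<Rightarrow> ennreal)"
proof -
  have oms: "outer_measure_space UNIV (hausdorff1_content \<delta> :: 'a set \<Rightarrow> ennreal)" for \<delta>
    by (rule outer_measure_space_hausdorff1_content)
  have "hausdorff1_outer ({} :: 'a set) = 0"
    using oms by (simp add: hausdorff1_outer_def outer_measure_space_def positive_def)
  moreover have "hausdorff1_outer S \<le> hausdorff1_outer T" if "S \<subseteq> T" for S T :: "'a set"
    unfolding hausdorff1_outer_def
    using oms that by (intro SUP_mono) (auto simp: outer_measure_space_def increasing_def)
  moreover have "hausdorff1_outer (\<Union>i. A i) \<le> (\<Sum>i. hausdorff1_outer (A i))"
    if "disjoint_family A" for A :: "nat \<Rightarrow> 'a set"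
    unfolding hausdorff1_outer_def
  proof (rule SUP_least)
    fix \<delta> :: real assume \<delta>: "\<delta> \<in> {0<..}"
    have "hausdorff1_content \<delta> (\<Union>i. A i) \<le> (\<Sum>i. hausdorff1_content \<delta> (A i))"
      using oms that by (simp add: outer_measure_space_def countably_subadditive_def)
    also have "\<dots> \<le> (\<Sum>i. SUP \<delta>\<in>{0<..}. hausdorff1_content \<delta> (A i))"
      using \<delta> by (intro suminf_le SUP_upper) auto
    finally show "hausdorff1_content \<delta> (\<Union>i. A i) \<le> \<dots>" .
  qed
  ultimately show ?thesis
    by (simp add: outer_measure_space_def positive_def increasing_def countably_subadditive_def)
qed

lemma hausdorff1_outer_empty [simp]: "hausdorff1_outer {} = 0"
  using outer_measure_space_hausdorff1_outer by (auto simp: outer_measure_space_def positive_def)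

lemma hausdorff1_outer_mono: "S \<subseteq> T \<Longrightarrow> hausdorff1_outer S \<le> hausdorff1_outer T"
  using outer_measure_space_hausdorff1_outer
  by (auto simp: outer_measure_space_def increasing_def)

lemma hausdorff1_outer_UN_le:
  "disjoint_family A \<Longrightarrow> hausdorff1_outer (\<Union>i. A i) \<le> (\<Sum>i. hausdorff1_outer (A i))"
  using outer_measure_space_hausdorff1_outer
  by (auto simp: outer_measure_space_def countably_subadditive_def)

lemma hausdorff1_outer_Un_le:
  "S \<inter> T = {} \<Longrightarrow> hausdorff1_outer (S \<union> T) \<le> hausdorff1_outer S + hausdorff1_outer T"
proof -
  interpret ring_of_sets "UNIV :: 'a set" "UNIV :: 'a set set"
    using ring_of_sets_Pow[of UNIV] by simp
  assume "S \<inter> T = {}"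
  then show ?thesis
    using countably_subadditive_subadditive[of hausdorff1_outer] outer_measure_space_hausdorff1_outer
    by (auto simp: outer_measure_space_def subadditive_def)
qed

lemma hausdorff1_content_antimono:
  "\<delta> \<le> \<epsilon> \<Longrightarrow> hausdorff1_content \<epsilon> S \<le> hausdorff1_content \<delta> S"
  unfolding hausdorff1_content_def
  by (intro INF_superset_mono) (auto intro: order_trans ennreal_leI)

lemma hausdorff1_content_separated:
  assumes sep: "\<And>x y. x \<in> A \<Longrightarrow> y \<in> B \<Longrightarrow> \<delta> < dist x y" and "0 < \<delta>"
  shows "hausdorff1_content \<delta> A + hausdorff1_content \<delta> B \<le> hausdorff1_content \<delta> (A \<union> B)"
  unfolding hausdorff1_content_def[of _ "A \<union> B"]
proof (rule INF_greatest, clarify)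
  fix C :: "nat \<Rightarrow> 'a set"
  assume C: "A \<union> B \<subseteq> (\<Union>i. C i)" "\<forall>i. ediam (C i) \<le> ennreal \<delta>"
  define D where "D S i = (if C i \<inter> S = {} then {} else C i)" for S i
  have le: "hausdorff1_content \<delta> S \<le> (\<Sum>i. ediam (D S i))" if "S \<subseteq> A \<union> B" for S
    unfolding hausdorff1_content_def using C that
    by (intro INF_lower2[of "D S"]) (auto simp: D_def, blast+)
  have "ediam (D A i) + ediam (D B i) \<le> ediam (C i)" for i
  proof (cases "C i \<inter> A = {} \<or> C i \<inter> B = {}")
    case True
    then show ?thesis by (auto simp: D_def)
  next
    case False
    then obtain x y where xy: "x \<in> C i" "x \<in> A" "y \<in> C i" "y \<in> B" by blast
    then have "ennreal (dist x y) \<le> ennreal \<delta>"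
      using C(2) dist_le_ediam order_trans by metis
    then show ?thesis using sep[OF xy(2,4)] \<open>0 < \<delta>\<close> by (simp add: ennreal_le_iff)
  qed
  then have "(\<Sum>i. ediam (D A i)) + (\<Sum>i. ediam (D B i)) \<le> (\<Sum>i. ediam (C i))"
    by (subst suminf_add) (auto intro!: suminf_le)
  then show "hausdorff1_content \<delta> A + hausdorff1_content \<delta> B \<le> (\<Sum>i. ediam (C i))"
    using add_mono[OF le[of A] le[of B]] by (auto intro: order_trans)
qed

lemma hausdorff1_outer_separated:
  assumes sep: "\<And>x y. x \<in> A \<Longrightarrow> y \<in> B \<Longrightarrow> r \<le> dist x y" and "0 < r"
  shows "hausdorff1_outer A + hausdorff1_outer B \<le> hausdorff1_outer (A \<union> B)"
proof -
  have *: "hausdorff1_content \<delta> A + hausdorff1_content \<epsilon> B \<le> hausdorff1_outer (A \<union> B)"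
    if "0 < \<delta>" "0 < \<epsilon>" for \<delta> \<epsilon>
  proof -
    define \<eta> where "\<eta> = min (r / 2) (min \<delta> \<epsilon>)"
    have \<eta>: "0 < \<eta>" "\<eta> < r" "\<eta> \<le> \<delta>" "\<eta> \<le> \<epsilon>" using that \<open>0 < r\<close> by (auto simp: \<eta>_def)
    have "hausdorff1_content \<delta> A + hausdorff1_content \<epsilon> B
        \<le> hausdorff1_content \<eta> A + hausdorff1_content \<eta> B"
      using \<eta> by (intro add_mono hausdorff1_content_antimono)
    also have "\<dots> \<le> hausdorff1_content \<eta> (A \<union> B)"
      using sep \<eta> by (intro hausdorff1_content_separated) (auto intro: less_le_trans)
    also have "\<dots> \<le> hausdorff1_outer (A \<union> B)"
      unfolding hausdorff1_outer_def using \<eta> by (intro SUP_upper) auto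
    finally show ?thesis .
  qed
  have "hausdorff1_outer A + hausdorff1_content \<epsilon> B \<le> hausdorff1_outer (A \<union> B)" if "0 < \<epsilon>" for \<epsilon>
    unfolding hausdorff1_outer_def[of A]
    by (subst ennreal_SUP_add_left[symmetric]) (auto intro!: SUP_least * that)
  then show ?thesis
    unfolding hausdorff1_outer_def[of B]
    by (subst ennreal_SUP_add_right) (auto intro!: SUP_least)
qed

lemma closed_hausdorff1_caratheodory:
  fixes C T :: "'a::metric_space set"
  assumes "closed C"
  shows "hausdorff1_outer (T \<inter> C) + hausdorff1_outer (T - C) \<le> hausdorff1_outer T"
proof (cases "C = {} \<or> hausdorff1_outer T = \<infinity>")
  case True
  then show ?thesis by auto
next
  case False
  let ?H = "hausdorff1_outer :: 'a set \<Rightarrow> ennreal"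
  have C: "C \<noteq> {}" and fin: "?H T \<noteq> \<infinity>" using False by auto
  define g where "g x = infdist x C" for x
  have g_pos: "0 < g x" if "x \<notin> C" for x
    using in_closed_iff_infdist_zero[OF \<open>closed C\<close> C] that infdist_nonneg[of x C]
    by (simp add: g_def less_le)
  have g_diff: "g x - g y \<le> dist x y" for x y
    using infdist_triangle[of x C y] by (simp add: g_def)
  define D where "D n = {x\<in>T. 1 / (real n + 1) \<le> g x}" for n :: nat
  define R where "R k = {x\<in>T. 1 / (real k + 2) \<le> g x \<and> g x < 1 / (real k + 1)}" for k :: nat

  have "?H (T \<inter> C) + ?H (D n) \<le> ?H T" for n
  proof -
    have "?H (T \<inter> C) + ?H (D n) \<le> ?H ((T \<inter> C) \<union> D n)"
    proof (rule hausdorff1_outer_separated[where r = "1 / (real n + 1)"])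
      fix x y assume "x \<in> T \<inter> C" "y \<in> D n"
      then show "1 / (real n + 1) \<le> dist x y"
        using g_diff[of y x] by (auto simp: D_def g_def dist_commute)
    qed simp
    also have "\<dots> \<le> ?H T" by (intro hausdorff1_outer_mono) (auto simp: D_def)
    finally show ?thesis .
  qed
  note upper = this

  have R_sep: "?H (\<Union>k<n. R (2 * k + p)) + ?H (R (2 * n + p))
      \<le> ?H ((\<Union>k<n. R (2 * k + p)) \<union> R (2 * n + p))" for n p
  proof (cases "n = 0")
    case False
    let ?m = "real (2 * n + p)"
    have m: "0 < ?m" using False by simp
    show ?thesis
    proof (rule hausdorff1_outer_separated[where r = "1 / ?m - 1 / (?m + 1)"])
      fix x y assume x: "x \<in> (\<Union>k<n. R (2 * k + p))" and y: "y \<in> R (2 * n + p)"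
      then obtain k where k: "k < n" "1 / (real (2 * k + p) + 2) \<le> g x" by (auto simp: R_def)
      have "2 * k + p + 2 \<le> 2 * n + p" using k(1) by simp
      then have "real (2 * k + p) + 2 \<le> ?m" by linarith
      then have "1 / ?m \<le> 1 / (real (2 * k + p) + 2)" by (intro divide_left_mono) (use m in auto)
      moreover have "g y < 1 / (?m + 1)" using y by (simp add: R_def)
      ultimately show "1 / ?m - 1 / (?m + 1) \<le> dist x y" using k(2) g_diff[of x y] by linarith
    next
      have "1 / (?m + 1) < 1 / ?m" using m by (intro divide_strict_left_mono) auto
      then show "0 < 1 / ?m - 1 / (?m + 1)" by linarith
    qed
  qed simp
  have R_sum: "(\<Sum>k<n. ?H (R (2 * k + p))) \<le> ?H (\<Union>k<n. R (2 * k + p))" for n p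
  proof (induction n)
    case (Suc n)
    have "(\<Sum>k<Suc n. ?H (R (2 * k + p))) \<le> ?H (\<Union>k<n. R (2 * k + p)) + ?H (R (2 * n + p))"
      using Suc by (simp add: add_right_mono)
    also have "\<dots> \<le> ?H (\<Union>k<Suc n. R (2 * k + p))"
      using R_sep[where n = n and p = p] by (simp add: lessThan_Suc Un_commute)
    finally show ?case .
  qed simp
  have R_le: "(\<Sum>k<n. ?H (R (2 * k + p))) \<le> ?H T" for n p
    by (rule order_trans[OF R_sum hausdorff1_outer_mono]) (auto simp: R_def)
  define s where "s = (\<Sum>k. ?H (R k))"
  have "s \<le> ?H T + ?H T"
    unfolding s_def
  proof (rule suminf_le_const)
    fix n
    have "(\<Sum>k<n. ?H (R k)) \<le> (\<Sum>k<2 * n. ?H (R k))" by (intro sum_mono2) auto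
    also have "(\<Sum>k<2 * n. ?H (R k)) = (\<Sum>k<n. ?H (R (2 * k + 0))) + (\<Sum>k<n. ?H (R (2 * k + 1)))"
      by (induction n) (simp_all add: algebra_simps)
    also have "\<dots> \<le> ?H T + ?H T" by (intro add_mono R_le)
    finally show "(\<Sum>k<n. ?H (R k)) \<le> ?H T + ?H T" .
  qed simp
  then have s_fin: "s \<noteq> \<infinity>" using fin by (auto simp: top_unique)

  have R_disj: "disjoint_family R"
    unfolding disjoint_family_on_def
  proof (intro ballI impI)
    have *: "R i \<inter> R j = {}" if "i < j" for i j
    proof -
      have "1 / (real j + 1) \<le> 1 / (real i + 2)" using that by (intro divide_left_mono) auto
      then show ?thesis by (auto simp: R_def)
    qed
    show "R i \<inter> R j = {}" if "i \<noteq> j" for i j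
      using *[of i j] *[of j i] that by (cases "i < j") auto
  qed

  have lower: "?H (T - C) + (\<Sum>k<n. ?H (R k)) \<le> ?H (D n) + s" for n
  proof -
    have cover: "T - C \<subseteq> D n \<union> (\<Union>k. R (k + n))"
    proof
      fix x assume x: "x \<in> T - C"
      show "x \<in> D n \<union> (\<Union>k. R (k + n))"
      proof (cases "x \<in> D n")
        case False
        let ?P = "\<lambda>m. 1 / (real m + 1) \<le> g x"
        obtain m0 where "inverse (real (Suc m0)) < g x" using reals_Archimedean g_pos x by blast
        then have "?P m0" by (simp add: inverse_eq_divide add.commute)
        define m where "m = (LEAST m. ?P m)"
        have m: "?P m" unfolding m_def by (rule LeastI) fact
        have "n < m"
        proof (rule ccontr)
          assume "\<not> n < m"
          then have "1 / (real n + 1) \<le> 1 / (real m + 1)" by (intro divide_left_mono) auto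
          then show False using False m x by (auto simp: D_def)
        qed
        then obtain k where k: "m = Suc (k + n)" using less_iff_Suc_add[of n m] by (auto simp: add.commute)
        then have "\<not> ?P (k + n)" using not_less_Least[of "k + n" ?P] by (simp add: m_def)
        then have "x \<in> R (k + n)" using m k x by (auto simp: R_def algebra_simps)
        then show ?thesis by blast
      qed simp
    qed
    have disj: "D n \<inter> (\<Union>k. R (k + n)) = {}"
    proof -
      have "D n \<inter> R (k + n) = {}" for k
      proof -
        have "1 / (real (k + n) + 1) \<le> 1 / (real n + 1)" by (intro divide_left_mono) auto
        then show ?thesis unfolding D_def R_def by (auto simp del: of_nat_add)
      qed
      then show ?thesis by blast
    qed
    have "disjoint_family (\<lambda>k. R (k + n))"
      using R_disj by (auto simp: disjoint_family_on_def)
    then have "?H (\<Union>k. R (k + n)) \<le> (\<Sum>k. ?H (R (k + n)))" by (rule hausdorff1_outer_UN_le)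
    then have "?H (T - C) \<le> ?H (D n) + (\<Sum>k. ?H (R (k + n)))"
      using hausdorff1_outer_mono[OF cover] hausdorff1_outer_Un_le[OF disj]
      by (meson add_left_mono order_trans)
    then show ?thesis
      unfolding s_def suminf_offset[OF summableI, of "\<lambda>k. ?H (R k)" n]
      by (metis add.assoc add_right_mono)
  qed

  have "?H (T \<inter> C) + ?H (T - C) + (\<Sum>k<n. ?H (R k)) \<le> ?H T + s" for n
  proof -
    have "?H (T \<inter> C) + ?H (T - C) + (\<Sum>k<n. ?H (R k)) \<le> ?H (T \<inter> C) + (?H (D n) + s)"
      using lower[of n] by (simp add: add.assoc add_left_mono)
    also have "\<dots> \<le> ?H T + s"
      using upper[of n] by (simp add: add.assoc[symmetric] add_right_mono)
    finally show ?thesis .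
  qed
  then have "?H (T \<inter> C) + ?H (T - C) + s \<le> ?H T + s"
    unfolding s_def suminf_eq_SUP
    by (subst ennreal_SUP_add_right) (auto intro!: SUP_least)
  then show ?thesis using s_fin ennreal_add_left_cancel_le[of s] by (metis add.commute)
qed

lemma measure_space_hausdorff1_outer:
  "measure_space UNIV (sets borel) (hausdorff1_outer :: 'a::metric_space set \<Rightarrow> ennreal)"
proof -
  interpret sigma_algebra "UNIV :: 'a set" "UNIV :: 'a set set"
    using sigma_algebra_Pow[of UNIV] by simp
  define L where "L = lambda_system UNIV UNIV (hausdorff1_outer :: 'a set \<Rightarrow> ennreal)"
  have L: "measure_space UNIV L (hausdorff1_outer :: 'a set \<Rightarrow> ennreal)"
    unfolding L_def by (rule caratheodory_lemma[OF outer_measure_space_hausdorff1_outer])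
  have "C \<in> L" if "closed C" for C
  proof -
    have "hausdorff1_outer (T \<inter> C) + hausdorff1_outer (T - C) = hausdorff1_outer T" for T
    proof (rule antisym[OF closed_hausdorff1_caratheodory[OF that]])
      have "T = (T \<inter> C) \<union> (T - C)" by blast
      then show "hausdorff1_outer T \<le> hausdorff1_outer (T \<inter> C) + hausdorff1_outer (T - C)"
        by (metis hausdorff1_outer_Un_le Diff_disjoint inf_assoc inf_bot_right)
    qed
    then show ?thesis by (simp add: L_def lambda_system_eq)
  qed
  then have "sigma_sets UNIV (Collect closed) \<subseteq> L"
    using L by (intro sigma_algebra.sigma_sets_subset) (auto simp: measure_space_def)
  then have "sets borel \<subseteq> L" by (simp add: borel_eq_closed)
  then show ?thesis
    using measure_down[OF L] sets.sigma_algebra_axioms[of borel] by simp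
qed

lemma sets_hausdorff1 [simp, measurable_cong]: "sets (hausdorff1 :: 'a::metric_space measure) = sets borel"
  using sets.sigma_sets_eq[of "borel :: 'a::metric_space measure"] by (simp add: hausdorff1_def)

lemma space_hausdorff1 [simp]: "space hausdorff1 = UNIV"
  by (simp add: hausdorff1_def)

lemma emeasure_hausdorff1:
  "S \<in> sets borel \<Longrightarrow> emeasure hausdorff1 S = hausdorff1_outer S"
  using measure_space_hausdorff1_outer unfolding hausdorff1_def
  by (intro emeasure_measure_of_sigma) (auto simp: measure_space_def)


section \<open>Triples of points and the integral \<open>\<beta>\<close>\<close>

text \<open>The list supplies the values \<open>z\<^sub>1, z\<^sub>2, z\<^sub>3\<close> at the indices \<open>0, 1, 2\<close>.\<close>

definition triangle_excess :: "'a::metric_space \<Rightarrow> 'a \<Rightarrow> 'a \<Rightarrow> real" where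
  "triangle_excess z1 z2 z3 = (let z = (\<lambda>i::nat. [z1, z2, z3] ! i) in
     Min ((\<lambda>\<sigma>. dist (z (\<sigma> 0)) (z (\<sigma> 1)) + dist (z (\<sigma> 1)) (z (\<sigma> 2)) - dist (z (\<sigma> 0)) (z (\<sigma> 2)))
            ` {\<sigma>. \<sigma> permutes {0, 1, 2}}))"

lemma triangle_excess_nonneg: "0 \<le> triangle_excess z1 z2 z3"
  unfolding triangle_excess_def Let_def
  by (subst Min_ge_iff) (auto simp: finite_permutations dist_triangle intro: permutes_id)

text \<open>The integrand vanishes for \<open>z\<^sub>1 = z\<^sub>2 = z\<^sub>3\<close> since \<open>x / 0 = 0\<close>. The integral with
  respect to the cube of Hausdorff measure is an iterated one, as \<^const>\<open>hausdorff1\<close> need not be \<open>\<sigma>\<close>-finite.\<close>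

definition beta :: "'a::metric_space set \<Rightarrow> ennreal" where
  "beta Z = (\<integral>\<^sup>+z1\<in>Z. (\<integral>\<^sup>+z2\<in>Z. (\<integral>\<^sup>+z3\<in>Z.
     ennreal (triangle_excess z1 z2 z3 / diameter {z1, z2, z3} ^ 3)
       \<partial>hausdorff1) \<partial>hausdorff1) \<partial>hausdorff1)"

text \<open>Rectifiability of the whole space \<open>'a\<close>. The exceptional set need not be Borel, hence
  the outer measure.\<close>

definition rectifiable_space :: "'a::metric_space itself \<Rightarrow> bool" where
  "rectifiable_space _ \<longleftrightarrow>
     (\<exists>(E :: real set) (f :: real \<Rightarrow> 'a) L. L-lipschitz_on E f \<and> hausdorff1_outer (UNIV - f ` E) = 0)"

end

theory Submission
  imports Defs "HOL-Complex_Analysis.Great_Picard"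
begin

text \<open>
  Let \<open>f\<close> be Lipschitz on a set of reals. A Vitali covering argument shows that the image of the points where
  the lower metric derivative of \<open>f\<close> vanishes is a null set, and the rest of the domain is a countable union of sets on
  which \<open>f\<close> is bi-Lipschitz. On the closure of the image of such a set the metric becomes a pseudometric \<open>\<rho>\<close> on an
  interval. In the integral of \<open>(\<rho> s t + \<rho> t u - \<rho> s u) / (u - s)\<^sup>3\<close> over \<open>s < t < u\<close>, \<open>e \<le> u - s\<close>, the three terms
  cancel up to a contribution of the strip \<open>t - s < e\<close>, which is bounded independently of \<open>e\<close>.

  Conversely let \<open>\<beta> Z\<close> be finite. The points with positive curvature integral form a \<open>\<sigma>\<close>-finite set, and the other
  ones are, near any of them and up to null sets, isometric to subsets of the line. For sets of finite measure, density
  arguments yield a piece \<open>K\<close> of a ball of radius \<open>R\<close>, with measure at least \<open>R / 4\<close>, with at most linear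
  growth of measure and with tiny curvature at each of its points. Choose \<open>p\<close> and \<open>q\<close> in \<open>K\<close> almost as far apart as possible
  and refine the chain \<open>{p, q}\<close> scale by scale: into each link that is long for the current scale insert a point
  of \<open>K\<close> chosen by Markov's inequality so that the curvature integrals at the vertices stay comparable to those
  over \<open>K\<close>. The total increase of length and the measure of the part of \<open>K\<close> that is not approached by the chains are
  then bounded by the curvature of \<open>K\<close>. A limit of the chains is a Lipschitz image meeting \<open>K\<close> in positive measure, and
  exhaustion finishes the proof.
\<close>

section \<open>The integrand and its semicontinuity\<close>

text \<open>X need be neither separable nor complete, and \<open>hausdorff1\<close> need not be
  \<sigma>-finite, so Tonelli's theorem is not at hand on X. Iterated integrals are measurable
  because the integrand is lower semicontinuous in each variable, and orders of integration are
  exchanged only after transport to the line. Without compactness of X, chains converge only through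
  real functions on a countable set. Chains are ordered by \<open>P\<close>, the distance to
  \<open>p\<close>. The increments of \<open>P\<close> along a chain from \<open>p\<close> to
  \<open>q\<close> add up to \<open>D\<close>, so its length minus \<open>D\<close> is a sum of
  nonnegative defects of links. This turns a bound on the length into control of single links. The
  constants may be read in the order \<open>kap\<close>, \<open>del\<close>, \<open>tau\<close>,
  \<open>A0\<close>, \<open>B0\<close>, \<open>rounds\<close>, \<open>eps0\<close>, each with a
  margin that depends on earlier ones. A refined link is shorter by the factor \<open>qq\<close>,
  barely below 1; the strict gain per scale makes the sums over all scales converge.\<close>

lemma triangle_excess_eq:
  "triangle_excess a b c =
     min (min (dist a b + dist b c - dist a c) (dist a c + dist b c - dist a b)) (dist a b + dist a c - dist b c)"
  (is "_ = ?m")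
proof -
  define z where "z = (\<lambda>i::nat. [a, b, c] ! i)"
  define F where "F = (\<lambda>\<sigma>::nat\<Rightarrow>nat. dist (z (\<sigma> 0)) (z (\<sigma> 1)) + dist (z (\<sigma> 1)) (z (\<sigma> 2)) - dist (z (\<sigma> 0)) (z (\<sigma> 2)))"
  have z: "z 0 = a" "z 1 = b" "z 2 = c" "z (Suc 0) = b" by (auto simp: z_def)
  define P where "P = {\<sigma>. \<sigma> permutes {0, 1, 2::nat}}"
  have te: "triangle_excess a b c = Min (F ` P)"
    unfolding triangle_excess_def Let_def F_def z_def P_def ..
  have fin: "finite P" unfolding P_def by (rule finite_permutations) simp
  have 1: "id \<in> P" by (simp add: P_def permutes_id)
  have 2: "Transposition.transpose 1 2 \<in> P" "Transposition.transpose 0 1 \<in> P" by (auto simp: P_def intro!: permutes_swap_id)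
  have "F id \<in> F ` P" "F (Transposition.transpose 1 2) \<in> F ` P" "F (Transposition.transpose 0 1) \<in> F ` P" using 1 2 by blast+
  then have "Min (F ` P) \<le> F id" "Min (F ` P) \<le> F (Transposition.transpose 1 2)" "Min (F ` P) \<le> F (Transposition.transpose 0 1)"
    using fin by (auto intro: Min_le)
  then have le: "triangle_excess a b c \<le> ?m"
    unfolding te F_def by (simp add: z Transposition.transpose_def dist_commute)
  have "?m \<le> F \<sigma>" if "\<sigma> \<in> P" for \<sigma>
  proof -
    have p: "\<sigma> permutes {0,1,2}" using that by (simp add: P_def)
    have in3: "\<sigma> 0 \<in> {0,1,2}" "\<sigma> 1 \<in> {0,1,2}" "\<sigma> 2 \<in> {0,1,2}"
      using permutes_in_image[OF p] by (metis insertI1 insertI2)+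
    have ne: "\<sigma> 0 \<noteq> \<sigma> 1" "\<sigma> 0 \<noteq> \<sigma> 2" "\<sigma> 1 \<noteq> \<sigma> 2"
      using permutes_inj[OF p] by (metis injD zero_neq_one zero_neq_numeral one_eq_numeral_iff semiring_norm(85))+
    show ?thesis
      using in3 ne unfolding F_def by (auto simp: z dist_commute simp del: One_nat_def)
  qed
  then have "?m \<le> triangle_excess a b c"
    unfolding te using fin 1 by (subst Min_ge_iff) auto
  with le show ?thesis by (rule antisym)
qed

lemma triangle_excess_commute:
  "triangle_excess a b c = triangle_excess b a c" "triangle_excess a b c = triangle_excess a c b"
  unfolding triangle_excess_eq using dist_commute[of a b] dist_commute[of b c] dist_commute[of a c] by linarith+

lemma triangle_excess_degenerate [simp]:
  "triangle_excess a a b = 0" "triangle_excess a b b = 0" "triangle_excess a b a = 0"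
  unfolding triangle_excess_eq by (simp_all add: dist_commute)

lemma diameter_triple:
  "diameter {a, b, c :: 'a :: metric_space} = max (max (dist a b) (dist b c)) (dist a c)"
proof (rule antisym)
  have "(SUP (x, y)\<in>{a, b, c} \<times> {a, b, c}. dist x y) \<le> max (max (dist a b) (dist b c)) (dist a c)"
    by (rule cSUP_least) (auto simp: dist_commute le_max_iff_disj)
  then show "diameter {a, b, c} \<le> max (max (dist a b) (dist b c)) (dist a c)"
    by (simp add: diameter_def)
  have "bounded {a, b, c}" by simp
  then show "max (max (dist a b) (dist b c)) (dist a c) \<le> diameter {a, b, c}"
    by (intro max.boundedI diameter_bounded_bound) auto
qed

definition crv :: "'a::metric_space \<Rightarrow> 'a \<Rightarrow> 'a \<Rightarrow> ennreal" where
  "crv x y z = ennreal (triangle_excess x y z / diameter {x, y, z} ^ 3)"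

lemma crv_commute: "crv a b c = crv b a c" "crv a b c = crv a c b"
  unfolding crv_def using triangle_excess_commute[of a b c]
  by (simp_all add: insert_commute)

lemma crv_degenerate [simp]: "crv a a b = 0" "crv a b b = 0" "crv a b a = 0"
  by (simp_all add: crv_def)

text \<open>Lower semicontinuity, unlike continuity, passes through an integral in another variable
  by Fatou's lemma; sequences suffice in a metric space.\<close>

definition slsc :: "('a::metric_space \<Rightarrow> ennreal) \<Rightarrow> bool" where
  "slsc f \<longleftrightarrow> (\<forall>x X. X \<longlonglongrightarrow> x \<longrightarrow> f x \<le> liminf (\<lambda>n. f (X n)))"

lemma slsc_borel_measurable:
  assumes "slsc f" shows "f \<in> borel_measurable borel"
proof (rule borel_measurableI_le)
  fix c
  have "closed {x. f x \<le> c}"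
    unfolding closed_sequential_limits
  proof (intro allI impI; elim conjE; simp)
    fix X l assume X: "\<forall>n. f (X n) \<le> c" "X \<longlonglongrightarrow> l"
    then have "f l \<le> liminf (\<lambda>n. f (X n))" using assms by (auto simp: slsc_def)
    also have "\<dots> \<le> liminf (\<lambda>n. c)" using X by (intro Liminf_mono) auto
    finally show "f l \<le> c" by (simp add: Liminf_const)
  qed
  then show "{x \<in> space borel. f x \<le> c} \<in> sets borel" by simp
qed

lemma slsc_nn_integral:
  fixes f :: "'a::metric_space \<Rightarrow> 'b \<Rightarrow> ennreal"
  assumes "\<And>x. f x \<in> borel_measurable M" and "\<And>y. slsc (\<lambda>x. f x y)"
  shows "slsc (\<lambda>x. \<integral>\<^sup>+y. f x y \<partial>M)"
  unfolding slsc_def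
proof (intro allI impI)
  fix x and X :: "nat \<Rightarrow> 'a" assume X: "X \<longlonglongrightarrow> x"
  have "(\<integral>\<^sup>+y. f x y \<partial>M) \<le> (\<integral>\<^sup>+y. liminf (\<lambda>n. f (X n) y) \<partial>M)"
    using assms(2) X by (intro nn_integral_mono) (auto simp: slsc_def)
  also have "\<dots> \<le> liminf (\<lambda>n. \<integral>\<^sup>+y. f (X n) y \<partial>M)"
    by (rule nn_integral_liminf) (use assms in auto)
  finally show "(\<integral>\<^sup>+y. f x y \<partial>M) \<le> liminf (\<lambda>n. \<integral>\<^sup>+y. f (X n) y \<partial>M)" .
qed

lemma slsc_indicator_mult:
  fixes f :: "'a::metric_space \<Rightarrow> ennreal"
  assumes "open U" "slsc f" shows "slsc (\<lambda>x. indicator U x * f x)"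
  unfolding slsc_def
proof (intro allI impI)
  fix x and X :: "nat \<Rightarrow> 'a" assume X: "X \<longlonglongrightarrow> x"
  show "indicator U x * f x \<le> liminf (\<lambda>n. indicator U (X n) * f (X n))"
  proof (cases "x \<in> U")
    case True
    have ev: "\<forall>\<^sub>F n in sequentially. X n \<in> U" using X True \<open>open U\<close> topological_tendstoD by blast
    have "f x \<le> liminf (\<lambda>n. f (X n))" using assms(2) X by (auto simp: slsc_def)
    also have "\<dots> = liminf (\<lambda>n. indicator U (X n) * f (X n))"
      by (rule Liminf_eq) (use ev in eventually_elim, auto)
    finally show ?thesis using True by simp
  qed simp
qed

lemma slsc_cmult: "slsc (f :: 'a::metric_space \<Rightarrow> ennreal) \<Longrightarrow> slsc (\<lambda>x. ennreal c * f x)"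
  unfolding slsc_def
proof (intro allI impI)
  fix x and X :: "nat \<Rightarrow> 'a" assume *: "\<forall>x X. X \<longlonglongrightarrow> x \<longrightarrow> f x \<le> liminf (\<lambda>n. f (X n))" "X \<longlonglongrightarrow> x"
  have "ennreal c * f x \<le> ennreal c * liminf (\<lambda>n. f (X n))" using * by (intro mult_left_mono) auto
  also have "\<dots> \<le> liminf (\<lambda>n. ennreal c * f (X n))"
    unfolding liminf_SUP_INF SUP_mult_left_ennreal
    by (intro SUP_mono bexI INF_greatest mult_left_mono INF_lower) auto
  finally show "ennreal c * f x \<le> liminf (\<lambda>n. ennreal c * f (X n))" .
qed

lemma slsc_crv: "slsc (\<lambda>x::'a::metric_space. crv x y z)"
  unfolding slsc_def
proof (intro allI impI)
  fix x and X :: "nat \<Rightarrow> 'a" assume X: "X \<longlonglongrightarrow> x"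
  show "crv x y z \<le> liminf (\<lambda>n. crv (X n) y z)"
  \<comment> \<open>The integrand may jump only where all three points coincide, and there it takes
    its minimum 0. Elsewhere it is continuous.\<close>
  proof (cases "x = y \<and> y = z")
    case False
    have "(\<lambda>n. crv (X n) y z) \<longlonglongrightarrow> crv x y z"
      unfolding crv_def diameter_triple triangle_excess_eq
      by (intro tendsto_intros X) (use False in \<open>auto simp: max_def\<close>)
    then show ?thesis by (metis lim_imp_Liminf order_refl trivial_limit_sequentially)
  qed simp
qed

lemma slsc_crv2: "slsc (\<lambda>x::'a::metric_space. crv y x z)"
proof -
  have "(\<lambda>x. crv y x z) = (\<lambda>x. crv x y z)" by (rule ext) (rule crv_commute(1))
  then show ?thesis using slsc_crv[of y z] by simp
qed

lemma slsc_crv3: "slsc (\<lambda>x::'a::metric_space. crv y z x)"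
proof -
  have "(\<lambda>x. crv y z x) = (\<lambda>x. crv y x z)" by (rule ext) (rule crv_commute(2))
  then show ?thesis using slsc_crv2[of y z] by simp
qed

lemma beta_eq: "beta Z = (\<integral>\<^sup>+z1\<in>Z. (\<integral>\<^sup>+z2\<in>Z. (\<integral>\<^sup>+z3\<in>Z. crv z1 z2 z3 \<partial>hausdorff1) \<partial>hausdorff1) \<partial>hausdorff1)"
  by (simp add: beta_def crv_def)

section \<open>Chains of points\<close>

text \<open>Pairs of consecutive points in the order induced by \<open>f\<close>. The order is given
  by the distance to \<open>p\<close> for chains in X and by the identity for sets of reals.\<close>

definition links :: "('b \<Rightarrow> real) \<Rightarrow> 'b set \<Rightarrow> ('b \<times> 'b) set" where
  "links f V = {(x, y). x \<in> V \<and> y \<in> V \<and> f x < f y \<and> (\<forall>v\<in>V. f v \<le> f x \<or> f y \<le> f v)}"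

lemma linksD:
  assumes "(x, y) \<in> links f V"
  shows "x \<in> V" "y \<in> V" "f x < f y" "\<And>v. v \<in> V \<Longrightarrow> f v \<le> f x \<or> f y \<le> f v"
  using assms by (auto simp: links_def)

lemma links_uminus: "(x, y) \<in> links (\<lambda>x. - f x) V \<longleftrightarrow> (y, x) \<in> links f V"
  by (auto simp: links_def)

lemma finite_links: "finite V \<Longrightarrow> finite (links f V)"
  by (rule finite_subset[of _ "V \<times> V"]) (auto simp: links_def)

text \<open>Insertion is local: every other link survives. This lets a round of refinement treat the
  links one after the other.\<close>

lemma links_insert:
  assumes inj: "inj_on f V" and xy: "(x, y) \<in> links f V" and z: "f x < f z" "f z < f y"
  shows "links f (insert z V) = insert (x, z) (insert (z, y) (links f V - {(x, y)}))"
proof -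
  have x: "x \<in> V" "y \<in> V" "f x < f y" and n: "\<And>v. v \<in> V \<Longrightarrow> f v \<le> f x \<or> f y \<le> f v"
    using linksD[OF xy] by auto
  show ?thesis
  proof (rule set_eqI; clarify)
    fix a b
    show "(a, b) \<in> links f (insert z V) \<longleftrightarrow> (a, b) \<in> insert (x, z) (insert (z, y) (links f V - {(x, y)}))"
    proof
      assume ab: "(a, b) \<in> links f (insert z V)"
      note l = linksD[OF ab]
      consider "a = z" "b = z" | "a = z" "b \<in> V" "b \<noteq> z" | "b = z" "a \<in> V" "a \<noteq> z" | "a \<noteq> z" "b \<noteq> z" "a \<in> V" "b \<in> V"
        using l(1,2) by auto
      then show "(a, b) \<in> insert (x, z) (insert (z, y) (links f V - {(x, y)}))"
      proof cases
        case 1 then show ?thesis using l(3) by simp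
      next
        case 2
        then have "f b = f y" using l(3) l(4)[of y] n[of b] x z by force
        then have "b = y" using inj 2 x by (auto simp: inj_on_def)
        then show ?thesis using 2 by simp
      next
        case 3
        then have "f a = f x" using l(3) l(4)[of x] n[of a] x z by force
        then have "a = x" using inj 3 x by (auto simp: inj_on_def)
        then show ?thesis using 3 by simp
      next
        case 4
        then have "(a, b) \<in> links f V" using ab by (auto simp: links_def)
        moreover have "(a, b) \<noteq> (x, y)" using l(4)[of z] z by auto
        ultimately show ?thesis by simp
      qed
    next
      assume "(a, b) \<in> insert (x, z) (insert (z, y) (links f V - {(x, y)}))"
      then consider "a = x" "b = z" | "a = z" "b = y" | "(a, b) \<in> links f V" "(a, b) \<noteq> (x, y)" by auto
      then show "(a, b) \<in> links f (insert z V)"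
      proof cases
        case 1 then show ?thesis using x n z by (force simp: links_def)
      next
        case 2 then show ?thesis using x n z by (force simp: links_def)
      next
        case 3
        note l = linksD[OF 3(1)]
        have "f z \<le> f a \<or> f b \<le> f z"
        proof (rule ccontr)
          assume "\<not> ?thesis"
          then have az: "f a < f z" "f z < f b" by auto
          have "f a \<le> f x" using n[of a] l az z by force
          moreover have "f y \<le> f b" using n[of b] l az z by force
          moreover have "f x \<le> f a" using l(4)[of x] x calculation by force
          moreover have "f b \<le> f y" using l(4)[of y] x calculation by force
          ultimately have "a = x" "b = y" using inj x l by (auto simp: inj_on_def)
          then show False using 3 by simp
        qed
        then show ?thesis using l by (auto simp: links_def)
      qed
    qed
  qed
qed

lemma sum_links_insert:
  fixes g :: "'b \<Rightarrow> 'b \<Rightarrow> real"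
  assumes "finite V" "inj_on f V" "(x, y) \<in> links f V" "f x < f z" "f z < f y"
  shows "(\<Sum>(a,b)\<in>links f (insert z V). g a b) = (\<Sum>(a,b)\<in>links f V. g a b) + (g x z + g z y - g x y)"
proof -
  have z: "z \<notin> V" using linksD(4)[OF assms(3)] assms(4,5) by force
  have 1: "(x, z) \<notin> insert (z, y) (links f V - {(x, y)})" "(z, y) \<notin> links f V - {(x, y)}"
    using z linksD[OF assms(3)] linksD(1,2)[of _ _ f V] by auto
  have "(\<Sum>(a,b)\<in>links f (insert z V). g a b) = g x z + (g z y + (\<Sum>(a,b)\<in>links f V - {(x, y)}. g a b))"
    unfolding links_insert[OF assms(2-5)] using 1 finite_links[OF assms(1), of f] by (simp add: sum.insert)
  also have "(\<Sum>(a,b)\<in>links f V - {(x, y)}. g a b) = (\<Sum>(a,b)\<in>links f V. g a b) - g x y"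
    using assms(3) finite_links[OF assms(1), of f] by (simp add: sum_diff1)
  finally show ?thesis by simp
qed

text \<open>Induction on the number of points strictly between: such a point splits the pair, and
  without one the pair is itself a link. The level bounds in the hypothesis confine the check to
  links inside the stretch.\<close>

lemma links_chain:
  assumes "finite V" "a \<in> V" "b \<in> V" "f a < f b"
    and step: "\<And>x y. (x, y) \<in> links f V \<Longrightarrow> f a \<le> f x \<Longrightarrow> f y \<le> f b \<Longrightarrow> Q x y"
    and trans: "\<And>x y z. Q x y \<Longrightarrow> Q y z \<Longrightarrow> Q x z"
  shows "Q a b"
  using assms(2-4) step
proof (induction "card {v \<in> V. f a < f v \<and> f v < f b}" arbitrary: a b rule: less_induct)
  case less
  show ?case
  proof (cases "{v \<in> V. f a < f v \<and> f v < f b} = {}")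
    case True
    then have "\<And>v. v \<in> V \<Longrightarrow> f v \<le> f a \<or> f b \<le> f v" by (auto simp: not_less)
    then have "(a, b) \<in> links f V" using less.prems(1-3) by (simp add: links_def)
    then show ?thesis by (rule less.prems(4)) simp_all
  next
    case False
    then obtain v where v: "v \<in> V" "f a < f v" "f v < f b" by auto
    have "{u \<in> V. f a < f u \<and> f u < f v} \<subset> {v \<in> V. f a < f v \<and> f v < f b}" using v by fastforce
    then have c1: "card {u \<in> V. f a < f u \<and> f u < f v} < card {v \<in> V. f a < f v \<and> f v < f b}"
      by (intro psubset_card_mono) (use assms(1) in auto)
    have "{u \<in> V. f v < f u \<and> f u < f b} \<subset> {v \<in> V. f a < f v \<and> f v < f b}" using v by fastforce
    then have c2: "card {u \<in> V. f v < f u \<and> f u < f b} < card {v \<in> V. f a < f v \<and> f v < f b}"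
      by (intro psubset_card_mono) (use assms(1) in auto)
    have "Q a v"
    proof (rule less.hyps[OF c1 less.prems(1) v(1,2)])
      show "Q x y" if "(x, y) \<in> links f V" "f a \<le> f x" "f y \<le> f v" for x y
        by (rule less.prems(4)[OF that(1,2)]) (use that v in linarith)
    qed
    moreover have "Q v b"
    proof (rule less.hyps[OF c2 v(1) less.prems(2) v(3)])
      show "Q x y" if "(x, y) \<in> links f V" "f v \<le> f x" "f y \<le> f b" for x y
        by (rule less.prems(4)[OF that(1) _ that(3)]) (use that v in linarith)
    qed
    ultimately show ?thesis by (rule trans)
  qed
qed

lemma links_locate:
  assumes "finite V" "u \<in> V" "t \<in> V" "f u \<le> c" "c < f t"
  obtains x y where "(x, y) \<in> links f V" "f u \<le> f x" "f x \<le> c" "c < f y" "f y \<le> f t"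
proof -
  define A where "A = {v \<in> V. f v \<le> c}"
  define B where "B = {v \<in> V. c < f v}"
  have "finite A" "A \<noteq> {}" "finite B" "B \<noteq> {}" using assms by (auto simp: A_def B_def)
  then have "Max (f ` A) \<in> f ` A" "Min (f ` B) \<in> f ` B" by auto
  then obtain x y where xy: "x \<in> A" "Max (f ` A) = f x" "y \<in> B" "Min (f ` B) = f y" by auto
  have x: "x \<in> A" "\<And>v. v \<in> A \<Longrightarrow> f v \<le> f x" using xy \<open>finite A\<close> by (auto simp flip: xy(2))
  have y: "y \<in> B" "\<And>v. v \<in> B \<Longrightarrow> f y \<le> f v" using xy \<open>finite B\<close> by (auto simp flip: xy(4))
  have "(x, y) \<in> links f V" unfolding links_def
    using x y by (auto simp: A_def B_def) (meson linorder_le_less_linear)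
  moreover have "f u \<le> f x" "f x \<le> c" "c < f y" "f y \<le> f t" using x y assms by (auto simp: A_def B_def)
  ultimately show ?thesis using that by blast
qed

text \<open>Parametrization by arc length: \<open>T v\<close> is the length of the chain up to
  \<open>v\<close>, so the chain is a 1-Lipschitz image of its parameters.\<close>

lemma links_param:
  fixes V :: "'a::metric_space set"
  assumes "finite V" "inj_on f V"
  obtains T where "\<And>v. v \<in> V \<Longrightarrow> 0 \<le> T v" "\<And>v. v \<in> V \<Longrightarrow> T v \<le> (\<Sum>(a,b)\<in>links f V. dist a b)"
    "\<And>v w. v \<in> V \<Longrightarrow> w \<in> V \<Longrightarrow> dist v w \<le> \<bar>T v - T w\<bar>"
proof -
  define T where "T v = (\<Sum>(a,b)\<in>{(a,b)\<in>links f V. f b \<le> f v}. dist a b)" for v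
  have fin: "finite {(a,b)\<in>links f V. f b \<le> f v}" for v
    by (rule finite_subset[OF _ finite_links[OF assms(1), of f]]) auto
  have main: "dist a b \<le> T b - T a" if "a \<in> V" "b \<in> V" "f a < f b" for a b
  proof (rule links_chain[OF assms(1) that])
    fix x y assume xy: "(x, y) \<in> links f V"
    have "T x + dist x y = (\<Sum>(a,b)\<in>insert (x,y) {(a,b)\<in>links f V. f b \<le> f x}. dist a b)"
      unfolding T_def by (subst sum.insert) (use fin linksD(3)[OF xy] in auto)
    also have "\<dots> \<le> T y"
      unfolding T_def by (rule sum_mono2) (use fin xy linksD[OF xy] in auto)
    finally show "dist x y \<le> T y - T x" by simp
  next
    fix x y z assume "dist x y \<le> T y - T x" "dist y z \<le> T z - T y"
    then show "dist x z \<le> T z - T x" using dist_triangle[of x z y] by linarith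
  qed
  show ?thesis
  proof (rule that[of T])
    show "0 \<le> T v" for v unfolding T_def by (rule sum_nonneg) auto
    show "T v \<le> (\<Sum>(a,b)\<in>links f V. dist a b)" for v
      unfolding T_def by (rule sum_mono2) (use finite_links[OF assms(1)] in auto)
    show "dist v w \<le> \<bar>T v - T w\<bar>" if "v \<in> V" "w \<in> V" for v w
    proof (cases "v = w")
      case False
      then have "f v < f w \<or> f w < f v" using assms(2) that by (metis inj_onD linorder_less_linear)
      then show ?thesis using main[of v w] main[of w v] that by (auto simp: dist_commute)
    qed simp
  qed
qed

section \<open>Geometry of a chain at one scale\<close>

lemma triangle_excess_cases:
  assumes "triangle_excess a b c \<le> e"
  shows "dist a b + dist b c \<le> dist a c + e \<or> dist a c + dist b c \<le> dist a b + e \<or> dist a b + dist a c \<le> dist b c + e"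
  using assms unfolding triangle_excess_eq by linarith

text \<open>The set \<open>K\<close> lies almost on a segment from \<open>p\<close> to \<open>q\<close>. The point \<open>m\<close> between them excludes the configuration
  in which \<open>K\<close> runs along both arcs of a closed curve through \<open>p\<close> and \<open>q\<close>.\<close>

locale path_scale =
  fixes K :: "'a::metric_space set" and N :: "'a measure" and p q m :: 'a and D e1 :: real
  assumes D: "D = dist p q" "0 < D"
    and e1: "0 \<le> e1" "e1 \<le> D /10000000000000"
    and bet: "\<And>w. w \<in> K \<Longrightarrow> dist p w + dist w q \<le> D + e1"
    and ref: "\<And>w. w \<in> K \<Longrightarrow> dist m w \<le> \<bar>dist p m - dist p w\<bar> + e1"
    and ref_pos: "D / 400 \<le> dist p m" "dist p m \<le> D - D / 400"
begin

text \<open>A candidate has distance at least \<open>kap * r\<close> from both ends of a link of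
  length \<open>r\<close> and lengthens it by at most \<open>kap / 2 * r\<close>, so the new links
  are at most \<open>(1 - kap / 2) * r = qq * r\<close> long. \<open>slope\<close> is
  \<open>1 + 2 * tau\<close>, a bound for \<open>1 / (1 - tau)\<close>. The values of
  \<open>lam\<close> and \<open>Mb\<close> satisfy \<open>24000 * lam = 12\<close> and
  \<open>Mb * kap / 4 = 12.5\<close>; both must reach the distance \<open>12 * s\<close> that occurs
  in \<open>covered_step\<close>.\<close>

abbreviation "kap \<equiv> 1 /1000000 :: real"
abbreviation "lam \<equiv> 1 / 2000 :: real"
abbreviation "del \<equiv> 1 /100000000 :: real"
abbreviation "tau \<equiv> 1 /100000000000000 :: real"
abbreviation "C2 \<equiv>100000 :: real"
abbreviation "Mb \<equiv> 50000000 :: real"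
abbreviation "qq \<equiv> 1999999 / 2000000 :: real"
abbreviation "slope \<equiv> 50000000000001 / 50000000000000 :: real"
abbreviation "P \<equiv> dist p"

definition E :: "'a \<Rightarrow> 'a \<Rightarrow> real" where "E x y = dist x y - (P y - P x)"

text \<open>A link of a chain is refined by a point of \<open>cand\<close>, unless it is stopped. Points of \<open>K\<close> near a stopped
  link are given up (\<open>lost\<close>): the balls around steep links are paid for by the excess of length of these links.\<close>

definition cand :: "'a \<Rightarrow> 'a \<Rightarrow> 'a set" where
  "cand x y = {z \<in> K. kap * dist x y \<le> dist x z \<and> kap * dist x y \<le> dist z y \<and>
     dist x z + dist z y \<le> 2000001 / 2000000 * dist x y}"

definition steep :: "'a \<Rightarrow> 'a \<Rightarrow> bool" where "steep x y \<longleftrightarrow> tau * dist x y < E x y"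
definition sparse :: "'a \<Rightarrow> 'a \<Rightarrow> bool" where "sparse x y \<longleftrightarrow> emeasure N (cand x y) < ennreal (kap * dist x y)"
definition stopped :: "'a \<Rightarrow> 'a \<Rightarrow> bool" where "stopped x y \<longleftrightarrow> steep x y \<or> sparse x y"

text \<open>A link may exceed the scale only if it is stopped, and a stopped link is never divided
  again. The lower bound in \<open>P\<close> keeps steep links from being too short for their balls
  to reach the points near them.\<close>

definition net :: "real \<Rightarrow> 'a set \<Rightarrow> bool" where
  "net s V \<longleftrightarrow> finite V \<and> p \<in> V \<and> q \<in> V \<and> V \<subseteq> insert p (insert q K) \<and> inj_on P V \<and> (\<forall>v\<in>V. P v \<le> D) \<and>
     (\<forall>(x,y)\<in>links P V. kap / 4 * s \<le> P y - P x \<and> (dist x y \<le> s \<or> stopped x y))"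

definition lost :: "'a set \<Rightarrow> 'a set" where
  "lost V = cball p (lam * D) \<union> cball q (lam * D) \<union>
     (\<Union>(x,y)\<in>{(x,y)\<in>links P V. stopped x y}. cball x (lam * dist x y) \<union> cball y (lam * dist x y)) \<union>
     (\<Union>(x,y)\<in>{(x,y)\<in>links P V. sparse x y}. cand x y) \<union>
     (\<Union>(x,y)\<in>{(x,y)\<in>links P V. steep x y}. cball x (Mb * dist x y) \<union> cball y (Mb * dist x y))"

text \<open>These are the points charged to the curvature: each forms a triple of definite excess
  with two vertices at comparable distance.\<close>

definition bent :: "real \<Rightarrow> 'a set \<Rightarrow> 'a set" where
  "bent s V = {w \<in> K. \<exists>u\<in>V. \<exists>x\<in>V. dist u x \<le> C2 * s \<and> dist u w \<le> C2 * s \<and> del * s < triangle_excess u x w}"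

lemma P_le: "P y - P x \<le> dist x y"
  using dist_triangle[of p y x] by linarith

lemma not_steep: "\<not> steep x y \<Longrightarrow> dist x y \<le> slope * (P y - P x)"
  unfolding steep_def E_def by (simp add: field_simps, use zero_le_dist[of x y] in linarith)

text \<open>If \<open>w\<close> is almost aligned with \<open>(u, x)\<close> and with \<open>(x, t)\<close>, then its distance to \<open>x\<close> is determined,
  except for the antipodal position on a closed curve of length \<open>2 R\<close>.\<close>

lemma aligned_dist:
  fixes u x t w :: "'b::metric_space"
  assumes "triangle_excess u x w \<le> e" "triangle_excess x t w \<le> e"
    and "X \<le> dist u x" "dist u x \<le> X + e" "R - X \<le> dist x t" "dist x t \<le> R - X + e"
    and "R - dist u w \<le> dist w t" "dist w t \<le> R - dist u w + 2 * e"
    and "\<not> (X + dist u w - e \<le> dist x w \<and> 2 * R - X - dist u w - e \<le> dist x w)" "0 \<le> e"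
  shows "dist x w \<le> \<bar>dist u w - X\<bar> + 3 * e"
proof -
  have t: "dist t w = dist w t" by (simp add: dist_commute)
  from triangle_excess_cases[OF assms(1)] triangle_excess_cases[OF assms(2)] assms(3-) show ?thesis
    unfolding t by linarith
qed

lemma net_sep:
  assumes "net s V" "x \<in> V" "y \<in> V" "P x < P y" "0 \<le> s"
  shows "kap / 4 * s \<le> P y - P x"
proof (rule links_chain[of V x y P])
  show "kap / 4 * s \<le> P b - P a" if "(a, b) \<in> links P V" for a b using assms(1) that by (auto simp: net_def)
  show "kap / 4 * s \<le> P c - P a" if "kap / 4 * s \<le> P b - P a" "kap / 4 * s \<le> P c - P b" for a b c
    using that assms(5) by simp
qed (use assms in \<open>auto simp: net_def\<close>)

text \<open>A bootstrap: a link is known not to be steep only if it is close to \<open>v\<close>,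
  and it is known to be close only if the links between it and \<open>v\<close> are not steep. The
  induction runs outward from \<open>v\<close>, and \<open>step\<close> may use the estimate already
  reached at \<open>y\<close>.\<close>

lemma near_chain:
  fixes f :: "'a \<Rightarrow> real"
  assumes fin: "finite V" and v: "v \<in> V" and c: "0 \<le> c"
    and step: "\<And>x y. (x, y) \<in> links f V \<Longrightarrow> f y \<le> f v \<Longrightarrow> f v - f y \<le> c \<Longrightarrow>
                 dist y v \<le> c' * (f v - f y) \<Longrightarrow> dist x y \<le> c' * (f y - f x)"
    and u: "u \<in> V" "f u < f v" "\<And>y. y \<in> V \<Longrightarrow> f u < f y \<Longrightarrow> f y \<le> f v \<Longrightarrow> f v - f y \<le> c"
  shows "dist u v \<le> c' * (f v - f u)"
  using u
proof (induction "card {y \<in> V. f u < f y \<and> f y \<le> f v}" arbitrary: u rule: less_induct)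
  case less
  obtain x y where xy: "(x, y) \<in> links f V" "f u \<le> f x" "f x \<le> f u" "f u < f y" "f y \<le> f v"
    by (rule links_locate[OF fin less.prems(1) v order_refl less.prems(2)]) blast
  have uy: "(u, y) \<in> links f V" using linksD[OF xy(1)] xy less.prems by (force simp: links_def)
  have y: "y \<in> V" "f y \<le> f v" using linksD[OF xy(1)] xy by auto
  have yv: "dist y v \<le> c' * (f v - f y) \<or> f y = f v"
  proof (cases "f y = f v")
    case False
    have "{z \<in> V. f y < f z \<and> f z \<le> f v} \<subset> {z \<in> V. f u < f z \<and> f z \<le> f v}" using y xy(4) by force
    then have "card {z \<in> V. f y < f z \<and> f z \<le> f v} < card {z \<in> V. f u < f z \<and> f z \<le> f v}"
      by (intro psubset_card_mono) (use fin in auto)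
    then show ?thesis using less.hyps[of y] False y less.prems(3) xy(4) by force
  qed simp
  show ?case
  proof (cases "f y = f v")
    case True
    then have "(u, v) \<in> links f V" using uy v by (auto simp: links_def)
    from step[OF this] c show ?thesis by simp
  next
    case False
    then have *: "dist y v \<le> c' * (f v - f y)" using yv by simp
    have "dist u y \<le> c' * (f y - f u)" by (rule step[OF uy y(2) less.prems(3)[OF y(1) xy(4) y(2)] *])
    then have "dist u v \<le> c' * (f y - f u) + c' * (f v - f y)" using * dist_triangle[of u v y] by linarith
    then show ?thesis by (simp add: algebra_simps)
  qed
qed


lemma bentD:
  assumes "w \<in> K" "w \<notin> bent s V" "u \<in> V" "x \<in> V" "dist u x \<le> C2 * s" "dist u w \<le> C2 * s"
  shows "triangle_excess u x w \<le> del * s"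
proof (rule ccontr)
  assume "\<not> ?thesis"
  then have "w \<in> bent s V" unfolding bent_def using assms by (auto simp: not_le intro!: bexI)
  then show False using assms(2) by simp
qed

lemma lostI:
  assumes "(x, y) \<in> links P V"
  shows "stopped x y \<Longrightarrow> dist x w \<le> lam * dist x y \<or> dist y w \<le> lam * dist x y \<Longrightarrow> w \<in> lost V"
    and "sparse x y \<Longrightarrow> w \<in> cand x y \<Longrightarrow> w \<in> lost V"
    and "steep x y \<Longrightarrow> dist x w \<le> Mb * dist x y \<or> dist y w \<le> Mb * dist x y \<Longrightarrow> w \<in> lost V"
    and "dist p w \<le> lam * D \<or> dist q w \<le> lam * D \<Longrightarrow> w \<in> lost V"
  using assms unfolding lost_def by fastforce+

text \<open>The common end of the covering argument: between the vertices \<open>u\<close> and \<open>t\<close> the net is almost a segment,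
  and \<open>w\<close> lies between two consecutive vertices of it.\<close>

lemma covered_between:
  assumes net: "net s V" and s: "0 < s" and w: "w \<in> K" "w \<notin> lost V" "w \<notin> bent s V"
    and ut: "u \<in> V" "t \<in> V" "P u < P t"
    and R: "P t - P u \<le> 48100 * s"
    and uw: "dist u w \<le> C2 * s"
    and exc: "dist u w + dist w t \<le> P t - P u + 2 * del * s"
    and between: "\<And>x. x \<in> V \<Longrightarrow> P u < P x \<Longrightarrow> P x < P t \<Longrightarrow>
        dist u x \<le> P x - P u + del * s \<and> dist x t \<le> P t - P x + del * s \<and> dist x w \<le> C2 * s \<and>
        \<not> (P x - P u + dist u w - del * s \<le> dist x w \<and> 2 * (P t - P u) - (P x - P u) - dist u w - del * s \<le> dist x w)"
    and far: "\<And>v. v \<in> V \<Longrightarrow> qq * s < dist v w"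
    and ut2: "P t - P u \<le> dist u w + dist w t"
  shows False
proof -
  define a where "a = dist u w"
  have fin: "finite V" using net by (auto simp: net_def)
  have at: "a < P t - P u" using far[OF ut(2)] exc s by (simp add: a_def dist_commute)
  have pos: "dist x w \<le> \<bar>a - (P x - P u)\<bar> + 3 * del * s" if x: "x \<in> V" "P u \<le> P x" "P x \<le> P t"  "x = u \<or> P u < P x" "x = t \<or> P x < P t" for x
  proof -
    consider "x = u" | "x = t" | "P u < P x" "P x < P t" using x(4,5) by blast
    then show ?thesis
    proof cases
      case 1 then show ?thesis using s by (simp add: a_def)
    next
      case 2 then show ?thesis using exc at s by (simp add: a_def dist_commute)
    next
      case 3
      note b = between[OF x(1) 3]
      have "dist x w \<le> \<bar>dist u w - (P x - P u)\<bar> + 3 * (del * s)"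
      proof (rule aligned_dist)
        show "triangle_excess u x w \<le> del * s"
          by (rule bentD[OF w(1,3) ut(1) x(1) _ uw]) (use b R 3 s in linarith)
        show "triangle_excess x t w \<le> del * s"
          by (rule bentD[OF w(1,3) x(1) ut(2)]) (use b R 3 s in linarith)+
        show "P x - P u \<le> dist u x" "(P t - P u) - (P x - P u) \<le> dist x t" using P_le[of x u] P_le[of t x] by auto
        show "dist u x \<le> P x - P u + del * s" "dist x t \<le> P t - P u - (P x - P u) + del * s" using b by auto
        show "P t - P u - dist u w \<le> dist w t" "dist w t \<le> P t - P u - dist u w + 2 * (del * s)" using exc ut2 by auto
        show "\<not> (P x - P u + dist u w - del * s \<le> dist x w \<and> 2 * (P t - P u) - (P x - P u) - dist u w - del * s \<le> dist x w)"
          using b by blast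
        show "0 \<le> del * s" using s by simp
      qed
      then show ?thesis by (simp add: a_def)
    qed
  qed
  have "P u \<le> P u + a" "P u + a < P t" using at by (auto simp: a_def)
  then obtain x y where xy: "(x, y) \<in> links P V" "P u \<le> P x" "P x \<le> P u + a" "P u + a < P y" "P y \<le> P t"
    by (rule links_locate[OF fin ut(1,2)])
  note l = linksD[OF xy(1)]
  have inj: "inj_on P V" using net by (auto simp: net_def)
  have x1: "x = u \<or> P u < P x" using xy(2) inj l(1) ut(1) by (metis inj_onD order_le_less)
  have y1: "y = t \<or> P y < P t" using xy(5) inj l(2) ut(2) by (metis inj_onD order_le_less)
  have dx: "dist x w \<le> a - (P x - P u) + 3 * del * s"
    using pos[OF l(1) xy(2) _ x1] xy l(3) by force
  have dy: "dist y w \<le> (P y - P u) - a + 3 * del * s"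
    using pos[OF l(2) _ xy(5) _ y1] xy l(3) by force
  have fx: "qq * s < dist x w" "qq * s < dist y w" using far l by auto
  have r: "P y - P x \<le> dist x y" by (rule P_le)
  \<comment> \<open>Both ends are farther than \<open>qq * s\<close> from \<open>w\<close>, while
    the two distances add up to at most \<open>P y - P x + 6 * del * s\<close>. So the link is
    longer than \<open>s\<close> and must be stopped; being steep or being sparse each puts
    \<open>w\<close> into \<open>lost V\<close>.\<close>
  have "s < dist x y" using dx dy fx r s by linarith
  then have st: "stopped x y" using net xy(1) by (auto simp: net_def)
  have "\<not> steep x y"
  proof
    assume "steep x y"
    moreover have "dist x w \<le> Mb * dist x y" using dx xy(4) r \<open>s < dist x y\<close> s by linarith
    ultimately show False using lostI(3)[OF xy(1)] w(2) by blast
  qed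
  then have sp: "sparse x y" using st by (simp add: stopped_def)
  have r2: "dist x y \<le> slope * (P y - P x)" by (rule not_steep) fact
  have "slope * (P y - P x) \<le> 2 * (P y - P x)" by (rule mult_right_mono) (use l(3) in auto)
  then have r2: "dist x y \<le> 2 * (P y - P x)" using r2 by (rule order_trans[rotated])
  have "P y - P x \<le> 48100 * s" using xy R by linarith
  then have "dist x y \<le> 96200 * s" using r2 unfolding right_diff_distrib by linarith
  \<comment> \<open>The bound on the whole stretch keeps this link short enough for the distance
    \<open>qq * s\<close> from \<open>w\<close> to its ends to meet the lower bounds in
    \<open>cand\<close>.\<close>
  then have "kap * dist x y \<le> qq * s" using s by linarith
  then have "w \<in> cand x y"
    unfolding cand_def using w(1) fx dx dy r \<open>s < dist x y\<close> s by (auto simp: dist_commute[of w y])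
  then show False using lostI(2)[OF xy(1) sp] w(2) by blast
qed

text \<open>If \<open>w\<close> were not covered at the next scale, it would have to sit between two
  consecutive vertices of an almost straight stretch, which \<open>covered_between\<close> excludes.
  At large scales the stretch is the whole chain; at small scales it is a window around
  \<open>v\<close>, chosen so that \<open>w\<close>, being close to \<open>v\<close>, can only lie
  between its ends.\<close>

lemma covered_step:
  assumes net: "net s V" and s: "0 < s" "s \<le> 2 * D" and w: "w \<in> K" "w \<notin> lost V" "w \<notin> bent s V"
    and v: "v \<in> V" "dist v w \<le> s"
  shows "\<exists>v\<in>V. dist v w \<le> qq * s"
proof (rule ccontr)
  assume "\<not> ?thesis"
  then have far: "\<And>v. v \<in> V \<Longrightarrow> qq * s < dist v w" by force
  have fin: "finite V" and pq: "p \<in> V" "q \<in> V" and VK: "V \<subseteq> insert p (insert q K)" and inj: "inj_on P V"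
    and PD: "\<And>v. v \<in> V \<Longrightarrow> P v \<le> D" using net by (auto simp: net_def)
  have Pp: "P p = 0" and Pq: "P q = D" using D by auto
  have wpq: "lam * D < dist p w" "lam * D < dist q w" using w(2) lostI(4) linksD unfolding lost_def by auto
  show False
  \<comment> \<open>Below this threshold \<open>12 * s < lam * D\<close>: a vertex \<open>v\<close>
    within \<open>11 * s\<close> of \<open>p\<close> or \<open>q\<close> would put \<open>w\<close>,
    which is within \<open>s\<close> of \<open>v\<close>, into the lost balls around the end
    points.\<close>
  proof (cases "lam * D / 12 \<le> s")
    case top: True
    have e: "e1 \<le> del * s" using e1 top by linarith
    have bw: "dist p w + dist w q \<le> D + e1" by (rule bet[OF w(1)])
    show False
    proof (rule covered_between[OF net s(1) w pq])
      show "P p < P q" using Pp Pq D by auto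
      show "P q - P p \<le> 48100 * s" using Pp Pq D top s by linarith
      show "dist p w \<le> C2 * s" using bw e zero_le_dist[of w q] top D(2) by linarith
      show "dist p w + dist w q \<le> P q - P p + 2 * del * s" using bw e Pp Pq s by linarith
      show "P q - P p \<le> dist p w + dist w q" using Pp Pq D dist_triangle[of p q w] by linarith
      show "qq * s < dist v w" if "v \<in> V" for v by (rule far[OF that])
      fix x assume x: "x \<in> V" "P p < P x" "P x < P q"
      have xK: "x \<in> K" using x VK by auto
      have bx: "dist p x + dist x q \<le> D + e1" by (rule bet[OF xK])
      have X: "kap / 4 * s \<le> P x" "kap / 4 * s \<le> D - P x"
        using net_sep[OF net pq(1) x(1,2)] net_sep[OF net x(1) pq(2) x(3)] s Pp Pq by auto
      have xw: "dist x w \<le> \<bar>dist p m - dist p x\<bar> + \<bar>dist p m - dist p w\<bar> + 2 * e1"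
        using ref[OF xK] ref[OF w(1)] dist_triangle[of x w m] by (simp add: dist_commute[of x m])
      have xw2: "dist x w \<le> C2 * s" using dist_triangle[of x w p] bx bw zero_le_dist[of x q] zero_le_dist[of w q] e top D(2) s dist_commute[of x p] by linarith
      have ee: "2 * e1 < kap / 4 * s" using e1 top D(2) by linarith
      \<comment> \<open>The antipodal position is excluded by comparing \<open>x\<close> and
        \<open>w\<close> through \<open>m\<close>: it would force \<open>P m\<close> to be close to
        0 or \<open>D\<close>, or force \<open>P x\<close> to be closer to 0 or \<open>D\<close>
        than the separation of the net allows.\<close>
      have "\<not> (P x + dist p w - del * s \<le> dist x w \<and> 2 * D - P x - dist p w - del * s \<le> dist x w)"
      proof
        assume a: "P x + dist p w - del * s \<le> dist x w \<and> 2 * D - P x - dist p w - del * s \<le> dist x w"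
        from a xw X ref_pos ee e s e1 show False by linarith
      qed
      then show "dist p x \<le> P x - P p + del * s \<and> dist x q \<le> P q - P x + del * s \<and> dist x w \<le> C2 * s \<and>
        \<not> (P x - P p + dist p w - del * s \<le> dist x w \<and> 2 * (P q - P p) - (P x - P p) - dist p w - del * s \<le> dist x w)"
        using bx e xw2 s Pp Pq by simp
    qed
  next
    case low: False
    define c where "c = 10 * s"
    have c0: "0 \<le> c" using s by (simp add: c_def)
    \<comment> \<open>The link has length at least \<open>kap / 4 * s\<close>, so its lost balls
      have radius at least \<open>12.5 * s\<close>, and an end within \<open>11 * s\<close> of
      \<open>v\<close> is within \<open>12 * s\<close> of \<open>w\<close>.\<close>
    have steep_far: "\<not> steep x y" if xy: "(x, y) \<in> links P V" and d: "dist x v \<le> 11 * s \<or> dist y v \<le> 11 * s" for x y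
    proof
      assume "steep x y"
      have "kap / 4 * s \<le> P y - P x" using net xy by (auto simp: net_def)
      then have "kap / 4 * s \<le> dist x y" using P_le[of y x] by linarith
      then have "dist x w \<le> Mb * dist x y \<or> dist y w \<le> Mb * dist x y"
        using d v(2) dist_triangle[of x w v] dist_triangle[of y w v] zero_le_dist[of x y] by linarith
      then show False using lostI(3)[OF xy \<open>steep x y\<close>] w(2) by blast
    qed
    \<comment> \<open>A link longer than \<open>24000 * s\<close> is stopped, and its lost balls
      have radius more than \<open>12 * s\<close>.\<close>
    have long: "dist x y \<le> 24000 * s" if xy: "(x, y) \<in> links P V" and d: "dist x v \<le> 11 * s \<or> dist y v \<le> 11 * s" for x y
    proof (rule ccontr)
      assume n: "\<not> ?thesis"
      then have "s < dist x y" using s by simp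
      then have "stopped x y" using net xy by (auto simp: net_def)
      moreover have "dist x w \<le> lam * dist x y \<or> dist y w \<le> lam * dist x y"
        using n d v(2) dist_triangle[of x w v] dist_triangle[of y w v] by linarith
      ultimately show False using lostI(1)[OF xy] w(2) by blast
    qed
    have l: "dist u v \<le> slope * (P v - P u)"
      if "u \<in> V" "P u < P v" "\<And>y. y \<in> V \<Longrightarrow> P u < P y \<Longrightarrow> P y \<le> P v \<Longrightarrow> P v - P y \<le> c" for u
    proof (rule near_chain[OF fin v(1) c0 _ that(1) that(2) that(3)])
      fix x y assume xy: "(x, y) \<in> links P V" "P y \<le> P v" "P v - P y \<le> c" "dist y v \<le> slope * (P v - P y)"
      then have "dist y v \<le> 11 * s" using s by (simp add: c_def)
      then show "dist x y \<le> slope * (P y - P x)" using not_steep steep_far[OF xy(1)] by blast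
    qed
    have r: "dist t v \<le> slope * (P t - P v)"
      if "t \<in> V" "P v < P t" "\<And>y. y \<in> V \<Longrightarrow> P y < P t \<Longrightarrow> P v \<le> P y \<Longrightarrow> P y - P v \<le> c" for t
    proof -
      have "dist t v \<le> slope * (- P v - - P t)"
      proof (rule near_chain[OF fin v(1) c0, where f = "\<lambda>x. - P x"])
        fix y x assume xy: "(y, x) \<in> links (\<lambda>x. - P x) V" "- P x \<le> - P v" "- P v - - P x \<le> c" "dist x v \<le> slope * (- P v - - P x)"
        then have xy1: "(x, y) \<in> links P V" by (simp add: links_uminus)
        have "dist x v \<le> 11 * s" using s xy by (simp add: c_def)
        then have "dist x y \<le> slope * (P y - P x)" using not_steep steep_far[OF xy1] by blast
        then show "dist y x \<le> slope * (- P x - - P y)" by (simp add: dist_commute)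
      qed (use that in \<open>auto simp: algebra_simps\<close>)
      then show ?thesis by simp
    qed
    have pv: "c \<le> P v"
    proof (rule ccontr)
      assume "\<not> ?thesis"
      then have "dist p v \<le> 11 * s" using l[OF pq(1)] Pp s by (cases "P v = 0") (auto simp: c_def)
      then have "dist p w \<le> lam * D" using v(2) low dist_triangle[of p w v] by linarith
      then show False using wpq by simp
    qed
    have vq: "P v + c < D"
    proof (rule ccontr)
      assume n: "\<not> ?thesis"
      have "dist q v \<le> 11 * s"
      proof (cases "P v = D")
        case True
        then have "v = q" using inj v pq Pq by (metis inj_onD)
        then show ?thesis using s by simp
      next
        case False
        then have "dist q v \<le> slope * (P q - P v)"
          by (intro r) (use n PD[OF v(1)] PD Pq pq in \<open>force+\<close>)
        then show ?thesis using n Pq s by (simp add: c_def)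
      qed
      then have "dist q w \<le> lam * D" using v(2) low dist_triangle[of q w v] by linarith
      then show False using wpq by simp
    qed
    \<comment> \<open>The window ends at the outer ends of the two links that cross the levels
      \<open>P v - c\<close> and \<open>P v + c\<close>. By \<open>long\<close> it has
      \<open>P\<close>-width at most 24010 times \<open>s\<close> on each side, hence the bound
      \<open>48100 * s\<close>.\<close>
    obtain u u' where u: "(u, u') \<in> links P V" "P p \<le> P u" "P u \<le> P v - c" "P v - c < P u'" "P u' \<le> P v"
      by (rule links_locate[OF fin pq(1) v(1), of P "P v - c"]) (use pv Pp s in \<open>auto simp: c_def\<close>)
    note lu = linksD[OF u(1)]
    obtain t' t where t: "(t', t) \<in> links P V" "P v \<le> P t'" "P t' \<le> P v + c" "P v + c < P t" "P t \<le> P q"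
      by (rule links_locate[OF fin v(1) pq(2), of P "P v + c"]) (use vq Pq s in \<open>auto simp: c_def\<close>)
    note lt = linksD[OF t(1)]
    have u'v: "dist u' v \<le> 11 * s"
    proof (cases "P u' = P v")
      case True
      then have "u' = v" using inj lu v by (metis inj_onD)
      then show ?thesis using s by simp
    next
      case False
      then have "dist u' v \<le> slope * (P v - P u')" by (intro l) (use u lu in auto)
      then show ?thesis using u(4) s by (simp add: c_def)
    qed
    have t'v: "dist t' v \<le> 11 * s"
    proof (cases "P t' = P v")
      case True
      then have "t' = v" using inj lt v by (metis inj_onD)
      then show ?thesis using s by simp
    next
      case False
      then have "dist t' v \<le> slope * (P t' - P v)" by (intro r) (use t lt in auto)
      then show ?thesis using t(3) s by (simp add: c_def)
    qed
    have uu': "P u' - P u \<le> 24000 * s" using long[OF u(1)] u'v P_le[of u' u] by auto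
    have tt': "P t - P t' \<le> 24000 * s" using long[OF t(1)] t'v P_le[of t t'] by auto
    have left: "dist x v \<le> P v - P x + del * s / 2" if "x \<in> V" "P u \<le> P x" "P x \<le> P v" for x
    proof (cases "P x = P v")
      case True
      then have "x = v" using inj that v by (metis inj_onD)
      then show ?thesis using s by simp
    next
      case False
      have "dist x v \<le> slope * (P v - P x)"
      proof (rule l[OF that(1)])
        show "P x < P v" using False that by simp
        show "P v - P y \<le> c" if "y \<in> V" "P x < P y" "P y \<le> P v" for y
          using lu(4)[OF that(1)] that \<open>P u \<le> P x\<close> u by auto
      qed
      then show ?thesis using that u uu' s by (simp add: c_def)
    qed
    have right: "dist x v \<le> P x - P v + del * s / 2" if "x \<in> V" "P v \<le> P x" "P x \<le> P t" for x
    proof (cases "P x = P v")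
      case True
      then have "x = v" using inj that v by (metis inj_onD)
      then show ?thesis using s by simp
    next
      case False
      have "dist x v \<le> slope * (P x - P v)"
      proof (rule r[OF that(1)])
        show "P v < P x" using False that by simp
        show "P y - P v \<le> c" if "y \<in> V" "P y < P x" "P v \<le> P y" for y
          using lt(4)[OF that(1)] that \<open>P x \<le> P t\<close> t by auto
      qed
      then show ?thesis using that t tt' s by (simp add: c_def)
    qed
    have tight: "dist x y \<le> P y - P x + del * s" if xy: "x \<in> V" "y \<in> V" "P u \<le> P x" "P x < P y" "P y \<le> P t" for x y
    proof -
      have "dist x y \<le> slope * (P y - P x)"
      proof (rule links_chain[OF fin xy(1,2,4)])
        fix a b assume ab: "(a, b) \<in> links P V" "P x \<le> P a" "P b \<le> P y"
        note lab = linksD[OF ab(1)]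
        have "\<not> steep a b"
        proof (cases "P b \<le> P v")
          case True
          have "dist b v \<le> 11 * s"
            using left[OF lab(2)] True lab(3) ab(2) xy(3) lu(4)[OF lab(2)] u s by (auto simp: c_def)
          then show ?thesis using steep_far[OF ab(1)] by blast
        next
          case False
          then have "P v \<le> P a" using lab(4)[OF v(1)] by auto
          moreover have "P a \<le> P t'" using lt(4)[OF lab(1)] lab(3) ab(3) xy(5) by auto
          ultimately have "dist a v \<le> 11 * s" using right[OF lab(1)] t s by (auto simp: c_def)
          then show ?thesis using steep_far[OF ab(1)] by blast
        qed
        then show "dist a b \<le> slope * (P b - P a)" by (rule not_steep)
      next
        fix a b d assume "dist a b \<le> slope * (P b - P a)" "dist b d \<le> slope * (P d - P b)"
        then show "dist a d \<le> slope * (P d - P a)" using dist_triangle[of a d b] unfolding right_diff_distrib by linarith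
      qed
      moreover have "P y - P x \<le> 48100 * s" using xy u t uu' tt' s by (simp add: c_def)
      ultimately show ?thesis using s unfolding right_diff_distrib by linarith
    qed
    have R: "P t - P u \<le> 48100 * s" using u t uu' tt' s by (simp add: c_def)
    have utlt: "P u < P t" using u t s by (simp add: c_def)
    have uv: "dist u v \<le> P v - P u + del * s / 2" using left[OF lu(1)] u c0 by simp
    have tv: "dist t v \<le> P t - P v + del * s / 2" using right[OF lt(2)] t c0 by simp
    have uv2: "P v - P u \<le> dist u v" "P t - P v \<le> dist t v" using P_le[of v u] P_le[of t v] by (auto simp: dist_commute)
    have uw: "dist u w \<le> dist u v + s" "dist u v - s \<le> dist u w" "dist w t \<le> dist t v + s" "dist t v - s \<le> dist w t"
      using dist_triangle[of u w v] dist_triangle[of u v w] dist_triangle[of w t v] dist_triangle[of t v w] v(2)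
      by (auto simp: dist_commute)
    have utd: "P t - P u \<le> dist u t" by (rule P_le)
    have "dist u t \<le> P t - P u + del * s" by (rule tight[OF lu(1) lt(2)]) (use utlt in auto)
    have te: "triangle_excess u t w \<le> del * s"
      by (rule bentD[OF w(1,3) lu(1) lt(2)]) (use \<open>dist u t \<le> P t - P u + del * s\<close> R uw uv s t c0 in \<open>auto simp: c_def\<close>)
    \<comment> \<open>Of the three alignments only that with \<open>w\<close> in the middle remains:
      \<open>w\<close> is within \<open>s\<close> of \<open>v\<close>, and \<open>v\<close> is more
      than about \<open>10 * s\<close> away from both \<open>u\<close> and \<open>t\<close>.\<close>
    have exc: "dist u w + dist w t \<le> dist u t + del * s"
      using triangle_excess_cases[OF te] uw uv uv2 tv utd u(3) t(4) s by (auto simp: c_def dist_commute[of t w])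
    show False
    proof (rule covered_between[OF net s(1) w lu(1) lt(2) utlt R])
      show "dist u w \<le> C2 * s" using uw uv R t c0 s by linarith
      show "dist u w + dist w t \<le> P t - P u + 2 * del * s" using exc \<open>dist u t \<le> P t - P u + del * s\<close> by linarith
      show "P t - P u \<le> dist u w + dist w t" using utd dist_triangle[of u t w] by linarith
      show "qq * s < dist v w" if "v \<in> V" for v by (rule far[OF that])
      fix x assume x: "x \<in> V" "P u < P x" "P x < P t"
      have "dist u x \<le> P x - P u + del * s" by (rule tight) (use x lu lt in auto)
      moreover have "dist x t \<le> P t - P x + del * s" by (rule tight) (use x lu lt in auto)
      moreover have xv: "dist x v \<le> \<bar>P x - P v\<bar> + del * s / 2"
      proof (cases "P x \<le> P v")
        case True then show ?thesis using left[OF x(1)] x(2) by simp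
      next
        case False then show ?thesis using right[OF x(1)] x(3) by simp
      qed
      moreover have xw: "dist x w \<le> dist x v + s" using dist_triangle[of x w v] v(2) by linarith
      moreover have "dist x w \<le> C2 * s" using xw xv x R u t c0 s by linarith
      moreover have "dist x w < P t - P u - del * s" using xw xv x u(3) t(4) s by (simp add: c_def)
      \<comment> \<open>The two inequalities of the antipodal position add up to
        \<open>2 * (P t - P u) - 2 * del * s \<le> 2 * dist x w\<close>, against the strict bound
        just shown.\<close>
      ultimately show "dist u x \<le> P x - P u + del * s \<and> dist x t \<le> P t - P x + del * s \<and> dist x w \<le> C2 * s \<and>
        \<not> (P x - P u + dist u w - del * s \<le> dist x w \<and> 2 * (P t - P u) - (P x - P u) - dist u w - del * s \<le> dist x w)"
        unfolding right_diff_distrib by linarith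
    qed
  qed
qed

end

section \<open>Refinement of a chain\<close>

lemma markov_set:
  fixes f :: "'a \<Rightarrow> ennreal"
  assumes f: "f \<in> borel_measurable M" and C: "C \<in> sets M" and c: "0 < c"
  shows "emeasure M {x \<in> C. ennreal (4 / c) * (\<integral>\<^sup>+x\<in>C. f x \<partial>M) < f x} \<le> ennreal (c / 4)"
proof -
  define I where "I = (\<integral>\<^sup>+x\<in>C. f x \<partial>M)"
  define B where "B = {x \<in> C. ennreal (4 / c) * I < f x}"
  have B: "B \<in> sets M"
  proof -
    have "B = C \<inter> {x \<in> space M. ennreal (4 / c) * I < f x}" using sets.sets_into_space[OF C] by (auto simp: B_def)
    then show ?thesis using f C by simp
  qed
  have le: "(ennreal (4 / c) * I) * emeasure M B \<le> I"
  proof -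
    have "(ennreal (4 / c) * I) * emeasure M B = (\<integral>\<^sup>+x\<in>B. ennreal (4 / c) * I \<partial>M)"
      using B by (simp add: nn_integral_cmult_indicator)
    also have "\<dots> \<le> I" unfolding I_def
      by (intro nn_integral_mono) (auto simp: B_def I_def indicator_def intro: less_imp_le)
    finally show ?thesis .
  qed
  have "emeasure M B \<le> ennreal (c / 4)"
  \<comment> \<open>With an infinite integral the threshold is infinite and the bad set empty; with
    integral 0 the bad set is null. Only the remaining case needs a division.\<close>
  proof (cases "I = \<infinity>")
    case True
    then have "B = {}" using c by (auto simp: B_def ennreal_mult_top)
    then show ?thesis by simp
  next
    case False
    then obtain i where i: "I = ennreal i" "0 \<le> i" by (cases I) auto
    show ?thesis
    proof (cases "i = 0")
      case True
      then have "(\<integral>\<^sup>+x\<in>C. f x \<partial>M) = 0" using i by (simp add: I_def)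
      then have "AE x in M. f x * indicator C x = 0" using f C by (subst (asm) nn_integral_0_iff_AE) auto
      then have "AE x in M. x \<notin> B" by eventually_elim (auto simp: B_def indicator_def split: if_splits)
      then have "emeasure M B = 0" using B AE_iff_null_sets[OF B] by auto
      then show ?thesis by simp
    next
      case False
      then have ip: "0 < i" using i by simp
      have "emeasure M B \<noteq> \<infinity>"
      proof
        assume "emeasure M B = \<infinity>"
        then have "(ennreal (4 / c) * I) * emeasure M B = \<infinity>" using c ip i by (simp add: ennreal_mult_top ennreal_zero_less_mult_iff flip: ennreal_mult)
        then show False using le i by (simp add: top_unique)
      qed
      then obtain b where b: "emeasure M B = ennreal b" "0 \<le> b" by (cases "emeasure M B") auto
      have "4 / c * i * b \<le> i" using le b i c by (simp add: ennreal_le_iff flip: ennreal_mult)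
      then have "b \<le> c / 4" using ip c by (simp add: field_simps)
      then show ?thesis using b by (simp add: ennreal_leI)
    qed
  qed
  then show ?thesis by (simp add: B_def I_def)
qed

text \<open>Each of the three bad sets takes at most a quarter of the mass \<open>c\<close>, so a
  quarter is left for \<open>z\<close>.\<close>

lemma markov_choose:
  fixes f1 f2 f3 :: "'a \<Rightarrow> ennreal"
  assumes f: "f1 \<in> borel_measurable M" "f2 \<in> borel_measurable M" "f3 \<in> borel_measurable M"
    and C: "C \<in> sets M" and c: "0 < c" "ennreal c \<le> emeasure M C"
  obtains z where "z \<in> C" "f1 z \<le> ennreal (4 / c) * (\<integral>\<^sup>+x\<in>C. f1 x \<partial>M)"
    "f2 z \<le> ennreal (4 / c) * (\<integral>\<^sup>+x\<in>C. f2 x \<partial>M)" "f3 z \<le> ennreal (4 / c) * (\<integral>\<^sup>+x\<in>C. f3 x \<partial>M)"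
proof -
  define B where "B f = {x \<in> C. ennreal (4 / c) * (\<integral>\<^sup>+x\<in>C. f x \<partial>M) < f x}" for f
  have B: "B f \<in> sets M" if [measurable]: "f \<in> borel_measurable M" for f
  proof -
    have "B f = C \<inter> {x \<in> space M. ennreal (4 / c) * (\<integral>\<^sup>+x\<in>C. f x \<partial>M) < f x}" using sets.sets_into_space[OF C] by (auto simp: B_def)
    then show ?thesis using C by simp
  qed
  have "emeasure M (B f1 \<union> B f2 \<union> B f3) \<le> emeasure M (B f1) + emeasure M (B f2) + emeasure M (B f3)"
    using B f by (meson add_mono emeasure_subadditive order_refl order_trans sets.Un)
  also have "\<dots> \<le> ennreal (c / 4) + ennreal (c / 4) + ennreal (c / 4)"
    unfolding B_def by (intro add_mono markov_set f C c)
  also have "\<dots> < ennreal c" using c by (simp add: ennreal_less_iff flip: ennreal_plus)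
  finally have "emeasure M (B f1 \<union> B f2 \<union> B f3) < emeasure M C" using c(2) by simp
  then have "\<not> C \<subseteq> B f1 \<union> B f2 \<union> B f3" using B f emeasure_mono[of C "B f1 \<union> B f2 \<union> B f3" M] by (auto simp: not_le[symmetric])
  then obtain z where "z \<in> C" "z \<notin> B f1" "z \<notin> B f2" "z \<notin> B f3" by auto
  then show ?thesis using that[of z] by (auto simp: B_def not_less)
qed

section \<open>Curvature integrals with respect to a finite Borel measure\<close>

locale curvature_measure =
  fixes N :: "'a::metric_space measure"
  assumes setsN [measurable_cong]: "sets N = sets borel" and finN: "emeasure N UNIV < \<infinity>"
begin

lemma spaceN [simp]: "space N = UNIV" using sets_eq_imp_space_eq[OF setsN] by simp

definition h :: "'a \<Rightarrow> 'a \<Rightarrow> ennreal" where "h u z = (\<integral>\<^sup>+w. crv u z w \<partial>N)"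

lemma h_commute: "h u z = h z u" by (simp add: h_def crv_commute(1)[of u])
lemma h_same [simp]: "h u u = 0" by (simp add: h_def)

lemma crv_measurable [measurable]: "(\<lambda>w. crv u z w) \<in> borel_measurable N"
  using slsc_borel_measurable[OF slsc_crv3[of u z]] measurable_cong_sets[OF setsN refl] by blast

lemma slsc_h: "slsc (\<lambda>u. h u z)" "slsc (\<lambda>u. h z u)"
  unfolding h_def by (rule slsc_nn_integral; simp add: slsc_crv slsc_crv2)+

lemma h_measurable [measurable]: "(\<lambda>u. h z u) \<in> borel_measurable N" "(\<lambda>u. h u z) \<in> borel_measurable N"
  using slsc_borel_measurable[OF slsc_h(2)[of z]] slsc_borel_measurable[OF slsc_h(1)[of z]] measurable_cong_sets[OF setsN refl] by blast+

end

locale path_measure = path_scale K N p q m D e1 + curvature_measure N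
  for K :: "'a::metric_space set" and N p q m D e1 +
  assumes K [measurable]: "K \<in> sets borel"
    and reg: "\<And>z r. z \<in> insert p (insert q K) \<Longrightarrow> 0 < r \<Longrightarrow> emeasure N (cball z r) \<le> ennreal (4 * r)"
begin

text \<open>Strict inequalities make the annulus open, as lower semicontinuity of \<open>G\<close>
  requires. The inner radius lies below the distance at least \<open>kap / 8 * s\<close> between a
  vertex and the candidates of an active link; the outer one exceeds the cut-off in
  \<open>tt\<close>.\<close>

definition annulus :: "real \<Rightarrow> 'a \<Rightarrow> 'a set" where
  "annulus s u = {z. kap / 16 * s < dist u z \<and> dist u z < 2 * C2 * s}"

lemma open_annulus: "open (annulus s u)"
  unfolding annulus_def by (intro open_Collect_conj open_Collect_less continuous_intros)

lemma annulus_sets [measurable]: "annulus s u \<in> sets N"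
  using open_annulus[of s u] by (simp add: setsN)

text \<open>The curvature at \<open>u\<close> seen at scale \<open>s\<close>. With \<open>N\<close>
  counted as a length, \<open>G\<close>, \<open>tt\<close>, \<open>S\<close> and \<open>L\<close>
  all scale like lengths, so they can be added in one balance over all scales.\<close>

definition G :: "real \<Rightarrow> 'a \<Rightarrow> ennreal" where
  "G s u = ennreal s * (\<integral>\<^sup>+z. indicator (annulus s u) z * h u z \<partial>N)"

lemma slsc_G: "slsc (G s)"
  unfolding G_def
proof (rule slsc_cmult, rule slsc_nn_integral)
  show "(\<lambda>z. indicator (annulus s u) z * h u z) \<in> borel_measurable N" for u
    by measurable
  show "slsc (\<lambda>x. indicator (annulus s x) z * h x z)" for z
  proof -
    have "(\<lambda>x. indicator (annulus s x) z * h x z) = (\<lambda>x. indicator (annulus s z) x * h x z)"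
      by (rule ext) (auto simp: annulus_def indicator_def dist_commute)
    then show ?thesis by (simp add: slsc_indicator_mult[OF open_annulus slsc_h(1)])
  qed
qed

lemma G_measurable [measurable]: "G s \<in> borel_measurable N"
  using slsc_borel_measurable[OF slsc_G[of s]] measurable_cong_sets[OF setsN refl] by blast

text \<open>The charge of a pair of vertices. The cut-off is the one in \<open>bent\<close>, so that
  \<open>S s V\<close> bounds the mass of \<open>bent s V\<close>.\<close>

definition tt :: "real \<Rightarrow> 'a \<Rightarrow> 'a \<Rightarrow> ennreal" where
  "tt s u z = indicator (cball u (C2 * s)) z * (ennreal (s\<^sup>2) * h u z)"

lemma tt_commute: "tt s u z = tt s z u"
  by (auto simp: tt_def indicator_def dist_commute h_commute)

definition S :: "real \<Rightarrow> 'a set \<Rightarrow> ennreal" where "S s V = (\<Sum>u\<in>V. \<Sum>x\<in>V. tt s u x)"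
definition L :: "'a set \<Rightarrow> real" where "L V = (\<Sum>(x,y)\<in>links P V. dist x y)"
text \<open>The share of \<open>G s u\<close> carried by a single link; over the active links these
  shares add up to at most \<open>G s u\<close>.\<close>

definition cg :: "real \<Rightarrow> 'a \<Rightarrow> 'a \<times> 'a \<Rightarrow> ennreal" where
  "cg s u = (\<lambda>(x, y). ennreal s * (\<integral>\<^sup>+z. indicator (annulus s u) z * h u z * indicator (cand x y) z \<partial>N))"

lemma cand_sets [measurable]: "cand x y \<in> sets borel"
proof -
  have "cand x y = K \<inter> {z. kap * dist x y \<le> dist x z \<and> kap * dist x y \<le> dist z y \<and> dist x z + dist z y \<le> 2000001 / 2000000 * dist x y}"
    by (auto simp: cand_def)
  moreover have "closed {z. kap * dist x y \<le> dist x z \<and> kap * dist x y \<le> dist z y \<and> dist x z + dist z y \<le> 2000001 / 2000000 * dist x y}"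
    by (intro closed_Collect_conj closed_Collect_le continuous_intros)
  ultimately show ?thesis using K by auto
qed

text \<open>On a link that is not steep \<open>P\<close> grows almost as fast as the length. A point
  kept away from both ends in distance is therefore kept away from them in \<open>P\<close>;
  \<open>kap / 2 - tau\<close> would be possible in place of \<open>kap / 4\<close>.\<close>

lemma cand_slab:
  assumes z: "z \<in> cand x y" and "\<not> steep x y"
  shows "kap / 4 * dist x y \<le> P z - P x" "kap / 4 * dist x y \<le> P y - P z"
    and "dist x z \<le> qq * dist x y" "dist z y \<le> qq * dist x y"
proof -
  have E: "dist x y - (P y - P x) \<le> tau * dist x y" using assms(2) by (simp add: steep_def E_def)
  have c: "kap * dist x y \<le> dist x z" "kap * dist x y \<le> dist z y" "dist x z + dist z y \<le> 2000001 / 2000000 * dist x y"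
    using z by (auto simp: cand_def)
  note t = P_le[of z x] P_le[of y z] zero_le_dist[of x y]
  show "kap / 4 * dist x y \<le> P z - P x" using E c t by linarith
  show "kap / 4 * dist x y \<le> P y - P z" using E c t by linarith
  show "dist x z \<le> qq * dist x y" using c by linarith
  show "dist z y \<le> qq * dist x y" using c by linarith
qed

text \<open>One Markov choice serves three purposes: the gain in length, the charges of the new
  vertex against the old ones, and the curvature \<open>Hf\<close> that it carries into later
  scales. The candidates have mass at least \<open>kap * s / 2\<close> since the link is not sparse
  and longer than \<open>s / 2\<close>.\<close>

lemma choose_vertex:
  assumes s: "0 < s" and W: "finite W" "\<And>u. u \<in> W \<Longrightarrow> P u \<le> P x \<or> P y \<le> P u"
    and xy: "qq * s < dist x y" "dist x y \<le> s" "\<not> stopped x y" and Hf [measurable]: "Hf \<in> borel_measurable N"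
  obtains z where "z \<in> cand x y"
    "ennreal (dist x z + dist z y - dist x y) \<le> ennreal (4 / kap) * (ennreal (s\<^sup>2) * h x y)"
    "(\<Sum>u\<in>W. tt s u z) \<le> ennreal (8 / kap) * (\<Sum>u\<in>W. cg s u (x, y))"
    "Hf z \<le> ennreal (8 / (kap * s)) * (\<integral>\<^sup>+z\<in>cand x y. Hf z \<partial>N)"
proof -
  define r where "r = dist x y"
  define C where "C = cand x y"
  have r: "0 < r" "s / 2 \<le> r" "r \<le> s" using xy s by (auto simp: r_def)
  have ns: "\<not> steep x y" and "\<not> sparse x y" using xy by (auto simp: stopped_def)
  then have mass: "ennreal (kap * r) \<le> emeasure N C" by (simp add: sparse_def C_def r_def not_less)
  have C [measurable]: "C \<in> sets N" by (simp add: C_def setsN)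
  define f1 where "f1 z = ennreal (r^3) * crv x y z" for z
  define f2 where "f2 z = (\<Sum>u\<in>W. tt s u z)" for z
  have cb [measurable]: "cball u e \<in> sets N" for u e by (simp add: setsN)
  have tm: "tt s u \<in> borel_measurable N" for u
    unfolding tt_def by measurable
  have m: "f1 \<in> borel_measurable N" "f2 \<in> borel_measurable N"
    unfolding f1_def f2_def using tm by measurable
  obtain z where z: "z \<in> C" "f1 z \<le> ennreal (4 / (kap * r)) * (\<integral>\<^sup>+x\<in>C. f1 x \<partial>N)"
    "f2 z \<le> ennreal (4 / (kap * r)) * (\<integral>\<^sup>+x\<in>C. f2 x \<partial>N)" "Hf z \<le> ennreal (4 / (kap * r)) * (\<integral>\<^sup>+x\<in>C. Hf x \<partial>N)"
    by (rule markov_choose[OF m Hf C _ mass]) (use r in auto)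
  note sl = cand_slab[OF z(1)[unfolded C_def] ns]
  have coef: "ennreal (4 / (kap * r)) \<le> ennreal (8 / (kap * s))" using r s by (intro ennreal_leI) (simp add: field_simps)
  show ?thesis
  proof (rule that)
    show "z \<in> cand x y" using z by (simp add: C_def)
    \<comment> \<open>For a candidate \<open>z\<close> the link is the longest side of the triangle,
      so the excess is attained with \<open>z\<close> in the middle and the diameter is
      \<open>r\<close>.\<close>
    have "ennreal (dist x z + dist z y - dist x y) = f1 z"
    proof -
      have le: "dist x z \<le> r" "dist z y \<le> r" using sl zero_le_dist[of x y] unfolding r_def by linarith+
      have te: "triangle_excess x y z = dist x z + dist z y - dist x y"
        unfolding triangle_excess_eq using le dist_commute[of z y] by (simp add: r_def)
      have "diameter {x, y, z} = r" unfolding diameter_triple using le dist_commute[of z y] by (simp add: r_def)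
      then have "crv x y z = ennreal ((dist x z + dist z y - dist x y) / r^3)" by (simp add: crv_def te)
      then show ?thesis unfolding f1_def using r by (simp flip: ennreal_mult')
    qed
    also have "\<dots> \<le> ennreal (4 / (kap * r)) * (\<integral>\<^sup>+x\<in>C. f1 x \<partial>N)" by fact
    also have "\<dots> \<le> ennreal (4 / (kap * r)) * (\<integral>\<^sup>+x. f1 x \<partial>N)"
      by (intro mult_left_mono nn_integral_mono) (auto simp: indicator_def)
    also have "\<dots> = ennreal (4 / (kap * r)) * (ennreal (r^3) * h x y)"
      unfolding f1_def h_def by (subst nn_integral_cmult) auto
    also have "\<dots> = ennreal (4 / kap * r\<^sup>2) * h x y"
      unfolding mult.assoc[symmetric] using r by (subst ennreal_mult[symmetric]) (auto simp: power2_eq_square power3_eq_cube)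
    also have "\<dots> \<le> ennreal (4 / kap * s\<^sup>2) * h x y"
      using r by (intro mult_right_mono ennreal_leI mult_left_mono power_mono) auto
    finally show "ennreal (dist x z + dist z y - dist x y) \<le> ennreal (4 / kap) * (ennreal (s\<^sup>2) * h x y)"
      by (simp add: ennreal_mult mult.assoc)
    have "(\<Sum>u\<in>W. tt s u z) \<le> ennreal (4 / (kap * r)) * (\<Sum>u\<in>W. \<integral>\<^sup>+x\<in>C. tt s u x \<partial>N)"
      using z(3) unfolding f2_def sum_distrib_right using tm by (subst (asm) nn_integral_sum) auto
    also have "\<dots> \<le> ennreal (8 / (kap * s)) * (\<Sum>u\<in>W. ennreal s * cg s u (x, y))"
    proof (intro mult_mono coef sum_mono)
      fix u assume u: "u \<in> W"
      have "(\<integral>\<^sup>+x\<in>C. tt s u x \<partial>N) \<le> (\<integral>\<^sup>+z. ennreal (s\<^sup>2) * (indicator (annulus s u) z * h u z * indicator C z) \<partial>N)"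
      proof (rule nn_integral_mono)
        fix w
        show "tt s u w * indicator C w \<le> ennreal (s\<^sup>2) * (indicator (annulus s u) w * h u w * indicator C w)"
        proof (cases "w \<in> C \<and> dist u w \<le> C2 * s")
          case True
          note sl = cand_slab[OF _ ns, folded r_def, of w]
          have "kap / 4 * r \<le> dist u w"
            using sl(1,2) True W(2)[OF u] P_le[of w u] P_le[of u w] dist_commute[of u w] by (auto simp: C_def)
          then have "w \<in> annulus s u" using True r s by (auto simp: annulus_def)
          then show ?thesis by (simp add: tt_def mult.assoc mult.left_commute indicator_def)
        next
          case False then show ?thesis by (auto simp: tt_def indicator_def)
        qed
      qed
      also have "\<dots> = ennreal s * cg s u (x, y)"
        using s open_annulus[of s u] unfolding cg_def C_def
        by (subst nn_integral_cmult) (auto simp: setsN power2_eq_square ennreal_mult mult.assoc)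
      finally show "(\<integral>\<^sup>+x\<in>C. tt s u x \<partial>N) \<le> ennreal s * cg s u (x, y)" .
    qed auto
    also have "\<dots> = ennreal (8 / kap) * (\<Sum>u\<in>W. cg s u (x, y))"
      unfolding sum_distrib_left[symmetric] mult.assoc[symmetric] using s by (subst ennreal_mult[symmetric]) auto
    finally show "(\<Sum>u\<in>W. tt s u z) \<le> ennreal (8 / kap) * (\<Sum>u\<in>W. cg s u (x, y))" .
    show "Hf z \<le> ennreal (8 / (kap * s)) * (\<integral>\<^sup>+z\<in>cand x y. Hf z \<partial>N)"
      using z(4) mult_right_mono[OF coef] unfolding C_def by (rule order_trans) simp
  qed
qed

end

context path_measure begin

lemma S_insert:
  assumes "finite W" "z \<notin> W"
  shows "S s (insert z W) = S s W + 2 * (\<Sum>u\<in>W. tt s u z)"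
proof -
  have "tt s z z = 0" by (simp add: tt_def)
  moreover have "(\<Sum>x\<in>W. tt s z x) = (\<Sum>u\<in>W. tt s u z)" by (simp add: tt_commute)
  ultimately have "S s (insert z W) = (\<Sum>u\<in>W. tt s u z) + ((\<Sum>u\<in>W. tt s u z) + S s W)"
    unfolding S_def using assms by (simp add: sum.distrib)
  then show ?thesis by (simp add: mult_2 ac_simps)
qed

lemma L_insert:
  assumes "finite V" "inj_on P V" "(x, y) \<in> links P V" "P x < P z" "P z < P y"
  shows "L (insert z V) = L V + (dist x z + dist z y - dist x y)"
  unfolding L_def by (rule sum_links_insert[OF assms])

text \<open>The sum telescopes and is unchanged by insertions; \<open>L V - span V\<close> is the
  total defect, which pays for the balls around steep links.\<close>

definition span :: "'a set \<Rightarrow> real" where "span V = (\<Sum>(x,y)\<in>links P V. P y - P x)"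

lemma L_nonneg: "0 \<le> L V" unfolding L_def by (rule sum_nonneg) auto

text \<open>The candidates of a link that is not steep have levels strictly between those of its
  ends, and such open level intervals are disjoint for different links.\<close>

lemma cand_disjoint:
  assumes "(x, y) \<in> links P V" "(x', y') \<in> links P V" "(x, y) \<noteq> (x', y')" "inj_on P V"
    "\<not> steep x y" "\<not> steep x' y'" "z \<in> cand x y"
  shows "z \<notin> cand x' y'"
proof
  assume z': "z \<in> cand x' y'"
  note l = linksD[OF assms(1)] and l' = linksD[OF assms(2)]
  have "0 < dist x y" "0 < dist x' y'" using l(3) l'(3) by auto
  then have "P x < P z" "P z < P y" "P x' < P z" "P z < P y'"
    using cand_slab(1,2)[OF assms(7,5)] cand_slab(1,2)[OF z' assms(6)] by linarith+
  then have "P x = P x'" "P y = P y'" using l(4)[OF l'(1)] l(4)[OF l'(2)] l'(4)[OF l(1)] l'(4)[OF l(2)] by linarith+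
  then show False using assms(3,4) l l' by (auto simp: inj_on_def)
qed

lemma sum_cand_le:
  fixes f :: "'a \<Rightarrow> ennreal"
  assumes A: "finite A" "A \<subseteq> links P V" "inj_on P V" "\<And>x y. (x, y) \<in> A \<Longrightarrow> \<not> steep x y"
    and f: "f \<in> borel_measurable N"
  shows "(\<Sum>(x,y)\<in>A. \<integral>\<^sup>+z\<in>cand x y. f z \<partial>N) \<le> (\<integral>\<^sup>+z. f z \<partial>N)"
proof -
  have "(\<Sum>(x,y)\<in>A. \<integral>\<^sup>+z\<in>cand x y. f z \<partial>N) = (\<integral>\<^sup>+z. (\<Sum>(x,y)\<in>A. f z * indicator (cand x y) z) \<partial>N)"
    using f by (subst nn_integral_sum) (auto simp: case_prod_beta setsN)
  also have "\<dots> \<le> (\<integral>\<^sup>+z. f z \<partial>N)"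
  proof (rule nn_integral_mono)
    fix z
    have fB: "finite {(x, y) \<in> A. z \<in> cand x y}" by (rule finite_subset[OF _ A(1)]) auto
    have "\<forall>a\<in>{(x, y) \<in> A. z \<in> cand x y}. \<forall>b\<in>{(x, y) \<in> A. z \<in> cand x y}. a = b"
    proof (clarify, rule ccontr)
      fix x y x' y' assume *: "(x, y) \<in> A" "z \<in> cand x y" "(x', y') \<in> A" "z \<in> cand x' y'" "\<not> (x = x' \<and> y = y')"
      then have "(x, y) \<noteq> (x', y')" by auto
      from cand_disjoint[OF _ _ this A(3) A(4)[OF *(1)] A(4)[OF *(3)] *(2)] A(2) * show False by auto
    qed
    then have "card {(x, y) \<in> A. z \<in> cand x y} \<le> 1"
      using card_le_Suc0_iff_eq[OF fB] by simp
    then have c: "of_nat (card {(x, y) \<in> A. z \<in> cand x y}) \<le> (1 :: ennreal)" by (simp add: of_nat_le_1_iff)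
    have "(\<Sum>(x,y)\<in>A. f z * indicator (cand x y) z) = f z * (\<Sum>(x,y)\<in>A. indicator (cand x y) z)"
      by (simp add: sum_distrib_left case_prod_beta)
    also have "(\<Sum>(x,y)\<in>A. indicator (cand x y) z) = (of_nat (card {(x, y) \<in> A. z \<in> cand x y}) :: ennreal)"
    proof -
      have "(\<Sum>(x,y)\<in>A. indicator (cand x y) z) = (\<Sum>a\<in>A. if a \<in> {(x, y) \<in> A. z \<in> cand x y} then 1 else 0 :: ennreal)"
        by (intro sum.cong) (auto simp: indicator_def)
      also have "\<dots> = (\<Sum>a\<in>{(x, y) \<in> A. z \<in> cand x y}. 1)"
        unfolding sum.inter_restrict[OF A(1), symmetric] by (rule sum.cong) auto
      finally show ?thesis by simp
    qed
    also have "f z * of_nat (card {(x, y) \<in> A. z \<in> cand x y}) \<le> f z * 1" by (intro mult_left_mono c) auto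
    finally show "(\<Sum>(x,y)\<in>A. f z * indicator (cand x y) z) \<le> f z" by simp
  qed
  finally show ?thesis .
qed

text \<open>Links of length at most \<open>qq * s\<close> already fit the next scale and wait; the
  stopped ones are never touched.\<close>

definition active :: "real \<Rightarrow> 'a set \<Rightarrow> ('a \<times> 'a) set" where
  "active s V = {(x, y) \<in> links P V. qq * s < dist x y \<and> \<not> stopped x y}"

text \<open>Induction on the set of links to be divided. The charges in \<open>S s W\<close> run
  over all vertices of the final \<open>W\<close>, since later insertions are also charged against
  the vertices inserted earlier in the same round.\<close>

lemma refine_links:
  assumes net: "net s V" and s: "0 < s" and Hf: "Hf \<in> borel_measurable N"
    and A: "finite A" "A \<subseteq> active s V"
  shows "\<exists>W. V \<subseteq> W \<and> finite W \<and> W \<subseteq> insert p (insert q K) \<and> inj_on P W \<and> (\<forall>v\<in>W. P v \<le> D) \<and> links P V - A \<subseteq> links P W \<and>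
    (\<forall>(a,b)\<in>links P W. (a,b) \<in> links P V - A \<or> (kap / 4 * (qq * s) \<le> P b - P a \<and> dist a b \<le> qq * s)) \<and>
    span W = span V \<and>
    ennreal (L W) \<le> ennreal (L V) + ennreal (4 / kap) * (\<Sum>(x,y)\<in>A. tt s x y) \<and>
    S s W \<le> S s V + ennreal (16 / kap) * (\<Sum>u\<in>W. \<Sum>l\<in>A. cg s u l) \<and>
    (\<Sum>u\<in>W. Hf u) \<le> (\<Sum>u\<in>V. Hf u) + ennreal (8 / (kap * s)) * (\<Sum>(x,y)\<in>A. \<integral>\<^sup>+z\<in>cand x y. Hf z \<partial>N)"
  using A
proof (induction A rule: finite_induct)
  case empty
  show ?case by (rule exI[of _ V]) (use net in \<open>auto simp: net_def\<close>)
next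
  case (insert l A)
  obtain x y where l: "l = (x, y)" by (cases l)
  have act: "(x, y) \<in> links P V" "qq * s < dist x y" "\<not> stopped x y" using insert.prems by (auto simp: active_def l)
  have xs: "dist x y \<le> s" using net act by (auto simp: net_def)
  have "A \<subseteq> active s V" using insert.prems by auto
  from insert.IH[OF this] obtain W where W: "V \<subseteq> W" "finite W" "W \<subseteq> insert p (insert q K)" "inj_on P W" "\<forall>v\<in>W. P v \<le> D" "links P V - A \<subseteq> links P W"
    "\<forall>(a,b)\<in>links P W. (a,b) \<in> links P V - A \<or> (kap / 4 * (qq * s) \<le> P b - P a \<and> dist a b \<le> qq * s)"
    "span W = span V"
    "ennreal (L W) \<le> ennreal (L V) + ennreal (4 / kap) * (\<Sum>(x,y)\<in>A. tt s x y)"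
    "S s W \<le> S s V + ennreal (16 / kap) * (\<Sum>u\<in>W. \<Sum>l\<in>A. cg s u l)"
    "(\<Sum>u\<in>W. Hf u) \<le> (\<Sum>u\<in>V. Hf u) + ennreal (8 / (kap * s)) * (\<Sum>(x,y)\<in>A. \<integral>\<^sup>+z\<in>cand x y. Hf z \<partial>N)"
    by (elim exE conjE) (rule that; assumption)
  have lW: "(x, y) \<in> links P W" using W(6) act insert.hyps l by auto
  note lD = linksD[OF lW]
  obtain z where z: "z \<in> cand x y"
    "ennreal (dist x z + dist z y - dist x y) \<le> ennreal (4 / kap) * (ennreal (s\<^sup>2) * h x y)"
    "(\<Sum>u\<in>W. tt s u z) \<le> ennreal (8 / kap) * (\<Sum>u\<in>W. cg s u (x, y))"
    "Hf z \<le> ennreal (8 / (kap * s)) * (\<integral>\<^sup>+z\<in>cand x y. Hf z \<partial>N)"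
    by (rule choose_vertex[OF s W(2) lD(4) act(2) xs act(3) Hf])
  have ns: "\<not> steep x y" using act by (simp add: stopped_def)
  note sl = cand_slab[OF z(1) ns]
  have pz: "P x < P z" "P z < P y" using sl(1,2) act(2) s by linarith+
  have zW: "z \<notin> W" using lD(4)[of z] pz by auto
  let ?W = "insert z W"
  have lk: "links P ?W = insert (x, z) (insert (z, y) (links P W - {(x, y)}))"
    by (rule links_insert[OF W(4) lW pz])
  have new: "kap / 4 * (qq * s) \<le> P z - P x" "kap / 4 * (qq * s) \<le> P y - P z" "dist x z \<le> qq * s" "dist z y \<le> qq * s"
    using sl act(2) xs by linarith+
  have exc0: "0 \<le> dist x z + dist z y - dist x y" using dist_triangle[of x y z] by linarith
  show ?case
  proof (intro exI[of _ ?W] conjI)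
    show "V \<subseteq> ?W" "finite ?W" using W by auto
    show "?W \<subseteq> insert p (insert q K)" using W(3) z(1) by (auto simp: cand_def)
    show "inj_on P ?W"
    proof -
      have "P z \<notin> P ` W" using lD(4) pz by force
      then show ?thesis using W(4) zW by simp
    qed
    show "\<forall>v\<in>?W. P v \<le> D" using W(5) pz lD(2) by force
    show "links P V - insert l A \<subseteq> links P ?W" using W(6) by (auto simp: lk l)
    show "\<forall>(a,b)\<in>links P ?W. (a,b) \<in> links P V - insert l A \<or> (kap / 4 * (qq * s) \<le> P b - P a \<and> dist a b \<le> qq * s)"
    proof (clarsimp simp only:)
      fix a b assume ab: "(a, b) \<in> links P ?W" "\<not> (kap / 4 * (qq * s) \<le> P b - P a \<and> dist a b \<le> qq * s)"
      then have "(a, b) \<in> links P W - {(x, y)}" using new lk by auto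
      then show "(a, b) \<in> links P V - insert l A" using W(7) ab(2) l by auto
    qed
    have "span ?W = span W" unfolding span_def by (subst sum_links_insert[OF W(2,4) lW pz]) simp
    then show "span ?W = span V" using W(8) by simp
    have "ennreal (L ?W) = ennreal (L W) + ennreal (dist x z + dist z y - dist x y)"
      unfolding L_insert[OF W(2,4) lW pz] using exc0 L_nonneg by (subst ennreal_plus) auto
    also have "\<dots> \<le> (ennreal (L V) + ennreal (4 / kap) * (\<Sum>(x,y)\<in>A. tt s x y)) + ennreal (4 / kap) * tt s x y"
    proof (intro add_mono W(9))
      have "dist x y \<le> C2 * s" using xs s by simp
      then have "tt s x y = ennreal (s\<^sup>2) * h x y" by (simp add: tt_def)
      then show "ennreal (dist x z + dist z y - dist x y) \<le> ennreal (4 / kap) * tt s x y" using z(2) by simp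
    qed
    also have "\<dots> = ennreal (L V) + ennreal (4 / kap) * (\<Sum>(x,y)\<in>insert l A. tt s x y)"
      using insert.hyps by (simp add: l distrib_left ac_simps)
    finally show "ennreal (L ?W) \<le> ennreal (L V) + ennreal (4 / kap) * (\<Sum>(x,y)\<in>insert l A. tt s x y)" .
    have "S s ?W = S s W + 2 * (\<Sum>u\<in>W. tt s u z)" by (rule S_insert[OF W(2) zW])
    also have "\<dots> \<le> (S s V + ennreal (16 / kap) * (\<Sum>u\<in>W. \<Sum>l\<in>A. cg s u l)) + 2 * (ennreal (8 / kap) * (\<Sum>u\<in>W. cg s u (x, y)))"
      by (intro add_mono W(10) mult_left_mono z(3)) auto
    also have "\<dots> = S s V + ennreal (16 / kap) * (\<Sum>u\<in>W. \<Sum>l\<in>insert l A. cg s u l)"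
    proof -
      have e: "2 * (ennreal (8 / kap) * B) = ennreal (16 / kap) * B" for B
      proof -
        have "ennreal (16 / kap) = ennreal 2 * ennreal (8 / kap)" by (subst ennreal_mult[symmetric]) auto
        then show ?thesis by (simp add: mult.assoc)
      qed
      have "(\<Sum>u\<in>W. \<Sum>l\<in>insert l A. cg s u l) = (\<Sum>u\<in>W. \<Sum>l\<in>A. cg s u l) + (\<Sum>u\<in>W. cg s u (x, y))"
        using insert.hyps by (simp add: l sum.distrib add.commute)
      then show ?thesis unfolding e by (simp only: distrib_left add.assoc)
    qed
    also have "\<dots> \<le> S s V + ennreal (16 / kap) * (\<Sum>u\<in>?W. \<Sum>l\<in>insert l A. cg s u l)"
      by (intro add_left_mono mult_left_mono sum_mono2) (use W in auto)
    finally show "S s ?W \<le> S s V + ennreal (16 / kap) * (\<Sum>u\<in>?W. \<Sum>l\<in>insert l A. cg s u l)" .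
    have "(\<Sum>u\<in>?W. Hf u) = (\<Sum>u\<in>W. Hf u) + Hf z" using W(2) zW by (simp add: add.commute)
    also have "\<dots> \<le> ((\<Sum>u\<in>V. Hf u) + ennreal (8 / (kap * s)) * (\<Sum>(x,y)\<in>A. \<integral>\<^sup>+z\<in>cand x y. Hf z \<partial>N)) +
       ennreal (8 / (kap * s)) * (\<integral>\<^sup>+z\<in>cand x y. Hf z \<partial>N)"
      by (intro add_mono W(11) z(4))
    also have "\<dots> = (\<Sum>u\<in>V. Hf u) + ennreal (8 / (kap * s)) * (\<Sum>(x,y)\<in>insert l A. \<integral>\<^sup>+z\<in>cand x y. Hf z \<partial>N)"
      using insert.hyps by (simp add: l distrib_left ac_simps)
    finally show "(\<Sum>u\<in>?W. Hf u) \<le> (\<Sum>u\<in>V. Hf u) + ennreal (8 / (kap * s)) * (\<Sum>(x,y)\<in>insert l A. \<integral>\<^sup>+z\<in>cand x y. Hf z \<partial>N)" .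
  qed
qed

text \<open>\<open>lost\<close> depends only on the fixed end points and on stopped links, and
  refinement preserves the latter.\<close>

lemma lost_mono:
  assumes "\<And>x y. (x, y) \<in> links P V \<Longrightarrow> stopped x y \<Longrightarrow> (x, y) \<in> links P W"
  shows "lost V \<subseteq> lost W"
proof -
  have "{(x,y)\<in>links P V. stopped x y} \<subseteq> {(x,y)\<in>links P W. stopped x y}"
    "{(x,y)\<in>links P V. sparse x y} \<subseteq> {(x,y)\<in>links P W. sparse x y}"
    "{(x,y)\<in>links P V. steep x y} \<subseteq> {(x,y)\<in>links P W. steep x y}"
    using assms by (auto simp: stopped_def)
  then show ?thesis unfolding lost_def by (intro Un_mono UN_mono) auto
qed

text \<open>Because the candidate sets of different active links are disjoint, the sums over links
  collapse to single integrals over the whole space.\<close>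

lemma refine_round:
  assumes net: "net s V" and s: "0 < s" and Hf: "Hf \<in> borel_measurable N"
  obtains W where "V \<subseteq> W" "net (qq * s) W" "lost V \<subseteq> lost W" "span W = span V"
    "ennreal (L W) \<le> ennreal (L V) + ennreal (4 / kap) * S s V"
    "S s W \<le> S s V + ennreal (16 / kap) * (\<Sum>u\<in>W. G s u)"
    "(\<Sum>u\<in>W. Hf u) \<le> (\<Sum>u\<in>V. Hf u) + ennreal (8 / (kap * s)) * (\<integral>\<^sup>+z. Hf z \<partial>N)"
proof -
  have fin: "finite V" and inj: "inj_on P V" using net by (auto simp: net_def)
  define A where "A = active s V"
  have Al: "A \<subseteq> links P V" by (auto simp: A_def active_def)
  have A: "finite A" "A \<subseteq> active s V" "A \<subseteq> links P V"
    using Al finite_subset[OF Al finite_links[OF fin, of P]] by (auto simp: A_def)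
  have ns: "\<not> steep x y" if "(x, y) \<in> A" for x y using that by (auto simp: A_def active_def stopped_def)
  have AV: "A \<subseteq> V \<times> V" using Al by (auto simp: links_def)
  obtain W where W: "V \<subseteq> W" "finite W" "W \<subseteq> insert p (insert q K)" "inj_on P W" "\<forall>v\<in>W. P v \<le> D" "links P V - A \<subseteq> links P W"
    "\<forall>(a,b)\<in>links P W. (a,b) \<in> links P V - A \<or> (kap / 4 * (qq * s) \<le> P b - P a \<and> dist a b \<le> qq * s)"
    "span W = span V"
    "ennreal (L W) \<le> ennreal (L V) + ennreal (4 / kap) * (\<Sum>(x,y)\<in>A. tt s x y)"
    "S s W \<le> S s V + ennreal (16 / kap) * (\<Sum>u\<in>W. \<Sum>l\<in>A. cg s u l)"
    "(\<Sum>u\<in>W. Hf u) \<le> (\<Sum>u\<in>V. Hf u) + ennreal (8 / (kap * s)) * (\<Sum>(x,y)\<in>A. \<integral>\<^sup>+z\<in>cand x y. Hf z \<partial>N)"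
    using refine_links[OF net s Hf A(1,2)] by (elim exE conjE) (rule that; assumption)
  show ?thesis
  proof (rule that[OF W(1)])
    show "net (qq * s) W"
    proof -
      have "kap / 4 * (qq * s) \<le> P b - P a \<and> (dist a b \<le> qq * s \<or> stopped a b)" if ab: "(a, b) \<in> links P W" for a b
      proof (cases "(a, b) \<in> links P V - A")
        case True
        then have "kap / 4 * s \<le> P b - P a" using net by (auto simp: net_def)
        then show ?thesis using True s by (auto simp: A_def active_def)
      next
        case False
        then show ?thesis using W(7) ab by auto
      qed
      then show ?thesis using W(1-5) net by (auto simp: net_def)
    qed
    show "lost V \<subseteq> lost W" by (rule lost_mono) (use W(6) in \<open>auto simp: A_def active_def\<close>)
    show "span W = span V" by fact
    have "(\<Sum>(x,y)\<in>A. tt s x y) \<le> (\<Sum>(x,y)\<in>V\<times>V. tt s x y)"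
      by (rule sum_mono2) (use fin AV in auto)
    also have "\<dots> = S s V" by (simp add: S_def sum.cartesian_product)
    finally have "ennreal (4 / kap) * (\<Sum>(x,y)\<in>A. tt s x y) \<le> ennreal (4 / kap) * S s V" by (rule mult_left_mono) auto
    then show "ennreal (L W) \<le> ennreal (L V) + ennreal (4 / kap) * S s V" using W(9) by (meson add_left_mono order_trans)
    have "(\<Sum>l\<in>A. cg s u l) \<le> G s u" for u
    proof -
      have m: "(\<lambda>z. indicator (annulus s u) z * h u z) \<in> borel_measurable N" by measurable
      have "(\<Sum>l\<in>A. cg s u l) = ennreal s * (\<Sum>(x,y)\<in>A. \<integral>\<^sup>+z\<in>cand x y. (indicator (annulus s u) z * h u z) \<partial>N)"
        unfolding cg_def sum_distrib_left by (simp add: case_prod_beta)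
      also have "\<dots> \<le> G s u" unfolding G_def
        by (intro mult_left_mono sum_cand_le[OF A(1,3) inj ns m]) auto
      finally show ?thesis .
    qed
    then have "ennreal (16 / kap) * (\<Sum>u\<in>W. \<Sum>l\<in>A. cg s u l) \<le> ennreal (16 / kap) * (\<Sum>u\<in>W. G s u)"
      by (intro mult_left_mono sum_mono) auto
    then show "S s W \<le> S s V + ennreal (16 / kap) * (\<Sum>u\<in>W. G s u)" using W(10) by (meson add_left_mono order_trans)
    have "ennreal (8 / (kap * s)) * (\<Sum>(x,y)\<in>A. \<integral>\<^sup>+z\<in>cand x y. Hf z \<partial>N) \<le> ennreal (8 / (kap * s)) * (\<integral>\<^sup>+z. Hf z \<partial>N)"
      by (intro mult_left_mono sum_cand_le[OF A(1,3) inj ns Hf]) auto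
    then show "(\<Sum>u\<in>W. Hf u) \<le> (\<Sum>u\<in>V. Hf u) + ennreal (8 / (kap * s)) * (\<integral>\<^sup>+z. Hf z \<partial>N)"
      using W(11) by (meson add_left_mono order_trans)
  qed
qed

end

section \<open>Measure of the points given up, and iteration over the scales\<close>

context path_measure begin

text \<open>The gain comes from the factor \<open>s\<^sup>2\<close> in \<open>tt\<close>, while the
  cut-off only drops terms. This gain allows the charges of one scale to be absorbed at the
  next.\<close>

lemma S_shrink: assumes "0 \<le> s" shows "S (qq * s) W \<le> ennreal (qq\<^sup>2) * S s W"
proof -
  have "tt (qq * s) u x \<le> ennreal (qq\<^sup>2) * tt s u x" for u x
  proof (cases "dist u x \<le> C2 * (qq * s)")
    case True
    then have "dist u x \<le> C2 * s" using assms by simp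
    moreover have "ennreal ((qq * s)\<^sup>2) * h u x = ennreal (qq\<^sup>2) * (ennreal (s\<^sup>2) * h u x)"
      unfolding power_mult_distrib by (subst ennreal_mult) (auto simp: mult.assoc)
    ultimately show ?thesis using True unfolding tt_def by (simp only: mem_cball indicator_simps mult_1 order_refl)
  qed (simp add: tt_def)
  then show ?thesis unfolding S_def sum_distrib_left by (intro sum_mono)
qed

lemma triangle_excess_sets: "{w. c < triangle_excess u x w} \<in> sets borel"
  unfolding triangle_excess_eq
  by (intro borel_open open_Collect_less continuous_intros continuous_on_min)

lemma bent_part_sets:
  "(if b then cball u r \<inter> {w. c < triangle_excess u x w} else {}) \<in> sets borel"
proof -
  have "cball u r \<inter> {w. c < triangle_excess u x w} \<in> sets borel" by (intro sets.Int triangle_excess_sets) auto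
  then show ?thesis by (cases b) (simp_all only: if_True if_False sets.empty_sets)
qed

text \<open>Markov's inequality for each pair of vertices: on a bent triple the integrand is at
  least \<open>del * s / (2 * C2 * s) ^ 3\<close>, and \<open>8 * 10^23\<close> is
  \<open>8 * C2 ^ 3 / del\<close>.\<close>

lemma emeasure_bent:
  assumes s: "0 < s" and V: "finite V"
  shows "emeasure N (bent s V) \<le> ennreal (8 * 10^23) * S s V"
proof -
  define B where "B u x = {w. dist u x \<le> C2 * s \<and> dist u w \<le> C2 * s \<and> del * s < triangle_excess u x w}" for u x :: 'a
  have Bs: "B u x \<in> sets N" for u x
  proof -
    have "B u x = (if dist u x \<le> C2 * s then cball u (C2 * s) \<inter> {w. del * s < triangle_excess u x w} else {})"
      by (auto simp: B_def)
    then show ?thesis unfolding setsN by (simp only: bent_part_sets)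
  qed
  have le: "emeasure N (B u x) \<le> ennreal (8 * 10^23) * tt s u x" for u x
  proof (cases "dist u x \<le> C2 * s")
    case True
    define c where "c = del * s / (2 * C2 * s)^3"
    have c: "0 < c" using s by (simp add: c_def)
    have "ennreal c * emeasure N (B u x) = (\<integral>\<^sup>+w. ennreal c * indicator (B u x) w \<partial>N)"
      using Bs by (simp add: nn_integral_cmult_indicator)
    also have "\<dots> \<le> h u x" unfolding h_def
    proof (rule nn_integral_mono)
      fix w
      show "ennreal c * indicator (B u x) w \<le> crv u x w"
      proof (cases "w \<in> B u x")
        case w: True
        then have B: "dist u w \<le> C2 * s" "del * s < triangle_excess u x w" by (auto simp: B_def)
        have d: "diameter {u, x, w} \<le> 2 * C2 * s"
          unfolding diameter_triple using True B dist_triangle[of x w u] dist_commute[of x u] s by simp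
        have d0: "0 < diameter {u, x, w}"
        proof (rule ccontr)
          assume "\<not> ?thesis"
          then have "u = x \<and> x = w" unfolding diameter_triple
            by (metis max.cobounded1 max.cobounded2 not_less order_trans zero_less_dist_iff)
          then show False using B s by simp
        qed
        have "c \<le> triangle_excess u x w / diameter {u, x, w} ^ 3"
          unfolding c_def by (intro frac_le power_mono d triangle_excess_nonneg) (use B s d0 in auto)
        then show ?thesis using w by (simp add: crv_def ennreal_leI)
      qed simp
    qed
    finally have *: "ennreal c * emeasure N (B u x) \<le> h u x" .
    have "emeasure N (B u x) = ennreal (1 / c) * (ennreal c * emeasure N (B u x))"
      using c unfolding mult.assoc[symmetric] by (subst ennreal_mult[symmetric]) auto
    also have "\<dots> \<le> ennreal (1 / c) * h u x" by (intro mult_left_mono *) auto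
    also have "1 / c = 8 * 10^23 * s\<^sup>2"
      using s by (simp add: c_def power3_eq_cube power2_eq_square field_simps)
    also have "ennreal (8 * 10^23 * s\<^sup>2) * h u x = ennreal (8 * 10^23) * tt s u x"
      using True by (simp add: tt_def ennreal_mult mult.assoc)
    finally show ?thesis .
  qed (simp add: B_def)
  have sub: "bent s V \<subseteq> (\<Union>a\<in>V\<times>V. B (fst a) (snd a))"
  proof
    fix w assume "w \<in> bent s V"
    then obtain u x where "u \<in> V" "x \<in> V" "w \<in> B u x" unfolding bent_def B_def by blast
    then show "w \<in> (\<Union>a\<in>V\<times>V. B (fst a) (snd a))" by (intro UN_I[of "(u, x)"]) simp_all
  qed
  have "(\<Union>a\<in>V\<times>V. B (fst a) (snd a)) \<in> sets N" by (intro sets.finite_UN Bs) (use V in simp)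
  then have "emeasure N (bent s V) \<le> emeasure N (\<Union>a\<in>V\<times>V. B (fst a) (snd a))"
    by (rule emeasure_mono[OF sub])
  also have "\<dots> \<le> (\<Sum>a\<in>V\<times>V. emeasure N (B (fst a) (snd a)))"
    by (rule emeasure_subadditive_finite) (use V Bs in auto)
  also have "\<dots> \<le> (\<Sum>a\<in>V\<times>V. ennreal (8 * 10^23) * tt s (fst a) (snd a))"
    by (intro sum_mono le)
  also have "\<dots> = ennreal (8 * 10^23) * S s V"
    by (simp add: S_def sum_distrib_left sum.cartesian_product case_prod_beta)
  finally show ?thesis .
qed

lemma bent_sets: "finite V \<Longrightarrow> bent s V \<in> sets borel"
proof -
  assume V: "finite V"
  have "bent s V = K \<inter> (\<Union>u\<in>V. \<Union>x\<in>V. if dist u x \<le> C2 * s then cball u (C2 * s) \<inter> {w. del * s < triangle_excess u x w} else {})"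
    (is "_ = ?R")
  proof
    show "bent s V \<subseteq> ?R" by (fastforce simp: bent_def)
    show "?R \<subseteq> bent s V" by (auto simp: bent_def split: if_splits intro!: bexI)
  qed
  moreover have "?R \<in> sets borel" using V K by (intro sets.Int sets.finite_UN bent_part_sets)
  ultimately show ?thesis by simp
qed

lemma finite_links_sub: "finite V \<Longrightarrow> finite {(x,y)\<in>links P V. R x y}"
  by (rule finite_subset[OF _ finite_links[of V P]]) auto

lemma lost_sets: assumes "finite V" shows "lost V \<in> sets borel"
  unfolding lost_def
  using finite_links_sub[OF assms] cand_sets
  by (intro sets.Un sets.finite_UN) (auto simp: case_prod_beta)

text \<open>The main contributions are the balls of relative radius \<open>lam\<close> around
  \<open>p\<close>, \<open>q\<close> and the stopped links, together about \<open>D / 125\<close>.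
  The defects of all links add up to at most \<open>D / 10^40\<close>, so the steep links are so
  short in total that even the factor \<open>Mb\<close> does no harm.\<close>

lemma emeasure_lost:
  assumes V: "net s V" and s: "0 < s" and span: "span V = D" and L: "L V \<le> D + D / 10^40"
  shows "emeasure N (lost V) \<le> ennreal (D / 64)"
proof -
  have fin: "finite V" and VK: "V \<subseteq> insert p (insert q K)" using V by (auto simp: net_def)
  define A where "A R = {(x,y)\<in>links P V. R x y}" for R
  have fA: "finite (A R)" for R unfolding A_def by (rule finite_links_sub[OF fin])
  have dp: "0 < dist x y" "x \<in> insert p (insert q K)" "y \<in> insert p (insert q K)" if "(x, y) \<in> A R" for x y R
    using that linksD[of x y P V] VK by (auto simp: A_def)
  have ball2: "emeasure N (cball x (c * dist x y) \<union> cball y (c * dist x y)) \<le> ennreal (8 * c * dist x y)"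
    if "(x, y) \<in> A R" "0 < c" for x y c R
  proof -
    have "emeasure N (cball x (c * dist x y) \<union> cball y (c * dist x y)) \<le> emeasure N (cball x (c * dist x y)) + emeasure N (cball y (c * dist x y))"
      by (rule emeasure_subadditive) (auto simp: setsN)
    also have "\<dots> \<le> ennreal (4 * (c * dist x y)) + ennreal (4 * (c * dist x y))"
      by (intro add_mono reg) (use dp[OF that(1)] that(2) in auto)
    also have "\<dots> = ennreal (8 * c * dist x y)" using that by (subst ennreal_plus[symmetric]) auto
    finally show ?thesis .
  qed
  define tot where "tot R = (\<Sum>(x,y)\<in>A R. dist x y)" for R
  have tot: "tot R \<le> L V" for R unfolding tot_def L_def
    by (rule sum_mono2) (use finite_links[OF fin] in \<open>auto simp: A_def\<close>)
  have balls: "emeasure N (\<Union>(x,y)\<in>A R. cball x (c * dist x y) \<union> cball y (c * dist x y)) \<le> ennreal (8 * c * tot R)"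
    if "0 < c" for c R
  proof -
    have "emeasure N (\<Union>(x,y)\<in>A R. cball x (c * dist x y) \<union> cball y (c * dist x y))
       \<le> (\<Sum>a\<in>A R. emeasure N (case a of (x, y) \<Rightarrow> cball x (c * dist x y) \<union> cball y (c * dist x y)))"
      by (rule emeasure_subadditive_finite) (use fA in \<open>auto simp: setsN\<close>)
    also have "\<dots> \<le> (\<Sum>a\<in>A R. ennreal (case a of (x, y) \<Rightarrow> 8 * c * dist x y))"
      by (rule sum_mono) (use ball2 that in \<open>auto split: prod.splits\<close>)
    also have "\<dots> = ennreal (8 * c * tot R)"
      using that unfolding tot_def by (subst sum_ennreal) (auto simp: sum_distrib_left case_prod_beta)
    finally show ?thesis .
  qed
  have cands: "emeasure N (\<Union>(x,y)\<in>A sparse. cand x y) \<le> ennreal (kap * tot sparse)"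
  proof -
    have "emeasure N (\<Union>(x,y)\<in>A sparse. cand x y) \<le> (\<Sum>a\<in>A sparse. emeasure N (case a of (x, y) \<Rightarrow> cand x y))"
      by (rule emeasure_subadditive_finite) (use fA cand_sets in \<open>auto simp: setsN\<close>)
    also have "\<dots> \<le> (\<Sum>a\<in>A sparse. ennreal (case a of (x, y) \<Rightarrow> kap * dist x y))"
      by (rule sum_mono) (auto simp: A_def sparse_def less_imp_le split: prod.splits)
    also have "\<dots> = ennreal (kap * tot sparse)"
      unfolding tot_def by (subst sum_ennreal) (auto simp: sum_distrib_left case_prod_beta)
    finally show ?thesis .
  qed
  have steep: "tau * tot steep \<le> D / 10^40"
  proof -
    have "tau * tot steep = (\<Sum>(x,y)\<in>A steep. tau * dist x y)" by (simp add: tot_def sum_distrib_left case_prod_beta)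
    also have "\<dots> \<le> (\<Sum>(x,y)\<in>A steep. E x y)" by (rule sum_mono) (auto simp: A_def steep_def)
    also have "\<dots> \<le> (\<Sum>(x,y)\<in>links P V. E x y)"
    proof (rule sum_mono2)
      show "0 \<le> (case b of (x, y) \<Rightarrow> E x y)" for b using P_le by (auto simp: E_def split: prod.splits)
    qed (use finite_links[OF fin] in \<open>auto simp: A_def\<close>)
    also have "\<dots> = L V - span V" unfolding L_def span_def E_def by (simp add: case_prod_beta sum_subtractf)
    finally show ?thesis using span L by simp
  qed
  have tot0: "0 \<le> tot R" for R unfolding tot_def by (rule sum_nonneg) auto
  have c: "cball x e \<in> sets N" for x e by (simp add: setsN)
  have "emeasure N (lost V) \<le> ennreal (4 * (lam * D)) + ennreal (4 * (lam * D)) + ennreal (8 * lam * tot stopped) + ennreal (kap * tot sparse) + ennreal (8 * Mb * tot steep)"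
  proof -
    have u: "emeasure N (X \<union> Y) \<le> a + b" if "X \<in> sets N" "Y \<in> sets N" "emeasure N X \<le> a" "emeasure N Y \<le> b" for X Y a b
      using emeasure_subadditive[OF that(1,2)] add_mono[OF that(3,4)] by (rule order_trans)
    show ?thesis unfolding lost_def A_def[symmetric]
    proof (intro u)
      show "emeasure N (cball p (lam * D)) \<le> ennreal (4 * (lam * D))" "emeasure N (cball q (lam * D)) \<le> ennreal (4 * (lam * D))"
        using reg[of p "lam * D"] reg[of q "lam * D"] D(2) by auto
      show "emeasure N (\<Union>(x,y)\<in>A stopped. cball x (lam * dist x y) \<union> cball y (lam * dist x y)) \<le> ennreal (8 * lam * tot stopped)"
        by (rule balls) simp
      show "emeasure N (\<Union>(x,y)\<in>A steep. cball x (Mb * dist x y) \<union> cball y (Mb * dist x y)) \<le> ennreal (8 * Mb * tot steep)"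
        by (rule balls) simp
      show "emeasure N (\<Union>(x,y)\<in>A sparse. cand x y) \<le> ennreal (kap * tot sparse)" by (rule cands)
    qed (use fA c cand_sets setsN in \<open>auto intro!: sets.finite_UN sets.Un\<close>)
  qed
  also have "\<dots> = ennreal (4 * (lam * D) + 4 * (lam * D) + 8 * lam * tot stopped + kap * tot sparse + 8 * Mb * tot steep)"
    using D tot0 by (simp flip: ennreal_plus)
  also have "\<dots> \<le> ennreal (D / 64)"
  proof (rule ennreal_leI)
    have "D / 10^40 \<le> tau * (D / 100000000000000000000)" using D(2) by (simp add: field_simps)
    then have "tau * tot steep \<le> tau * (D / 100000000000000000000)" using steep by linarith
    then have steep': "tot steep \<le> D / 100000000000000000000" by (rule mult_left_le_imp_le) simp
    have "D / 10^40 \<le> D / 1000" by (rule divide_left_mono) (use D(2) in auto)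
    then have "L V \<le> 1001 / 1000 * D" using L by linarith
    then show "4 * (lam * D) + 4 * (lam * D) + 8 * lam * tot stopped + kap * tot sparse + 8 * Mb * tot steep \<le> D / 64"
      using tot[of stopped] tot[of sparse] steep' D(2) by linarith
  qed
  finally show ?thesis .
qed

text \<open>Scale 0 is twice \<open>D\<close>, so that the two-point chain is a net and covers all
  of \<open>K\<close>.\<close>

definition sc :: "nat \<Rightarrow> real" where "sc k = 2 * D * qq ^ k"

lemma sc_pos: "0 < sc k" "sc k \<le> 2 * D" "sc (Suc k) = qq * sc k"
  using D(2) by (auto simp: sc_def power_le_one mult_left_le)

text \<open>The curvature that a vertex present at scale \<open>k\<close> may still be charged for
  before scale \<open>n\<close>.\<close>

definition HH :: "nat \<Rightarrow> nat \<Rightarrow> 'a \<Rightarrow> ennreal" where "HH n k u = (\<Sum>i\<in>{k..<n}. G (sc i) u)"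

lemma HH_measurable [measurable]: "HH n k \<in> borel_measurable N"
  unfolding HH_def by measurable

text \<open>Two inequalities dictate the weights:
  \<open>4 / kap + 1 \<le> A0 * (1 - qq\<^sup>2)\<close>, where the right-hand side is about
  \<open>10^7\<close>, and \<open>A0 * qq\<^sup>2 * 16 / kap \<le> B0\<close>.\<close>

definition A0 :: ennreal where "A0 = ennreal (10^13)"
definition B0 :: ennreal where "B0 = ennreal (10^21)"

definition uncovered :: "real \<Rightarrow> 'a set \<Rightarrow> 'a set" where
  "uncovered s V = {w \<in> K. (\<forall>v\<in>V. s < dist v w) \<and> w \<notin> lost V}"

lemma uncovered_sets: assumes "finite V" shows "uncovered s V \<in> sets borel"
proof -
  have "uncovered s V = K - (\<Union>v\<in>V. cball v s) - lost V" by (auto simp: uncovered_def not_le)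
  moreover have "(\<Union>v\<in>V. cball v s) \<in> sets borel" using assms by (intro sets.finite_UN) auto
  ultimately show ?thesis using K lost_sets[OF assms] by auto
qed

lemma ennreal_collect:
  "0 \<le> a \<Longrightarrow> 0 \<le> b \<Longrightarrow> 0 \<le> c \<Longrightarrow> ennreal a + 1 + ennreal b * ennreal c = ennreal (a + 1 + b * c)"
  "0 \<le> a \<Longrightarrow> 0 \<le> b \<Longrightarrow> 0 \<le> c \<Longrightarrow> ennreal a * ennreal b * ennreal c = ennreal (a * b * c)"
  by (simp_all add: ennreal_mult)

lemma regroup:
  fixes l a S A Q c1 c2 g B H :: ennreal
  shows "(l + c1 * S) + (a + S) + A * (Q * (S + c2 * g)) + B * H
    = l + a + (c1 + 1 + A * Q) * S + (A * Q * c2) * g + B * H"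
  by (simp add: distrib_left distrib_right ac_simps)

text \<open>The left-hand side of the first inequality is the quantity that does not increase from one scale to the next:
  the length of the chain, the curvature seen at the current scale, and the curvature still to be seen at smaller
  scales; \<open>acc\<close> accumulates the curvature used up so far, which bounds the mass that has been missed.\<close>

lemma refine_all:
  assumes "k \<le> n"
  shows "\<exists>V acc. net (sc k) V \<and> span V = D \<and>
    ennreal (L V) + acc + A0 * S (sc k) V + B0 * (\<Sum>u\<in>V. HH n k u)
      \<le> ennreal D + A0 * S (sc 0) {p, q} + B0 * (HH n 0 p + HH n 0 q) + B0 * (\<Sum>j<k. ennreal (8 / (kap * sc j)) * (\<integral>\<^sup>+u. HH n j u \<partial>N)) \<and>
    emeasure N (uncovered (sc k) V) \<le> ennreal (8 * 10^23) * acc"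
  using assms
proof (induction k)
  case 0
  have pq: "p \<noteq> q" using D by auto
  have l: "links P {p, q} = {(p, q)}" using D by (auto simp: links_def)
  have Dq: "P q = D" using D(1) by simp
  have s0: "sc 0 = 2 * D" by (simp add: sc_def)
  have "net (sc 0) {p, q}" unfolding net_def l s0 using D(2) pq Dq by (auto simp: inj_on_def)
  moreover have "span {p, q} = D" "L {p, q} = D" using Dq by (auto simp: span_def L_def l)
  moreover have "uncovered (sc 0) {p, q} = {}"
  proof -
    have "dist p w \<le> 2 * D" if "w \<in> K" for w using bet[OF that] zero_le_dist[of w q] e1 D(2) by linarith
    then show ?thesis by (force simp: uncovered_def s0)
  qed
  ultimately show ?case using pq by (intro exI[of _ "{p, q}"] exI[of _ 0]) (simp add: ac_simps)
next
  case (Suc k)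
  define s where "s = sc k"
  have s: "0 < s" "s \<le> 2 * D" "sc (Suc k) = qq * s" using sc_pos by (auto simp: s_def)
  from Suc obtain V acc where V: "net s V" "span V = D"
    "ennreal (L V) + acc + A0 * S s V + B0 * (\<Sum>u\<in>V. HH n k u)
      \<le> ennreal D + A0 * S (sc 0) {p, q} + B0 * (HH n 0 p + HH n 0 q) + B0 * (\<Sum>j<k. ennreal (8 / (kap * sc j)) * (\<integral>\<^sup>+u. HH n j u \<partial>N))"
    "emeasure N (uncovered s V) \<le> ennreal (8 * 10^23) * acc"
    unfolding s_def by auto
  have fin: "finite V" using V by (auto simp: net_def)
  obtain W where W: "V \<subseteq> W" "net (qq * s) W" "lost V \<subseteq> lost W" "span W = span V"
    "ennreal (L W) \<le> ennreal (L V) + ennreal (4 / kap) * S s V"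
    "S s W \<le> S s V + ennreal (16 / kap) * (\<Sum>u\<in>W. G s u)"
    "(\<Sum>u\<in>W. HH n k u) \<le> (\<Sum>u\<in>V. HH n k u) + ennreal (8 / (kap * s)) * (\<integral>\<^sup>+z. HH n k z \<partial>N)"
    by (rule refine_round[OF V(1) s(1) HH_measurable])
  have finW: "finite W" using W by (auto simp: net_def)
  define g where "g = (\<Sum>u\<in>W. G s u)"
  define H' where "H' = (\<Sum>u\<in>W. HH n (Suc k) u)"
  define c where "c = ennreal (8 / (kap * s)) * (\<integral>\<^sup>+z. HH n k z \<partial>N)"
  define T where "T = ennreal D + A0 * S (sc 0) {p, q} + B0 * (HH n 0 p + HH n 0 q)"
  define R where "R = (\<Sum>j<k. ennreal (8 / (kap * sc j)) * (\<integral>\<^sup>+u. HH n j u \<partial>N))"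
  have gH: "g + H' = (\<Sum>u\<in>W. HH n k u)"
    unfolding g_def H'_def HH_def s_def using Suc.prems by (simp add: sum.atLeast_Suc_lessThan sum.distrib)
  have "ennreal (L W) + (acc + S s V) + A0 * S (qq * s) W + B0 * H'
    \<le> (ennreal (L V) + ennreal (4 / kap) * S s V) + (acc + S s V) + A0 * (ennreal (qq\<^sup>2) * (S s V + ennreal (16 / kap) * g)) + B0 * H'"
  proof (intro add_mono mult_left_mono order_refl)
    show "ennreal (L W) \<le> ennreal (L V) + ennreal (4 / kap) * S s V" by (rule W(5))
    have "S (qq * s) W \<le> ennreal (qq\<^sup>2) * S s W" by (rule S_shrink) (use s in simp)
    also have "\<dots> \<le> ennreal (qq\<^sup>2) * (S s V + ennreal (16 / kap) * g)"
      using W(6) unfolding g_def by (rule mult_left_mono) auto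
    finally show "S (qq * s) W \<le> \<dots>" .
  qed auto
  also have "\<dots> = ennreal (L V) + acc + (ennreal (4 / kap) + 1 + A0 * ennreal (qq\<^sup>2)) * S s V + (A0 * ennreal (qq\<^sup>2) * ennreal (16 / kap)) * g + B0 * H'"
    by (rule regroup)
  also have "\<dots> \<le> ennreal (L V) + acc + A0 * S s V + B0 * g + B0 * H'"
  proof (intro add_mono mult_right_mono order_refl)
    \<comment> \<open>The three terms are the growth of length, the mass of bent points and the pair
      charges carried on; together they must not exceed the present weight of
      \<open>S s V\<close>.\<close>
    show "ennreal (4 / kap) + 1 + A0 * ennreal (qq\<^sup>2) \<le> A0"
    proof -
      have "ennreal (4 / kap) + 1 + A0 * ennreal (qq\<^sup>2) = ennreal (4 / kap + 1 + 10^13 * qq\<^sup>2)"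
        unfolding A0_def by (rule ennreal_collect) simp_all
      also have "\<dots> \<le> A0" unfolding A0_def by (rule ennreal_leI) (simp add: power2_eq_square)
      finally show ?thesis .
    qed
    show "A0 * ennreal (qq\<^sup>2) * ennreal (16 / kap) \<le> B0"
    proof -
      have "A0 * ennreal (qq\<^sup>2) * ennreal (16 / kap) = ennreal (10^13 * qq\<^sup>2 * (16 / kap))"
        unfolding A0_def by (rule ennreal_collect) simp_all
      also have "\<dots> \<le> B0" unfolding B0_def by (rule ennreal_leI) (simp add: power2_eq_square)
      finally show ?thesis .
    qed
  qed auto
  also have "\<dots> = ennreal (L V) + acc + A0 * S s V + B0 * (\<Sum>u\<in>W. HH n k u)"
    unfolding gH[symmetric] by (simp only: distrib_left add.assoc)
  also have "\<dots> \<le> ennreal (L V) + acc + A0 * S s V + B0 * ((\<Sum>u\<in>V. HH n k u) + c)"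
    using W(7) unfolding c_def by (intro add_mono mult_left_mono order_refl) auto
  also have "\<dots> = (ennreal (L V) + acc + A0 * S s V + B0 * (\<Sum>u\<in>V. HH n k u)) + B0 * c"
    by (simp only: distrib_left add.assoc)
  also have "\<dots> \<le> (T + B0 * R) + B0 * c"
    by (rule add_right_mono) (use V(3) in \<open>simp only: T_def R_def\<close>)
  also have "\<dots> = T + B0 * (\<Sum>j<Suc k. ennreal (8 / (kap * sc j)) * (\<integral>\<^sup>+u. HH n j u \<partial>N))"
    unfolding R_def c_def s_def by (simp only: sum.lessThan_Suc distrib_left add.assoc)
  finally have main: "ennreal (L W) + (acc + S s V) + A0 * S (sc (Suc k)) W + B0 * H' \<le> \<dots>" by (simp only: s(3))
  \<comment> \<open>By \<open>covered_step\<close>, a point can cease to be covered in this round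
    only by being bent.\<close>
  have sub: "uncovered (qq * s) W \<subseteq> uncovered s V \<union> bent s V"
  proof
    fix w assume w: "w \<in> uncovered (qq * s) W"
    then have w1: "w \<in> K" "\<And>v. v \<in> V \<Longrightarrow> qq * s < dist v w" "w \<notin> lost V" using W(1,3) by (auto simp: uncovered_def)
    show "w \<in> uncovered s V \<union> bent s V"
    proof (rule ccontr)
      assume n: "\<not> ?thesis"
      then obtain v where "v \<in> V" "dist v w \<le> s" using w1 by (force simp: uncovered_def)
      then obtain v' where "v' \<in> V" "dist v' w \<le> qq * s"
        using covered_step[OF V(1) s(1,2) w1(1,3)] n by blast
      then show False using w1(2) by force
    qed
  qed
  have "emeasure N (uncovered (qq * s) W) \<le> emeasure N (uncovered s V) + emeasure N (bent s V)"
  proof -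
    have st: "uncovered s V \<in> sets N" "bent s V \<in> sets N" using uncovered_sets[OF fin] bent_sets[OF fin] by (auto simp: setsN)
    have "emeasure N (uncovered (qq * s) W) \<le> emeasure N (uncovered s V \<union> bent s V)" by (rule emeasure_mono[OF sub]) (use st in auto)
    then show ?thesis using emeasure_subadditive[OF st] by simp
  qed
  also have "\<dots> \<le> ennreal (8 * 10^23) * acc + ennreal (8 * 10^23) * S s V"
    by (intro add_mono V(4) emeasure_bent s fin)
  also have "\<dots> = ennreal (8 * 10^23) * (acc + S s V)" by (simp add: distrib_left)
  finally have unc: "emeasure N (uncovered (sc (Suc k)) W) \<le> ennreal (8 * 10^23) * (acc + S s V)" by (simp only: s(3))
  show ?case
  proof (intro exI conjI)
    show "net (sc (Suc k)) W" unfolding s(3) by (rule W(2))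
    show "span W = D" using W(4) V(2) by simp
    show "emeasure N (uncovered (sc (Suc k)) W) \<le> ennreal (8 * 10^23) * (acc + S s V)" by (rule unc)
    show "ennreal (L W) + (acc + S s V) + A0 * S (sc (Suc k)) W + B0 * (\<Sum>u\<in>W. HH n (Suc k) u)
      \<le> ennreal D + A0 * S (sc 0) {p, q} + B0 * (HH n 0 p + HH n 0 q) + B0 * (\<Sum>j<Suc k. ennreal (8 / (kap * sc j)) * (\<integral>\<^sup>+u. HH n j u \<partial>N))"
      using main unfolding H'_def T_def .
  qed
qed

end

section \<open>A short chain close to a large part of the set\<close>

text \<open>\<open>3200000000000\<close> is the quotient of the outer and inner radii of
  \<open>annulus\<close>: after this many scales the annulus around a vertex has moved off its
  former position.\<close>

definition rounds :: nat where "rounds = (SOME n. (1999999 / 2000000 :: real) ^ n < 1 / 3200000000000)"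
text \<open>The total charge is a multiple of \<open>eps0 * D\<close> with factor of order
  \<open>10^33 * rounds\<close>. It has to stay below \<open>D / 10^40\<close>; the remaining powers
  of ten are a margin.\<close>

definition eps0 :: real where "eps0 = 1 / (10^80 * (real rounds + 1))"

lemma rounds: "(1999999 / 2000000 :: real) ^ rounds < 1 / 3200000000000"
  unfolding rounds_def by (rule someI_ex, rule real_arch_pow_inv) auto

lemma ennreal_mult_plus:
  "0 \<le> a \<Longrightarrow> 0 \<le> b \<Longrightarrow> 0 \<le> c \<Longrightarrow> ennreal a * (ennreal b + ennreal c) = ennreal (a * (b + c))"
  by (simp add: ennreal_mult)

lemma ennreal_mult4:
  "0 \<le> a \<Longrightarrow> 0 \<le> b \<Longrightarrow> 0 \<le> c \<Longrightarrow> 0 \<le> d \<Longrightarrow>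
    ennreal a * (ennreal b * (ennreal c * ennreal d)) = ennreal (a * (b * (c * d)))"
  by (simp add: ennreal_mult)

lemma eps0_pos: "0 < eps0" by (simp add: eps0_def)

context path_measure begin

lemma sum_sc: "(\<Sum>i<n. sc i) \<le> 4 * 10^6 * D"
proof -
  have "(\<Sum>i<n. sc i) = 2000000 * (sc 0 - sc n)"
    by (induction n) (simp_all add: sc_pos(3))
  also have "\<dots> \<le> 2000000 * sc 0" using sc_pos(1)[of n] by simp
  finally show ?thesis by (simp add: sc_def)
qed

text \<open>A geometric sum dominated by its last term; \<open>2000000\<close> is
  \<open>1 / (1 - qq)\<close>.\<close>

lemma sum_inverse_sc: "(\<Sum>j\<le>i. 1 / sc j) \<le> 2000000 / sc i"
proof (induction i)
  case 0
  then show ?case using sc_pos(1)[of 0] by (simp add: divide_right_mono)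
next
  case (Suc i)
  have "2000000 / sc i + 1 / (qq * sc i) = 2000000 / (qq * sc i)" using sc_pos(1)[of i] by (simp add: field_simps)
  then show ?case using Suc by (simp add: sc_pos(3))
qed

lemma card_scales: "card {i. i < n \<and> z \<in> annulus (sc i) u} \<le> rounds"
proof (cases "{i. i < n \<and> z \<in> annulus (sc i) u} = {}")
  case False
  define I where "I = {i. i < n \<and> z \<in> annulus (sc i) u}"
  have fin: "finite I" by (simp add: I_def)
  define k where "k = Min I"
  have k: "k \<in> I" "\<And>i. i \<in> I \<Longrightarrow> k \<le> i" using False fin by (auto simp: k_def I_def[symmetric])
  have "i < k + rounds" if i: "i \<in> I" for i
  proof (rule ccontr)
    assume "\<not> ?thesis"
    then obtain j where j: "i = k + (rounds + j)" by (auto simp: not_less le_iff_add add.assoc)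
    have "sc i = sc k * (qq ^ rounds * qq ^ j)" by (simp add: sc_def j power_add)
    also have "\<dots> \<le> sc k * (1 / 3200000000000 * 1)"
      using rounds sc_pos(1)[of k] by (intro mult_left_mono mult_mono power_le_one) auto
    finally have "2 * C2 * sc i \<le> kap / 16 * sc k" by simp
    then show False using i k(1) by (auto simp: I_def annulus_def)
  qed
  then have "I \<subseteq> {k..<k + rounds}" using k by auto
  then have "card I \<le> card {k..<k + rounds}" by (intro card_mono) auto
  then show ?thesis by (simp add: I_def)
next
  case True
  show ?thesis unfolding True by simp
qed

text \<open>For fixed \<open>u\<close> and \<open>z\<close> at most \<open>rounds\<close> of the
  scales have \<open>z\<close> in their annulus around \<open>u\<close>, so the sum over scales
  costs only this factor, independently of \<open>n\<close>.\<close>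

lemma sum_G_le: "(\<Sum>i<n. ennreal (1 / sc i) * (\<integral>\<^sup>+u. G (sc i) u \<partial>N)) \<le> of_nat rounds * (\<integral>\<^sup>+u. \<integral>\<^sup>+z. h u z \<partial>N \<partial>N)"
proof -
  define g where "g i u = (\<integral>\<^sup>+z. indicator (annulus (sc i) u) z * h u z \<partial>N)" for i u
  have gG: "g i u = ennreal (1 / sc i) * G (sc i) u" for i u
    unfolding G_def g_def mult.assoc[symmetric] using sc_pos(1)[of i] by (subst ennreal_mult[symmetric]) auto
  have gm: "g i \<in> borel_measurable N" for i unfolding gG by measurable
  have "(\<Sum>i<n. ennreal (1 / sc i) * (\<integral>\<^sup>+u. G (sc i) u \<partial>N)) = (\<Sum>i<n. \<integral>\<^sup>+u. g i u \<partial>N)"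
    unfolding gG by (intro sum.cong refl) (simp add: nn_integral_cmult)
  also have "\<dots> = (\<integral>\<^sup>+u. (\<Sum>i<n. g i u) \<partial>N)" by (subst nn_integral_sum) (use gm in auto)
  also have "\<dots> \<le> (\<integral>\<^sup>+u. of_nat rounds * (\<integral>\<^sup>+z. h u z \<partial>N) \<partial>N)"
  proof (rule nn_integral_mono)
    fix u
    have "(\<Sum>i<n. g i u) = (\<integral>\<^sup>+z. (\<Sum>i<n. indicator (annulus (sc i) u) z * h u z) \<partial>N)"
      unfolding g_def by (subst nn_integral_sum) auto
    also have "\<dots> \<le> (\<integral>\<^sup>+z. of_nat rounds * h u z \<partial>N)"
    proof (rule nn_integral_mono)
      fix z
      have "(\<Sum>i<n. indicator (annulus (sc i) u) z) = (\<Sum>i<n. if z \<in> annulus (sc i) u then 1 else 0 :: ennreal)"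
        by (intro sum.cong) (auto simp: indicator_def)
      also have "\<dots> = of_nat (card {i. i < n \<and> z \<in> annulus (sc i) u})"
        by (subst sum.inter_filter[symmetric]) (auto intro!: arg_cong[where f=card])
      also have "\<dots> \<le> of_nat rounds" using card_scales by (simp only: of_nat_le_iff)
      finally have "(\<Sum>i<n. indicator (annulus (sc i) u) z) * h u z \<le> of_nat rounds * h u z" by (intro mult_right_mono) auto
      then show "(\<Sum>i<n. indicator (annulus (sc i) u) z * h u z) \<le> of_nat rounds * h u z" by (simp add: sum_distrib_right)
    qed
    also have "\<dots> = of_nat rounds * (\<integral>\<^sup>+z. h u z \<partial>N)" by (subst nn_integral_cmult) auto
    finally show "(\<Sum>i<n. g i u) \<le> of_nat rounds * (\<integral>\<^sup>+z. h u z \<partial>N)" .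
  qed
  also have "\<dots> = of_nat rounds * (\<integral>\<^sup>+u. \<integral>\<^sup>+z. h u z \<partial>N \<partial>N)"
    by (subst nn_integral_cmult) (use slsc_borel_measurable[OF slsc_nn_integral[OF h_measurable(1) slsc_h(1)]] measurable_cong_sets[OF setsN refl] in blast, simp)
  finally show ?thesis .
qed

text \<open>Exchange the sums over \<open>j \<le> i\<close>: the factors
  \<open>8 / (kap * sc j)\<close> add up to a multiple of \<open>1 / sc i\<close>, which is the
  weight of \<open>G (sc i)\<close> in \<open>sum_G_le\<close>. Hence there is no dependence on the
  number of scales.\<close>

lemma sum_H_le:
  "(\<Sum>j<n. ennreal (8 / (kap * sc j)) * (\<integral>\<^sup>+u. HH n j u \<partial>N)) \<le> ennreal (16 * 10^12) * (of_nat rounds * (\<integral>\<^sup>+u. \<integral>\<^sup>+z. h u z \<partial>N \<partial>N))"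
proof -
  define I where "I i = (\<integral>\<^sup>+u. G (sc i) u \<partial>N)" for i
  have "(\<integral>\<^sup>+u. HH n j u \<partial>N) = (\<Sum>i\<in>{j..<n}. I i)" for j
    unfolding HH_def I_def by (subst nn_integral_sum) auto
  then have "(\<Sum>j<n. ennreal (8 / (kap * sc j)) * (\<integral>\<^sup>+u. HH n j u \<partial>N)) = (\<Sum>j<n. \<Sum>i\<in>{j..<n}. ennreal (8 / (kap * sc j)) * I i)"
    by (simp only: sum_distrib_left)
  also have "\<dots> = (\<Sum>j<n. \<Sum>i<n. if j \<le> i then ennreal (8 / (kap * sc j)) * I i else 0)"
    by (intro sum.cong refl sum.mono_neutral_cong_left) auto
  also have "\<dots> = (\<Sum>i<n. \<Sum>j<n. if j \<le> i then ennreal (8 / (kap * sc j)) * I i else 0)" by (rule sum.swap)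
  also have "\<dots> = (\<Sum>i<n. (\<Sum>j\<le>i. ennreal (8 / (kap * sc j))) * I i)"
    unfolding sum_distrib_right by (intro sum.cong refl sum.mono_neutral_cong_right) auto
  also have "\<dots> \<le> (\<Sum>i<n. ennreal (16 * 10^12) * (ennreal (1 / sc i) * I i))"
  proof (intro sum_mono)
    fix i
    have "(\<Sum>j\<le>i. ennreal (8 / (kap * sc j))) = ennreal (\<Sum>j\<le>i. 8 / (kap * sc j))"
      using sc_pos(1) by (intro sum_ennreal) (simp add: less_imp_le)
    also have "(\<Sum>j\<le>i. 8 / (kap * sc j)) = 8000000 * (\<Sum>j\<le>i. 1 / sc j)" by (simp add: sum_distrib_left)
    also have "ennreal \<dots> \<le> ennreal (8000000 * (2000000 / sc i))"
      by (intro ennreal_leI mult_left_mono sum_inverse_sc) auto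
    also have "\<dots> = ennreal (16 * 10^12) * ennreal (1 / sc i)" by (subst ennreal_mult[symmetric]) (use sc_pos(1)[of i] in auto)
    finally show "(\<Sum>j\<le>i. ennreal (8 / (kap * sc j))) * I i \<le> ennreal (16 * 10^12) * (ennreal (1 / sc i) * I i)"
      unfolding mult.assoc[symmetric] by (rule mult_right_mono) simp
  qed
  also have "\<dots> = ennreal (16 * 10^12) * (\<Sum>i<n. ennreal (1 / sc i) * I i)" by (simp only: sum_distrib_left)
  also have "\<dots> \<le> ennreal (16 * 10^12) * (of_nat rounds * (\<integral>\<^sup>+u. \<integral>\<^sup>+z. h u z \<partial>N \<partial>N))"
    using sum_G_le unfolding I_def by (intro mult_left_mono) auto
  finally show ?thesis .
qed

lemma HH_le: assumes "(\<integral>\<^sup>+z. h u z \<partial>N) \<le> ennreal e" "0 \<le> e"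
  shows "HH n 0 u \<le> ennreal (4 * 10^6 * D * e)"
proof -
  have "G (sc i) u \<le> ennreal (sc i) * ennreal e" for i
    unfolding G_def using assms(1)
    by (intro mult_left_mono order_trans[OF nn_integral_mono assms(1)]) (auto simp: indicator_def)
  then have "HH n 0 u \<le> (\<Sum>i<n. ennreal (sc i) * ennreal e)"
    unfolding HH_def by (auto simp: lessThan_atLeast0 intro!: sum_mono)
  also have "\<dots> = ennreal ((\<Sum>i<n. sc i) * e)"
    unfolding sum_distrib_right[symmetric] using sc_pos(1) assms(2)
    by (subst sum_ennreal) (auto simp: less_imp_le ennreal_mult sum_nonneg)
  also have "\<dots> \<le> ennreal (4 * 10^6 * D * e)" using sum_sc assms(2) by (intro ennreal_leI mult_right_mono)
  finally show ?thesis .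
qed

text \<open>The initial balance is at most \<open>D + D / 10^40\<close>, and every chain has length
  at least \<open>span V = D\<close>; so the charge \<open>acc\<close> is at most
  \<open>D / 10^40\<close>. Of the mass \<open>D / 16\<close> of \<open>K\<close> at most
  \<open>D / 64\<close> is then uncovered and at most \<open>D / 64\<close> lost.\<close>

lemma net_exists:
  assumes small: "h p q \<le> ennreal (eps0 / D)" "(\<integral>\<^sup>+z. h p z \<partial>N) \<le> ennreal eps0" "(\<integral>\<^sup>+z. h q z \<partial>N) \<le> ennreal eps0"
      "(\<integral>\<^sup>+u. \<integral>\<^sup>+z. h u z \<partial>N \<partial>N) \<le> ennreal (eps0 * D)"
    and mass: "ennreal (D / 16) \<le> emeasure N K"
  obtains V where "p \<in> V" "finite V" "inj_on P V" "L V \<le> 2 * D"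
    "ennreal (D / 32) \<le> emeasure N {w \<in> K. \<exists>v\<in>V. dist v w \<le> sc n}"
proof -
  obtain V acc where V: "net (sc n) V" "span V = D"
    "ennreal (L V) + acc + A0 * S (sc n) V + B0 * (\<Sum>u\<in>V. HH n n u)
      \<le> ennreal D + A0 * S (sc 0) {p, q} + B0 * (HH n 0 p + HH n 0 q) + B0 * (\<Sum>j<n. ennreal (8 / (kap * sc j)) * (\<integral>\<^sup>+u. HH n j u \<partial>N))"
    "emeasure N (uncovered (sc n) V) \<le> ennreal (8 * 10^23) * acc"
    using refine_all[OF order_refl, of n] by auto
  have fin: "finite V" "inj_on P V" using V(1) by (auto simp: net_def)
  have pq: "p \<noteq> q" using D by auto
  have e0: "0 \<le> eps0" using eps0_pos by simp
  have S0: "A0 * S (sc 0) {p, q} \<le> ennreal (8 * 10^13 * (eps0 * D))"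
  proof -
    have "S (sc 0) {p, q} = 2 * tt (sc 0) p q" using pq by (simp add: S_def tt_commute[of _ q p] mult_2) (simp add: tt_def)
    also have "\<dots> \<le> 2 * (ennreal ((sc 0)\<^sup>2) * h p q)"
      by (intro mult_left_mono) (auto simp: tt_def indicator_def)
    also have "\<dots> \<le> 2 * (ennreal ((sc 0)\<^sup>2) * ennreal (eps0 / D))"
      by (intro mult_left_mono small) auto
    also have "\<dots> = ennreal (8 * (eps0 * D))"
    proof -
      have "2 * (ennreal ((sc 0)\<^sup>2) * ennreal (eps0 / D)) = ennreal 2 * ennreal ((sc 0)\<^sup>2 * (eps0 / D))"
        by (subst ennreal_mult) (use e0 D(2) in auto)
      also have "\<dots> = ennreal (2 * ((sc 0)\<^sup>2 * (eps0 / D)))" by (subst ennreal_mult) (use e0 D(2) in auto)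
      also have "2 * ((sc 0)\<^sup>2 * (eps0 / D)) = 8 * (eps0 * D)" using D(2) by (simp add: sc_def power2_eq_square)
      finally show ?thesis .
    qed
    finally have "A0 * S (sc 0) {p, q} \<le> A0 * ennreal (8 * (eps0 * D))" by (intro mult_left_mono) auto
    also have "\<dots> = ennreal (8 * 10^13 * (eps0 * D))" unfolding A0_def by (subst ennreal_mult[symmetric]) (use e0 D(2) in auto)
    finally show ?thesis .
  qed
  have H0: "B0 * (HH n 0 p + HH n 0 q) \<le> ennreal (8 * 10^27 * (eps0 * D))"
  proof -
    have "B0 * (HH n 0 p + HH n 0 q) \<le> B0 * (ennreal (4 * 10^6 * D * eps0) + ennreal (4 * 10^6 * D * eps0))"
      by (intro mult_left_mono add_mono HH_le small e0) auto
    also have "\<dots> = ennreal (10^21 * (4 * 10^6 * D * eps0 + 4 * 10^6 * D * eps0))"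
      unfolding B0_def by (rule ennreal_mult_plus) (use e0 D(2) in auto)
    also have "10^21 * (4 * 10^6 * D * eps0 + 4 * 10^6 * D * eps0) = 8 * 10^27 * (eps0 * D)" by simp
    finally show ?thesis .
  qed
  have X0: "B0 * (\<Sum>j<n. ennreal (8 / (kap * sc j)) * (\<integral>\<^sup>+u. HH n j u \<partial>N)) \<le> ennreal (16 * 10^33 * real rounds * (eps0 * D))"
  proof -
    have "B0 * (\<Sum>j<n. ennreal (8 / (kap * sc j)) * (\<integral>\<^sup>+u. HH n j u \<partial>N)) \<le> B0 * (ennreal (16 * 10^12) * (of_nat rounds * ennreal (eps0 * D)))"
      by (intro mult_left_mono order_trans[OF sum_H_le] small) auto
    also have "of_nat rounds = ennreal (real rounds)" by (simp add: ennreal_of_nat_eq_real_of_nat)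
    also have "B0 * (ennreal (16 * 10^12) * (ennreal (real rounds) * ennreal (eps0 * D))) = ennreal (10^21 * (16 * 10^12 * (real rounds * (eps0 * D))))"
      unfolding B0_def by (rule ennreal_mult4) (use e0 D(2) in auto)
    also have "10^21 * (16 * 10^12 * (real rounds * (eps0 * D))) = 16 * 10^33 * real rounds * (eps0 * D)" by simp
    finally show ?thesis .
  qed
  have tot: "8 * 10^13 * (eps0 * D) + 8 * 10^27 * (eps0 * D) + 16 * 10^33 * real rounds * (eps0 * D) \<le> D / 10^40"
  proof -
    have "8 * 10^13 * (eps0 * D) + 8 * 10^27 * (eps0 * D) + 16 * 10^33 * real rounds * (eps0 * D) = (8 * 10^13 + 8 * 10^27 + 16 * 10^33 * real rounds) * (eps0 * D)"
      by (simp only: distrib_right)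
    also have "\<dots> \<le> (10^40 * (real rounds + 1)) * (eps0 * D)" by (intro mult_right_mono) (use e0 D(2) in auto)
    also have "\<dots> = D / 10^40"
      unfolding eps0_def by (simp add: field_simps add_nonneg_eq_0_iff)
    finally show ?thesis .
  qed
  have "ennreal (L V) + acc \<le> ennreal (L V) + acc + A0 * S (sc n) V + B0 * (\<Sum>u\<in>V. HH n n u)"
    by (simp add: add.assoc)
  also note V(3)
  also have "ennreal D + A0 * S (sc 0) {p, q} + B0 * (HH n 0 p + HH n 0 q) + B0 * (\<Sum>j<n. ennreal (8 / (kap * sc j)) * (\<integral>\<^sup>+u. HH n j u \<partial>N))
    \<le> ennreal D + ennreal (8 * 10^13 * (eps0 * D)) + ennreal (8 * 10^27 * (eps0 * D)) + ennreal (16 * 10^33 * real rounds * (eps0 * D))"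
    by (intro add_mono S0 H0 X0 order_refl)
  also have "\<dots> = ennreal (D + (8 * 10^13 * (eps0 * D) + 8 * 10^27 * (eps0 * D) + 16 * 10^33 * real rounds * (eps0 * D)))"
    using e0 D(2) by (simp only: ennreal_plus add_nonneg_nonneg mult_nonneg_nonneg zero_le_numeral zero_le_power of_nat_0_le_iff less_imp_le add.assoc)
  also have "\<dots> \<le> ennreal (D + D / 10^40)" using tot by (intro ennreal_leI) simp
  finally have LA: "ennreal (L V) + acc \<le> ennreal (D + D / 10^40)" .
  then have "acc \<noteq> top" by (auto simp: top_unique)
  then obtain al where al: "acc = ennreal al" "0 \<le> al" by (cases acc) auto
  have LA': "L V + al \<le> D + D / 10^40"
    using LA al L_nonneg[of V] D(2) by (simp add: ennreal_le_iff del: ennreal_plus flip: ennreal_plus)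
  have LD: "D \<le> L V" unfolding V(2)[symmetric] span_def L_def by (rule sum_mono) (use P_le in auto)
  have "emeasure N (uncovered (sc n) V) \<le> ennreal (8 * 10^23) * ennreal (D / 10^40)"
    using V(4) al LA' LD by (auto elim!: order_trans intro!: mult_left_mono ennreal_leI)
  also have "\<dots> = ennreal (8 * 10^23 * (D / 10^40))" by (subst ennreal_mult) (use D(2) in auto)
  also have "\<dots> \<le> ennreal (D / 64)" by (rule ennreal_leI) (use D(2) in simp)
  finally have unc: "emeasure N (uncovered (sc n) V) \<le> ennreal (D / 64)" .
  have los: "emeasure N (lost V) \<le> ennreal (D / 64)"
    by (rule emeasure_lost[OF V(1) sc_pos(1) V(2)]) (use LA' al in simp)
  define Y where "Y = {w \<in> K. \<exists>v\<in>V. dist v w \<le> sc n}"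
  have Y: "Y \<in> sets N"
  proof -
    have "Y = K \<inter> (\<Union>v\<in>V. cball v (sc n))" by (auto simp: Y_def)
    then show ?thesis using K fin by (auto simp: setsN intro!: sets.finite_UN)
  qed
  have st: "uncovered (sc n) V \<in> sets N" "lost V \<in> sets N" using uncovered_sets lost_sets fin by (auto simp: setsN)
  have "K \<subseteq> Y \<union> (uncovered (sc n) V \<union> lost V)" by (auto simp: Y_def uncovered_def not_le)
  then have "emeasure N K \<le> emeasure N (Y \<union> (uncovered (sc n) V \<union> lost V))" by (rule emeasure_mono) (use Y st in auto)
  also have "\<dots> \<le> emeasure N Y + emeasure N (uncovered (sc n) V \<union> lost V)" by (rule emeasure_subadditive) (use Y st in auto)
  also have "\<dots> \<le> emeasure N Y + (ennreal (D / 64) + ennreal (D / 64))"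
    using emeasure_subadditive[OF st] add_mono[OF unc los] by (intro add_left_mono) (rule order_trans)
  also have "ennreal (D / 64) + ennreal (D / 64) = ennreal (D / 32)" using D(2) by (simp flip: ennreal_plus)
  finally have "ennreal (D / 16) \<le> emeasure N Y + ennreal (D / 32)" using mass by (rule order_trans[rotated])
  also have "ennreal (D / 16) = ennreal (D / 32) + ennreal (D / 32)" using D(2) by (simp flip: ennreal_plus)
  finally have "ennreal (D / 32) \<le> emeasure N Y" by (simp add: add.commute[of "emeasure N Y"])
  moreover have "L V \<le> 2 * D"
  proof -
    have "D / 10^40 \<le> D / 1" by (rule divide_left_mono) (use D(2) in auto)
    then show ?thesis using LA' al by linarith
  qed
  moreover have "p \<in> V" using V(1) by (simp add: net_def)
  ultimately show ?thesis using that fin by (simp add: Y_def)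
qed

end

section \<open>Choice of the end points\<close>

lemma (in curvature_measure) emeasure_h_large:
  assumes "(\<integral>\<^sup>+z. h u z \<partial>N) \<le> ennreal a" "0 < a" "0 < b"
  shows "emeasure N {z. ennreal b < h u z} \<le> ennreal (a / b)"
proof -
  have "emeasure N {z. ennreal b < h u z} \<le> emeasure N {x \<in> UNIV. ennreal (4 / (4 * a / b)) * (\<integral>\<^sup>+z\<in>UNIV. h u z \<partial>N) < h u x}"
  proof (rule emeasure_mono)
    have "ennreal (4 / (4 * a / b)) * (\<integral>\<^sup>+z\<in>UNIV. h u z \<partial>N) \<le> ennreal (b / a) * ennreal a"
      using assms by (intro mult_mono) auto
    also have "\<dots> = ennreal b" using assms by (subst ennreal_mult[symmetric]) auto
    finally show "{z. ennreal b < h u z} \<subseteq> {x \<in> UNIV. ennreal (4 / (4 * a / b)) * (\<integral>\<^sup>+z\<in>UNIV. h u z \<partial>N) < h u x}" by auto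
    have "{x \<in> space N. c < h u x} \<in> sets N" for c by measurable
    then show "{x \<in> UNIV. ennreal (4 / (4 * a / b)) * (\<integral>\<^sup>+z\<in>UNIV. h u z \<partial>N) < h u x} \<in> sets N" by simp
  qed
  also have "\<dots> \<le> ennreal ((4 * a / b) / 4)"
    by (rule markov_set) (use assms in \<open>auto simp: setsN\<close>)
  finally show ?thesis by simp
qed

lemma (in curvature_measure) emeasure_excess_large:
  assumes h: "h u z \<le> ennreal b" and d: "0 < d" "0 < R" "0 \<le> b" and K: "K \<in> sets borel" "\<And>x y. x \<in> K \<Longrightarrow> y \<in> K \<Longrightarrow> dist x y \<le> 2 * R" "u \<in> K" "z \<in> K"
  shows "emeasure N {w \<in> K. d < triangle_excess u z w} \<le> ennreal (8 * R^3 / d * b)"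
proof -
  define c where "c = d / (2 * R)^3"
  have c: "0 < c" using d by (simp add: c_def)
  define B where "B = {w \<in> K. d < triangle_excess u z w}"
  have "B = K \<inter> {w. d < triangle_excess u z w}" by (auto simp: B_def)
  moreover have "open {w. d < triangle_excess u z w}" unfolding triangle_excess_eq
    by (intro open_Collect_less continuous_intros continuous_on_min)
  ultimately have B: "B \<in> sets N" using K(1) by (auto simp: setsN)
  have "ennreal c * emeasure N B = (\<integral>\<^sup>+w. ennreal c * indicator B w \<partial>N)"
    using B by (simp add: nn_integral_cmult_indicator)
  also have "\<dots> \<le> h u z" unfolding h_def
  proof (rule nn_integral_mono)
    fix w
    show "ennreal c * indicator B w \<le> crv u z w"
    proof (cases "w \<in> B")
      case True
      then have B: "w \<in> K" "d < triangle_excess u z w" by (auto simp: B_def)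
      have d2: "diameter {u, z, w} \<le> 2 * R"
        unfolding diameter_triple using K(2)[OF K(3,4)] K(2)[OF K(3) B(1)] K(2)[OF K(4) B(1)] by simp
      have d0: "0 < diameter {u, z, w}"
      proof (rule ccontr)
        assume "\<not> ?thesis"
        then have "u = z \<and> z = w" unfolding diameter_triple
          by (metis max.cobounded1 max.cobounded2 not_less order_trans zero_less_dist_iff)
        then show False using B d by simp
      qed
      have "c \<le> triangle_excess u z w / diameter {u, z, w} ^ 3"
        unfolding c_def by (intro frac_le power_mono d2 triangle_excess_nonneg) (use B d d0 in auto)
      then show ?thesis using True by (simp add: crv_def ennreal_leI)
    qed simp
  qed
  also note h
  finally have *: "ennreal c * emeasure N B \<le> ennreal b" .
  have "emeasure N B = ennreal (1 / c) * (ennreal c * emeasure N B)"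
    using c unfolding mult.assoc[symmetric] by (subst ennreal_mult[symmetric]) auto
  also have "\<dots> \<le> ennreal (1 / c) * ennreal b" by (intro mult_left_mono *) auto
  also have "\<dots> = ennreal (8 * R^3 / d * b)"
    using c d by (subst ennreal_mult[symmetric]) (auto simp: c_def power_mult_distrib)
  finally show ?thesis by (simp add: B_def)
qed

locale root_measure = curvature_measure N for N :: "'a::metric_space measure" +
  fixes K :: "'a set" and x0 :: 'a and R :: real
  assumes R: "0 < R" and KR: "K \<subseteq> cball x0 R" and K: "K \<in> sets borel" and NK: "emeasure N (- K) = 0"
    and mass: "ennreal (R / 4) \<le> emeasure N K"
    and regK: "\<And>z r. z \<in> K \<Longrightarrow> 0 < r \<Longrightarrow> emeasure N (cball z r) \<le> ennreal (4 * r)"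
    and flat: "\<And>u. u \<in> K \<Longrightarrow> (\<integral>\<^sup>+z. h u z \<partial>N) \<le> ennreal (eps0 / 10^10)"
begin

lemma eps0_le: "eps0 \<le> 1 / 10^80"
  unfolding eps0_def by (intro divide_left_mono) auto

lemma distK: "x \<in> K \<Longrightarrow> y \<in> K \<Longrightarrow> dist x y \<le> 2 * R"
  using subsetD[OF KR, of x] subsetD[OF KR, of y] dist_triangle[of x y x0] dist_commute[of x x0] by simp

text \<open>The threshold gives \<open>h p q \<le> eps0 / D\<close> for a good pair, because all
  distances in \<open>K\<close> are at most \<open>2 * R\<close>.\<close>

definition good :: "'a \<Rightarrow> 'a \<Rightarrow> bool" where "good u z \<longleftrightarrow> h u z \<le> ennreal (eps0 / 2 / R)"
definition e :: real where "e = R / 10^16"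
definition bentset :: "'a \<Rightarrow> 'a \<Rightarrow> 'a set" where "bentset u z = {w \<in> K. e < triangle_excess u z w}"

text \<open>The factor \<open>10^10\<close> in \<open>flat\<close> is spent here: Markov's
  inequality leaves mass at most \<open>2 * R / 10^10\<close> for the bad partners of a
  point.\<close>

lemma bad_small:
  assumes "u \<in> K" shows "{z. \<not> good u z} \<in> sets N" "emeasure N {z. \<not> good u z} \<le> ennreal (R / 10^9)"
proof -
  have e: "{z. \<not> good u z} = {z. ennreal (eps0 / 2 / R) < h u z}" by (auto simp: good_def not_le)
  have "{x \<in> space N. c < h u x} \<in> sets N" for c by measurable
  then show "{z. \<not> good u z} \<in> sets N" unfolding e by simp
  have "emeasure N {z. \<not> good u z} \<le> ennreal ((eps0 / 10^10) / (eps0 / 2 / R))"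
    unfolding e by (rule emeasure_h_large[OF flat[OF assms]]) (use eps0_pos R in auto)
  also have "(eps0 / 10^10) / (eps0 / 2 / R) \<le> R / 10^9" using eps0_pos R by simp
  finally show "emeasure N {z. \<not> good u z} \<le> ennreal (R / 10^9)" by (simp add: ennreal_leI)
qed

lemma bentset_sets: "bentset u z \<in> sets N"
proof -
  have "bentset u z = K \<inter> {w. e < triangle_excess u z w}" by (auto simp: bentset_def)
  moreover have "open {w. e < triangle_excess u z w}" unfolding triangle_excess_eq
    by (intro open_Collect_less continuous_intros continuous_on_min)
  ultimately show ?thesis using K by (auto simp: setsN)
qed

lemma bentset_small:
  assumes "u \<in> K" "z \<in> K" "good u z" shows "emeasure N (bentset u z) \<le> ennreal (R / 10^9)"
proof -
  have e0: "0 < e" using R by (simp add: e_def)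
  have "emeasure N (bentset u z) \<le> ennreal (8 * R^3 / e * (eps0 / 2 / R))"
    unfolding bentset_def
    by (rule emeasure_excess_large[OF assms(3)[unfolded good_def] e0 R _ K distK assms(1,2)]) (use eps0_pos R in auto)
  also have "8 * R^3 / e * (eps0 / 2 / R) = 4 * 10^16 * R * eps0"
    using R by (simp add: e_def power3_eq_cube)
  also have "ennreal \<dots> \<le> ennreal (R / 10^9)"
  proof (rule ennreal_leI)
    have "4 * 10^16 * R * eps0 \<le> 4 * 10^16 * R * (1 / 10^80)" using R eps0_le by (intro mult_left_mono) auto
    also have "\<dots> \<le> R / 10^9" using R by simp
    finally show "4 * 10^16 * R * eps0 \<le> R / 10^9" .
  qed
  finally show ?thesis .
qed


lemma mass_diff:
  assumes "A \<in> sets N" "B \<in> sets N" "A \<subseteq> B \<union> C" "C \<in> sets N" "ennreal a \<le> emeasure N A" "emeasure N C \<le> ennreal c" "0 \<le> c"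
  shows "ennreal (a - c) \<le> emeasure N B"
proof -
  have "ennreal a \<le> emeasure N (B \<union> C)" using assms(5) emeasure_mono[OF assms(3)] assms by (meson order_trans sets.Un)
  also have "\<dots> \<le> emeasure N B + ennreal c"
    using emeasure_subadditive[OF assms(2,4)] assms(6) by (meson add_left_mono order_trans)
  finally have "ennreal a \<le> emeasure N B + ennreal c" .
  then show ?thesis
    by (cases "emeasure N B") (use assms(7) in \<open>auto simp: ennreal_le_iff2 simp flip: ennreal_plus split: if_splits\<close>)
qed

text \<open>Maximality of the distance is demanded only among good pairs, since the curvature of the
  pair \<open>p\<close>, \<open>q\<close> must be controlled. Most of \<open>K\<close> is good with
  respect to both ends and aligned with them; \<open>m\<close> is then used to discard the points on
  the opposite arc.\<close>

lemma root:
  obtains p q m K2 D e1 where "path_measure K2 N p q m D e1" "K2 \<subseteq> K" "D \<le> 2 * R" "R / 20 \<le> D"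
    "h p q \<le> ennreal (eps0 / D)" "(\<integral>\<^sup>+z. h p z \<partial>N) \<le> ennreal eps0" "(\<integral>\<^sup>+z. h q z \<partial>N) \<le> ennreal eps0"
    "(\<integral>\<^sup>+u. \<integral>\<^sup>+z. h u z \<partial>N \<partial>N) \<le> ennreal (eps0 * D)" "ennreal (D / 16) \<le> emeasure N K2"
proof -
  have e: "0 < e" "e = R / 10000000000000000" using R by (auto simp: e_def)
  have KN: "K \<in> sets N" using K by (simp add: setsN)
  define Dset where "Dset = {dist u z | u z. u \<in> K \<and> z \<in> K \<and> good u z}"
  have bdd: "bdd_above Dset" unfolding Dset_def by (rule bdd_aboveI[of _ "2 * R"]) (auto intro: distK)
  have "Dset \<noteq> {}"
  proof -
    have "K \<noteq> {}" using mass R by (auto simp: ennreal_le_iff2)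
    then obtain u where u: "u \<in> K" by auto
    have "\<not> K \<subseteq> {z. \<not> good u z}"
    proof
      assume "K \<subseteq> {z. \<not> good u z}"
      then have "ennreal (R / 4) \<le> ennreal (R / 10^9)"
        using mass emeasure_mono[of K "{z. \<not> good u z}" N] bad_small[OF u] by (meson order_trans)
      then show False using R by (simp add: ennreal_le_iff)
    qed
    then show ?thesis using u by (auto simp: Dset_def)
  qed
  then obtain t where "t \<in> Dset" "Sup Dset - e < t" using less_cSupD[of Dset "Sup Dset - e"] e by auto
  then obtain p q where pq: "p \<in> K" "q \<in> K" "good p q" "Sup Dset - e < dist p q" by (auto simp: Dset_def)
  define D where "D = dist p q"
  have Dmax: "dist u z \<le> D + e" if "u \<in> K" "z \<in> K" "good u z" for u z
  proof -
    have "dist u z \<le> Sup Dset" by (rule cSup_upper[OF _ bdd]) (use that in \<open>auto simp: Dset_def\<close>)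
    then show ?thesis using pq by (simp add: D_def)
  qed
  define C1 where "C1 = {z. \<not> good p z} \<union> {z. \<not> good q z} \<union> bentset p q"
  define K1 where "K1 = K - C1"
  have C1: "C1 \<in> sets N" "emeasure N C1 \<le> ennreal (3 * R / 10^9)"
  proof -
    show s: "C1 \<in> sets N" unfolding C1_def using bad_small pq bentset_sets by auto
    have "emeasure N C1 \<le> emeasure N {z. \<not> good p z} + emeasure N {z. \<not> good q z} + emeasure N (bentset p q)"
      unfolding C1_def using bad_small(1) pq(1,2) bentset_sets
      by (meson add_right_mono emeasure_subadditive order_trans sets.Un)
    also have "\<dots> \<le> ennreal (R / 10^9) + ennreal (R / 10^9) + ennreal (R / 10^9)"
      by (intro add_mono bad_small bentset_small pq)
    also have "\<dots> = ennreal (3 * R / 10^9)" using R by (simp flip: ennreal_plus)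
    finally show "emeasure N C1 \<le> ennreal (3 * R / 10^9)" .
  qed
  have K1N: "K1 \<in> sets N" unfolding K1_def using KN C1 by auto
  have mK1: "ennreal (R / 4 - 3 * R / 10^9) \<le> emeasure N K1"
    by (rule mass_diff[OF KN K1N _ C1(1) mass C1(2)]) (use R in \<open>auto simp: K1_def\<close>)
  have K1: "w \<in> K" "good p w" "good q w" "triangle_excess p q w \<le> e" if "w \<in> K1" for w
    using that by (auto simp: K1_def C1_def bentset_def not_less)
  have dK1: "dist p w \<le> D + e" "dist q w \<le> D + e" if "w \<in> K1" for w
    using Dmax[OF pq(1) K1(1,2)] Dmax[OF pq(2) K1(1,3)] that by auto
  \<comment> \<open>Otherwise the ball of radius \<open>D + e\<close> around \<open>p\<close>, which
    contains \<open>K1\<close>, would have too little mass by \<open>regK\<close>.\<close>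
  have DR: "R / 20 \<le> D"
  proof -
    have D0: "0 \<le> D" by (simp add: D_def)
    have "K1 \<subseteq> cball p (D + e)" using dK1 by auto
    then have "emeasure N K1 \<le> emeasure N (cball p (D + e))" by (rule emeasure_mono) (simp add: setsN)
    also have "\<dots> \<le> ennreal (4 * (D + e))" by (rule regK[OF pq(1)]) (use e(1) D0 in linarith)
    finally have "ennreal (R / 4 - 3 * R / 10^9) \<le> ennreal (4 * (D + e))" using mK1 by (rule order_trans[rotated])
    then have "R / 4 - 3 * R / 10^9 \<le> 4 * (D + e)" using e D0 by (subst (asm) ennreal_le_iff) auto
    then show ?thesis using e R by simp
  qed
  have D0: "0 < D" using DR R by simp
  have D2: "D \<le> 2 * R" unfolding D_def by (rule distK[OF pq(1,2)])
  \<comment> \<open>As \<open>D\<close> is maximal up to \<open>e\<close>, an alignment with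
    \<open>p\<close> or \<open>q\<close> in the middle forces \<open>w\<close> to lie within
    \<open>2 * e\<close> of that point.\<close>
  have bet: "dist p w + dist w q \<le> D + 4 * e" if "w \<in> K1" for w
    using triangle_excess_cases[OF K1(4)[OF that]] dK1[OF that] dist_commute[of q w] e unfolding D_def by linarith
  obtain m where m: "m \<in> K1" "R / 100 < dist p m" "R / 100 < dist q m"
  proof -
    have "\<not> K1 \<subseteq> cball p (R / 100) \<union> cball q (R / 100)"
    proof
      assume s: "K1 \<subseteq> cball p (R / 100) \<union> cball q (R / 100)"
      note mK1
      also have "emeasure N K1 \<le> emeasure N (cball p (R / 100) \<union> cball q (R / 100))"
        by (rule emeasure_mono[OF s]) (simp add: setsN)
      also have "\<dots> \<le> emeasure N (cball p (R / 100)) + emeasure N (cball q (R / 100))"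
        by (rule emeasure_subadditive) (auto simp: setsN)
      also have "\<dots> \<le> ennreal (4 * (R / 100)) + ennreal (4 * (R / 100))"
        by (intro add_mono regK pq) (use R in auto)
      also have "\<dots> = ennreal (8 * (R / 100))" using R by (simp flip: ennreal_plus)
      finally show False using R by (subst (asm) ennreal_le_iff) auto
    qed
    then obtain m where "m \<in> K1" "m \<notin> cball p (R / 100)" "m \<notin> cball q (R / 100)" by blast
    then show ?thesis using that[of m] by (simp only: mem_cball not_le)
  qed
  define K2 where "K2 = {w \<in> K1. dist m w \<le> \<bar>dist p m - dist p w\<bar> + 5 * e}"
  have K2N: "K2 \<in> sets N"
  proof -
    have "K2 = K1 \<inter> {w. dist m w \<le> \<bar>dist p m - dist p w\<bar> + 5 * e}" by (auto simp: K2_def)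
    moreover have "closed {w. dist m w \<le> \<bar>dist p m - dist p w\<bar> + 5 * e}" by (intro closed_Collect_le continuous_intros)
    ultimately show ?thesis using K1N by (auto simp: setsN)
  qed
  \<comment> \<open>These points form with \<open>p\<close>, \<open>m\<close>, \<open>q\<close> an
    almost pseudo-linear quadruple in Menger's sense: opposite points on a closed curve of length
    about \<open>2 * D\<close>.\<close>
  define Pl where "Pl = K1 - K2 - bentset p m - bentset q m"
  have PlN: "Pl \<in> sets N" unfolding Pl_def using K1N K2N bentset_sets by auto
  have mK: "m \<in> K" using K1 m by auto
  have Pl: "D - 5 * e \<le> dist p m + dist p w \<and> dist p m + dist p w \<le> D + 5 * e \<and> D - 6 * e \<le> dist m w \<and> dist m w \<le> D + 5 * e"
    if w: "w \<in> Pl" for w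
  proof -
    have w1: "w \<in> K1" "w \<notin> K2" using w by (auto simp: Pl_def)
    have "triangle_excess p m w \<le> e" "triangle_excess q m w \<le> e"
      using w K1(1)[OF w1(1)] by (auto simp: Pl_def bentset_def not_less)
    note t = triangle_excess_cases[OF this(1)] triangle_excess_cases[OF this(2)]
    have n: "\<bar>dist p m - dist p w\<bar> + 5 * e < dist m w" using w1 by (auto simp: K2_def not_le)
    show ?thesis
      using t n bet[OF m(1)] bet[OF w1(1)] dist_triangle[of p q m] dist_triangle[of p q w] dist_triangle[of m w p] dist_triangle[of m w q]
        dist_commute[of m q] dist_commute[of w q] dist_commute[of m p] e(1) D_def
      by linarith
  qed
  have mPl: "emeasure N Pl \<le> ennreal (R / 10^8)"
  proof (cases "\<exists>m'\<in>Pl. good m m'")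
    case False
    then have "Pl \<subseteq> {z. \<not> good m z}" by auto
    then have "emeasure N Pl \<le> emeasure N {z. \<not> good m z}" using bad_small(1)[OF mK] by (rule emeasure_mono)
    also have "\<dots> \<le> ennreal (R / 10^9)" by (rule bad_small(2)[OF mK])
    also have "\<dots> \<le> ennreal (R / 10^8)" using R by (intro ennreal_leI) auto
    finally show ?thesis .
  next
    case True
    then obtain m' where m': "m' \<in> Pl" "good m m'" by auto
    have m'1: "m' \<in> K1" "m' \<in> K" using m' K1 by (auto simp: Pl_def)
    \<comment> \<open>Two points opposite to \<open>m\<close> have, up to a few \<open>e\<close>,
      the same distances to \<open>p\<close>, to \<open>q\<close> and to \<open>m\<close>. Alignment
      with each of these leaves only that the two points almost coincide, so \<open>Pl\<close> has
      small mass.\<close>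
    have sub: "Pl \<subseteq> bentset m m' \<union> bentset p m' \<union> bentset q m' \<union> cball m' (20 * e)"
    proof
      fix w assume w: "w \<in> Pl"
      have w1: "w \<in> K1" "w \<in> K" using w K1 by (auto simp: Pl_def)
      show "w \<in> bentset m m' \<union> bentset p m' \<union> bentset q m' \<union> cball m' (20 * e)"
      proof (rule ccontr)
        assume n: "\<not> ?thesis"
        then have "triangle_excess m m' w \<le> e" "triangle_excess p m' w \<le> e" "triangle_excess q m' w \<le> e" "20 * e < dist m' w"
          using w1 by (auto simp: bentset_def not_less)
        note t = triangle_excess_cases[OF this(1)] triangle_excess_cases[OF this(2)] triangle_excess_cases[OF this(3)] this(4)
        have De: "100 * e < D" using DR e R by simp
        show False
          using t Pl[OF w] Pl[OF m'(1)] bet[OF m'1(1)] bet[OF w1(1)] dist_triangle[of p q m'] dist_triangle[of p q w] De e(1)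
            dist_triangle[of m' w p] dist_commute[of m' p] e(2) R
            dist_commute[of m' q] dist_commute[of w q] m D_def
          by linarith
      qed
    qed
    have st: "bentset m m' \<in> sets N" "bentset p m' \<in> sets N" "bentset q m' \<in> sets N" "cball m' (20 * e) \<in> sets N"
      using bentset_sets by (auto simp: setsN)
    have "emeasure N Pl \<le> emeasure N (bentset m m' \<union> bentset p m' \<union> bentset q m' \<union> cball m' (20 * e))"
      by (rule emeasure_mono[OF sub]) (use st in auto)
    also have "\<dots> \<le> emeasure N (bentset m m') + emeasure N (bentset p m') + emeasure N (bentset q m') + emeasure N (cball m' (20 * e))"
      using st by (meson add_right_mono emeasure_subadditive order_trans sets.Un)
    also have "\<dots> \<le> ennreal (R / 10^9) + ennreal (R / 10^9) + ennreal (R / 10^9) + ennreal (4 * (20 * e))"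
      by (intro add_mono bentset_small mK m'1 pq m' K1 m regK) (use e in auto)
    also have "\<dots> = ennreal (3 * R / 10^9 + 80 * e)" using R e by (simp flip: ennreal_plus)
    also have "\<dots> \<le> ennreal (R / 10^8)" using R e by (intro ennreal_leI) simp
    finally show ?thesis .
  qed
  have mK2: "ennreal (R / 8) \<le> emeasure N K2"
  proof -
    have st: "bentset p m \<in> sets N" "bentset q m \<in> sets N" using bentset_sets by auto
    have "emeasure N (Pl \<union> bentset p m \<union> bentset q m) \<le> emeasure N Pl + emeasure N (bentset p m) + emeasure N (bentset q m)"
      using st PlN by (meson add_right_mono emeasure_subadditive order_trans sets.Un)
    also have "\<dots> \<le> ennreal (R / 10^8) + ennreal (R / 10^9) + ennreal (R / 10^9)"
      by (intro add_mono mPl bentset_small mK pq K1 m)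
    also have "\<dots> = ennreal (R / 10^8 + R / 10^9 + R / 10^9)" using R by (simp flip: ennreal_plus)
    finally have "ennreal ((R / 4 - 3 * R / 10^9) - (R / 10^8 + R / 10^9 + R / 10^9)) \<le> emeasure N K2"
      by (intro mass_diff[OF K1N K2N _ _ mK1]) (use st PlN R in \<open>auto simp: Pl_def\<close>)
    moreover have "ennreal (R / 8) \<le> ennreal ((R / 4 - 3 * R / 10^9) - (R / 10^8 + R / 10^9 + R / 10^9))"
      using R by (intro ennreal_leI) simp
    ultimately show ?thesis by (rule order_trans[rotated])
  qed
  have K2K: "K2 \<subseteq> K" using K1 by (auto simp: K2_def)
  have pm: "path_measure K2 N p q m D (5 * e)"
  proof
    show "D = dist p q" "0 < D" by (auto simp: D_def[symmetric] D0)
    show "0 \<le> 5 * e" "5 * e \<le> D /10000000000000" using e DR by auto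
    show "dist p w + dist w q \<le> D + 5 * e" if "w \<in> K2" for w using bet[of w] that e by (auto simp: K2_def)
    show "dist m w \<le> \<bar>dist p m - dist p w\<bar> + 5 * e" if "w \<in> K2" for w using that by (auto simp: K2_def)
    show "D / 400 \<le> dist p m" using m D2 R by linarith
    show "dist p m \<le> D - D / 400" using bet[OF m(1)] m dist_commute[of m q] e D2 R by linarith
    show "K2 \<in> sets borel" using K2N by (simp add: setsN)
    show "emeasure N (cball z r) \<le> ennreal (4 * r)" if "z \<in> insert p (insert q K2)" "0 < r" for z r
      using regK[of z r] that pq K2K by auto
  qed
  have fl: "(\<integral>\<^sup>+z. h u z \<partial>N) \<le> ennreal eps0" if "u \<in> K" for u
    using flat[OF that] eps0_pos by (elim order_trans) (auto intro!: ennreal_leI)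
  have hpq: "h p q \<le> ennreal (eps0 / D)"
  proof -
    have "eps0 / 2 / R \<le> eps0 / D" using D2 D0 R eps0_pos by (simp add: field_simps)
    then show ?thesis using pq(3) unfolding good_def by (meson ennreal_leI order_trans)
  qed
  have "(\<integral>\<^sup>+u. \<integral>\<^sup>+z. h u z \<partial>N \<partial>N) \<le> (\<integral>\<^sup>+u. ennreal (eps0 / 10^10) \<partial>N)"
  proof (rule nn_integral_mono_AE)
    have "- K \<in> sets N" using sets.compl_sets[OF KN] by (simp add: Compl_eq_Diff_UNIV)
    then have "- K \<in> null_sets N" using NK by (simp add: null_sets_def)
    then have "AE u in N. u \<notin> - K" by (rule AE_not_in)
    then show "AE u in N. (\<integral>\<^sup>+z. h u z \<partial>N) \<le> ennreal (eps0 / 10^10)" by eventually_elim (use flat in auto)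
  qed
  also have "\<dots> = ennreal (eps0 / 10^10) * emeasure N UNIV" by simp
  also have "emeasure N UNIV \<le> ennreal (8 * R)"
  proof -
    have "emeasure N UNIV = emeasure N (K \<union> - K)" by simp
    also have "\<dots> \<le> emeasure N K + emeasure N (- K)"
      by (rule emeasure_subadditive) (use KN sets.compl_sets[OF KN] in \<open>auto simp: Compl_eq_Diff_UNIV\<close>)
    also have "\<dots> \<le> emeasure N (cball p (2 * R))"
      using NK emeasure_mono[of K "cball p (2 * R)" N] distK[OF pq(1)] by (force simp: setsN subset_eq)
    also have "\<dots> \<le> ennreal (8 * R)" using regK[OF pq(1), of "2 * R"] R by simp
    finally show ?thesis .
  qed
  also have "ennreal (eps0 / 10^10) * ennreal (8 * R) = ennreal (eps0 / 10^10 * (8 * R))"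
    using eps0_pos R by (subst ennreal_mult) auto
  also have "\<dots> \<le> ennreal (eps0 * D)"
  proof (rule ennreal_leI)
    have "eps0 * (8 * R / 10^10) \<le> eps0 * D" using DR R eps0_pos by (intro mult_left_mono) auto
    moreover have "eps0 / 10^10 * (8 * R) = eps0 * (8 * R / 10^10)" by simp
    ultimately show "eps0 / 10^10 * (8 * R) \<le> eps0 * D" by linarith
  qed
  finally have all: "(\<integral>\<^sup>+u. \<integral>\<^sup>+z. h u z \<partial>N \<partial>N) \<le> ennreal (eps0 * D)" by (simp add: mult_left_mono)
  have "ennreal (D / 16) \<le> emeasure N K2" using mK2 D2 by (elim order_trans[rotated]) (auto intro!: ennreal_leI)
  then show ?thesis by (rule that[OF pm K2K D2 DR hpq fl[OF pq(1)] fl[OF pq(2)] all])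
qed

end

section \<open>Limit of chains\<close>

text \<open>In the absence of compactness the chains themselves need not converge. Instead the
  distance \<open>\<rho> k t x\<close> of \<open>(t, x)\<close> to the graph of the
  \<open>k\<close>-th parametrization is followed; it is bounded and 1-Lipschitz in both variables,
  and a diagonal subsequence converges on a countable set. The limit curve is the zero set of the
  limit.\<close>

lemma limit_curve:
  fixes N :: "'a::metric_space measure"
  assumes setsN: "sets N = sets borel" and finN: "emeasure N UNIV < \<infinity>" and K: "K \<in> sets borel"
    and V: "\<And>k. finite (V k)" "\<And>k. V k \<noteq> {}" "\<And>k. V k \<subseteq> cball a B"
    and T: "\<And>k v. v \<in> V k \<Longrightarrow> 0 \<le> T k v" "\<And>k v. v \<in> V k \<Longrightarrow> T k v \<le> \<Lambda>"
      "\<And>k v w. v \<in> V k \<Longrightarrow> w \<in> V k \<Longrightarrow> dist v w \<le> \<bar>T k v - T k w\<bar>"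
    and s: "s \<longlonglongrightarrow> 0"
    and cov: "\<And>k. c \<le> emeasure N {w\<in>K. \<exists>v\<in>V k. dist v w \<le> s k}"
  obtains F E :: "_ set" and f :: "real \<Rightarrow> 'a" where "closed F" "E \<subseteq> {0..\<Lambda>}" "1-lipschitz_on E f" "f ` E = F" "c \<le> emeasure N F"
proof -
  define \<rho> where "\<rho> k t x = Min ((\<lambda>v. \<bar>t - T k v\<bar> + dist v x) ` V k)" for k t x
  have upper: "\<rho> k t x \<le> \<bar>t - T k v\<bar> + dist v x" if "v \<in> V k" for k t x v
    unfolding \<rho>_def using V that by (intro Min_le) auto
  have attained: "\<exists>v\<in>V k. \<rho> k t x = \<bar>t - T k v\<bar> + dist v x" for k t x
  proof -
    have "\<rho> k t x \<in> (\<lambda>v. \<bar>t - T k v\<bar> + dist v x) ` V k" unfolding \<rho>_def using V by (intro Min_in) auto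
    then show ?thesis by auto
  qed
  have nonneg: "0 \<le> \<rho> k t x" for k t x using attained[of k t x] by force
  have close: "\<rho> k t x \<le> \<rho> k t' x' + \<bar>t - t'\<bar> + dist x x'" for k t t' x x'
  proof -
    obtain v where v: "v \<in> V k" "\<rho> k t' x' = \<bar>t' - T k v\<bar> + dist v x'" using attained by blast
    have "dist v x \<le> dist v x' + dist x x'" by (metis dist_triangle dist_commute add.commute)
    then show ?thesis using upper[OF v(1), of t x] v(2) by linarith
  qed
  have apart: "dist x y \<le> \<rho> k t x + \<bar>t - t'\<bar> + \<rho> k t' y" for k t t' x y
  proof -
    obtain v where v: "v \<in> V k" "\<rho> k t x = \<bar>t - T k v\<bar> + dist v x" using attained by blast
    obtain w where w: "w \<in> V k" "\<rho> k t' y = \<bar>t' - T k w\<bar> + dist w y" using attained by blast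
    have "dist x y \<le> dist v x + dist v w + dist w y"
      by (metis add_mono_thms_linordered_semiring(3) dist_commute dist_triangle order_trans)
    then show ?thesis using v w T(3)[OF v(1) w(1)] by linarith
  qed
  define Q where "Q = (\<Union>k. V k)"
  have Q: "countable Q" unfolding Q_def using V by (auto intro: countable_finite)
  \<comment> \<open>The parameter interval is enlarged because the rational parameters used below
    approximate \<open>t\<close> from above and may pass \<open>\<Lambda>\<close>.\<close>
  define S where "S = (\<rat> \<inter> {-1..\<Lambda>+1}) \<times> Q"
  have "countable S" unfolding S_def by (intro countable_SIGMA Q countable_Int1 countable_rat)
  moreover have "norm (case u of (t, x) \<Rightarrow> \<rho> k t x) \<le> 2 * \<Lambda> + 2 + 2 * B" if "u \<in> S" for k u
  proof -
    obtain t x where eq: "u = (t, x)" by (cases u)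
    have u: "u = (t, x)" "-1 \<le> t" "t \<le> \<Lambda> + 1" "x \<in> Q" using that by (auto simp: S_def eq)
    obtain v where v: "v \<in> V k" using V by blast
    have "x \<in> cball a B" using u(4) V(3) unfolding Q_def by blast
    moreover have "v \<in> cball a B" using v V(3) by blast
    ultimately have "dist a x \<le> B" "dist a v \<le> B" by auto
    then have "dist v x \<le> 2 * B" using dist_triangle3[of v x a] by linarith
    moreover have "\<bar>t - T k v\<bar> \<le> 2 * \<Lambda> + 2" using u(2,3) T(1,2)[OF v] by linarith
    ultimately show ?thesis using upper[OF v, of t x] nonneg[of k t x] u(1) by simp
  qed
  ultimately obtain r where r: "strict_mono (r :: nat \<Rightarrow> nat)"
    and conv: "\<And>u. u \<in> S \<Longrightarrow> \<exists>l. (\<lambda>n. case u of (t, x) \<Rightarrow> \<rho> (r n) t x) \<longlonglongrightarrow> l"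
    using function_convergent_subsequence[of S "\<lambda>k u. case u of (t, x) \<Rightarrow> \<rho> k t x"] by metis
  have conv: "\<exists>l. (\<lambda>n. \<rho> (r n) t x) \<longlonglongrightarrow> l" if "t \<in> \<rat>" "-1 \<le> t" "t \<le> \<Lambda>+1" "x \<in> Q" for t x
    using conv[of "(t, x)"] that by (simp add: S_def)
  define F where "F = {x. \<exists>t\<in>{0..\<Lambda>}. (\<lambda>k. \<rho> (r k) t x) \<longlonglongrightarrow> 0}"
  define E where "E = {t\<in>{0..\<Lambda>}. \<exists>x. (\<lambda>k. \<rho> (r k) t x) \<longlonglongrightarrow> 0}"
  define f where "f t = (SOME x. (\<lambda>k. \<rho> (r k) t x) \<longlonglongrightarrow> 0)" for t
  have f: "(\<lambda>k. \<rho> (r k) t (f t)) \<longlonglongrightarrow> 0" if "t \<in> E" for t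
    unfolding f_def by (rule someI_ex) (use that in \<open>auto simp: E_def\<close>)
  have limdist: "dist x y \<le> \<bar>t - t'\<bar>" if "(\<lambda>k. \<rho> (r k) t x) \<longlonglongrightarrow> 0" "(\<lambda>k. \<rho> (r k) t' y) \<longlonglongrightarrow> 0" for x y t t'
  proof -
    have "(\<lambda>k. \<rho> (r k) t x + \<bar>t - t'\<bar> + \<rho> (r k) t' y) \<longlonglongrightarrow> 0 + \<bar>t - t'\<bar> + 0"
      by (intro tendsto_add that tendsto_const)
    then have "dist x y \<le> 0 + \<bar>t - t'\<bar> + 0"
      by (rule tendsto_lowerbound) (rule always_eventually, rule allI, rule apart, simp)
    then show ?thesis by simp
  qed
  have zeroI: "(\<lambda>k. \<rho> (r k) t x) \<longlonglongrightarrow> 0" if "\<And>e. 0 < e \<Longrightarrow> eventually (\<lambda>k. \<rho> (r k) t x < e) sequentially" for t x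
    using that nonneg by (intro tendstoI) (simp add: dist_real_def)
  have zeroD: "eventually (\<lambda>k. \<rho> (r k) t x < e) sequentially" if "(\<lambda>k. \<rho> (r k) t x) \<longlonglongrightarrow> 0" "0 < e" for t x e
    using order_tendstoD(2)[OF that] .
  have "closed F"
    unfolding closed_sequential_limits
  proof (intro allI impI, elim conjE)
    fix xs x assume xs: "\<forall>n. xs n \<in> F" "xs \<longlonglongrightarrow> x"
    then have "\<forall>n. \<exists>t. t \<in> {0..\<Lambda>} \<and> (\<lambda>k. \<rho> (r k) t (xs n)) \<longlonglongrightarrow> 0" unfolding F_def by blast
    from choice[OF this] obtain ts where ts: "\<And>n. ts n \<in> {0..\<Lambda>}" "\<And>n. (\<lambda>k. \<rho> (r k) (ts n) (xs n)) \<longlonglongrightarrow> 0" by blast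
    obtain t u where t: "t \<in> {0..\<Lambda>}" "strict_mono (u :: nat \<Rightarrow> nat)" "(ts \<circ> u) \<longlonglongrightarrow> t"
      by (rule seq_compactE[OF compact_imp_seq_compact[OF compact_Icc[of 0 \<Lambda>]], of ts]) (use ts(1) in blast)+
    have "(\<lambda>k. \<rho> (r k) t x) \<longlonglongrightarrow> 0"
    proof (rule zeroI)
      fix e :: real assume e: "0 < e"
      have "eventually (\<lambda>n. dist ((ts \<circ> u) n) t < e/3) sequentially" "eventually (\<lambda>n. dist ((xs \<circ> u) n) x < e/3) sequentially"
        by (rule tendstoD[OF t(3)], use e in simp, rule tendstoD[OF LIMSEQ_subseq_LIMSEQ[OF xs(2) t(2)]], use e in simp)
      then have "eventually (\<lambda>n. dist ((ts \<circ> u) n) t < e/3 \<and> dist ((xs \<circ> u) n) x < e/3) sequentially" by (rule eventually_conj)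
      then obtain n where n: "dist (ts (u n)) t < e/3" "dist (xs (u n)) x < e/3" by (auto dest: eventually_happens)
      have ev: "eventually (\<lambda>k. \<rho> (r k) (ts (u n)) (xs (u n)) < e/3) sequentially" using e by (intro zeroD ts) auto
      show "eventually (\<lambda>k. \<rho> (r k) t x < e) sequentially"
        using ev
      proof eventually_elim
        case (elim k)
        show ?case using elim n close[of "r k" t x "ts (u n)" "xs (u n)"] by (simp add: dist_real_def dist_commute abs_minus_commute)
      qed
    qed
    then show "x \<in> F" using t(1) by (auto simp: F_def)
  qed
  moreover have "1-lipschitz_on E f"
    using limdist[OF f f] by (intro lipschitz_onI) (auto simp: dist_real_def)
  moreover have "f ` E = F"
  proof
    have "E \<subseteq> {0..\<Lambda>}" by (auto simp: E_def)
    then show "f ` E \<subseteq> F" using f unfolding F_def by blast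
    show "F \<subseteq> f ` E"
    proof
      fix x assume "x \<in> F"
      then obtain t where t: "t \<in> {0..\<Lambda>}" "(\<lambda>k. \<rho> (r k) t x) \<longlonglongrightarrow> 0" by (auto simp: F_def)
      then have tE: "t \<in> E" by (auto simp: E_def)
      have "dist x (f t) \<le> \<bar>t - t\<bar>" by (rule limdist[OF t(2) f[OF tE]])
      then show "x \<in> f ` E" using tE by simp
    qed
  qed
  moreover have "c \<le> emeasure N F"
  proof -
    define Y where "Y k = {w\<in>K. \<exists>v\<in>V k. dist v w \<le> s k}" for k
    have Ymeas: "Y k \<in> sets N" for k
    proof -
      have "Y k = K \<inter> (\<Union>v\<in>V k. cball v (s k))" by (auto simp: Y_def)
      also have "\<dots> \<in> sets borel" using V K by (intro sets.Int K borel_closed closed_UN) auto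
      finally show ?thesis using setsN by simp
    qed
    \<comment> \<open>Reverse Fatou: as \<open>N\<close> is finite, the points that lie in
      infinitely many \<open>Y (r n)\<close> still have mass at least \<open>c\<close>.\<close>
    define U where "U n = (\<Union>k\<in>{n..}. Y (r k))" for n
    have Umeas: "U n \<in> sets N" for n unfolding U_def using Ymeas by (intro sets.countable_UN') auto
    have "decseq U" unfolding decseq_def U_def by force
    have lim: "(INF n. emeasure N (U n)) = emeasure N (\<Inter>n. U n)"
    proof (rule INF_emeasure_decseq[OF _ \<open>decseq U\<close>])
      show "emeasure N (U n) \<noteq> \<infinity>" for n
      proof -
        have "emeasure N (U n) \<le> emeasure N UNIV" using Umeas setsN by (intro emeasure_mono) auto
        then show ?thesis using finN by (metis leD)
      qed
    qed (use Umeas in auto)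
    have "c \<le> emeasure N (U n)" for n
    proof -
      have "Y (r n) \<subseteq> U n" by (auto simp: U_def)
      then have "emeasure N (Y (r n)) \<le> emeasure N (U n)" by (rule emeasure_mono[OF _ Umeas])
      then show ?thesis using cov[of "r n"] unfolding Y_def by (rule order_trans[rotated])
    qed
    then have "c \<le> emeasure N (\<Inter>n. U n)" unfolding lim[symmetric] by (rule INF_greatest)
    also have "\<dots> \<le> emeasure N F"
    proof (rule emeasure_mono)
      show "F \<in> sets N" using \<open>closed F\<close> setsN by simp
      show "(\<Inter>n. U n) \<subseteq> F"
      proof
        fix x assume "x \<in> (\<Inter>n. U n)"
        then have "\<exists>k v. n \<le> k \<and> v \<in> V (r k) \<and> dist v x \<le> s (r k)" for n unfolding U_def Y_def by blast
        then obtain kk vv where kv: "\<And>n. n \<le> kk n" "\<And>n. vv n \<in> V (r (kk n))" "\<And>n. dist (vv n) x \<le> s (r (kk n))" by metis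
        have "T (r (kk n)) (vv n) \<in> {0..\<Lambda>}" for n using T(1,2)[OF kv(2)] by simp
        note TT = this
        obtain t u where t: "t \<in> {0..\<Lambda>}" "strict_mono (u :: nat \<Rightarrow> nat)" "((\<lambda>n. T (r (kk n)) (vv n)) \<circ> u) \<longlonglongrightarrow> t"
          by (rule seq_compactE[OF compact_imp_seq_compact[OF compact_Icc[of 0 \<Lambda>]], of "\<lambda>n. T (r (kk n)) (vv n)"]) (use TT in blast)+
        have kk: "filterlim (\<lambda>n. kk (u n)) at_top sequentially"
        proof (rule filterlim_at_top_mono[OF filterlim_subseq[OF t(2)]])
          show "eventually (\<lambda>n. u n \<le> kk (u n)) sequentially" using kv(1) by simp
        qed
        have rk: "filterlim (\<lambda>n. r (kk (u n))) at_top sequentially"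
          using filterlim_compose[OF filterlim_subseq[OF r] kk] .
        have small: "eventually (\<lambda>n. s (r (kk (u n))) < e) sequentially" if "0 < e" for e
          using order_tendstoD(2)[OF filterlim_compose[OF s rk] that] .
        have "(\<lambda>k. \<rho> (r k) t x) \<longlonglongrightarrow> 0"
        proof (rule zeroI)
          fix e :: real assume e: "0 < e"
          define d where "d = min (e/20) (1/2)"
          have d: "0 < d" "d \<le> e/20" "d < 1" using e by (auto simp: d_def)
          obtain t' where t': "t' \<in> \<rat>" "t < t'" "t' < t + d" using Rats_dense_in_real[of t "t+d"] d by auto
          obtain j where j: "s (r (kk (u j))) < d" using small[OF d(1)] by (auto dest: eventually_happens)
          define v where "v = vv (u j)"
          have v: "v \<in> Q" "dist v x < d" using kv(2)[of "u j"] kv(3)[of "u j"] j by (auto simp: Q_def v_def)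
          \<comment> \<open>Near \<open>x\<close> the distance to the graphs is known to be small
            only along a further subsequence. Convergence at the countably many points
            \<open>(t', v)\<close> makes it small for all later indices, and \<open>close\<close>
            carries this over to \<open>(t, x)\<close>.\<close>
          obtain l where l: "(\<lambda>n. \<rho> (r n) t' v) \<longlonglongrightarrow> l" using conv[OF t'(1) _ _ v(1)] t' t(1) d by auto
          have "(\<lambda>n. \<rho> (r (kk (u n))) t' v) \<longlonglongrightarrow> l" using filterlim_compose[OF l kk] .
          moreover have "eventually (\<lambda>n. \<rho> (r (kk (u n))) t' v \<le> 5 * d) sequentially"
            using small[OF d(1)] tendstoD[OF t(3) d(1)]
          proof eventually_elim
            case (elim n)
            have "\<rho> (r (kk (u n))) t' v \<le> \<bar>t' - T (r (kk (u n))) (vv (u n))\<bar> + dist (vv (u n)) v" by (rule upper[OF kv(2)])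
            moreover have "dist (vv (u n)) v \<le> dist (vv (u n)) x + dist v x" by (rule dist_triangle2)
            ultimately show ?case using elim kv(3)[of "u n"] v(2) t' by (simp add: dist_real_def)
          qed
          ultimately have "l \<le> 5 * d" by (rule tendsto_upperbound) simp
          then have "l < 6 * d" using d by simp
          have ev: "eventually (\<lambda>n. \<rho> (r n) t' v < 6 * d) sequentially" by (rule order_tendstoD(2)[OF l \<open>l < 6 * d\<close>])
          show "eventually (\<lambda>k. \<rho> (r k) t x < e) sequentially"
            using ev
          proof eventually_elim
            case (elim k)
            show ?case using elim v(2) t' d e close[of "r k" t x t' v] by (simp add: dist_commute)
          qed
        qed
        then show "x \<in> F" using t(1) by (auto simp: F_def)
      qed
    qed
    finally show ?thesis .
  qed
  moreover have "E \<subseteq> {0..\<Lambda>}" by (auto simp: E_def)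
  ultimately show thesis using that[of F E f] by blast
qed

lemma (in path_measure) curve_exists:
  assumes small: "h p q \<le> ennreal (eps0 / D)" "(\<integral>\<^sup>+z. h p z \<partial>N) \<le> ennreal eps0" "(\<integral>\<^sup>+z. h q z \<partial>N) \<le> ennreal eps0"
      "(\<integral>\<^sup>+u. \<integral>\<^sup>+z. h u z \<partial>N \<partial>N) \<le> ennreal (eps0 * D)"
    and mass: "ennreal (D / 16) \<le> emeasure N K"
  obtains F E and f :: "real \<Rightarrow> 'a" where "closed F" "bounded E" "1-lipschitz_on E f" "f ` E = F" "0 < emeasure N F"
proof -
  have "\<exists>V. p \<in> V \<and> finite V \<and> inj_on P V \<and> L V \<le> 2 * D \<and> ennreal (D / 32) \<le> emeasure N {w \<in> K. \<exists>v\<in>V. dist v w \<le> sc n}" for n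
    by (rule net_exists[OF small mass, of n]) blast
  then have "\<forall>n. \<exists>V. p \<in> V \<and> finite V \<and> inj_on P V \<and> L V \<le> 2 * D \<and> ennreal (D / 32) \<le> emeasure N {w \<in> K. \<exists>v\<in>V. dist v w \<le> sc n}" ..
  from choice[OF this] obtain V where V: "\<And>n. p \<in> V n" "\<And>n. finite (V n)" "\<And>n. inj_on P (V n)" "\<And>n. L (V n) \<le> 2 * D"
    "\<And>n. ennreal (D / 32) \<le> emeasure N {w \<in> K. \<exists>v\<in>V n. dist v w \<le> sc n}" by blast
  have "\<exists>T. (\<forall>v\<in>V n. 0 \<le> T v) \<and> (\<forall>v\<in>V n. T v \<le> 2 * D) \<and> (\<forall>v\<in>V n. \<forall>w\<in>V n. dist v w \<le> \<bar>T v - T w\<bar>)" for n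
  proof (rule links_param[OF V(2,3)[of n]], goal_cases)
    case (1 T)
    have "T v \<le> 2 * D" if "v \<in> V n" for v using 1(2)[OF that] V(4)[of n] by (simp add: L_def)
    then show ?case using 1(1,3) by blast
  qed
  then have "\<forall>n. \<exists>T. (\<forall>v\<in>V n. 0 \<le> T v) \<and> (\<forall>v\<in>V n. T v \<le> 2 * D) \<and> (\<forall>v\<in>V n. \<forall>w\<in>V n. dist v w \<le> \<bar>T v - T w\<bar>)" ..
  from choice[OF this] obtain T where T: "\<And>n v. v \<in> V n \<Longrightarrow> 0 \<le> T n v" "\<And>n v. v \<in> V n \<Longrightarrow> T n v \<le> 2 * D"
    "\<And>n v w. v \<in> V n \<Longrightarrow> w \<in> V n \<Longrightarrow> dist v w \<le> \<bar>T n v - T n w\<bar>" by blast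
  have sub: "V n \<subseteq> cball p (2 * D)" for n
  proof
    fix v assume v: "v \<in> V n"
    show "v \<in> cball p (2 * D)" using T(3)[OF V(1) v] T(1,2)[OF v] T(1,2)[OF V(1), of n] by auto
  qed
  have lim: "sc \<longlonglongrightarrow> 0" unfolding sc_def by (intro tendsto_mult_right_zero LIMSEQ_realpow_zero) auto
  have ne: "V n \<noteq> {}" for n using V(1) by auto
  show thesis
  proof (rule limit_curve[OF setsN finN K V(2) ne sub T lim V(5)], assumption+, goal_cases)
    case (1 F E f)
    have "bounded E" using 1(2) bounded_closed_interval bounded_subset by blast
    moreover have "0 < ennreal (D / 32)" using D(2) by simp
    then have "0 < emeasure N F" using 1(5) by (rule less_le_trans)
    ultimately show ?case using that 1 by blast
  qed
qed

lemma (in root_measure) curve_exists: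
  obtains F E and f :: "real \<Rightarrow> 'a" where "closed F" "bounded E" "1-lipschitz_on E f" "f ` E = F" "0 < emeasure N F"
proof -
  obtain p q m K2 D e1 where pm: "path_measure K2 N p q m D e1" and small: "h p q \<le> ennreal (eps0 / D)"
    "(\<integral>\<^sup>+z. h p z \<partial>N) \<le> ennreal eps0" "(\<integral>\<^sup>+z. h q z \<partial>N) \<le> ennreal eps0"
    "(\<integral>\<^sup>+u. \<integral>\<^sup>+z. h u z \<partial>N \<partial>N) \<le> ennreal (eps0 * D)" "ennreal (D / 16) \<le> emeasure N K2"
    by (rule root) blast
  show thesis by (rule path_measure.curve_exists[OF pm small]) (rule that)
qed

section \<open>Hausdorff measure and densities\<close>

lemma hausdorff1_outer_subadditive: "hausdorff1_outer (\<Union>i. A i) \<le> (\<Sum>i. hausdorff1_outer (A (i::nat)))"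
proof -
  have "hausdorff1_outer (\<Union>i. A i) = hausdorff1_outer (\<Union>i. disjointed A i)" by (simp add: UN_disjointed_eq)
  also have "\<dots> \<le> (\<Sum>i. hausdorff1_outer (disjointed A i))" by (rule hausdorff1_outer_UN_le[OF disjoint_family_disjointed])
  also have "\<dots> \<le> (\<Sum>i. hausdorff1_outer (A i))"
    by (intro suminf_le hausdorff1_outer_mono disjointed_subset) auto
  finally show ?thesis .
qed

lemma hausdorff1_content_le_outer: "0 < d \<Longrightarrow> hausdorff1_content d S \<le> hausdorff1_outer S"
  unfolding hausdorff1_outer_def by (rule SUP_upper) simp

lemma hausdorff1_content_le_ediam: "ediam V \<le> ennreal d \<Longrightarrow> S \<subseteq> V \<Longrightarrow> hausdorff1_content d S \<le> ediam V"
  unfolding hausdorff1_content_def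
  by (rule INF_lower2[of "\<lambda>i. if i = (0::nat) then V else {}"], force, subst suminf_finite[of "{0}"]) auto

lemma hausdorff1_content_coverE:
  assumes "hausdorff1_content d S < a"
  obtains C where "S \<subseteq> (\<Union>i. C i)" "\<And>i::nat. ediam (C i) \<le> ennreal d" "(\<Sum>i. ediam (C i)) < a"
  using assms unfolding hausdorff1_content_def INF_less_iff by auto

lemma hausdorff1_content_subadditive: "hausdorff1_content d (\<Union>i. A i) \<le> (\<Sum>i. hausdorff1_content d (A (i::nat)))"
proof -
  have "countably_subadditive UNIV (hausdorff1_content d :: 'a set \<Rightarrow> _)" and mono: "increasing UNIV (hausdorff1_content d :: 'a set \<Rightarrow> _)"
    using outer_measure_space_hausdorff1_content[of d] by (auto simp: outer_measure_space_def)
  then have "hausdorff1_content d (\<Union>i. disjointed A i) \<le> (\<Sum>i. hausdorff1_content d (disjointed A i))"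
    unfolding countably_subadditive_def using disjoint_family_disjointed[of A] by auto
  also have "\<dots> \<le> (\<Sum>i. hausdorff1_content d (A i))"
    using mono unfolding increasing_def by (intro suminf_le) (auto simp: disjointed_subset)
  finally show ?thesis by (simp add: UN_disjointed_eq)
qed

lemma hausdorff1_content_empty [simp]: "hausdorff1_content d {} = 0"
  using outer_measure_space_hausdorff1_content[of d] by (auto simp: outer_measure_space_def positive_def)

lemma hausdorff1_content_Un: "hausdorff1_content d (A \<union> B) \<le> hausdorff1_content d A + hausdorff1_content d B"
proof -
  have "hausdorff1_content d (\<Union>i. binaryset A B i) \<le> (\<Sum>i. hausdorff1_content d (binaryset A B i))"
    by (rule hausdorff1_content_subadditive)
  then show ?thesis by (simp add: UN_binaryset_eq suminf_binaryset_eq)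
qed

lemma hausdorff1_outer_Un: "hausdorff1_outer (A \<union> B) \<le> hausdorff1_outer A + hausdorff1_outer B"
proof -
  have "hausdorff1_outer (\<Union>i. binaryset A B i) \<le> (\<Sum>i. hausdorff1_outer (binaryset A B i))"
    by (rule hausdorff1_outer_subadditive)
  then show ?thesis by (simp add: UN_binaryset_eq suminf_binaryset_eq)
qed

lemma hausdorff1_outer_le_iff: "hausdorff1_outer S \<le> c \<longleftrightarrow> (\<forall>d>0. hausdorff1_content d S \<le> c)"
  unfolding hausdorff1_outer_def SUP_le_iff by auto

lemma hausdorff1_outer_sing [simp]: "hausdorff1_outer {x} = 0"
proof -
  have "hausdorff1_outer {x} \<le> 0" unfolding hausdorff1_outer_le_iff
    using hausdorff1_content_le_ediam[of "{x}" _ "{x}"] by (simp add: ediam_def)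
  then show ?thesis by simp
qed

lemma ediam_cball: "0 \<le> r \<Longrightarrow> ediam (cball x r) \<le> ennreal (2 * r)"
  unfolding ediam_def
proof (intro SUP_least ennreal_leI)
  fix y z assume "y \<in> cball x r" "z \<in> cball x r"
  then show "dist y z \<le> 2 * r" using dist_triangle3[of y z x] by simp
qed

lemma ennreal_two_half: "2 * a / 2 = (a::ennreal)"
  using ennreal_mult_divide_eq[of 2 a] by (simp add: mult.commute)

lemma ennreal_halfD: "a / 2 \<le> b \<Longrightarrow> a \<le> 2 * (b::ennreal)"
  using mult_left_mono[of "a / 2" b 2] by (simp add: ennreal_times_divide ennreal_two_half)

lemma ennreal_doubleD: "2 * a \<le> b \<Longrightarrow> a \<le> (b::ennreal) / 2"
  using divide_right_mono_ennreal[of "2 * a" b 2] by (simp add: ennreal_two_half)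

text \<open>Greedy choice: each step adjoins a member with at least half of the measure still
  available. The measures of the adjoined sets are summable, so nothing of positive measure remains
  disjoint from their union.\<close>

lemma measure_exhaustion:
  fixes M :: "'a measure"
  assumes "{} \<in> \<C>" and \<C>: "\<C> \<subseteq> sets M" and fin: "\<And>C. C \<in> \<C> \<Longrightarrow> emeasure M C \<le> c" "c < \<infinity>"
    and UN: "\<And>A :: nat \<Rightarrow> 'a set. disjoint_family A \<Longrightarrow> (\<And>i. A i \<in> \<C>) \<Longrightarrow> (\<Union>i. A i) \<in> \<C>"
  obtains B where "B \<in> \<C>" "\<And>C. C \<in> \<C> \<Longrightarrow> C \<inter> B = {} \<Longrightarrow> emeasure M C = 0"
proof -
  define m where "m B = (SUP C\<in>{C\<in>\<C>. C \<inter> B = {}}. emeasure M C)" for B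
  have "\<exists>C\<in>\<C>. C \<inter> B = {} \<and> m B \<le> 2 * emeasure M C" for B
  proof (cases "m B = 0")
    case True
    then show ?thesis using assms(1) by auto
  next
    case False
    have "m B \<le> c" unfolding m_def using fin by (intro SUP_least) auto
    then have fb: "m B < \<infinity>" using fin(2) by (rule le_less_trans)
    have "m B / 2 < m B" using False fb by (cases "m B") (auto simp: ennreal_divide_numeral ennreal_less_iff)
    then obtain C where "C \<in> \<C>" "C \<inter> B = {}" "m B / 2 < emeasure M C"
      unfolding m_def[of B] less_SUP_iff by auto
    moreover from this have "m B \<le> 2 * emeasure M C"
      by (intro ennreal_halfD) simp
    ultimately show ?thesis by blast
  qed
  then obtain g where g: "\<And>B. g B \<in> \<C>" "\<And>B. g B \<inter> B = {}" "\<And>B. m B \<le> 2 * emeasure M (g B)" by metis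
  define B where "B = rec_nat {} (\<lambda>_ B. B \<union> g B)"
  have B: "B 0 = {}" "\<And>n. B (Suc n) = B n \<union> g (B n)" by (simp_all add: B_def)
  have Bmono: "B i \<subseteq> B j" if "i \<le> j" for i j using that B(2) by (rule_tac lift_Suc_mono_le[of B]) auto
  have disj: "disjoint_family (\<lambda>n. g (B n))"
  proof -
    have "g (B i) \<inter> g (B j) = {}" if "i < j" for i j
      using Bmono[of "Suc i" j] that B(2)[of i] g(2)[of "B j"] by auto
    then show ?thesis unfolding disjoint_family_on_def by (metis inf_commute nat_neq_iff)
  qed
  define U where "U = (\<Union>n. g (B n))"
  have U: "U \<in> \<C>" unfolding U_def by (rule UN[OF disj]) (rule g)
  have BU: "B n \<subseteq> U" for n by (induction n) (auto simp: B U_def)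
  have sum: "(\<Sum>n. emeasure M (g (B n))) = emeasure M U"
    unfolding U_def using g(1) \<C> by (intro suminf_emeasure disj) auto
  have "summable (\<lambda>n. enn2real (emeasure M (g (B n))))"
  proof -
    have "(\<Sum>n. emeasure M (g (B n))) \<noteq> \<infinity>" using sum fin(1)[OF U] fin(2) by (auto simp: top_unique)
    moreover have fn: "emeasure M (g (B n)) \<noteq> \<infinity>" for n using fin(1)[OF g(1)[of "B n"]] fin(2) by (auto simp: top_unique)
    ultimately show ?thesis
      by (intro summable_suminf_not_top) (auto simp: less_top)
  qed
  then have lim: "(\<lambda>n. enn2real (emeasure M (g (B n)))) \<longlonglongrightarrow> 0" by (rule summable_LIMSEQ_zero)
  show thesis
  proof (rule that[OF U])
    fix C assume C: "C \<in> \<C>" "C \<inter> U = {}"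
    have fC: "emeasure M C \<noteq> \<infinity>" using fin(1)[OF C(1)] fin(2) by (auto simp: top_unique)
    have "enn2real (emeasure M C) \<le> 2 * enn2real (emeasure M (g (B n)))" for n
    proof -
      have fn: "emeasure M (g (B n)) \<noteq> \<infinity>" using fin(1)[OF g(1)[of "B n"]] fin(2) by (auto simp: top_unique)
      have "C \<inter> B n = {}" using C(2) BU by blast
      then have "emeasure M C \<le> m (B n)" unfolding m_def using C by (intro SUP_upper) auto
      also have "\<dots> \<le> 2 * emeasure M (g (B n))" by (rule g)
      finally have "enn2real (emeasure M C) \<le> enn2real (2 * emeasure M (g (B n)))"
        using fn by (intro enn2real_mono) (auto simp: ennreal_mult_less_top less_top)
      then show ?thesis by (simp add: enn2real_mult)
    qed
    then have "enn2real (emeasure M C) \<le> 2 * 0"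
      by (intro tendsto_lowerbound[OF tendsto_mult_left[OF lim]] always_eventually) auto
    then show "emeasure M C = 0" using fC by (cases "emeasure M C") auto
  qed
qed

text \<open>Remove a maximal Borel set on which the content is at most half of the measure. On the
  rest \<open>G\<close> the bound holds, since a violating \<open>G \<inter> V\<close> would be
  another such set. If \<open>G\<close> were null for all \<open>d\<close>, the contents of
  \<open>Z\<close> would stay below half of its measure and could not converge to it.\<close>

lemma upper_density:
  fixes Z :: "'a::metric_space set"
  assumes Z: "Z \<in> sets borel" "0 < hausdorff1_outer Z" "hausdorff1_outer Z < \<infinity>"
  obtains G d where "G \<in> sets borel" "G \<subseteq> Z" "0 < hausdorff1_outer G" "0 < d"
    "\<And>V. V \<in> sets borel \<Longrightarrow> ediam V \<le> ennreal d \<Longrightarrow> hausdorff1_outer (G \<inter> V) \<le> 2 * ediam V"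
proof -
  have step: "\<exists>G\<subseteq>Z. G \<in> sets borel \<and> (\<forall>V\<in>sets borel. ediam V \<le> ennreal d \<longrightarrow> hausdorff1_outer (G \<inter> V) \<le> 2 * ediam V)
      \<and> 2 * hausdorff1_content d Z \<le> hausdorff1_outer Z + hausdorff1_outer G" if d: "0 < d" for d
  proof -
    define \<C> where "\<C> = {B \<in> sets borel. B \<subseteq> Z \<and> 2 * hausdorff1_content d B \<le> hausdorff1_outer B}"
    obtain B where B: "B \<in> \<C>" "\<And>C. C \<in> \<C> \<Longrightarrow> C \<inter> B = {} \<Longrightarrow> emeasure hausdorff1 C = 0"
    proof (rule measure_exhaustion[of \<C> hausdorff1 "hausdorff1_outer Z"])
      have "hausdorff1_content d ({}::'a set) \<le> hausdorff1_outer ({}::'a set)" by (rule hausdorff1_content_le_outer[OF d])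
      then show "{} \<in> \<C>" unfolding \<C>_def by simp
      show "\<C> \<subseteq> sets hausdorff1" by (auto simp: \<C>_def)
      show "emeasure hausdorff1 C \<le> hausdorff1_outer Z" if "C \<in> \<C>" for C
        using that by (auto simp: \<C>_def emeasure_hausdorff1 intro: hausdorff1_outer_mono)
      show "hausdorff1_outer Z < \<infinity>" by fact
      show "(\<Union>i. A i) \<in> \<C>" if A: "disjoint_family A" "\<And>i. A i \<in> \<C>" for A :: "nat \<Rightarrow> 'a set"
      proof -
        have bor: "A i \<in> sets borel" for i using A(2) by (simp add: \<C>_def)
        have "2 * hausdorff1_content d (\<Union>i. A i) \<le> 2 * (\<Sum>i. hausdorff1_content d (A i))"
          by (intro mult_left_mono hausdorff1_content_subadditive) simp
        also have "\<dots> = (\<Sum>i. 2 * hausdorff1_content d (A i))" by (simp add: ennreal_suminf_cmult)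
        also have "\<dots> \<le> (\<Sum>i. hausdorff1_outer (A i))" using A(2) by (intro suminf_le) (auto simp: \<C>_def)
        also have "\<dots> = (\<Sum>i. emeasure hausdorff1 (A i))" using bor by (simp add: emeasure_hausdorff1)
        also have "\<dots> = emeasure hausdorff1 (\<Union>i. A i)" using A(1) bor by (intro suminf_emeasure) auto
        also have "\<dots> = hausdorff1_outer (\<Union>i. A i)" using bor by (intro emeasure_hausdorff1) auto
        finally show ?thesis using bor A(2) by (auto simp: \<C>_def)
      qed
    qed blast
    have B': "B \<in> sets borel" "B \<subseteq> Z" "2 * hausdorff1_content d B \<le> hausdorff1_outer B" using B(1) by (auto simp: \<C>_def)
    define G where "G = Z - B"
    have G: "G \<subseteq> Z" "G \<in> sets borel" "G \<inter> B = {}" using Z B' by (auto simp: G_def)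
    have "hausdorff1_outer (G \<inter> V) \<le> 2 * ediam V" if V: "V \<in> sets borel" "ediam V \<le> ennreal d" for V
    proof (rule ccontr)
      assume *: "\<not> ?thesis"
      have "2 * hausdorff1_content d (G \<inter> V) \<le> 2 * ediam V" by (intro mult_left_mono hausdorff1_content_le_ediam V) auto
      also have "\<dots> \<le> hausdorff1_outer (G \<inter> V)" using * by simp
      finally have "G \<inter> V \<in> \<C>" using G V by (auto simp: \<C>_def)
      then have "emeasure hausdorff1 (G \<inter> V) = 0" using G by (intro B) auto
      then show False using * G V by (simp add: emeasure_hausdorff1)
    qed
    moreover have "2 * hausdorff1_content d Z \<le> hausdorff1_outer Z + hausdorff1_outer G"
    proof -
      have eq: "emeasure hausdorff1 Z = emeasure hausdorff1 B + emeasure hausdorff1 G"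
        using G B' Z by (subst plus_emeasure) (auto simp: G_def Un_absorb1)
      have "Z = B \<union> G" using B' by (auto simp: G_def)
      then have "hausdorff1_content d Z \<le> hausdorff1_content d B + hausdorff1_content d G"
        using hausdorff1_content_Un by metis
      then have "2 * hausdorff1_content d Z \<le> 2 * hausdorff1_content d B + 2 * hausdorff1_content d G"
        unfolding distrib_left[symmetric] by (rule mult_left_mono) simp
      also have "\<dots> \<le> hausdorff1_outer B + (hausdorff1_outer G + hausdorff1_outer G)"
        unfolding mult_2[of "hausdorff1_content d G"] by (intro add_mono B' hausdorff1_content_le_outer[OF d])
      also have "\<dots> = hausdorff1_outer Z + hausdorff1_outer G"
        using eq G B' Z by (simp add: emeasure_hausdorff1 add.assoc)
      finally show ?thesis .
    qed
    ultimately show ?thesis using G by blast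
  qed
  show thesis
  proof (rule ccontr)
    assume *: "\<not> thesis"
    note obt = that
    have "2 * hausdorff1_content d Z \<le> hausdorff1_outer Z" if d: "0 < d" for d
    proof -
      obtain G where G: "G \<subseteq> Z" "G \<in> sets borel" "\<forall>V\<in>sets borel. ediam V \<le> ennreal d \<longrightarrow> hausdorff1_outer (G \<inter> V) \<le> 2 * ediam V"
        "2 * hausdorff1_content d Z \<le> hausdorff1_outer Z + hausdorff1_outer G" using step[OF d] by blast
      have "\<not> 0 < hausdorff1_outer G" using * obt[OF G(2,1) _ d] G(3) by blast
      then show ?thesis using G(4) by simp
    qed
    then have "hausdorff1_content d Z \<le> hausdorff1_outer Z / 2" if "0 < d" for d
      using that by (intro ennreal_doubleD)
    then have "hausdorff1_outer Z \<le> hausdorff1_outer Z / 2" unfolding hausdorff1_outer_le_iff by blast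
    then show False using Z(2,3) by (cases "hausdorff1_outer Z") (auto simp: ennreal_divide_numeral)
  qed
qed

text \<open>Otherwise every small set \<open>C\<close> of a cover would meet \<open>A\<close> in
  measure at most half of its diameter, and a cover of total diameter below \<open>3 / 2\<close> of
  the measure of \<open>A\<close> would contradict subadditivity.\<close>

lemma lower_density:
  fixes A :: "'a::metric_space set"
  assumes A: "0 < hausdorff1_outer A" "hausdorff1_outer A < \<infinity>" and r0: "0 < r0"
  obtains x r where "x \<in> A" "0 < r" "r < r0" "ennreal (r / 4) < hausdorff1_outer (A \<inter> cball x r)"
proof (rule ccontr)
  assume *: "\<not> thesis"
  note obt = that
  have le: "hausdorff1_outer (A \<inter> cball x r) \<le> ennreal (r / 4)" if "x \<in> A" "0 < r" "r < r0" for x r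
  proof (rule ccontr)
    assume "\<not> ?thesis"
    then have thesis using that by (intro obt[of x r]) (simp_all add: not_le)
    then show False using * by blast
  qed
  have piece: "hausdorff1_outer (A \<inter> C) \<le> ediam C / 2" if C: "ediam C \<le> ennreal (r0 / 2)" for C
  proof (cases "\<exists>x y. x \<in> A \<inter> C \<and> y \<in> A \<inter> C \<and> x \<noteq> y")
    case False
    then have "A \<inter> C = {} \<or> (\<exists>x. A \<inter> C = {x})" by blast
    then show ?thesis by (elim disjE exE) simp_all
  next
    case True
    then obtain x y where xy: "x \<in> A" "x \<in> C" "y \<in> C" "x \<noteq> y" by blast
    obtain e where e: "ediam C = ennreal e" "0 \<le> e" "e \<le> r0 / 2" using C r0 by (cases "ediam C") (auto simp: ennreal_le_iff top_unique)
    have dle: "dist x z \<le> e" if "z \<in> C" for z using dist_le_ediam[OF xy(2) that] e by (simp add: ennreal_le_iff)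
    have "0 < e" using dle[OF xy(3)] xy(4) by (metis dist_pos_lt less_le_trans)
    have "hausdorff1_outer (A \<inter> C) \<le> hausdorff1_outer (A \<inter> cball x e)" using dle by (intro hausdorff1_outer_mono) auto
    also have "\<dots> \<le> ennreal (e / 4)" using le[OF xy(1) \<open>0 < e\<close>] e r0 by simp
    also have "\<dots> \<le> ediam C / 2" unfolding e(1) using e(2) by (simp add: ennreal_divide_numeral ennreal_le_iff)
    finally show ?thesis .
  qed
  define a where "a = hausdorff1_outer A"
  have a: "0 < a" "a < \<infinity>" using A by (auto simp: a_def)
  have "a < a + a / 2" using a by (cases a) (auto simp: ennreal_divide_numeral ennreal_less_iff simp flip: ennreal_plus)
  then have "hausdorff1_content (r0 / 2) A < a + a / 2"
    using hausdorff1_content_le_outer[of "r0/2" A] r0 by (auto simp: a_def intro: le_less_trans)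
  then obtain C where C: "A \<subseteq> (\<Union>i. C i)" "\<And>i::nat. ediam (C i) \<le> ennreal (r0 / 2)" "(\<Sum>i. ediam (C i)) < a + a / 2"
    by (rule hausdorff1_content_coverE) blast
  have "a \<le> hausdorff1_outer (\<Union>i. A \<inter> C i)" unfolding a_def using C(1) by (intro hausdorff1_outer_mono) auto
  also have "\<dots> \<le> (\<Sum>i. hausdorff1_outer (A \<inter> C i))" by (rule hausdorff1_outer_subadditive)
  also have "\<dots> \<le> (\<Sum>i. ediam (C i) / 2)" by (intro suminf_le piece C) auto
  also have "\<dots> = (\<Sum>i. ediam (C i)) / 2" by simp
  also have "\<dots> \<le> (a + a / 2) / 2" using C(3) by (intro divide_right_mono_ennreal) simp
  finally show False using a
    by (cases a) (auto simp: ennreal_divide_numeral ennreal_le_iff simp flip: ennreal_plus)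
qed

section \<open>Hausdorff measure restricted to a Borel set\<close>

definition hres :: "'a::metric_space set \<Rightarrow> 'a measure" where "hres K = density hausdorff1 (indicator K)"

lemma sets_hres [simp, measurable_cong]: "sets (hres K) = sets borel" by (simp add: hres_def)
lemma space_hres [simp]: "space (hres K) = UNIV" by (simp add: hres_def)

lemma nn_integral_hres:
  assumes "K \<in> sets borel" "f \<in> borel_measurable borel"
  shows "(\<integral>\<^sup>+x. f x \<partial>hres K) = (\<integral>\<^sup>+x. f x * indicator K x \<partial>hausdorff1)"
  unfolding hres_def using assms
  by (subst nn_integral_density) (auto simp: mult.commute measurable_cong_sets[OF sets_hausdorff1 refl])

lemma nn_integral_hres_mono:
  assumes "K \<in> sets borel" "K' \<in> sets borel" "f \<in> borel_measurable borel" "K \<subseteq> K'"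
  shows "(\<integral>\<^sup>+x. f x \<partial>hres K) \<le> (\<integral>\<^sup>+x. f x \<partial>hres K')"
  unfolding nn_integral_hres[OF assms(1,3)] nn_integral_hres[OF assms(2,3)]
  using assms(4) by (intro nn_integral_mono mult_left_mono) (auto simp: indicator_def)

lemma emeasure_hres: "K \<in> sets borel \<Longrightarrow> A \<in> sets borel \<Longrightarrow> emeasure (hres K) A = hausdorff1_outer (K \<inter> A)"
  unfolding hres_def
  by (subst emeasure_density) (auto simp: emeasure_hausdorff1[symmetric] indicator_inter_arith[symmetric] measurable_cong_sets[OF sets_hausdorff1 refl])

lemma curvature_measure_hres: "K \<in> sets borel \<Longrightarrow> hausdorff1_outer K < \<infinity> \<Longrightarrow> curvature_measure (hres K)"
  by unfold_locales (auto simp: emeasure_hres)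

lemma slsc_crv_int:
  fixes M :: "'a::metric_space measure"
  assumes M: "sets M = sets borel"
  shows "slsc (\<lambda>z2. \<integral>\<^sup>+z3. crv z1 z2 z3 \<partial>M)" "slsc (\<lambda>z1. \<integral>\<^sup>+z3. crv z1 z2 z3 \<partial>M)"
    "slsc (\<lambda>z1. \<integral>\<^sup>+z2. \<integral>\<^sup>+z3. crv z1 z2 z3 \<partial>M \<partial>M)"
proof -
  have m3: "(\<lambda>z3. crv z1 z2 z3) \<in> borel_measurable M" for z1 z2
    using slsc_borel_measurable[OF slsc_crv3[of z1 z2]] measurable_cong_sets[OF M refl] by blast
  show s2: "slsc (\<lambda>z2. \<integral>\<^sup>+z3. crv z1 z2 z3 \<partial>M)" for z1 by (rule slsc_nn_integral[OF m3 slsc_crv2])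
  show s1: "slsc (\<lambda>z1. \<integral>\<^sup>+z3. crv z1 z2 z3 \<partial>M)" for z2 by (rule slsc_nn_integral[OF m3 slsc_crv])
  have m2: "(\<lambda>z2. \<integral>\<^sup>+z3. crv z1 z2 z3 \<partial>M) \<in> borel_measurable M" for z1
    using slsc_borel_measurable[OF s2] measurable_cong_sets[OF M refl] by blast
  show "slsc (\<lambda>z1. \<integral>\<^sup>+z2. \<integral>\<^sup>+z3. crv z1 z2 z3 \<partial>M \<partial>M)" by (rule slsc_nn_integral[OF m2 s1])
qed

lemma beta_hres:
  assumes Z: "Z \<in> sets borel"
  shows "beta Z = (\<integral>\<^sup>+z1. \<integral>\<^sup>+z2. \<integral>\<^sup>+z3. crv z1 z2 z3 \<partial>hres Z \<partial>hres Z \<partial>hres Z)"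
proof -
  note meas = slsc_borel_measurable[OF slsc_crv3] slsc_crv_int[OF sets_hres[of Z], THEN slsc_borel_measurable]
  have 1: "(\<integral>\<^sup>+z3\<in>Z. crv z1 z2 z3 \<partial>hausdorff1) = (\<integral>\<^sup>+z3. crv z1 z2 z3 \<partial>hres Z)" for z1 z2
    by (rule nn_integral_hres[OF Z meas(1), symmetric])
  have 2: "(\<integral>\<^sup>+z2\<in>Z. (\<integral>\<^sup>+z3. crv z1 z2 z3 \<partial>hres Z) \<partial>hausdorff1) = (\<integral>\<^sup>+z2. \<integral>\<^sup>+z3. crv z1 z2 z3 \<partial>hres Z \<partial>hres Z)" for z1
    by (rule nn_integral_hres[OF Z meas(2), symmetric])
  show ?thesis unfolding beta_eq 1 2 by (rule nn_integral_hres[OF Z meas(4), symmetric])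
qed

lemma beta_mono: "A \<in> sets borel \<Longrightarrow> B \<in> sets borel \<Longrightarrow> A \<subseteq> B \<Longrightarrow> beta A \<le> beta B"
  unfolding beta_eq by (intro nn_integral_mono mult_mono nn_set_integral_set_mono) (auto simp: indicator_def)

text \<open>Successive restrictions establish \<open>root_measure\<close>: first to a set with
  bounded upper density, then to points whose curvature integral over a fixed small ball is below
  the threshold, finally to a ball in which this set has definite mass. Shrinking the set only
  decreases the curvature.\<close>

lemma curve_of_positive_measure:
  fixes Z :: "'a::metric_space set"
  assumes Z: "Z \<in> sets borel" "0 < hausdorff1_outer Z" "hausdorff1_outer Z < \<infinity>" and beta: "beta Z < \<infinity>"
  obtains F E and f :: "real \<Rightarrow> 'a" where "closed F" "bounded E" "1-lipschitz_on E f" "f ` E = F" "0 < hausdorff1_outer (Z \<inter> F)"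
proof -
  obtain G d where G: "G \<in> sets borel" "G \<subseteq> Z" "0 < hausdorff1_outer G" and d: "0 < d"
    and dens: "\<And>V. V \<in> sets borel \<Longrightarrow> ediam V \<le> ennreal d \<Longrightarrow> hausdorff1_outer (G \<inter> V) \<le> 2 * ediam V"
    by (rule upper_density[OF Z]) blast
  have Gfin: "hausdorff1_outer G < \<infinity>" using hausdorff1_outer_mono[OF G(2)] Z(3) by (rule le_less_trans)
  define N where "N = hres G"
  interpret curvature_measure N unfolding N_def by (rule curvature_measure_hres[OF G(1) Gfin])
  have hN: "(\<lambda>z. \<integral>\<^sup>+u. h z u \<partial>N) = (\<lambda>z. \<integral>\<^sup>+u. \<integral>\<^sup>+w. crv z u w \<partial>hres G \<partial>hres G)"
    unfolding N_def[symmetric] by (intro ext nn_integral_cong) (rule h_def)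
  define \<phi> where "\<phi> n z = (\<integral>\<^sup>+u. indicator (ball z (1 / (real n + 1))) u * h z u \<partial>N)" for n z
  have meas: "(\<lambda>u. indicator (ball z r) u * h z u) \<in> borel_measurable N" for z r
    by (intro borel_measurable_times_ennreal h_measurable borel_measurable_indicator) (simp add: setsN)
  have slsc: "slsc (\<phi> n)" for n
    unfolding \<phi>_def
  proof (rule slsc_nn_integral[OF meas])
    fix u
    have "(\<lambda>z. indicator (ball z (1 / (real n + 1))) u * h z u) = (\<lambda>z. indicator (ball u (1 / (real n + 1))) z * h z u)"
      by (rule ext) (auto simp: indicator_def dist_commute)
    then show "slsc (\<lambda>z. indicator (ball z (1 / (real n + 1))) u * h z u)"
      by (simp add: slsc_indicator_mult[OF open_ball slsc_h(1)])
  qed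
  define \<eta> where "\<eta> = ennreal (eps0 / 10^10)"
  have \<eta>: "0 < \<eta>" using eps0_pos by (simp add: \<eta>_def)
  define A where "A n = G \<inter> {z. \<phi> n z \<le> \<eta>}" for n
  have A: "A n \<in> sets borel" for n
    unfolding A_def using slsc_borel_measurable[OF slsc[of n]] G(1) by (intro sets.Int) (auto simp: borel_measurable_iff_le)
  have "AE z in N. (\<integral>\<^sup>+u. h z u \<partial>N) \<noteq> \<infinity>"
  proof (rule nn_integral_PInf_AE)
    show "(\<lambda>z. \<integral>\<^sup>+u. h z u \<partial>N) \<in> borel_measurable N"
      unfolding hN using slsc_borel_measurable[OF slsc_crv_int(3)[OF sets_hres[of G]]] measurable_cong_sets[OF setsN refl] by blast
    have "(\<integral>\<^sup>+z. \<integral>\<^sup>+u. h z u \<partial>N \<partial>N) = beta G" unfolding hN unfolding N_def by (rule beta_hres[OF G(1), symmetric])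
    also have "\<dots> \<le> beta Z" by (rule beta_mono[OF G(1) Z(1) G(2)])
    finally show "(\<integral>\<^sup>+z. \<integral>\<^sup>+u. h z u \<partial>N \<partial>N) \<noteq> \<infinity>" using beta by (auto simp: top_unique)
  qed
  then have ae: "AE z in N. \<exists>n. \<phi> n z \<le> \<eta>"
  proof eventually_elim
    case (elim z)
    define g where "g n u = indicator (ball z (1 / (real n + 1))) u * h z u" for n u
    have "(INF n. g n u) = 0" for u
    \<comment> \<open>The balls shrink to \<open>z\<close>, and \<open>h z z = 0\<close> takes care
      of that one point.\<close>
    proof (cases "u = z")
      case False
      then obtain n where "inverse (real (Suc n)) < dist z u" using reals_Archimedean[of "dist z u"] by auto
      then have "g n u = 0" by (simp add: g_def inverse_eq_divide add.commute)
      then have "(INF n. g n u) \<le> 0" by (metis INF_lower UNIV_I)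
      then show ?thesis by simp
    qed (simp add: g_def)
    then have "0 = (\<integral>\<^sup>+u. (INF n. g n u) \<partial>N)" by simp
    also have "\<dots> = (INF n. integral\<^sup>N N (g n))"
    proof (rule nn_integral_monotone_convergence_INF_decseq)
      show "decseq g"
      proof (intro decseq_SucI le_funI)
        fix n u
        have "1 / (real (Suc n) + 1) \<le> 1 / (real n + 1)" by (intro divide_left_mono) auto
        then show "g (Suc n) u \<le> g n u" unfolding g_def by (intro mult_right_mono) (auto simp: indicator_def)
      qed
      show "g i \<in> borel_measurable N" for i unfolding g_def by (rule meas)
      have "integral\<^sup>N N (g 0) \<le> (\<integral>\<^sup>+u. h z u \<partial>N)" unfolding g_def by (intro nn_integral_mono) (auto simp: indicator_def)
      then show "integral\<^sup>N N (g 0) < \<infinity>" using elim by (simp add: less_top le_less_trans)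
    qed
    also have "(\<lambda>n. integral\<^sup>N N (g n)) = (\<lambda>n. \<phi> n z)" unfolding \<phi>_def by (intro ext nn_integral_cong) (rule g_def)
    finally have "(INF n. \<phi> n z) < \<eta>" using \<eta> by simp
    then obtain n where "\<phi> n z < \<eta>" unfolding INF_less_iff by auto
    then show "\<exists>n. \<phi> n z \<le> \<eta>" using less_imp_le by blast
  qed
  have "\<exists>n. emeasure N (A n) \<noteq> 0"
  proof (rule ccontr)
    assume "\<not> ?thesis"
    then have "emeasure N (\<Union>n. A n) = 0" using A by (intro emeasure_UN_eq_0) (auto simp: setsN)
    then have n1: "(\<Union>n. A n) \<in> null_sets N" using A by (intro null_setsI) (auto simp: setsN)
    have "AE z in N. z \<in> G" unfolding N_def hres_def using G(1)
      by (subst AE_density) (auto simp: measurable_cong_sets[OF sets_hausdorff1 refl] indicator_def)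
    with ae AE_not_in[OF n1] have "AE z in N. False" by eventually_elim (auto simp: A_def)
    then have "emeasure N UNIV = 0" by (simp add: AE_iff_measurable[of UNIV] setsN)
    then show False using G by (simp add: N_def emeasure_hres)
  qed
  then obtain n where n: "emeasure N (A n) \<noteq> 0" by blast
  have AG: "A n \<subseteq> G" by (auto simp: A_def)
  have "emeasure N (A n) = hausdorff1_outer (A n)" using A G(1) AG by (simp add: N_def emeasure_hres Int_absorb1)
  then have Apos: "0 < hausdorff1_outer (A n)" using n by (simp add: zero_less_iff_neq_zero)
  have Afin: "hausdorff1_outer (A n) < \<infinity>" using hausdorff1_outer_mono[OF AG] Gfin by (rule le_less_trans)
  \<comment> \<open>\<open>2 * R < 1 / (n + 1)\<close> puts \<open>K\<close> into the ball around
    each of its points for which \<open>\<phi> n\<close> is small, and \<open>R \<le> d / 2\<close>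
    allows the density bound for the ball of radius \<open>R\<close>.\<close>
  define r0 where "r0 = min (d / 2) (1 / (real n + 1) / 2)"
  have r0: "0 < r0" "r0 \<le> d / 2" "r0 \<le> 1 / (real n + 1) / 2" using d by (auto simp: r0_def)
  obtain x R where x: "x \<in> A n" and R: "0 < R" "R < r0" and mass: "ennreal (R / 4) < hausdorff1_outer (A n \<inter> cball x R)"
    by (rule lower_density[OF Apos Afin r0(1)]) blast
  define K where "K = A n \<inter> cball x R"
  have K: "K \<in> sets borel" "K \<subseteq> G" using A AG by (auto simp: K_def)
  have Kfin: "hausdorff1_outer K < \<infinity>" using hausdorff1_outer_mono[OF K(2)] Gfin by (rule le_less_trans)
  interpret K: curvature_measure "hres K" by (rule curvature_measure_hres[OF K(1) Kfin])
  interpret K: root_measure "hres K" K x R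
  proof unfold_locales
    show "0 < R" by fact
    show "K \<subseteq> cball x R" by (auto simp: K_def)
    show "K \<in> sets borel" by fact
    show "emeasure (hres K) (- K) = 0" using K by (simp add: emeasure_hres)
    show "ennreal (R / 4) \<le> emeasure (hres K) K" using mass K(1) by (simp add: emeasure_hres K_def[symmetric])
  next
    fix z r assume zr: "z \<in> K" "0 < (r::real)"
    have small: "hausdorff1_outer (G \<inter> cball y s) \<le> ennreal (4 * s)" if "0 < s" "s \<le> d / 2" for y s
    proof -
      have "ediam (cball y s) \<le> ennreal (2 * s)" using that by (intro ediam_cball) simp
      moreover from this have "ediam (cball y s) \<le> ennreal d" by (rule order_trans) (use that in \<open>simp add: ennreal_leI\<close>)
      then have "hausdorff1_outer (G \<inter> cball y s) \<le> 2 * ediam (cball y s)" by (intro dens) auto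
      ultimately have "hausdorff1_outer (G \<inter> cball y s) \<le> 2 * ennreal (2 * s)" by (meson mult_left_mono order_trans zero_le)
      also have "\<dots> = ennreal (2 * (2 * s))" using that by (subst ennreal_mult) auto
      finally show ?thesis by simp
    qed
    have eq: "emeasure (hres K) (cball z r) = hausdorff1_outer (K \<inter> cball z r)" using K by (simp add: emeasure_hres)
    show "emeasure (hres K) (cball z r) \<le> ennreal (4 * r)"
    proof (cases "r \<le> d / 2")
      case True
      have "hausdorff1_outer (K \<inter> cball z r) \<le> hausdorff1_outer (G \<inter> cball z r)" using K by (intro hausdorff1_outer_mono) auto
      then show ?thesis unfolding eq using small[OF zr(2) True, of z] by (rule order_trans)
    next
      case False
      have "hausdorff1_outer (K \<inter> cball z r) \<le> hausdorff1_outer (G \<inter> cball x R)" using K by (intro hausdorff1_outer_mono) (auto simp: K_def)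
      also have "\<dots> \<le> ennreal (4 * R)" using R r0 by (intro small) auto
      also have "\<dots> \<le> ennreal (4 * r)" using False R r0 by (intro ennreal_leI) auto
      finally show ?thesis unfolding eq .
    qed
  next
    fix u assume u: "u \<in> K"
    have hm: "(\<lambda>z. h u z) \<in> borel_measurable borel" using slsc_borel_measurable[OF slsc_h(2)] .
    have le: "K.h u z \<le> h u z" for z unfolding K.h_def h_def unfolding N_def
      by (rule nn_integral_hres_mono[OF K(1) G(1) slsc_borel_measurable[OF slsc_crv3] K(2)])
    have sub: "K \<subseteq> ball u (1 / (real n + 1))"
    proof
      fix z assume "z \<in> K"
      then have "dist u z \<le> 2 * R" using u dist_triangle3[of u z x] by (auto simp: K_def)
      also have "\<dots> < 1 / (real n + 1)"
      proof -
        have "2 * R < e" if "r0 \<le> e / 2" for e using that R by linarith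
        then show ?thesis using r0(3) .
      qed
      finally show "z \<in> ball u (1 / (real n + 1))" by simp
    qed
    have "(\<integral>\<^sup>+z. K.h u z \<partial>hres K) \<le> (\<integral>\<^sup>+z. h u z \<partial>hres K)" by (intro nn_integral_mono le)
    also have "\<dots> = (\<integral>\<^sup>+z. h u z * indicator K z \<partial>hausdorff1)" by (rule nn_integral_hres[OF K(1) hm])
    also have "\<dots> \<le> (\<integral>\<^sup>+z. indicator (ball u (1 / (real n + 1))) z * h u z * indicator G z \<partial>hausdorff1)"
      using sub K(2) by (intro nn_integral_mono) (auto simp: indicator_def)
    also have "\<dots> = \<phi> n u"
    proof -
      have "(\<lambda>z. indicator (ball u (1 / (real n + 1))) z * h u z) \<in> borel_measurable borel"
        by (intro borel_measurable_times_ennreal hm borel_measurable_indicator) simp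
      from nn_integral_hres[OF G(1) this] show ?thesis by (simp add: \<phi>_def N_def)
    qed
    also have "\<dots> \<le> \<eta>" using u by (auto simp: K_def A_def)
    finally show "(\<integral>\<^sup>+z. K.h u z \<partial>hres K) \<le> ennreal (eps0 / 10^10)" by (simp add: \<eta>_def)
  qed
  show thesis
  proof (rule K.curve_exists, goal_cases)
    case (1 F E f)
    have "emeasure (hres K) F = hausdorff1_outer (K \<inter> F)" using K 1 by (intro emeasure_hres) auto
    also have "\<dots> \<le> hausdorff1_outer (Z \<inter> F)" using K(2) G(2) by (intro hausdorff1_outer_mono) auto
    finally have "0 < hausdorff1_outer (Z \<inter> F)" using 1(5) by (rule less_le_trans[rotated])
    then show ?case using 1 that by blast
  qed
qed

section \<open>Sets covered by Lipschitz images\<close>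

text \<open>Countably many maps instead of one give a notion that is stable under countable unions;
  the maps are joined into one only for the whole space.\<close>

definition lipschitz_covered :: "'a::metric_space set \<Rightarrow> bool" where
  "lipschitz_covered A \<longleftrightarrow> (\<exists>(E :: nat \<Rightarrow> real set) (f :: nat \<Rightarrow> real \<Rightarrow> 'a).
     (\<forall>i. 1-lipschitz_on (E i) (f i)) \<and> hausdorff1_outer (A - (\<Union>i. f i ` E i)) = 0)"

lemma lipschitz_covered_null: "hausdorff1_outer A = 0 \<Longrightarrow> lipschitz_covered A"
  unfolding lipschitz_covered_def by (rule exI[of _ "\<lambda>_. {}"]) (auto simp: lipschitz_on_def)

lemma lipschitz_covered_mono: "lipschitz_covered B \<Longrightarrow> A \<subseteq> B \<Longrightarrow> lipschitz_covered A"
  unfolding lipschitz_covered_def by (metis Diff_mono hausdorff1_outer_mono le_zero_eq order_refl)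

lemma lipschitz_covered_image: "1-lipschitz_on (E :: real set) f \<Longrightarrow> A \<subseteq> f ` E \<Longrightarrow> lipschitz_covered A"
  unfolding lipschitz_covered_def by (intro exI[of _ "\<lambda>_. E"] exI[of _ "\<lambda>_. f"]) (simp add: Diff_eq_empty_iff[THEN iffD2])

lemma lipschitz_covered_UN:
  assumes "\<And>i::nat. lipschitz_covered (A i)" shows "lipschitz_covered (\<Union>i. A i)"
proof -
  have "\<forall>i. \<exists>(E :: nat \<Rightarrow> real set) f. (\<forall>j::nat. 1-lipschitz_on (E j) (f j)) \<and> hausdorff1_outer (A i - (\<Union>j. f j ` E j)) = 0"
    by (intro allI assms[unfolded lipschitz_covered_def])
  from choice[OF this] obtain E :: "nat \<Rightarrow> nat \<Rightarrow> real set" where "\<forall>i. \<exists>f. (\<forall>j::nat. 1-lipschitz_on (E i j) (f j)) \<and> hausdorff1_outer (A i - (\<Union>j. f j ` E i j)) = 0" by blast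
  from choice[OF this] obtain f where Ef: "\<And>i j::nat. 1-lipschitz_on (E i j) (f i j)" "\<And>i. hausdorff1_outer (A i - (\<Union>j::nat. f i j ` E i j)) = 0"
    by blast
  define E' where "E' k = (case prod_decode k of (i, j) \<Rightarrow> E i j)" for k
  define f' where "f' k = (case prod_decode k of (i, j) \<Rightarrow> f i j)" for k
  have "f i j ` E i j \<subseteq> (\<Union>k. f' k ` E' k)" for i j
    using UN_upper[of "prod_encode (i, j)" UNIV "\<lambda>k. f' k ` E' k"] by (simp add: E'_def f'_def)
  then have "(\<Union>j. f i j ` E i j) \<subseteq> (\<Union>k. f' k ` E' k)" for i by (rule UN_least)
  then have "A i - (\<Union>k. f' k ` E' k) \<subseteq> A i - (\<Union>j. f i j ` E i j)" for i by (rule Diff_mono[OF order_refl])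
  then have "(\<Union>i. A i) - (\<Union>k. f' k ` E' k) \<subseteq> (\<Union>i. A i - (\<Union>j. f i j ` E i j))"
    unfolding UN_extend_simps by (rule UN_mono[OF order_refl])
  then have "hausdorff1_outer ((\<Union>i. A i) - (\<Union>k. f' k ` E' k)) \<le> (\<Sum>i. hausdorff1_outer (A i - (\<Union>j. f i j ` E i j)))"
    by (rule order_trans[OF hausdorff1_outer_mono hausdorff1_outer_subadditive])
  moreover have "1-lipschitz_on (E' k) (f' k)" for k using Ef(1) by (simp add: E'_def f'_def split: prod.split)
  ultimately show ?thesis unfolding lipschitz_covered_def using Ef(2) by auto
qed

lemma lipschitz_covered_Un: "lipschitz_covered A \<Longrightarrow> lipschitz_covered B \<Longrightarrow> lipschitz_covered (A \<union> B)"
  using lipschitz_covered_UN[of "binaryset A B"] by (auto simp: UN_binaryset_eq binaryset_def lipschitz_covered_null)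

lemma lipschitz_covered_countable_UN:
  assumes "countable I" "\<And>i. i \<in> I \<Longrightarrow> lipschitz_covered (A i)" shows "lipschitz_covered (\<Union>i\<in>I. A i)"
proof (cases "I = {}")
  case False
  then have "(\<Union>i\<in>I. A i) = (\<Union>n. A (from_nat_into I n))" using assms(1) by (metis image_image range_from_nat_into)
  then show ?thesis using lipschitz_covered_UN assms(2) from_nat_into[OF False] by metis
qed (simp add: lipschitz_covered_null)

text \<open>The pieces, cut to domains of diameter at most one, are placed along the line one after the other
  with gaps longer than the jumps between them.\<close>

lemma rectifiable_spaceI:
  assumes "lipschitz_covered (UNIV :: 'a::metric_space set)" shows "rectifiable_space TYPE('a)"
proof -
  obtain E and f :: "nat \<Rightarrow> real \<Rightarrow> 'a" where Ef: "\<And>i. 1-lipschitz_on (E i) (f i)" "hausdorff1_outer (UNIV - (\<Union>i. f i ` E i)) = 0"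
    using assms unfolding lipschitz_covered_def by blast
  define ind where "ind k = (case prod_decode k of (i, j) \<Rightarrow> (i, real_of_int (int_decode j)))" for k
  define i where "i k = fst (ind k)" for k
  define c where "c k = snd (ind k)" for k
  define B where "B k = {s. 0 \<le> s \<and> s \<le> 1 \<and> c k + s \<in> E (i k)}" for k
  \<comment> \<open>For an empty cell \<open>x k\<close> is an unspecified point. The estimate
    \<open>gap\<close> holds for it as well, so empty cells need no separate treatment.\<close>
  define x where "x k = f (i k) (c k + (SOME s. s \<in> B k))" for k
  \<comment> \<open>The constant 4 covers the two distances of at most 1 to the base points and the
    length 1 of a cell.\<close>
  define p where "p k = (\<Sum>j<k. 4 + dist (x j) (x (Suc j)))" for k
  define S where "S = (\<Union>k. (\<lambda>s. p k + s) ` B k)"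
  have gap: "4 + dist (x j) (x k) \<le> p k - p j" if "j < k" for j k
    using that
  proof (induction k)
    case (Suc k)
    have pk: "p (Suc k) = p k + (4 + dist (x k) (x (Suc k)))" by (simp add: p_def)
    show ?case
    proof (cases "j = k")
      case False
      then have "4 + dist (x j) (x k) \<le> p k - p j" using Suc by simp
      then show ?thesis using pk dist_triangle[of "x j" "x (Suc k)" "x k"] by linarith
    qed (use pk in simp)
  qed simp
  have xB: "dist (f (i k) (c k + s)) (x k) \<le> 1" if "s \<in> B k" for k s
  proof -
    define s' where "s' = (SOME s. s \<in> B k)"
    have s': "s' \<in> B k" unfolding s'_def by (rule someI_ex) (use that in blast)
    have "dist (f (i k) (c k + s)) (f (i k) (c k + s')) \<le> 1 * dist (c k + s) (c k + s')"
      by (rule lipschitz_onD[OF Ef(1)]) (use that s' in \<open>auto simp: B_def\<close>)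
    also have "\<dots> \<le> 1" using that s' by (auto simp: B_def dist_real_def)
    finally show ?thesis by (simp add: x_def s'_def)
  qed
  have far: "dist (f (i j) (c j + s)) (f (i k) (c k + t)) \<le> \<bar>(p j + s) - (p k + t)\<bar> \<and> p j + s < p k + t"
    if "j < k" "s \<in> B j" "t \<in> B k" for j k s t
  proof -
    have "dist (f (i j) (c j + s)) (f (i k) (c k + t)) \<le> dist (f (i j) (c j + s)) (x j) + dist (x j) (x k) + dist (x k) (f (i k) (c k + t))"
      using dist_triangle[of "f (i j) (c j + s)" "f (i k) (c k + t)" "x j"] dist_triangle[of "x j" "f (i k) (c k + t)" "x k"] by linarith
    then have "dist (f (i j) (c j + s)) (f (i k) (c k + t)) \<le> 2 + dist (x j) (x k)"
      using xB[OF that(2)] xB[OF that(3)] by (simp add: dist_commute)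
    moreover have "s \<le> 1" "0 \<le> t" using that by (auto simp: B_def)
    ultimately show ?thesis using gap[OF that(1)] zero_le_dist[of "x j" "x k"] by linarith
  qed
  define F where "F r = (let (k, s) = (SOME (k, s). s \<in> B k \<and> r = p k + s) in f (i k) (c k + s))" for r
  have F: "F (p k + s) = f (i k) (c k + s)" if "s \<in> B k" for k s
  proof -
    have "(SOME (k', s'). s' \<in> B k' \<and> p k + s = p k' + s') = (k, s)"
    proof (rule some_equality)
      fix y assume y: "case y of (k', s') \<Rightarrow> s' \<in> B k' \<and> p k + s = p k' + s'"
      obtain k' s' where ks: "y = (k', s')" by (cases y)
      have "k' = k"
      proof (rule ccontr)
        assume "k' \<noteq> k"
        then show False using far[of k k' s s'] far[of k' k s' s] y ks that by (cases "k < k'") auto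
      qed
      then show "y = (k, s)" using y ks by simp
    qed (use that in simp)
    then show ?thesis by (simp add: F_def)
  qed
  have "1-lipschitz_on S F"
  proof (rule lipschitz_onI)
    fix r r' assume "r \<in> S" "r' \<in> S"
    then obtain j s k t where r: "r = p j + s" "s \<in> B j" "r' = p k + t" "t \<in> B k" by (auto simp: S_def)
    consider "j < k" | "k < j" | "j = k" by linarith
    then show "dist (F r) (F r') \<le> 1 * dist r r'"
    proof cases
      case 1
      show ?thesis using far[OF 1 r(2,4), THEN conjunct1] r(2,4) unfolding r(1,3) by (simp add: F dist_real_def)
    next
      case 2
      show ?thesis using far[OF 2 r(4,2), THEN conjunct1] r(2,4) unfolding r(1,3) by (simp add: F dist_real_def dist_commute abs_minus_commute)
    next
      case 3
      have "dist (f (i k) (c k + s)) (f (i k) (c k + t)) \<le> 1 * dist (c k + s) (c k + t)"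
        by (rule lipschitz_onD[OF Ef(1)]) (use r 3 in \<open>auto simp: B_def\<close>)
      then show ?thesis using r 3 by (simp add: F dist_real_def)
    qed
  qed simp
  moreover have "f m ` E m \<subseteq> F ` S" for m
  proof
    fix y assume "y \<in> f m ` E m"
    then obtain t where t: "t \<in> E m" "y = f m t" by blast
    define k where "k = prod_encode (m, int_encode \<lfloor>t\<rfloor>)"
    have k: "i k = m" "c k = of_int \<lfloor>t\<rfloor>" by (simp_all add: k_def i_def c_def ind_def)
    have s: "t - of_int \<lfloor>t\<rfloor> \<in> B k" using t k by (auto simp: B_def) linarith
    then have "F (p k + (t - of_int \<lfloor>t\<rfloor>)) = y" using F[OF s] k t by simp
    moreover have "p k + (t - of_int \<lfloor>t\<rfloor>) \<in> S" using s by (auto simp: S_def)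
    ultimately show "y \<in> F ` S" by blast
  qed
  then have "UNIV - F ` S \<subseteq> UNIV - (\<Union>i. f i ` E i)" by blast
  then have "hausdorff1_outer (UNIV - F ` S) = 0" using Ef(2) hausdorff1_outer_mono by (metis le_zero_eq)
  ultimately show ?thesis unfolding rectifiable_space_def by blast
qed

text \<open>The complement of a maximal covered Borel subset has finite measure and finite
  \<open>beta\<close>; if it had positive measure, \<open>curve_of_positive_measure\<close> would
  produce a further covered piece.\<close>

lemma lipschitz_covered_finite:
  fixes Z :: "'a::metric_space set"
  assumes Z: "Z \<in> sets borel" "hausdorff1_outer Z < \<infinity>" "beta Z < \<infinity>"
  shows "lipschitz_covered Z"
proof -
  define \<C> where "\<C> = {B \<in> sets borel. B \<subseteq> Z \<and> lipschitz_covered B}"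
  obtain B where B: "B \<in> \<C>" "\<And>C. C \<in> \<C> \<Longrightarrow> C \<inter> B = {} \<Longrightarrow> emeasure hausdorff1 C = 0"
  proof (rule measure_exhaustion[of \<C> hausdorff1 "hausdorff1_outer Z"])
    show "{} \<in> \<C>" by (simp add: \<C>_def lipschitz_covered_null)
    show "\<C> \<subseteq> sets hausdorff1" by (auto simp: \<C>_def)
    show "emeasure hausdorff1 C \<le> hausdorff1_outer Z" if "C \<in> \<C>" for C
      using that by (auto simp: \<C>_def emeasure_hausdorff1 intro: hausdorff1_outer_mono)
    show "(\<Union>i. A i) \<in> \<C>" if "\<And>i. A i \<in> \<C>" for A :: "nat \<Rightarrow> 'a set"
      using that lipschitz_covered_UN[of A] by (auto simp: \<C>_def)
  qed (use Z in auto)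
  have B': "B \<in> sets borel" "B \<subseteq> Z" "lipschitz_covered B" using B(1) by (auto simp: \<C>_def)
  have ZB: "Z - B \<in> sets borel" using Z B' by blast
  have "hausdorff1_outer (Z - B) = 0"
  proof (rule ccontr)
    assume "hausdorff1_outer (Z - B) \<noteq> 0"
    then have pos: "0 < hausdorff1_outer (Z - B)" by (simp add: zero_less_iff_neq_zero)
    have fin: "hausdorff1_outer (Z - B) < \<infinity>" using hausdorff1_outer_mono[of "Z - B" Z] Z(2) by (auto intro: le_less_trans)
    have "beta (Z - B) < \<infinity>" using beta_mono[OF ZB Z(1)] Z(3) by (auto intro: le_less_trans)
    then obtain F E and f :: "real \<Rightarrow> 'a" where F: "closed F" "1-lipschitz_on E f" "f ` E = F" "0 < hausdorff1_outer ((Z - B) \<inter> F)"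
      by (rule curve_of_positive_measure[OF ZB pos fin]) blast
    have bor: "(Z - B) \<inter> F \<in> sets borel" by (rule sets.Int[OF ZB borel_closed[OF F(1)]])
    have "lipschitz_covered ((Z - B) \<inter> F)" using F by (intro lipschitz_covered_image[of E f]) auto
    then have "(Z - B) \<inter> F \<in> \<C>" using bor by (auto simp: \<C>_def)
    then have "emeasure hausdorff1 ((Z - B) \<inter> F) = 0" by (intro B) auto
    then show False using F(4) bor by (simp add: emeasure_hausdorff1)
  qed
  then have "lipschitz_covered (B \<union> (Z - B))" by (intro lipschitz_covered_Un B' lipschitz_covered_null)
  then show ?thesis by (rule lipschitz_covered_mono) blast
qed

section \<open>Points of vanishing curvature\<close>

lemma crv_eq_0D:
  assumes "crv p z w = 0"
  shows "dist z w = \<bar>dist p z - dist p w\<bar> \<or> dist z w = dist p z + dist p w"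
proof (cases "p = z \<or> p = w \<or> z = w")
  case False
  then have "0 < diameter {p, z, w}" by (auto simp: diameter_triple less_max_iff_disj)
  moreover have "triangle_excess p z w / diameter {p, z, w} ^ 3 \<le> 0" using assms by (simp add: crv_def ennreal_eq_0_iff)
  ultimately have "triangle_excess p z w \<le> 0" by (simp add: divide_le_0_iff)
  then show ?thesis unfolding triangle_excess_eq
    using dist_triangle[of p z w] dist_triangle2[of p w z] dist_triangle3[of z w p] by (auto simp: dist_commute abs_real_def min_le_iff_disj)
qed (auto simp: dist_commute)

lemma hres_AE_null:
  assumes "A \<in> sets borel" "AE w in hres A. P w"
  obtains N where "hausdorff1_outer (A \<inter> N) = 0" "\<And>w. w \<in> A \<Longrightarrow> w \<notin> N \<Longrightarrow> P w"
proof -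
  obtain N where N: "{w \<in> space (hres A). \<not> P w} \<subseteq> N" "N \<in> null_sets (hres A)"
    using assms(2) unfolding eventually_ae_filter by blast
  then have "hausdorff1_outer (A \<inter> N) = 0" using emeasure_hres[OF assms(1), of N] by (auto simp: null_sets_def)
  then show thesis using that N(1) by auto
qed

text \<open>Two points that are isometric to almost every \<open>w\<close> are compared through one
  \<open>w\<close> that serves both and whose level is close to that of the first. The points whose
  level has a null neighbourhood in \<open>A\<close> lack such a \<open>w\<close> and are
  removed.\<close>

lemma lipschitz_covered_ae_isometric:
  fixes A :: "'a::metric_space set" and g :: "'a \<Rightarrow> real"
  assumes A: "A \<in> sets borel" and g: "g \<in> borel_measurable borel"
    and iso: "AE z in hres A. AE w in hres A. dist z w = \<bar>g z - g w\<bar>"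
  shows "lipschitz_covered A"
proof -
  obtain N1 where N1: "hausdorff1_outer (A \<inter> N1) = 0" "\<And>z. z \<in> A \<Longrightarrow> z \<notin> N1 \<Longrightarrow> AE w in hres A. dist z w = \<bar>g z - g w\<bar>"
    by (rule hres_AE_null[OF A iso]) blast
  \<comment> \<open>Rational end points keep the family of null slabs countable, so their union is
    covered.\<close>
  define I where "I = {(a, b). a \<in> \<rat> \<and> b \<in> \<rat> \<and> hausdorff1_outer (A \<inter> {w. a < g w \<and> g w < b}) = 0}"
  have cI: "countable I" by (rule countable_subset[of _ "\<rat> \<times> \<rat>"]) (auto simp: I_def countable_rat)
  define N2 where "N2 = (\<Union>(a, b)\<in>I. A \<inter> {w. a < g w \<and> g w < b})"
  have N2: "lipschitz_covered N2" unfolding N2_def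
    by (rule lipschitz_covered_countable_UN[OF cI]) (auto simp: I_def intro!: lipschitz_covered_null)
  define B where "B = A - N1 - N2"
  have near: "\<exists>w. \<bar>g z - g w\<bar> < e \<and> dist z w = \<bar>g z - g w\<bar> \<and> dist z' w = \<bar>g z' - g w\<bar>" if zz: "z \<in> B" "z' \<in> B" "0 < e" for z z' e
  proof (rule ccontr)
    assume no: "\<not> ?thesis"
    obtain a where a: "a \<in> \<rat>" "g z - e < a" "a < g z" using Rats_dense_in_real[of "g z - e" "g z"] zz(3) by force
    obtain b where b: "b \<in> \<rat>" "g z < b" "b < g z + e" using Rats_dense_in_real[of "g z" "g z + e"] zz(3) by force
    have zB: "z \<in> A" "z \<notin> N1" "z' \<in> A" "z' \<notin> N1" using zz by (auto simp: B_def)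
    have "AE w in hres A. \<not> (a < g w \<and> g w < b)"
      using N1(2)[OF zB(1,2)] N1(2)[OF zB(3,4)]
    proof eventually_elim
      case (elim w)
      show ?case
      proof
        assume "a < g w \<and> g w < b"
        then have "\<bar>g z - g w\<bar> < e" using a b by (simp add: abs_less_iff)
        then show False using no elim by blast
      qed
    qed
    then obtain N3 where N3: "hausdorff1_outer (A \<inter> N3) = 0" "\<And>w. w \<in> A \<Longrightarrow> w \<notin> N3 \<Longrightarrow> \<not> (a < g w \<and> g w < b)"
      by (rule hres_AE_null[OF A]) blast
    have "A \<inter> {w. a < g w \<and> g w < b} \<subseteq> A \<inter> N3" using N3(2) by blast
    from hausdorff1_outer_mono[OF this] have "(a, b) \<in> I" using N3(1) a b by (simp add: I_def)
    then have "z \<in> N2" unfolding N2_def using a b zB by blast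
    then show False using zz by (simp add: B_def)
  qed
  have isoB: "dist z z' \<le> \<bar>g z - g z'\<bar>" if "z \<in> B" "z' \<in> B" for z z'
  proof (rule field_le_epsilon)
    fix e :: real assume "0 < e"
    then have "0 < e / 2" by simp
    from near[OF that this] obtain w where w: "\<bar>g z - g w\<bar> < e / 2" "dist z w = \<bar>g z - g w\<bar>" "dist z' w = \<bar>g z' - g w\<bar>"
      by blast
    then show "dist z z' \<le> \<bar>g z - g z'\<bar> + e" using dist_triangle2[of z z' w] by linarith
  qed
  have inj: "inj_on g B"
  proof (rule inj_onI)
    fix z z' assume "z \<in> B" "z' \<in> B" "g z = g z'"
    then show "z = z'" using isoB[of z z'] by simp
  qed
  have "lipschitz_covered B"
  proof (rule lipschitz_covered_image)
    show "1-lipschitz_on (g ` B) (inv_into B g)"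
      by (rule lipschitz_onI) (auto simp: inv_into_f_f[OF inj] dist_real_def isoB)
    show "B \<subseteq> inv_into B g ` g ` B" by (force simp: inv_into_f_f[OF inj])
  qed
  then have "lipschitz_covered (B \<union> (A \<inter> N1 \<union> N2))" by (intro lipschitz_covered_Un N2 lipschitz_covered_null[OF N1(1)])
  then show ?thesis by (rule lipschitz_covered_mono) (auto simp: B_def)
qed

definition curv :: "'a::metric_space set \<Rightarrow> 'a \<Rightarrow> ennreal" where
  "curv Z p = (\<integral>\<^sup>+z. \<integral>\<^sup>+w. crv p z w \<partial>hres Z \<partial>hres Z)"

lemma curv_measurable: "curv Z \<in> borel_measurable borel"
  unfolding curv_def by (rule slsc_borel_measurable[OF slsc_crv_int(3)]) simp

lemma curv_0_AE:
  assumes "Z \<in> sets borel" "B \<in> sets borel" "B \<subseteq> Z" "curv Z p = 0"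
  shows "AE z in hres B. AE w in hres B. crv p z w = 0"
proof -
  have m3: "(\<lambda>w. crv p z w) \<in> borel_measurable borel" for z by (rule slsc_borel_measurable[OF slsc_crv3])
  have m2: "(\<lambda>z. \<integral>\<^sup>+w. crv p z w \<partial>hres B) \<in> borel_measurable borel" by (rule slsc_borel_measurable[OF slsc_crv_int(1)]) simp
  have "(\<integral>\<^sup>+z. \<integral>\<^sup>+w. crv p z w \<partial>hres B \<partial>hres B) \<le> (\<integral>\<^sup>+z. \<integral>\<^sup>+w. crv p z w \<partial>hres B \<partial>hres Z)"
    by (rule nn_integral_hres_mono[OF assms(2,1) m2 assms(3)])
  also have "\<dots> \<le> curv Z p" unfolding curv_def
    by (intro nn_integral_mono nn_integral_hres_mono[OF assms(2,1) m3 assms(3)])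
  finally have "(\<integral>\<^sup>+z. \<integral>\<^sup>+w. crv p z w \<partial>hres B \<partial>hres B) = 0" using assms(4) by simp
  then have "AE z in hres B. (\<integral>\<^sup>+w. crv p z w \<partial>hres B) = 0"
    using m2 by (subst (asm) nn_integral_0_iff_AE) (auto simp: measurable_cong_sets[OF sets_hres refl])
  then show ?thesis
    by eventually_elim (use m3 in \<open>subst (asm) nn_integral_0_iff_AE, auto simp: measurable_cong_sets[OF sets_hres refl]\<close>)
qed

text \<open>Zero excess leaves two possibilities for the distance of two points seen from
  \<open>p\<close>: the difference or the sum of their distances to \<open>p\<close>. In a thin
  shell these are separated by a gap. Around \<open>q\<close> only the difference occurs, with base
  point \<open>p\<close>; on the far side the same is true with base point \<open>q\<close>.\<close>

lemma lipschitz_covered_slab: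
  fixes A :: "'a::metric_space set"
  assumes Z: "Z \<in> sets borel" and A: "A \<in> sets borel" "A \<subseteq> Z" and flat: "\<And>z. z \<in> A \<Longrightarrow> curv Z z = 0" and p: "curv Z p = 0"
    and slab: "\<And>z. z \<in> A \<Longrightarrow> a < dist p z" "\<And>z. z \<in> A \<Longrightarrow> dist p z \<le> 9 / 8 * a" and a: "0 < a"
  shows "lipschitz_covered A"
proof (cases "\<exists>q\<in>A. AE w in hres A. crv p q w = 0")
  case False
  obtain N where N: "hausdorff1_outer (A \<inter> N) = 0" "\<And>z. z \<in> A \<Longrightarrow> z \<notin> N \<Longrightarrow> AE w in hres A. crv p z w = 0"
    by (rule hres_AE_null[OF A(1) curv_0_AE[OF Z A p]]) blast
  then have "A = A \<inter> N" using False by blast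
  then show ?thesis using N(1) by (metis lipschitz_covered_null)
next
  case True
  then obtain q where q: "q \<in> A" "AE w in hres A. crv p q w = 0" by blast
  obtain N where N: "hausdorff1_outer (A \<inter> N) = 0" "\<And>w. w \<in> A \<Longrightarrow> w \<notin> N \<Longrightarrow> crv p q w = 0"
    by (rule hres_AE_null[OF A(1) q(2)]) blast
  \<comment> \<open>In the shell a difference of distances is at most \<open>a / 8\<close> and a sum
    exceeds \<open>2 * a\<close>, so these two parts exhaust \<open>A\<close> up to the null set
    \<open>N\<close>.\<close>
  define A1 where "A1 = A \<inter> cball q (a / 8)"
  define A2 where "A2 = A \<inter> {w. 2 * a \<le> dist q w}"
  have A12: "A1 \<in> sets borel" "A2 \<in> sets borel" unfolding A1_def A2_def
    by (rule sets.Int[OF A(1) borel_closed], intro closed_cball closed_Collect_le continuous_intros)+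
  have sub: "A1 \<subseteq> Z" "A2 \<subseteq> Z" using A by (auto simp: A1_def A2_def)
  have inA: "AE w in hres B. w \<in> B" if "B \<in> sets borel" for B :: "'a set"
    unfolding hres_def using that by (subst AE_density) (auto simp: measurable_cong_sets[OF sets_hausdorff1 refl] indicator_def)
  have c1: "lipschitz_covered A1"
  proof (rule lipschitz_covered_ae_isometric[OF A12(1)])
    show "dist p \<in> borel_measurable borel" by (intro borel_measurable_continuous_onI continuous_intros)
    show "AE z in hres A1. AE w in hres A1. dist z w = \<bar>dist p z - dist p w\<bar>"
      using curv_0_AE[OF Z A12(1) sub(1) p] inA[OF A12(1)]
    proof eventually_elim
      case (elim z)
      note z = elim
      show ?case using z(1) inA[OF A12(1)]
      proof eventually_elim
        case (elim w)
        have "dist q z \<le> a / 8" "dist q w \<le> a / 8" "a < dist p z" "a < dist p w" using z(2) elim(2) slab by (auto simp: A1_def)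
        then have "dist z w \<noteq> dist p z + dist p w" using dist_triangle3[of z w q] a by linarith
        then show ?case using crv_eq_0D[OF elim(1)] by blast
      qed
    qed
  qed
  have c2: "lipschitz_covered A2"
  proof (rule lipschitz_covered_ae_isometric[OF A12(2)])
    show "dist q \<in> borel_measurable borel" by (intro borel_measurable_continuous_onI continuous_intros)
    show "AE z in hres A2. AE w in hres A2. dist z w = \<bar>dist q z - dist q w\<bar>"
      using curv_0_AE[OF Z A12(2) sub(2) flat[OF q(1)]] inA[OF A12(2)]
    proof eventually_elim
      case (elim z)
      note z = elim
      show ?case using z(1) inA[OF A12(2)]
      proof eventually_elim
        case (elim w)
        have "2 * a \<le> dist q z" "2 * a \<le> dist q w" "dist p z \<le> 9 / 8 * a" "dist p w \<le> 9 / 8 * a" using z(2) elim(2) slab by (auto simp: A2_def)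
        then have "dist z w \<noteq> dist q z + dist q w" using dist_triangle3[of z w p] a by linarith
        then show ?case using crv_eq_0D[OF elim(1)] by blast
      qed
    qed
  qed
  have "lipschitz_covered (A1 \<union> A2 \<union> (A \<inter> N))" by (intro lipschitz_covered_Un c1 c2 lipschitz_covered_null[OF N(1)])
  moreover have "w \<in> A1 \<union> A2" if w: "w \<in> A" "w \<notin> N" for w
    using crv_eq_0D[OF N(2)[OF w]] slab[OF w(1)] slab[OF q(1)] w(1) by (auto simp: A1_def A2_def abs_real_def)
  then have "A \<subseteq> A1 \<union> A2 \<union> (A \<inter> N)" by blast
  ultimately show ?thesis by (rule lipschitz_covered_mono)
qed

theorem lipschitz_covered_beta:
  fixes Z :: "'a::metric_space set"
  assumes Z: "Z \<in> sets borel" and beta: "beta Z < \<infinity>"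
  shows "lipschitz_covered Z"
proof -
  define Zp where "Zp n = Z \<inter> {z. ennreal (1 / (real n + 1)) \<le> curv Z z}" for n
  define Z0 where "Z0 = Z \<inter> {z. curv Z z = 0}"
  have Zp: "Zp n \<in> sets borel" for n unfolding Zp_def using Z curv_measurable[of Z] by (intro sets.Int) (auto simp: borel_measurable_iff_ge)
  have Z0: "Z0 \<in> sets borel"
  proof -
    have "{z. curv Z z = 0} = {z. curv Z z \<le> 0}" by auto
    then show ?thesis unfolding Z0_def using Z curv_measurable[of Z] by (intro sets.Int) (auto simp: borel_measurable_iff_le)
  qed
  have "lipschitz_covered (Zp n)" for n
  proof (rule lipschitz_covered_finite[OF Zp])
    have sub: "Zp n \<subseteq> Z" by (auto simp: Zp_def)
    show "beta (Zp n) < \<infinity>" using beta_mono[OF Zp Z sub] beta by (rule le_less_trans)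
    have c: "0 < 1 / (real n + 1)" by simp
    \<comment> \<open>Markov's inequality for the curvature integral, with total integral
      \<open>beta Z\<close>.\<close>
    have "ennreal (1 / (real n + 1)) * hausdorff1_outer (Zp n) = (\<integral>\<^sup>+z. ennreal (1 / (real n + 1)) * indicator (Zp n) z \<partial>hausdorff1)"
      using Zp[of n] by (subst nn_integral_cmult_indicator) (auto simp: emeasure_hausdorff1)
    also have "\<dots> \<le> (\<integral>\<^sup>+z. curv Z z * indicator Z z \<partial>hausdorff1)"
      by (intro nn_integral_mono) (auto simp: Zp_def indicator_def)
    also have "\<dots> = (\<integral>\<^sup>+z. curv Z z \<partial>hres Z)" by (rule nn_integral_hres[OF Z curv_measurable, symmetric])
    also have "\<dots> = beta Z" unfolding beta_hres[OF Z] curv_def ..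
    finally have "ennreal (1 / (real n + 1)) * hausdorff1_outer (Zp n) < \<infinity>" using beta by (rule le_less_trans)
    then show "hausdorff1_outer (Zp n) < \<infinity>" using c by (auto simp: ennreal_mult_less_top ennreal_eq_0_iff)
  qed
  then have "lipschitz_covered (\<Union>n. Zp n)" by (rule lipschitz_covered_UN)
  moreover have "lipschitz_covered Z0"
  proof (cases "Z0 = {}")
    case False
    then obtain p where p: "p \<in> Z0" by blast
    \<comment> \<open>Shells around one flat point with the ratio \<open>9 / 8\<close> of
      \<open>lipschitz_covered_slab\<close>; only the centre is left over.\<close>
    define A where "A k = Z0 \<inter> {z. (9/8) powi k < dist p z \<and> dist p z \<le> 9 / 8 * (9/8) powi k}" for k :: int
    have "lipschitz_covered (A k)" for k
    proof (rule lipschitz_covered_slab[OF Z])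
      show "A k \<in> sets borel" unfolding A_def using Z0
        unfolding Collect_conj_eq
        by (intro sets.Int[OF Z0] sets.Int borel_open borel_closed open_Collect_less closed_Collect_le continuous_intros)
    qed (use p in \<open>auto simp: A_def Z0_def\<close>)
    then have "lipschitz_covered ((\<Union>k. A k) \<union> {p})"
      by (intro lipschitz_covered_Un lipschitz_covered_countable_UN lipschitz_covered_null[of "{p}"]) auto
    moreover have "Z0 \<subseteq> (\<Union>k. A k) \<union> {p}"
    proof
      fix z assume z: "z \<in> Z0"
      show "z \<in> (\<Union>k. A k) \<union> {p}"
      proof (cases "z = p")
        case False
        define k where "k = \<lceil>log (9/8) (dist p z)\<rceil> - 1"
        have pos: "0 < dist p z" using False by simp
        have "of_int k < log (9/8) (dist p z)" "log (9/8) (dist p z) \<le> of_int (k + 1)" unfolding k_def by linarith+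
        then have "(9/8) powr (of_int k) < dist p z" "dist p z \<le> (9/8) powr (of_int (k + 1))"
          using pos by (simp_all add: less_log_iff log_le_iff)
        then have "(9/8) powi k < dist p z" "dist p z \<le> 9 / 8 * (9/8) powi k"
          by (simp_all add: powr_real_of_int' power_int_add powr_add)
        then show ?thesis using z by (auto simp: A_def)
      qed simp
    qed
    ultimately show ?thesis by (rule lipschitz_covered_mono)
  qed (simp add: lipschitz_covered_null)
  ultimately have "lipschitz_covered ((\<Union>n. Zp n) \<union> Z0)" by (rule lipschitz_covered_Un)
  moreover have "Z \<subseteq> (\<Union>n. Zp n) \<union> Z0"
  proof
    fix z assume z: "z \<in> Z"
    show "z \<in> (\<Union>n. Zp n) \<union> Z0"
    proof (cases "curv Z z = 0")
      case False
      obtain n where "ennreal (1 / (real n + 1)) \<le> curv Z z"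
      proof (cases "curv Z z")
        case (real r)
        then have "0 < r" using False by (auto simp: less_le)
        then obtain n where "inverse (real (Suc n)) < r" using reals_Archimedean by blast
        then show ?thesis using that[of n] real by (simp add: ennreal_leI inverse_eq_divide add.commute)
      qed simp
      then show ?thesis using z by (auto simp: Zp_def)
    qed (use z in \<open>simp add: Z0_def\<close>)
  qed
  ultimately show ?thesis by (rule lipschitz_covered_mono)
qed

section \<open>Lipschitz images of subsets of the line\<close>

lemma ediam_le: "(\<And>x y. x \<in> S \<Longrightarrow> y \<in> S \<Longrightarrow> dist x y \<le> d) \<Longrightarrow> ediam S \<le> ennreal d"
  unfolding ediam_def by (intro SUP_least ennreal_leI)

lemma hausdorff1_lipschitz_interval:
  fixes f :: "real \<Rightarrow> 'a::metric_space"
  assumes f: "L-lipschitz_on E f" and ab: "a \<le> b"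
  shows "hausdorff1_outer (f ` (E \<inter> {a..b})) \<le> ennreal (L * (b - a))"
  unfolding hausdorff1_outer_le_iff
proof (intro allI impI)
  fix d :: real assume d: "0 < d"
  have L: "0 \<le> L" using f by (rule lipschitz_on_nonneg)
  define \<eta> where "\<eta> = d / (L + 1)"
  have \<eta>: "0 < \<eta>" using d L by (simp add: \<eta>_def)
  have L\<eta>: "L * \<eta> \<le> d" using d L by (simp add: \<eta>_def field_simps)
  have small: "hausdorff1_content d (f ` (E \<inter> {a..b})) \<le> ennreal (L * (b - a))" if "a \<le> b" "b - a \<le> \<eta>" for a b
  proof -
    have "ediam (f ` (E \<inter> {a..b})) \<le> ennreal (L * (b - a))"
    proof (rule ediam_le, elim imageE)
      fix x y u v assume uv: "x = f u" "u \<in> E \<inter> {a..b}" "y = f v" "v \<in> E \<inter> {a..b}"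
      then have "dist x y \<le> L * dist u v" using lipschitz_onD[OF f, of u v] by simp
      also have "\<dots> \<le> L * (b - a)" using uv by (intro mult_left_mono L) (auto simp: dist_real_def)
      finally show "dist x y \<le> L * (b - a)" .
    qed
    moreover have "L * (b - a) \<le> d" using mult_left_mono[OF that(2) L] L\<eta> by linarith
    ultimately have "ediam (f ` (E \<inter> {a..b})) \<le> ennreal d" by (meson ennreal_leI order_trans)
    then have "hausdorff1_content d (f ` (E \<inter> {a..b})) \<le> ediam (f ` (E \<inter> {a..b}))" by (rule hausdorff1_content_le_ediam) simp
    then show ?thesis using \<open>ediam _ \<le> ennreal (L * (b - a))\<close> by (rule order_trans)
  qed
  have "hausdorff1_content d (f ` (E \<inter> {a..b})) \<le> ennreal (L * (b - a))" if "a \<le> b" "b - a \<le> real n * \<eta>" for a b n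
    using that
  proof (induction n arbitrary: a)
    case 0
    then have "b - a \<le> \<eta>" using \<eta> by simp
    then show ?case by (rule small[OF 0(1)])
  next
    case (Suc n)
    show ?case
    proof (cases "b - a \<le> \<eta>")
      case True
      then show ?thesis using small Suc.prems by blast
    next
      case False
      define c where "c = a + \<eta>"
      have c: "a \<le> c" "c \<le> b" "c - a \<le> \<eta>" using False \<eta> by (auto simp: c_def)
      have "f ` (E \<inter> {a..b}) = f ` (E \<inter> {a..c}) \<union> f ` (E \<inter> {c..b})" using c by (auto simp: image_Un[symmetric] Int_Un_distrib[symmetric] ivl_disj_un)
      then have "hausdorff1_content d (f ` (E \<inter> {a..b})) \<le> hausdorff1_content d (f ` (E \<inter> {a..c})) + hausdorff1_content d (f ` (E \<inter> {c..b}))"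
        using hausdorff1_content_Un by metis
      also have "\<dots> \<le> ennreal (L * (c - a)) + ennreal (L * (b - c))"
      proof (rule add_mono[OF small Suc.IH])
        show "b - c \<le> real n * \<eta>" using Suc.prems(2) by (simp add: c_def distrib_right)
      qed (use c in auto)
      also have "\<dots> = ennreal (L * (c - a) + L * (b - c))" using L c by (intro ennreal_plus[symmetric] mult_nonneg_nonneg) auto
      also have "L * (c - a) + L * (b - c) = L * (b - a)" by (simp add: right_diff_distrib)
      finally show ?thesis .
    qed
  qed
  moreover obtain n where "b - a \<le> real n * \<eta>" using reals_Archimedean3[OF \<eta>] less_imp_le by blast
  ultimately show "hausdorff1_content d (f ` (E \<inter> {a..b})) \<le> ennreal (L * (b - a))" using ab by blast
qed

lemma hausdorff1_lipschitz_le: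
  fixes f :: "real \<Rightarrow> 'a::metric_space"
  assumes f: "L-lipschitz_on E f" and S: "S \<in> lmeasurable" "S \<subseteq> cbox a b"
  shows "hausdorff1_outer (f ` (E \<inter> S)) \<le> ennreal (L * measure lebesgue S)"
proof (rule ennreal_le_epsilon)
  have L: "0 \<le> L" using f by (rule lipschitz_on_nonneg)
  fix e :: real assume e: "0 < e"
  define e' where "e' = e / (L + 1)"
  have e': "0 < e'" "L * e' \<le> e" using e L by (simp_all add: e'_def field_simps)
  obtain \<D> where \<D>: "countable \<D>" "\<And>K. K \<in> \<D> \<Longrightarrow> K \<subseteq> cbox a b \<and> K \<noteq> {} \<and> (\<exists>c d. K = cbox c d)"
        "pairwise (\<lambda>A B. interior A \<inter> interior B = {}) \<D>"
        "S \<subseteq> \<Union>\<D>" "\<Union>\<D> \<in> lmeasurable" "measure lebesgue (\<Union>\<D>) \<le> measure lebesgue S + e'"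
    by (rule measurable_outer_intervals_bounded[OF S e'(1)]) blast
  obtain K and J :: "nat set" where K: "\<D> = K ` J" "inj_on K J"
    using \<D>(1) unfolding countable_as_injective_image_subset by blast
  define K' where "K' n = (if n \<in> J then K n else {})" for n
  have "\<exists>c d. K n = {c..d} \<and> c \<le> d" if "n \<in> J" for n using \<D>(2)[of "K n"] that K(1) by auto
  then obtain c d where cd: "\<And>n. n \<in> J \<Longrightarrow> K n = {c n..d n}" "\<And>n. n \<in> J \<Longrightarrow> c n \<le> d n" by metis
  \<comment> \<open>The covering intervals may share end points. Counting their interiors gives the
    same lengths and a disjoint family to sum over.\<close>
  have piece: "hausdorff1_outer (f ` (E \<inter> K' n)) \<le> ennreal L * emeasure lborel (interior (K' n))" for n
  proof (cases "n \<in> J")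
    case True
    have "hausdorff1_outer (f ` (E \<inter> K' n)) \<le> ennreal (L * (d n - c n))"
      using hausdorff1_lipschitz_interval[OF f cd(2)[OF True]] True by (simp add: K'_def cd(1))
    also have "\<dots> = ennreal L * emeasure lborel (interior (K' n))"
      using True cd(2)[OF True] L by (simp add: K'_def cd(1) ennreal_mult)
    finally show ?thesis .
  qed (simp add: K'_def)
  have disj: "disjoint_family (\<lambda>n. interior (K' n))"
    unfolding disjoint_family_on_def
  proof (intro ballI impI)
    fix m n :: nat assume "m \<noteq> n"
    then show "interior (K' m) \<inter> interior (K' n) = {}"
      using \<D>(3) K by (auto simp: K'_def pairwise_def inj_on_eq_iff)
  qed
  have UK: "(\<Union>n. K' n) = \<Union>\<D>" unfolding K'_def K(1) by (auto split: if_splits)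
  have "(\<Sum>n. emeasure lborel (interior (K' n))) = emeasure lebesgue (\<Union>n. interior (K' n))"
    by (subst suminf_emeasure[OF _ disj]) auto
  also have "\<dots> \<le> emeasure lebesgue (\<Union>\<D>)"
  proof (rule emeasure_mono)
    show "(\<Union>n. interior (K' n)) \<subseteq> \<Union>\<D>" unfolding UK[symmetric] by (intro UN_mono interior_subset order_refl)
  qed (use \<D>(5) in auto)
  also have "\<dots> = ennreal (measure lebesgue (\<Union>\<D>))" using \<D>(5) by (simp add: emeasure_eq_measure2)
  also have "\<dots> \<le> ennreal (measure lebesgue S + e')" by (intro ennreal_leI \<D>)
  finally have total: "(\<Sum>n. emeasure lborel (interior (K' n))) \<le> ennreal (measure lebesgue S + e')" .
  have "S \<subseteq> (\<Union>n. K' n)" using \<D>(4) UK by simp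
  then have "f ` (E \<inter> S) \<subseteq> (\<Union>n. f ` (E \<inter> K' n))" by blast
  then have "hausdorff1_outer (f ` (E \<inter> S)) \<le> (\<Sum>n. hausdorff1_outer (f ` (E \<inter> K' n)))"
    by (rule order_trans[OF hausdorff1_outer_mono hausdorff1_outer_subadditive])
  also have "\<dots> \<le> (\<Sum>n. ennreal L * emeasure lborel (interior (K' n)))" by (intro suminf_le piece) auto
  also have "\<dots> = ennreal L * (\<Sum>n. emeasure lborel (interior (K' n)))" by simp
  also have "\<dots> \<le> ennreal L * ennreal (measure lebesgue S + e')" by (intro mult_left_mono total) simp
  also have "\<dots> = ennreal (L * measure lebesgue S + L * e')"
    using L e' by (simp add: ennreal_mult[symmetric] distrib_left)
  also have "\<dots> \<le> ennreal (L * measure lebesgue S + e)" using e' by (intro ennreal_leI) simp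
  also have "\<dots> = ennreal (L * measure lebesgue S) + ennreal e" using L e by (simp add: ennreal_plus)
  finally show "hausdorff1_outer (f ` (E \<inter> S)) \<le> ennreal (L * measure lebesgue S) + ennreal e" .
qed

lemma hausdorff1_content_mono: "S \<subseteq> T \<Longrightarrow> hausdorff1_content d S \<le> hausdorff1_content d T"
  using outer_measure_space_hausdorff1_content[of d] by (auto simp: outer_measure_space_def increasing_def)

section \<open>Inscribed polygons and variation of a map on a set of reals\<close>

lemma links_insert_max:
  fixes A :: "real set"
  assumes "finite A" "A \<noteq> {}" "\<And>a. a \<in> A \<Longrightarrow> a < b"
  shows "links (\<lambda>x. x) (insert b A) = insert (Max A, b) (links (\<lambda>x. x) A)"
proof -
  have M: "Max A \<in> A" "\<And>a. a \<in> A \<Longrightarrow> a \<le> Max A" using assms by auto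
  have "(x, y) \<in> insert (Max A, b) (links (\<lambda>x. x) A)" if "(x, y) \<in> links (\<lambda>x. x) (insert b A)" for x y
  proof -
    note l = linksD[OF that]
    have "x \<in> A" using l(1,2,3) assms(3)[of y] by auto
    show ?thesis
    proof (cases "y = b")
      case True
      have "Max A < b" by (rule assms(3)[OF M(1)])
      then have "x = Max A" using l(4)[of "Max A"] M(1) M(2)[OF \<open>x \<in> A\<close>] True by auto
      then show ?thesis using True by simp
    next
      case False
      then show ?thesis using that \<open>x \<in> A\<close> by (auto simp: links_def)
    qed
  qed
  moreover have "(x, y) \<in> links (\<lambda>x. x) (insert b A)" if "(x, y) \<in> insert (Max A, b) (links (\<lambda>x. x) A)" for x y
    using that M assms(3) by (auto simp: links_def intro: less_imp_le)
  ultimately show ?thesis by (intro equalityI subrelI)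
qed

lemma sum_links_insert_max:
  fixes A :: "real set"
  assumes "finite A" "A \<noteq> {}" "\<And>a. a \<in> A \<Longrightarrow> a < b"
  shows "(\<Sum>(x,y)\<in>links (\<lambda>x. x) (insert b A). g x y) = (\<Sum>(x,y)\<in>links (\<lambda>x. x) A. g x y) + (g (Max A) b :: real)"
proof -
  have "(Max A, b) \<notin> links (\<lambda>x. x) A" using linksD(2)[of "Max A" b "\<lambda>x. x" A] assms(3)[of b] by auto
  then have "(\<Sum>(x,y)\<in>insert (Max A, b) (links (\<lambda>x. x) A). g x y) = (\<Sum>(x,y)\<in>links (\<lambda>x. x) A. g x y) + g (Max A) b"
    using finite_links[OF assms(1)] by (simp add: add.commute)
  then show ?thesis using links_insert_max[OF assms] by simp
qed

lemma links_telescope: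
  fixes A :: "real set" and W :: "real \<Rightarrow> real"
  assumes "finite A" "A \<noteq> {}"
  shows "(\<Sum>(x,y)\<in>links (\<lambda>x. x) A. W y - W x) = W (Max A) - W (Min A)"
  using assms
proof (induction rule: finite_linorder_max_induct)
  case (insert b A)
  show ?case
  proof (cases "A = {}")
    case True
    then have "links (\<lambda>x. x) (insert b A) = {}" by (auto simp: links_def)
    then show ?thesis using True by simp
  next
    case False
    have lt: "a < b" if "a \<in> A" for a using insert(2) that by blast
    have "Max (insert b A) = b" using insert(1) lt by (intro Max_eqI) (auto intro: less_imp_le)
    moreover have "Min (insert b A) = Min A"
      using insert(1) less_imp_le[OF lt[OF Min_in[OF insert(1) False]]] Min_in[OF insert(1) False] by (intro Min_eqI) auto
    ultimately show ?thesis using sum_links_insert_max[OF insert(1) False lt, of "\<lambda>x y. W y - W x"] insert.IH[OF False] by simp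
  qed
qed simp

definition polygon_length :: "(real \<Rightarrow> 'a::metric_space) \<Rightarrow> real set \<Rightarrow> real" where
  "polygon_length f F = (\<Sum>(x,y)\<in>links (\<lambda>x. x) F. dist (f x) (f y))"

lemma polygon_length_insert:
  assumes F: "finite F" shows "polygon_length f F \<le> polygon_length f (insert z F)"
proof (cases "\<exists>x y. (x, y) \<in> links (\<lambda>x. x) F \<and> x < z \<and> z < y")
  case True
  then obtain x y where xy: "(x, y) \<in> links (\<lambda>x. x) F" "x < z" "z < y" by blast
  show ?thesis unfolding polygon_length_def sum_links_insert[OF F inj_on_id2 xy]
    using dist_triangle[of "f x" "f y" "f z"] by simp
next
  case False
  then have "links (\<lambda>x. x) F \<subseteq> links (\<lambda>x. x) (insert z F)"
  proof (intro subrelI)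
    fix x y assume xy: "(x, y) \<in> links (\<lambda>x. x) F"
    then have "z \<le> x \<or> y \<le> z" using False by (meson not_le)
    then show "(x, y) \<in> links (\<lambda>x. x) (insert z F)" using xy by (simp add: links_def)
  qed
  then show ?thesis unfolding polygon_length_def using F by (intro sum_mono2 finite_links) auto
qed

lemma polygon_length_mono:
  assumes "finite F'" "F \<subseteq> F'" shows "polygon_length f F \<le> polygon_length f F'"
proof -
  have "polygon_length f F \<le> polygon_length f (F \<union> G)" if "finite G" for G
    using that
  proof induction
    case (insert z G)
    then show ?case using polygon_length_insert[of "F \<union> G" f z] assms by (simp add: finite_subset)
  qed simp
  from this[OF assms(1)] show ?thesis using assms(2) by (simp add: Un_absorb1)
qed

lemma polygon_length_insert_max:
  assumes "finite A" "x \<in> A" "\<And>a. a \<in> A \<Longrightarrow> a \<le> x" "x < y"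
  shows "polygon_length f (insert y A) = polygon_length f A + dist (f x) (f y)"
proof -
  have "Max A = x" using assms by (intro Max_eqI) auto
  moreover have "a < y" if "a \<in> A" for a using assms(3)[OF that] assms(4) by simp
  moreover have "A \<noteq> {}" using assms(2) by blast
  ultimately show ?thesis unfolding polygon_length_def
    using sum_links_insert_max[OF assms(1), of y "\<lambda>x y. dist (f x) (f y)"] by simp
qed

text \<open>Take a finite set whose polygon nearly exhausts the variation of \<open>f\<close>. On
  short intervals off this set whose end values almost agree, hardly any length is used by a refined
  polygon, so the total variation on disjoint such intervals is small. It dominates the diameters of
  the images, and Vitali's theorem lets these intervals cover almost all of
  \<open>D\<close>.\<close>

lemma hausdorff1_stationary_null:
  fixes f :: "real \<Rightarrow> 'a::metric_space"
  assumes f: "L-lipschitz_on E f" and E: "E \<subseteq> {-T..T}" and D: "D \<subseteq> E"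
    and stat: "\<And>x e. x \<in> D \<Longrightarrow> 0 < e \<Longrightarrow> \<exists>y\<in>E. y \<noteq> x \<and> \<bar>x - y\<bar> < e \<and> dist (f x) (f y) \<le> e * \<bar>x - y\<bar>"
  shows "hausdorff1_outer (f ` D) = 0"
proof (cases "D = {}")
  case False
  then have T: "0 \<le> T" using D E by force
  have L: "0 \<le> L" using f by (rule lipschitz_on_nonneg)
  define \<V> where "\<V> X = polygon_length f ` {F. finite F \<and> F \<subseteq> X}" for X
  have bound: "polygon_length f F \<le> 2 * L * T" if "finite F" "F \<subseteq> E" for F
  proof (cases "F = {}")
    case False
    have "polygon_length f F \<le> (\<Sum>(x,y)\<in>links (\<lambda>x. x) F. L * y - L * x)" unfolding polygon_length_def
    proof (rule sum_mono, clarify)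
      fix x y assume "(x, y) \<in> links (\<lambda>x. x) F"
      from linksD(1-3)[OF this] have xy: "x \<in> E" "y \<in> E" "x < y" using that(2) by auto
      show "dist (f x) (f y) \<le> L * y - L * x"
        using lipschitz_onD[OF f xy(1,2)] xy(3) by (simp add: dist_real_def right_diff_distrib)
    qed
    also have "\<dots> = L * (Max F - Min F)" unfolding links_telescope[OF that(1) False] by (simp add: right_diff_distrib)
    also have "\<dots> \<le> L * (2 * T)"
    proof (rule mult_left_mono[OF _ L])
      have "Max F \<in> {-T..T}" "Min F \<in> {-T..T}" using that E False Max_in[of F] Min_in[of F] by blast+
      then show "Max F - Min F \<le> 2 * T" by simp
    qed
    finally show ?thesis by (simp add: mult.assoc mult.left_commute)
  qed (simp add: polygon_length_def links_def L T)
  have bdd: "bdd_above (\<V> X)" if "X \<subseteq> E" for X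
    unfolding \<V>_def using bound that by (intro bdd_aboveI2[of _ _ "2 * L * T"]) auto
  define V where "V x = Sup (\<V> (E \<inter> {..x}))" for x
  define V' where "V' = Sup (\<V> E)"
  have ne: "0 \<in> \<V> X" for X unfolding \<V>_def by (rule image_eqI[of _ _ "{}"]) (auto simp: polygon_length_def links_def)
  have V0: "0 \<le> V x" for x unfolding V_def by (rule cSup_upper[OF ne bdd]) auto
  have V1: "V x \<le> V'" for x unfolding V_def V'_def
    by (rule cSup_subset_mono[OF _ bdd]) (use ne in \<open>auto simp: \<V>_def\<close>)
  have step: "V x + dist (f x) (f y) \<le> V y" if "x \<in> E" "y \<in> E" "x < y" for x y
  proof -
    have "V x \<le> V y - dist (f x) (f y)" unfolding V_def[of x]
    proof (rule cSup_least)
      show "\<V> (E \<inter> {..x}) \<noteq> {}" using ne by blast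
      fix v assume "v \<in> \<V> (E \<inter> {..x})"
      then obtain F where F: "finite F" "F \<subseteq> E \<inter> {..x}" "v = polygon_length f F" by (auto simp: \<V>_def)
      have "v \<le> polygon_length f (insert x F)" unfolding F(3) by (rule polygon_length_insert[OF F(1)])
      also have "\<dots> = polygon_length f (insert y (insert x F)) - dist (f x) (f y)"
      proof -
        have "a \<le> x" if "a \<in> insert x F" for a using that F(2) by auto
        then show ?thesis using polygon_length_insert_max[of "insert x F" x y f] F(1) that(3) by simp
      qed
      also have "polygon_length f (insert y (insert x F)) \<le> V y" unfolding V_def
        by (rule cSup_upper[OF _ bdd]) (use F that in \<open>auto simp: \<V>_def intro!: imageI\<close>)
      finally show "v \<le> V y - dist (f x) (f y)" by simp
    qed
    then show ?thesis by simp
  qed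
  have main: "hausdorff1_content \<delta> (f ` D) \<le> ennreal (\<eta> * (1 + 2 * T))" if \<delta>: "0 < \<delta>" and \<eta>: "0 < \<eta>" for \<delta> \<eta>
  proof -
    obtain F0 where F0: "finite F0" "F0 \<subseteq> E" "V' - \<eta> < polygon_length f F0"
      using less_cSupD[of "\<V> E" "V' - \<eta>"] ne \<eta> unfolding V'_def[symmetric] by (auto simp: \<V>_def)
    define \<delta>0 where "\<delta>0 = \<delta> / (L + 1)"
    have \<delta>0: "0 < \<delta>0" "L * \<delta>0 \<le> \<delta>" using \<delta> L by (auto simp: \<delta>0_def field_simps)
    \<comment> \<open>Both end points lie in \<open>E\<close>, where increments of \<open>V\<close>
      bound distances of values. Avoiding \<open>F0\<close> makes each chosen interval a link of the
      refined polygon.\<close>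
    define K where "K = {(a, b). a \<in> E \<and> b \<in> E \<and> a < b \<and> dist (f a) (f b) \<le> \<eta> * (b - a) \<and> b - a < \<delta>0 \<and> F0 \<inter> {a..b} = {}}"
    define c where "c i = (fst i + snd i) / 2" for i :: "real \<times> real"
    define r where "r i = (snd i - fst i) / 2" for i :: "real \<times> real"
    have cr: "cball (c i) (r i) = {fst i..snd i}" for i by (auto simp: c_def r_def dist_real_def abs_le_iff field_simps)
    have fine: "\<exists>i. i \<in> K \<and> x \<in> cball (c i) (r i) \<and> r i < d" if xd: "x \<in> D - F0" "0 < d" for x d
    proof -
      obtain e0 where e0: "0 < e0" "\<And>v. v \<in> F0 \<Longrightarrow> v \<noteq> x \<Longrightarrow> e0 \<le> dist x v" using finite_set_avoid[OF F0(1), of x] by blast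
      define e where "e = min (min \<eta> d) (min \<delta>0 e0)"
      have e: "0 < e" "e \<le> \<eta>" "e \<le> d" "e \<le> \<delta>0" "e \<le> e0" using \<eta> xd \<delta>0 e0 by (auto simp: e_def)
      obtain y where y: "y \<in> E" "y \<noteq> x" "\<bar>x - y\<bar> < e" "dist (f x) (f y) \<le> e * \<bar>x - y\<bar>" using stat[of x e] xd e by auto
      define a where "a = min x y"
      define b where "b = max x y"
      have ab: "a \<in> E" "b \<in> E" "a < b" "b - a = \<bar>x - y\<bar>" "dist (f a) (f b) = dist (f x) (f y)" "x \<in> {a..b}"
        using y xd D by (auto simp: a_def b_def min_def max_def dist_commute)
      have "e * \<bar>x - y\<bar> \<le> \<eta> * \<bar>x - y\<bar>" by (intro mult_right_mono e) simp
      then have 1: "dist (f a) (f b) \<le> \<eta> * (b - a)" using y(4) ab by simp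
      have 2: "F0 \<inter> {a..b} = {}"
      proof (rule ccontr)
        assume "F0 \<inter> {a..b} \<noteq> {}"
        then obtain v where v: "v \<in> F0" "a \<le> v" "v \<le> b" by auto
        then have "v \<noteq> x" using xd by auto
        then have "e0 \<le> \<bar>x - v\<bar>" using e0(2)[OF v(1)] by (simp add: dist_real_def)
        then show False using v(2,3) ab(4,6) y(3) e(5) by auto
      qed
      have "(a, b) \<in> K" using ab 1 2 y(3) e(4) by (auto simp: K_def)
      then show ?thesis using ab y(3) e(3) unfolding cr by (intro exI[of _ "(a, b)"]) (auto simp: r_def)
    qed
    obtain C where C: "countable C" "C \<subseteq> K" "pairwise (\<lambda>i j. disjnt (cball (c i) (r i)) (cball (c j) (r j))) C"
      "negligible (D - F0 - (\<Union>i\<in>C. cball (c i) (r i)))"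
    proof (rule Vitali_covering_theorem_cballs[of K r "D - F0" c])
      show "0 < r i" if "i \<in> K" for i using that by (auto simp: K_def r_def)
    qed (use fine in blast)+
    have Kd: "fst i \<in> E" "snd i \<in> E" "fst i < snd i" "dist (f (fst i)) (f (snd i)) \<le> \<eta> * (snd i - fst i)"
        "snd i - fst i < \<delta>0" "F0 \<inter> {fst i..snd i} = {}" if "i \<in> C" for i
      using subsetD[OF C(2) that] by (simp_all add: K_def case_prod_beta)
    have disj: "{fst i..snd i} \<inter> {fst j..snd j} = {}" if "i \<in> C" "j \<in> C" "i \<noteq> j" for i j
      using C(3) that unfolding pairwise_def cr disjnt_def by blast
    have finsum: "(\<Sum>i\<in>I. V (snd i) - V (fst i)) \<le> \<eta> * (1 + 2 * T)" if I: "finite I" "I \<subseteq> C" for I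
    proof (cases "I = {}")
      case False
      define G where "G = F0 \<union> fst ` I \<union> snd ` I"
      have G: "finite G" "G \<noteq> {}" "G \<subseteq> E" "F0 \<subseteq> G" using F0 I False Kd(1,2) by (auto simp: G_def)
      have IG: "I \<subseteq> links (\<lambda>x. x) G"
      proof
        fix i assume i: "i \<in> I"
        have "v \<le> fst i \<or> snd i \<le> v" if "v \<in> G" for v
        proof (cases "v \<in> F0")
          case True
          then have "v \<notin> {fst i..snd i}" using Kd(6)[of i] i I(2) by blast
          then show ?thesis by auto
        next
          case False
          then obtain j where j: "j \<in> I" "v = fst j \<or> v = snd j" using \<open>v \<in> G\<close> by (auto simp: G_def)
          show ?thesis
          proof (cases "i = j")
            case False
            have "v \<in> {fst j..snd j}" using j(2) Kd(3)[of j] subsetD[OF I(2) j(1)] by auto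
            then have "v \<notin> {fst i..snd i}" using disj[of i j] False i j I by blast
            then show ?thesis by auto
          qed (use j in auto)
        qed
        then show "i \<in> links (\<lambda>x. x) G" using i I Kd(3)[of i] by (auto simp: links_def G_def case_prod_beta)
      qed
      \<comment> \<open>On every link this slack is nonnegative, and on a chosen interval it is at
        least the increment of \<open>V\<close>. Summed over all links it telescopes to at most
        \<open>V' + 2 * \<eta> * T\<close> minus the polygon length, which is less than
        \<open>\<eta> * (1 + 2 * T)\<close>.\<close>
      define t where "t x y = (V y + \<eta> * y) - (V x + \<eta> * x) - dist (f x) (f y)" for x y
      have t0: "0 \<le> t x y" if "(x, y) \<in> links (\<lambda>x. x) G" for x y
      proof -
        have xy: "x \<in> E" "y \<in> E" "x < y" using linksD(1-3)[OF that] G(3) by auto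
        then have "\<eta> * x \<le> \<eta> * y" using \<eta> by simp
        then show ?thesis using step[OF xy] by (simp add: t_def)
      qed
      have "(\<Sum>i\<in>I. V (snd i) - V (fst i)) \<le> (\<Sum>i\<in>I. case i of (x, y) \<Rightarrow> t x y)"
      proof (rule sum_mono)
        fix i assume "i \<in> I"
        then show "V (snd i) - V (fst i) \<le> (case i of (x, y) \<Rightarrow> t x y)"
          using Kd(4)[of i] I by (auto simp: t_def case_prod_beta right_diff_distrib)
      qed
      also have "\<dots> \<le> (\<Sum>i\<in>links (\<lambda>x. x) G. case i of (x, y) \<Rightarrow> t x y)"
        using finite_links[OF G(1)] IG t0 by (intro sum_mono2) auto
      also have "\<dots> = (V (Max G) + \<eta> * Max G) - (V (Min G) + \<eta> * Min G) - polygon_length f G"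
        unfolding links_telescope[OF G(1,2), of "\<lambda>x. V x + \<eta> * x", symmetric] polygon_length_def t_def
        by (simp add: sum_subtractf[symmetric] case_prod_beta)
      also have "\<dots> \<le> \<eta> * (1 + 2 * T)"
      proof -
        have "Max G \<in> {-T..T}" "Min G \<in> {-T..T}" using G(1-3) E Max_in[of G] Min_in[of G] by blast+
        then have "\<eta> * (Max G - Min G) \<le> \<eta> * (2 * T)" using \<eta> by (intro mult_left_mono) auto
        moreover have "V' - \<eta> < polygon_length f G" using F0(3) polygon_length_mono[OF G(1,4), of f] by simp
        ultimately show ?thesis using V1[of "Max G"] V0[of "Min G"] unfolding right_diff_distrib distrib_left by simp
      qed
      finally show ?thesis .
    qed (use \<eta> T in simp)
    obtain k and J :: "nat set" where k: "C = k ` J" "inj_on k J"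
      using C(1) unfolding countable_as_injective_image_subset by blast
    \<comment> \<open>What Vitali's theorem leaves over is negligible, and so is its Lipschitz
      image.\<close>
    define N where "N = (D - (\<Union>i\<in>C. cball (c i) (r i))) \<union> F0"
    have N: "negligible N"
    proof (rule negligible_subset)
      show "negligible (D - F0 - (\<Union>i\<in>C. cball (c i) (r i)) \<union> F0)" using C(4) F0(1) by (simp add: negligible_finite)
    qed (auto simp: N_def)
    define A where "A n = (if n \<in> J then f ` (E \<inter> {fst (k n)..snd (k n)}) else {})" for n
    have piece: "hausdorff1_content \<delta> (A n) \<le> ennreal (if n \<in> J then V (snd (k n)) - V (fst (k n)) else 0)" for n
    proof (cases "n \<in> J")
      case True
      define a where "a = fst (k n)"
      define b where "b = snd (k n)"
      have ab: "a \<in> E" "b \<in> E" "a < b" "b - a < \<delta>0" using Kd[of "k n"] k(1) True by (auto simp: a_def b_def)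
      have Vm: "V x \<le> V y" if "x \<in> E" "y \<in> E" "x \<le> y" for x y
      proof (cases "x = y")
        case False
        then have "V x + dist (f x) (f y) \<le> V y" using step[OF that(1,2)] that(3) by simp
        then show ?thesis using zero_le_dist[of "f x" "f y"] by linarith
      qed simp
      have VV: "dist (f x) (f y) \<le> V b - V a" if "x \<in> E \<inter> {a..b}" "y \<in> E \<inter> {a..b}" "x < y" for x y
        using step[of x y] Vm[of a x] Vm[of y b] that ab by auto
      have d1: "ediam (A n) \<le> ennreal (V b - V a)"
        unfolding A_def a_def[symmetric] b_def[symmetric]
      proof (simp only: True if_True, rule ediam_le, elim imageE)
        fix x y u v assume "x = f u" "u \<in> E \<inter> {a..b}" "y = f v" "v \<in> E \<inter> {a..b}"
        then show "dist x y \<le> V b - V a" using VV[of u v] VV[of v u] Vm[of a b] ab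
          by (cases u v rule: linorder_cases) (auto simp: dist_commute)
      qed
      have d2: "ediam (A n) \<le> ennreal \<delta>"
        unfolding A_def a_def[symmetric] b_def[symmetric]
      proof (simp only: True if_True, rule ediam_le, elim imageE)
        fix x y u v assume uv: "x = f u" "u \<in> E \<inter> {a..b}" "y = f v" "v \<in> E \<inter> {a..b}"
        then have "dist x y \<le> L * dist u v" using lipschitz_onD[OF f, of u v] by simp
        also have "\<dots> \<le> L * \<delta>0" using uv ab by (intro mult_left_mono L) (auto simp: dist_real_def)
        finally show "dist x y \<le> \<delta>" using \<delta>0 by simp
      qed
      have "hausdorff1_content \<delta> (A n) \<le> ediam (A n)" by (rule hausdorff1_content_le_ediam[OF d2]) simp
      then show ?thesis using d1 True by (simp add: a_def b_def)
    qed (simp add: A_def)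
    have "f ` D \<subseteq> f ` (E \<inter> N) \<union> (\<Union>n. A n)"
    proof
      fix y assume "y \<in> f ` D"
      then obtain x where x: "x \<in> D" "y = f x" by blast
      show "y \<in> f ` (E \<inter> N) \<union> (\<Union>n. A n)"
      proof (cases "x \<in> N")
        case False
        then obtain i where i: "i \<in> C" "x \<in> {fst i..snd i}" using x unfolding N_def cr by blast
        then obtain n where "n \<in> J" "k n = i" using k(1) by blast
        then have "y \<in> A n" using x D i by (auto simp: A_def)
        then show ?thesis by blast
      qed (use x D in blast)
    qed
    then have "hausdorff1_content \<delta> (f ` D) \<le> hausdorff1_content \<delta> (f ` (E \<inter> N) \<union> (\<Union>n. A n))"
      by (rule hausdorff1_content_mono)
    also have "\<dots> \<le> hausdorff1_content \<delta> (f ` (E \<inter> N)) + hausdorff1_content \<delta> (\<Union>n. A n)" by (rule hausdorff1_content_Un)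
    also have "\<dots> \<le> 0 + (\<Sum>n. hausdorff1_content \<delta> (A n))"
    proof (rule add_mono[OF _ hausdorff1_content_subadditive])
      have "N \<subseteq> cbox (-T) T" using D E F0(2) by (auto simp: N_def)
      then have "hausdorff1_outer (f ` (E \<inter> N)) \<le> ennreal (L * measure lebesgue N)"
        using N by (intro hausdorff1_lipschitz_le[OF f]) (auto intro: negligible_imp_measurable)
      then show "hausdorff1_content \<delta> (f ` (E \<inter> N)) \<le> 0"
        using hausdorff1_content_le_outer[OF \<delta>, of "f ` (E \<inter> N)"] N by (simp add: negligible_imp_measure0)
    qed
    also have "\<dots> \<le> (\<Sum>n. ennreal (if n \<in> J then V (snd (k n)) - V (fst (k n)) else 0))"
      unfolding add_0_left by (intro suminf_le piece) auto
    also have "\<dots> \<le> ennreal (\<eta> * (1 + 2 * T))"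
    proof (rule suminf_le_const)
      fix n
      have pos: "0 \<le> V (snd (k i)) - V (fst (k i))" if "i \<in> J" for i
      proof -
        have "k i \<in> C" using that k(1) by blast
        from step[OF Kd(1,2,3)[OF this]] show ?thesis using zero_le_dist[of "f (fst (k i))" "f (snd (k i))"] by linarith
      qed
      have "(\<Sum>i<n. ennreal (if i \<in> J then V (snd (k i)) - V (fst (k i)) else 0))
          = ennreal (\<Sum>i<n. if i \<in> J then V (snd (k i)) - V (fst (k i)) else 0)"
        using pos by (intro sum_ennreal) auto
      also have "(\<Sum>i<n. if i \<in> J then V (snd (k i)) - V (fst (k i)) else 0) = (\<Sum>i\<in>J \<inter> {..<n}. V (snd (k i)) - V (fst (k i)))"
        by (simp add: sum.If_cases Int_commute)
      also have "\<dots> = (\<Sum>i\<in>k ` (J \<inter> {..<n}). V (snd i) - V (fst i))"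
        by (subst sum.reindex[OF inj_on_subset[OF k(2)]]) auto
      also have "\<dots> \<le> \<eta> * (1 + 2 * T)" using k(1) by (intro finsum) auto
      finally show "(\<Sum>i<n. ennreal (if i \<in> J then V (snd (k i)) - V (fst (k i)) else 0)) \<le> ennreal (\<eta> * (1 + 2 * T))"
        by (simp add: ennreal_leI)
    qed simp
    finally show ?thesis .
  qed
  have "hausdorff1_content \<delta> (f ` D) = 0" if "0 < \<delta>" for \<delta>
  proof (rule ccontr)
    assume *: "hausdorff1_content \<delta> (f ` D) \<noteq> 0"
    have fin: "hausdorff1_content \<delta> (f ` D) \<le> ennreal (1 + 2 * T)" using main[OF that, of 1] by simp
    obtain x where x: "hausdorff1_content \<delta> (f ` D) = ennreal x" "0 < x"
      using * fin by (cases "hausdorff1_content \<delta> (f ` D)") (auto simp: top_unique less_le)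
    have "ennreal x \<le> ennreal (x / (2 * (1 + 2 * T)) * (1 + 2 * T))"
      unfolding x(1)[symmetric] by (rule main[OF that]) (use x T in simp)
    also have "x / (2 * (1 + 2 * T)) * (1 + 2 * T) = x / 2" using T by (simp add: field_simps)
    finally show False using x by (simp add: ennreal_le_iff)
  qed
  then have "hausdorff1_outer (f ` D) \<le> 0" unfolding hausdorff1_outer_le_iff by simp
  then show ?thesis by simp
qed simp

section \<open>The excess integral of a pseudometric on the line\<close>

lemma nn_integral_cube_tail:
  assumes m: "0 < m"
  shows "(\<integral>\<^sup>+x. ennreal (if m \<le> x then 1 / x ^ 3 else 0) \<partial>lborel) = ennreal (1 / (2 * m\<^sup>2))"
proof -
  have "(\<integral>\<^sup>+x. ennreal (1 / x ^ 3) * indicator {m..} x \<partial>lborel) = ennreal (0 - (- 1 / (2 * m\<^sup>2)))"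
  proof (rule nn_integral_FTC_atLeast)
    show "((\<lambda>x. - 1 / (2 * x\<^sup>2)) has_real_derivative 1 / x ^ 3) (at x)" if "m \<le> x" for x
    proof -
      have "0 < x" using that m by simp
      then show ?thesis by (auto intro!: derivative_eq_intros simp: power2_eq_square power3_eq_cube field_simps)
    qed
    show "((\<lambda>x::real. - 1 / (2 * x\<^sup>2)) \<longlongrightarrow> 0) at_top" by real_asymp
  qed (use m in auto)
  also have "(\<lambda>x. ennreal (1 / x ^ 3) * indicator {m..} x) = (\<lambda>x. ennreal (if m \<le> x then 1 / x ^ 3 else 0))"
    by (auto simp: indicator_def)
  finally show ?thesis by simp
qed

lemma nn_integral_cube_tails:
  assumes m: "0 < m"
  shows "(\<integral>\<^sup>+u. ennreal (if m \<le> u - s then 1 / (u - s) ^ 3 else 0) \<partial>lborel) = ennreal (1 / (2 * m\<^sup>2))"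
    "(\<integral>\<^sup>+s. ennreal (if m \<le> u - s then 1 / (u - s) ^ 3 else 0) \<partial>lborel) = ennreal (1 / (2 * m\<^sup>2))"
proof -
  show "(\<integral>\<^sup>+u. ennreal (if m \<le> u - s then 1 / (u - s) ^ 3 else 0) \<partial>lborel) = ennreal (1 / (2 * m\<^sup>2))"
    using nn_integral_cube_tail[OF m] by (subst nn_integral_real_affine[of _ 1 s]) (auto cong: if_cong)
  show "(\<integral>\<^sup>+s. ennreal (if m \<le> u - s then 1 / (u - s) ^ 3 else 0) \<partial>lborel) = ennreal (1 / (2 * m\<^sup>2))"
    using nn_integral_cube_tail[OF m] by (subst nn_integral_real_affine[of _ "-1" u]) (auto cong: if_cong)
qed

locale line_pseudometric =
  fixes \<rho> :: "real \<Rightarrow> real \<Rightarrow> real" and L T :: real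
  assumes LT: "0 \<le> L" "0 \<le> T" and nonneg: "0 \<le> \<rho> s t" and triangle: "\<rho> s u \<le> \<rho> s t + \<rho> t u"
    and lip: "\<rho> s t \<le> L * \<bar>s - t\<bar>" and cont: "continuous_on UNIV (\<lambda>p. \<rho> (fst p) (snd p))"
begin

lemma \<rho>_measurable [measurable (raw)]:
  assumes [measurable]: "f \<in> borel_measurable M" "g \<in> borel_measurable M"
  shows "(\<lambda>x. \<rho> (f x) (g x)) \<in> borel_measurable M"
proof -
  have "(\<lambda>p. \<rho> (fst p) (snd p)) \<in> borel_measurable (borel \<Otimes>\<^sub>M borel)"
    unfolding borel_prod by (rule borel_measurable_continuous_onI[OF cont])
  from measurable_compose[OF _ this, of "\<lambda>x. (f x, g x)" M] show ?thesis by simp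
qed

definition inside :: "real \<Rightarrow> real \<Rightarrow> real \<Rightarrow> bool" where
  "inside s t u \<longleftrightarrow> - T \<le> s \<and> s < t \<and> t < u \<and> u \<le> T"

definition w :: "real \<Rightarrow> real \<Rightarrow> real \<Rightarrow> ennreal" where
  "w s t u = ennreal (if inside s t u then (\<rho> s t + \<rho> t u - \<rho> s u) / (u - s) ^ 3 else 0)"
definition we :: "real \<Rightarrow> real \<Rightarrow> real \<Rightarrow> real \<Rightarrow> ennreal" where
  "we e s t u = ennreal (if inside s t u \<and> e \<le> u - s then (\<rho> s t + \<rho> t u - \<rho> s u) / (u - s) ^ 3 else 0)"
definition w1 :: "real \<Rightarrow> real \<Rightarrow> real \<Rightarrow> real \<Rightarrow> ennreal" where
  "w1 e s t u = ennreal (if inside s t u \<and> e \<le> u - s then \<rho> s t / (u - s) ^ 3 else 0)"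
definition w2 :: "real \<Rightarrow> real \<Rightarrow> real \<Rightarrow> real \<Rightarrow> ennreal" where
  "w2 e s t u = ennreal (if inside s t u \<and> e \<le> u - s then \<rho> t u / (u - s) ^ 3 else 0)"
definition w3 :: "real \<Rightarrow> real \<Rightarrow> real \<Rightarrow> real \<Rightarrow> ennreal" where
  "w3 e s t u = ennreal (if inside s t u \<and> e \<le> u - s then \<rho> s u / (u - s) ^ 3 else 0)"
text \<open>Integrating \<^const>\<open>w1\<close> in \<open>u\<close> and \<^const>\<open>w2\<close> in \<open>s\<close> gives at most \<open>wm\<close>, integrating \<^const>\<open>w3\<close>
  in \<open>t\<close> gives \<open>wa\<close>; as \<open>2 wm\<close> and \<open>wa\<close> agree for \<open>t - s \<ge> e\<close>, only a strip around the diagonal survives.\<close>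

definition wm :: "real \<Rightarrow> real \<Rightarrow> real \<Rightarrow> ennreal" where
  "wm e s t = ennreal (if - T \<le> s \<and> s < t \<and> t \<le> T then \<rho> s t / (2 * (max (t - s) e)\<^sup>2) else 0)"

lemma w_measurable [measurable (raw)]:
  assumes [measurable]: "f \<in> borel_measurable M" "g \<in> borel_measurable M" "h \<in> borel_measurable M"
  shows "(\<lambda>x. w (f x) (g x) (h x)) \<in> borel_measurable M" "(\<lambda>x. we e (f x) (g x) (h x)) \<in> borel_measurable M"
    "(\<lambda>x. w1 e (f x) (g x) (h x)) \<in> borel_measurable M" "(\<lambda>x. w2 e (f x) (g x) (h x)) \<in> borel_measurable M"
    "(\<lambda>x. w3 e (f x) (g x) (h x)) \<in> borel_measurable M" "(\<lambda>x. wm e (f x) (g x)) \<in> borel_measurable M"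
  unfolding w_def we_def w1_def w2_def w3_def wm_def inside_def by measurable

text \<open>The third term is kept on the left because subtraction in \<open>ennreal\<close> does
  not distribute over the integrals.\<close>

lemma we_split: "we e s t u + w3 e s t u = w1 e s t u + w2 e s t u"
proof (cases "inside s t u \<and> e \<le> u - s")
  case True
  then have "0 < (u - s) ^ 3" by (simp add: inside_def)
  then show ?thesis unfolding we_def w1_def w2_def w3_def using True nonneg triangle[of s u t]
    by (simp add: add_divide_distrib[symmetric] flip: ennreal_plus)
next
  case False
  show ?thesis unfolding we_def w1_def w2_def w3_def if_not_P[OF False] by simp
qed

lemma w1_le:
  assumes e: "0 < e" shows "(\<integral>\<^sup>+u. w1 e s t u \<partial>lborel) \<le> wm e s t"
proof (cases "- T \<le> s \<and> s < t \<and> t \<le> T")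
  case True
  define m where "m = max (t - s) e"
  have m: "0 < m" using e by (simp add: m_def)
  have "(\<integral>\<^sup>+u. w1 e s t u \<partial>lborel) \<le> (\<integral>\<^sup>+u. ennreal (\<rho> s t) * ennreal (if m \<le> u - s then 1 / (u - s) ^ 3 else 0) \<partial>lborel)"
    by (intro nn_integral_mono) (use nonneg in \<open>auto simp: w1_def inside_def m_def ennreal_mult[symmetric]\<close>)
  also have "\<dots> = ennreal (\<rho> s t) * ennreal (1 / (2 * m\<^sup>2))"
    using nn_integral_cube_tails(1)[OF m] by (subst nn_integral_cmult) auto
  also have "\<dots> = wm e s t" using True nonneg by (simp add: wm_def m_def ennreal_mult[symmetric])
  finally show ?thesis .
next
  case False
  then have "w1 e s t u = 0" for u by (auto simp: w1_def inside_def)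
  then show ?thesis by simp
qed

lemma w2_le:
  assumes e: "0 < e" shows "(\<integral>\<^sup>+s. w2 e s t u \<partial>lborel) \<le> wm e t u"
proof (cases "- T \<le> t \<and> t < u \<and> u \<le> T")
  case True
  define m where "m = max (u - t) e"
  have m: "0 < m" using e by (simp add: m_def)
  have "(\<integral>\<^sup>+s. w2 e s t u \<partial>lborel) \<le> (\<integral>\<^sup>+s. ennreal (\<rho> t u) * ennreal (if m \<le> u - s then 1 / (u - s) ^ 3 else 0) \<partial>lborel)"
    by (intro nn_integral_mono) (use nonneg in \<open>auto simp: w2_def inside_def m_def ennreal_mult[symmetric]\<close>)
  also have "\<dots> = ennreal (\<rho> t u) * ennreal (1 / (2 * m\<^sup>2))"
    using nn_integral_cube_tails(2)[OF m] by (subst nn_integral_cmult) auto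
  also have "\<dots> = wm e t u" using True nonneg by (simp add: wm_def m_def ennreal_mult[symmetric])
  finally show ?thesis .
next
  case False
  then have "w2 e s t u = 0" for s by (auto simp: w2_def inside_def)
  then show ?thesis by simp
qed

definition wa :: "real \<Rightarrow> real \<Rightarrow> real \<Rightarrow> ennreal" where
  "wa e s u = ennreal (if - T \<le> s \<and> s < u \<and> u \<le> T \<and> e \<le> u - s then \<rho> s u / (u - s)\<^sup>2 else 0)"
text \<open>In the strip \<open>\<rho>\<close> is at most \<open>L * e\<close>, and twice the factor
  \<open>1 / (2 * e\<^sup>2)\<close> gives \<open>L / e\<close>. Over a strip of width
  \<open>e\<close> this integrates to a bound free of \<open>e\<close>.\<close>

definition wb :: "real \<Rightarrow> real \<Rightarrow> real \<Rightarrow> ennreal" where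
  "wb e s u = ennreal (if - T \<le> s \<and> s \<le> T \<and> s < u \<and> u < s + e then L / e else 0)"

lemma wa_measurable [measurable (raw)]:
  assumes [measurable]: "f \<in> borel_measurable M" "g \<in> borel_measurable M"
  shows "(\<lambda>x. wa e (f x) (g x)) \<in> borel_measurable M" "(\<lambda>x. wb e (f x) (g x)) \<in> borel_measurable M"
  unfolding wa_def wb_def by measurable

lemma w3_eq: assumes "0 < e" shows "(\<integral>\<^sup>+t. w3 e s t u \<partial>lborel) = wa e s u"
proof (cases "- T \<le> s \<and> s < u \<and> u \<le> T \<and> e \<le> u - s")
  case True
  have "(\<integral>\<^sup>+t. w3 e s t u \<partial>lborel) = (\<integral>\<^sup>+t. ennreal (\<rho> s u / (u - s) ^ 3) * indicator {s<..<u} t \<partial>lborel)"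
    by (intro nn_integral_cong) (use True in \<open>auto simp: w3_def inside_def indicator_def\<close>)
  also have "\<dots> = ennreal (\<rho> s u / (u - s) ^ 3) * ennreal (u - s)"
    using True by (subst nn_integral_cmult_indicator) auto
  also have "\<dots> = ennreal (\<rho> s u / (u - s) ^ 3 * (u - s))"
    using True nonneg by (intro ennreal_mult[symmetric]) auto
  also have "\<rho> s u / (u - s) ^ 3 * (u - s) = \<rho> s u / (u - s)\<^sup>2"
    using True by (simp add: power3_eq_cube power2_eq_square)
  finally show ?thesis using True by (simp add: wa_def)
next
  case False
  then have "w3 e s t u = 0" for t by (auto simp: w3_def inside_def)
  moreover have "wa e s u = 0" using False by (auto simp: wa_def)
  ultimately show ?thesis by simp
qed

lemma wm_le: assumes e: "0 < e" shows "wm e s t + wm e s t \<le> wa e s t + wb e s t"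
proof (cases "- T \<le> s \<and> s < t \<and> t \<le> T")
  case True
  show ?thesis
  proof (cases "e \<le> t - s")
    case e': True
    have "\<rho> s t / (2 * (t - s)\<^sup>2) + \<rho> s t / (2 * (t - s)\<^sup>2) = \<rho> s t / (t - s)\<^sup>2" by simp
    then have "wm e s t + wm e s t = wa e s t" using True e' nonneg
      by (simp add: wm_def wa_def max_absorb1 flip: ennreal_plus)
    then show ?thesis by simp
  next
    case False
    have "\<rho> s t \<le> L * e"
    proof -
      have "\<rho> s t \<le> L * \<bar>s - t\<bar>" by (rule lip)
      also have "\<dots> \<le> L * e" using True False by (intro mult_left_mono LT) auto
      finally show ?thesis .
    qed
    then have "\<rho> s t / (2 * e\<^sup>2) + \<rho> s t / (2 * e\<^sup>2) \<le> L / e" using e by (simp add: field_simps power2_eq_square)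
    then have "wm e s t + wm e s t \<le> wb e s t" using True False nonneg
      by (simp add: wm_def wb_def max_absorb2 ennreal_leI flip: ennreal_plus)
    then show ?thesis by (simp add: add_increasing)
  qed
next
  case False
  then have "wm e s t = 0" by (auto simp: wm_def)
  then show ?thesis by simp
qed

text \<open>The reason for truncating at \<open>e\<close>: the common term can be cancelled only if
  it is finite, whereas without truncation it may diverge.\<close>

lemma wa_finite: assumes e: "0 < e" shows "(\<integral>\<^sup>+s. \<integral>\<^sup>+u. wa e s u \<partial>lborel \<partial>lborel) < \<infinity>"
proof -
  have "(\<integral>\<^sup>+u. wa e s u \<partial>lborel) \<le> ennreal (L / e * (2 * T)) * indicator {-T..T} s" for s
  proof -
    have "wa e s u \<le> ennreal (L / e) * indicator {-T..T} u * indicator {-T..T} s" for u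
    proof (cases "- T \<le> s \<and> s < u \<and> u \<le> T \<and> e \<le> u - s")
      case True
      then have us: "0 < u - s" using e by simp
      have "\<rho> s u \<le> L * (u - s)" using lip[of s u] True by simp
      then have "\<rho> s u / (u - s)\<^sup>2 \<le> L * (u - s) / (u - s)\<^sup>2" by (rule divide_right_mono) simp
      also have "\<dots> = L / (u - s)" using us by (simp add: power2_eq_square)
      also have "\<dots> \<le> L / e" using True e LT by (intro divide_left_mono) auto
      finally show ?thesis using True by (simp add: wa_def ennreal_leI)
    qed (auto simp: wa_def)
    then have "(\<integral>\<^sup>+u. wa e s u \<partial>lborel) \<le> (\<integral>\<^sup>+u. ennreal (L / e) * indicator {-T..T} u * indicator {-T..T} s \<partial>lborel)"
      by (rule nn_integral_mono)
    also have "\<dots> = ennreal (L / e) * ennreal (2 * T) * indicator {-T..T} s"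
      using LT by (simp add: nn_integral_multc nn_integral_cmult_indicator)
    also have "ennreal (L / e) * ennreal (2 * T) = ennreal (L / e * (2 * T))" using LT e by (intro ennreal_mult[symmetric]) auto
    finally show ?thesis .
  qed
  then have "(\<integral>\<^sup>+s. \<integral>\<^sup>+u. wa e s u \<partial>lborel \<partial>lborel) \<le> (\<integral>\<^sup>+s. ennreal (L / e * (2 * T)) * indicator {-T..T} s \<partial>lborel)"
    by (rule nn_integral_mono)
  also have "\<dots> < \<infinity>" using LT by (subst nn_integral_cmult_indicator) (auto simp: ennreal_mult_less_top)
  finally show ?thesis .
qed

lemma wb_le: assumes e: "0 < e" shows "(\<integral>\<^sup>+s. \<integral>\<^sup>+u. wb e s u \<partial>lborel \<partial>lborel) \<le> ennreal (2 * T * L)"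
proof -
  have "(\<integral>\<^sup>+u. wb e s u \<partial>lborel) = ennreal L * indicator {-T..T} s" for s
  proof -
    have "(\<integral>\<^sup>+u. wb e s u \<partial>lborel) = (\<integral>\<^sup>+u. ennreal (L / e) * indicator {s<..<s+e} u * indicator {-T..T} s \<partial>lborel)"
      by (intro nn_integral_cong) (auto simp: wb_def indicator_def)
    also have "\<dots> = ennreal (L / e) * ennreal e * indicator {-T..T} s"
      using e by (simp add: nn_integral_multc nn_integral_cmult_indicator)
    also have "ennreal (L / e) * ennreal e = ennreal L" using e LT by (simp add: ennreal_mult[symmetric])
    finally show ?thesis .
  qed
  then have "(\<integral>\<^sup>+s. \<integral>\<^sup>+u. wb e s u \<partial>lborel \<partial>lborel) = ennreal L * ennreal (2 * T)"
    using LT by (simp add: nn_integral_cmult_indicator)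
  also have "\<dots> = ennreal (2 * T * L)" using LT by (simp add: ennreal_mult[symmetric] mult.commute)
  finally show ?thesis by simp
qed

lemma we_bound: assumes e: "0 < e" shows "(\<integral>\<^sup>+s. \<integral>\<^sup>+t. \<integral>\<^sup>+u. we e s t u \<partial>lborel \<partial>lborel \<partial>lborel) \<le> ennreal (2 * T * L)"
proof -
  define A where "A = (\<integral>\<^sup>+s. \<integral>\<^sup>+u. wa e s u \<partial>lborel \<partial>lborel)"
  have "(\<integral>\<^sup>+s. \<integral>\<^sup>+t. \<integral>\<^sup>+u. we e s t u \<partial>lborel \<partial>lborel \<partial>lborel) + A
      = (\<integral>\<^sup>+s. \<integral>\<^sup>+t. \<integral>\<^sup>+u. we e s t u \<partial>lborel \<partial>lborel \<partial>lborel) + (\<integral>\<^sup>+s. \<integral>\<^sup>+t. \<integral>\<^sup>+u. w3 e s t u \<partial>lborel \<partial>lborel \<partial>lborel)"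
  proof -
    have "(\<integral>\<^sup>+t. \<integral>\<^sup>+u. w3 e s t u \<partial>lborel \<partial>lborel) = (\<integral>\<^sup>+u. \<integral>\<^sup>+t. w3 e s t u \<partial>lborel \<partial>lborel)" for s
      by (rule lborel_pair.Fubini') measurable
    then show ?thesis by (simp add: A_def w3_eq[OF e])
  qed
  also have "\<dots> = (\<integral>\<^sup>+s. \<integral>\<^sup>+t. \<integral>\<^sup>+u. we e s t u + w3 e s t u \<partial>lborel \<partial>lborel \<partial>lborel)"
    by (simp add: nn_integral_add)
  also have "\<dots> = (\<integral>\<^sup>+s. \<integral>\<^sup>+t. \<integral>\<^sup>+u. w1 e s t u \<partial>lborel \<partial>lborel \<partial>lborel) + (\<integral>\<^sup>+s. \<integral>\<^sup>+t. \<integral>\<^sup>+u. w2 e s t u \<partial>lborel \<partial>lborel \<partial>lborel)"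
    by (simp add: we_split nn_integral_add)
  also have "\<dots> \<le> (\<integral>\<^sup>+s. \<integral>\<^sup>+t. wm e s t \<partial>lborel \<partial>lborel) + (\<integral>\<^sup>+s. \<integral>\<^sup>+t. wm e s t \<partial>lborel \<partial>lborel)"
  proof (rule add_mono)
    show "(\<integral>\<^sup>+s. \<integral>\<^sup>+t. \<integral>\<^sup>+u. w1 e s t u \<partial>lborel \<partial>lborel \<partial>lborel) \<le> (\<integral>\<^sup>+s. \<integral>\<^sup>+t. wm e s t \<partial>lborel \<partial>lborel)"
      by (intro nn_integral_mono w1_le e)
    have "(\<integral>\<^sup>+s. \<integral>\<^sup>+t. \<integral>\<^sup>+u. w2 e s t u \<partial>lborel \<partial>lborel \<partial>lborel) = (\<integral>\<^sup>+t. \<integral>\<^sup>+s. \<integral>\<^sup>+u. w2 e s t u \<partial>lborel \<partial>lborel \<partial>lborel)"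
      by (rule lborel_pair.Fubini'[symmetric]) measurable
    also have "\<dots> = (\<integral>\<^sup>+t. \<integral>\<^sup>+u. \<integral>\<^sup>+s. w2 e s t u \<partial>lborel \<partial>lborel \<partial>lborel)"
      by (intro nn_integral_cong lborel_pair.Fubini'[symmetric]) measurable
    also have "\<dots> \<le> (\<integral>\<^sup>+s. \<integral>\<^sup>+t. wm e s t \<partial>lborel \<partial>lborel)" by (intro nn_integral_mono w2_le e)
    finally show "(\<integral>\<^sup>+s. \<integral>\<^sup>+t. \<integral>\<^sup>+u. w2 e s t u \<partial>lborel \<partial>lborel \<partial>lborel) \<le> (\<integral>\<^sup>+s. \<integral>\<^sup>+t. wm e s t \<partial>lborel \<partial>lborel)" .
  qed
  also have "\<dots> = (\<integral>\<^sup>+s. \<integral>\<^sup>+t. wm e s t + wm e s t \<partial>lborel \<partial>lborel)" by (simp add: nn_integral_add)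
  also have "\<dots> \<le> (\<integral>\<^sup>+s. \<integral>\<^sup>+t. wa e s t + wb e s t \<partial>lborel \<partial>lborel)" by (intro nn_integral_mono wm_le e)
  also have "\<dots> = A + (\<integral>\<^sup>+s. \<integral>\<^sup>+t. wb e s t \<partial>lborel \<partial>lborel)" by (simp add: A_def nn_integral_add)
  also have "\<dots> \<le> A + ennreal (2 * T * L)" by (intro add_left_mono wb_le e)
  finally show ?thesis
    using wa_finite[OF e] ennreal_add_left_cancel_le[of A] unfolding A_def[symmetric] by (auto simp: add.commute less_top)
qed

text \<open>The numerator is nonnegative by the triangle inequality, so the truncated integrands
  increase as \<open>e\<close> decreases to 0 and the uniform bound survives.\<close>

theorem excess_integral: "(\<integral>\<^sup>+s. \<integral>\<^sup>+t. \<integral>\<^sup>+u. w s t u \<partial>lborel \<partial>lborel \<partial>lborel) \<le> ennreal (2 * T * L)"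
proof -
  have we_mono: "we e s t u \<le> we d s t u" if "d \<le> e" for d e s t u
  proof -
    have "0 \<le> (\<rho> s t + \<rho> t u - \<rho> s u) / (u - s) ^ 3" if "inside s t u"
      using that triangle[of s u t] by (intro divide_nonneg_nonneg) (auto simp: inside_def)
    then show ?thesis using that by (auto simp: we_def intro!: ennreal_leI)
  qed
  have mono: "1 / (real (Suc n) + 1) \<le> 1 / (real n + 1)" for n by (intro divide_left_mono) auto
  let ?f = "\<lambda>n. we (1 / (real n + 1))"
  have inc: "?f n s t u \<le> ?f (Suc n) s t u" for n s t u by (rule we_mono[OF mono])
  have lim: "w s t u = (SUP n. ?f n s t u)" for s t u
  proof (rule antisym)
    show "w s t u \<le> (SUP n. ?f n s t u)"
    proof (cases "inside s t u")
      case True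
      then have "0 < u - s" by (simp add: inside_def)
      then obtain n where "inverse (real (Suc n)) < u - s" using reals_Archimedean by blast
      then have "w s t u = ?f n s t u" using True by (simp add: w_def we_def inverse_eq_divide add.commute)
      then show ?thesis by (rule ord_eq_le_trans) (rule SUP_upper[OF UNIV_I, of "\<lambda>n. ?f n s t u"])
    qed (simp add: w_def)
    have "0 \<le> (\<rho> s t + \<rho> t u - \<rho> s u) / (u - s) ^ 3" if "inside s t u"
      using that triangle[of s u t] by (intro divide_nonneg_nonneg) (auto simp: inside_def)
    then show "(SUP n. ?f n s t u) \<le> w s t u"
      by (intro SUP_least) (auto simp: w_def we_def)
  qed
  have 1: "(\<integral>\<^sup>+u. w s t u \<partial>lborel) = (SUP n. \<integral>\<^sup>+u. ?f n s t u \<partial>lborel)" for s t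
    unfolding lim
  proof (rule nn_integral_monotone_convergence_SUP)
    show "incseq (\<lambda>n. ?f n s t)" by (intro incseq_SucI le_funI inc)
  qed measurable
  have 2: "(\<integral>\<^sup>+t. \<integral>\<^sup>+u. w s t u \<partial>lborel \<partial>lborel) = (SUP n. \<integral>\<^sup>+t. \<integral>\<^sup>+u. ?f n s t u \<partial>lborel \<partial>lborel)" for s
    unfolding 1
  proof (rule nn_integral_monotone_convergence_SUP)
    show "incseq (\<lambda>n t. \<integral>\<^sup>+u. ?f n s t u \<partial>lborel)" by (intro incseq_SucI le_funI nn_integral_mono inc)
  qed measurable
  have "(\<integral>\<^sup>+s. \<integral>\<^sup>+t. \<integral>\<^sup>+u. w s t u \<partial>lborel \<partial>lborel \<partial>lborel) = (SUP n. \<integral>\<^sup>+s. \<integral>\<^sup>+t. \<integral>\<^sup>+u. ?f n s t u \<partial>lborel \<partial>lborel \<partial>lborel)"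
    unfolding 2
  proof (rule nn_integral_monotone_convergence_SUP)
    show "incseq (\<lambda>n s. \<integral>\<^sup>+t. \<integral>\<^sup>+u. ?f n s t u \<partial>lborel \<partial>lborel)" by (intro incseq_SucI le_funI nn_integral_mono inc)
  qed measurable
  also have "\<dots> \<le> ennreal (2 * T * L)" by (intro SUP_least we_bound) simp
  finally show ?thesis .
qed

end

section \<open>Charts\<close>

text \<open>McShane's formula: the infimum of the cones with slope \<open>c\<close> over the given
  values.\<close>

lemma mcshane_extension:
  fixes g :: "'b::metric_space \<Rightarrow> real"
  assumes A: "A \<noteq> {}" and c: "0 \<le> c" and g: "\<And>x y. x \<in> A \<Longrightarrow> y \<in> A \<Longrightarrow> \<bar>g x - g y\<bar> \<le> c * dist x y"
  obtains G where "\<And>x. x \<in> A \<Longrightarrow> G x = g x" "\<And>x y. \<bar>G x - G y\<bar> \<le> c * dist x y"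
proof -
  define G where "G x = Inf ((\<lambda>a. g a + c * dist a x) ` A)" for x
  have lower: "g b - c * dist b x \<le> g a + c * dist a x" if "a \<in> A" "b \<in> A" for a b x
  proof -
    have "c * dist b a \<le> c * (dist b x + dist a x)" by (intro mult_left_mono c dist_triangle2)
    then show ?thesis using g[OF that(2,1)] unfolding distrib_left by linarith
  qed
  have bdd: "bdd_below ((\<lambda>a. g a + c * dist a x) ` A)" for x
  proof -
    obtain b where "b \<in> A" using A by blast
    then show ?thesis by (intro bdd_belowI2[of _ "g b - c * dist b x"] lower)
  qed
  have le: "G x \<le> g a + c * dist a x" if "a \<in> A" for a x
    unfolding G_def by (rule cInf_lower[OF imageI[OF that] bdd])
  have step: "G x \<le> G y + c * dist x y" for x y
  proof -
    have "G x - c * dist x y \<le> G y" unfolding G_def[of y]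
    proof (rule cInf_greatest, use A in simp, elim imageE)
      fix v a assume a: "v = g a + c * dist a y" "a \<in> A"
      have "c * dist a x \<le> c * (dist a y + dist x y)" by (intro mult_left_mono c dist_triangle2)
      then show "G x - c * dist x y \<le> v" using le[OF a(2), of x] a(1) unfolding distrib_left by linarith
    qed
    then show ?thesis by simp
  qed
  show thesis
  proof (rule that[of G])
    fix x assume x: "x \<in> A"
    have "g x \<le> G x" unfolding G_def by (rule cInf_greatest) (use A lower[OF _ x, of _ x] in auto)
    then show "G x = g x" using le[OF x, of x] by simp
  next
    fix x y show "\<bar>G x - G y\<bar> \<le> c * dist x y" using step[of x y] step[of y x] by (simp add: dist_commute abs_le_iff)
  qed
qed

lemma (in line_pseudometric) permuted_integrals:
  "(\<integral>\<^sup>+s. \<integral>\<^sup>+t. \<integral>\<^sup>+u. w s u t \<partial>lborel \<partial>lborel \<partial>lborel) = (\<integral>\<^sup>+s. \<integral>\<^sup>+t. \<integral>\<^sup>+u. w s t u \<partial>lborel \<partial>lborel \<partial>lborel)"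
  "(\<integral>\<^sup>+s. \<integral>\<^sup>+t. \<integral>\<^sup>+u. w t s u \<partial>lborel \<partial>lborel \<partial>lborel) = (\<integral>\<^sup>+s. \<integral>\<^sup>+t. \<integral>\<^sup>+u. w s t u \<partial>lborel \<partial>lborel \<partial>lborel)"
  "(\<integral>\<^sup>+s. \<integral>\<^sup>+t. \<integral>\<^sup>+u. w t u s \<partial>lborel \<partial>lborel \<partial>lborel) = (\<integral>\<^sup>+s. \<integral>\<^sup>+t. \<integral>\<^sup>+u. w s t u \<partial>lborel \<partial>lborel \<partial>lborel)"
  "(\<integral>\<^sup>+s. \<integral>\<^sup>+t. \<integral>\<^sup>+u. w u s t \<partial>lborel \<partial>lborel \<partial>lborel) = (\<integral>\<^sup>+s. \<integral>\<^sup>+t. \<integral>\<^sup>+u. w s t u \<partial>lborel \<partial>lborel \<partial>lborel)"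
  "(\<integral>\<^sup>+s. \<integral>\<^sup>+t. \<integral>\<^sup>+u. w u t s \<partial>lborel \<partial>lborel \<partial>lborel) = (\<integral>\<^sup>+s. \<integral>\<^sup>+t. \<integral>\<^sup>+u. w s t u \<partial>lborel \<partial>lborel \<partial>lborel)"
proof -
  show 1: "(\<integral>\<^sup>+s. \<integral>\<^sup>+t. \<integral>\<^sup>+u. w s u t \<partial>lborel \<partial>lborel \<partial>lborel) = (\<integral>\<^sup>+s. \<integral>\<^sup>+t. \<integral>\<^sup>+u. w s t u \<partial>lborel \<partial>lborel \<partial>lborel)"
    by (intro nn_integral_cong lborel_pair.Fubini') measurable
  show 2: "(\<integral>\<^sup>+s. \<integral>\<^sup>+t. \<integral>\<^sup>+u. w t s u \<partial>lborel \<partial>lborel \<partial>lborel) = (\<integral>\<^sup>+s. \<integral>\<^sup>+t. \<integral>\<^sup>+u. w s t u \<partial>lborel \<partial>lborel \<partial>lborel)"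
    by (rule lborel_pair.Fubini') measurable
  have "(\<integral>\<^sup>+s. \<integral>\<^sup>+t. \<integral>\<^sup>+u. w t u s \<partial>lborel \<partial>lborel \<partial>lborel) = (\<integral>\<^sup>+t. \<integral>\<^sup>+s. \<integral>\<^sup>+u. w t u s \<partial>lborel \<partial>lborel \<partial>lborel)"
    by (rule lborel_pair.Fubini') measurable
  with 1 show "(\<integral>\<^sup>+s. \<integral>\<^sup>+t. \<integral>\<^sup>+u. w t u s \<partial>lborel \<partial>lborel \<partial>lborel) = (\<integral>\<^sup>+s. \<integral>\<^sup>+t. \<integral>\<^sup>+u. w s t u \<partial>lborel \<partial>lborel \<partial>lborel)"
    by simp
  have "(\<integral>\<^sup>+s. \<integral>\<^sup>+t. \<integral>\<^sup>+u. w u s t \<partial>lborel \<partial>lborel \<partial>lborel) = (\<integral>\<^sup>+s. \<integral>\<^sup>+u. \<integral>\<^sup>+t. w u s t \<partial>lborel \<partial>lborel \<partial>lborel)"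
    by (intro nn_integral_cong lborel_pair.Fubini') measurable
  with 2 show "(\<integral>\<^sup>+s. \<integral>\<^sup>+t. \<integral>\<^sup>+u. w u s t \<partial>lborel \<partial>lborel \<partial>lborel) = (\<integral>\<^sup>+s. \<integral>\<^sup>+t. \<integral>\<^sup>+u. w s t u \<partial>lborel \<partial>lborel \<partial>lborel)"
    by simp
  have "(\<integral>\<^sup>+s. \<integral>\<^sup>+t. \<integral>\<^sup>+u. w u t s \<partial>lborel \<partial>lborel \<partial>lborel) = (\<integral>\<^sup>+s. \<integral>\<^sup>+u. \<integral>\<^sup>+t. w u t s \<partial>lborel \<partial>lborel \<partial>lborel)"
    by (intro nn_integral_cong lborel_pair.Fubini') measurable
  also have "\<dots> = (\<integral>\<^sup>+u. \<integral>\<^sup>+s. \<integral>\<^sup>+t. w u t s \<partial>lborel \<partial>lborel \<partial>lborel)"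
    by (rule lborel_pair.Fubini') measurable
  finally show "(\<integral>\<^sup>+s. \<integral>\<^sup>+t. \<integral>\<^sup>+u. w u t s \<partial>lborel \<partial>lborel \<partial>lborel) = (\<integral>\<^sup>+s. \<integral>\<^sup>+t. \<integral>\<^sup>+u. w s t u \<partial>lborel \<partial>lborel \<partial>lborel)"
    using 1 by simp
qed

text \<open>\<open>G\<close> is Lipschitz on all of X, which makes it Borel; its inverse is
  controlled only on \<open>F\<close>.\<close>

locale chart =
  fixes F :: "'a::metric_space set" and G :: "'a \<Rightarrow> real" and c L T :: real
  assumes closedF: "closed F" and Fne: "F \<noteq> {}" and c: "0 < c" and L: "0 \<le> L"
    and Glip: "\<And>x y. \<bar>G x - G y\<bar> \<le> c * dist x y"
    and Ginv: "\<And>x y. x \<in> F \<Longrightarrow> y \<in> F \<Longrightarrow> dist x y \<le> L * \<bar>G x - G y\<bar>"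
    and GT: "\<And>x. x \<in> F \<Longrightarrow> \<bar>G x\<bar> \<le> T"
begin

lemma G_measurable: "G \<in> borel_measurable borel"
proof (rule borel_measurable_continuous_onI, rule lipschitz_on_continuous_on)
  show "c-lipschitz_on UNIV G" using c Glip by (intro lipschitz_onI) (auto simp: dist_real_def)
qed

lemma inj: "inj_on G F"
proof (rule inj_onI)
  fix x y assume "x \<in> F" "y \<in> F" "G x = G y"
  then show "x = y" using Ginv[of x y] by simp
qed

text \<open>The part of \<open>F\<close> over a Borel set \<open>B\<close> is contained in the image
  of \<open>B\<close> under the \<open>L\<close>-Lipschitz inverse, so its measure is at most
  \<open>L\<close> times that of \<open>B\<close>. Thus an iterated integral over \<open>F\<close>
  moves to the line one variable at a time, innermost first, without Tonelli on X.\<close>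

lemma pushforward_le:
  assumes [measurable]: "\<psi> \<in> borel_measurable borel"
  shows "(\<integral>\<^sup>+x\<in>F. \<psi> (G x) \<partial>hausdorff1) \<le> ennreal L * (\<integral>\<^sup>+t. \<psi> t \<partial>lborel)"
proof -
  have F: "F \<in> sets borel" using closedF by simp
  note [measurable] = G_measurable
  define f where "f = inv_into F G"
  have f: "L-lipschitz_on (G ` F) f"
    using Ginv L by (intro lipschitz_onI) (auto simp: f_def inv_into_f_f[OF inj] dist_real_def)
  have "emeasure (distr (hres F) borel G) B \<le> emeasure (scale_measure (ennreal L) lborel) B" if B: "B \<in> sets borel" for B
  proof -
    have lm: "B \<inter> {-T..T} \<in> lmeasurable"
      by (rule bounded_set_imp_lmeasurable) (use B in \<open>auto intro: bounded_subset[OF bounded_closed_interval]\<close>)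
    have "G -` B \<in> sets borel" using measurable_sets[OF G_measurable B] by simp
    then have "emeasure (distr (hres F) borel G) B = hausdorff1_outer (F \<inter> G -` B)"
      using B F by (subst emeasure_distr) (auto simp: emeasure_hres measurable_cong_sets[OF sets_hres refl] G_measurable)
    also have "F \<inter> G -` B \<subseteq> f ` (G ` F \<inter> (B \<inter> {-T..T}))"
    proof
      fix x assume x: "x \<in> F \<inter> G -` B"
      then have "f (G x) = x" "G x \<in> G ` F \<inter> (B \<inter> {-T..T})" using GT[of x] by (auto simp: f_def inv_into_f_f[OF inj] abs_le_iff)
      then show "x \<in> f ` (G ` F \<inter> (B \<inter> {-T..T}))" by (metis imageI)
    qed
    then have "hausdorff1_outer (F \<inter> G -` B) \<le> hausdorff1_outer (f ` (G ` F \<inter> (B \<inter> {-T..T})))" by (rule hausdorff1_outer_mono)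
    also have "\<dots> \<le> ennreal (L * measure lebesgue (B \<inter> {-T..T}))"
      by (rule hausdorff1_lipschitz_le[OF f lm, of "-T" T]) auto
    also have "\<dots> = ennreal L * emeasure lebesgue (B \<inter> {-T..T})"
      using L lm by (simp add: ennreal_mult emeasure_eq_measure2)
    also have "\<dots> = ennreal L * emeasure lborel (B \<inter> {-T..T})" using B by (subst emeasure_completion) auto
    also have "\<dots> \<le> ennreal L * emeasure lborel B" using B by (intro mult_left_mono emeasure_mono) auto
    finally show ?thesis by simp
  qed
  then have le: "distr (hres F) borel G \<le> scale_measure (ennreal L) lborel"
    by (subst le_measure) (auto simp: le_fun_def)
  have "(\<integral>\<^sup>+x\<in>F. \<psi> (G x) \<partial>hausdorff1) = (\<integral>\<^sup>+x. \<psi> (G x) \<partial>hres F)"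
    by (rule nn_integral_hres[OF F, symmetric]) measurable
  also have "\<dots> = (\<integral>\<^sup>+t. \<psi> t \<partial>distr (hres F) borel G)"
    by (subst nn_integral_distr) (auto simp: measurable_cong_sets[OF sets_hres refl] G_measurable)
  also have "\<dots> \<le> (\<integral>\<^sup>+t. \<psi> t \<partial>scale_measure (ennreal L) lborel)" by (rule nn_integral_mono_measure[OF _ le]) simp
  also have "\<dots> = ennreal L * (\<integral>\<^sup>+t. \<psi> t \<partial>lborel)" by (rule nn_integral_scale_measure) simp
  finally show ?thesis .
qed

definition \<Phi> :: "(real \<Rightarrow> real) set" where
  "\<Phi> = {\<phi>. (\<forall>s t. \<bar>\<phi> s - \<phi> t\<bar> \<le> L * \<bar>s - t\<bar>) \<and> (\<forall>x\<in>F. \<forall>y\<in>F. \<bar>\<phi> (G x) - \<phi> (G y)\<bar> \<le> dist x y)}"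

text \<open>The largest pseudometric on the line that is bounded by \<open>L\<close> times the distance and on \<open>G ` F\<close> by the
  metric of \<open>F\<close>; on \<open>G ` F\<close> it coincides with the latter.\<close>

definition \<rho> :: "real \<Rightarrow> real \<Rightarrow> real" where "\<rho> s t = (SUP \<phi>\<in>\<Phi>. \<bar>\<phi> s - \<phi> t\<bar>)"

lemma \<Phi>_ne: "\<Phi> \<noteq> {}"
  using L by (auto simp: \<Phi>_def intro!: exI[of _ "\<lambda>_. 0"])

lemma \<rho>_upper: "\<phi> \<in> \<Phi> \<Longrightarrow> \<bar>\<phi> s - \<phi> t\<bar> \<le> \<rho> s t"
  unfolding \<rho>_def by (rule cSUP_upper) (auto simp: \<Phi>_def intro!: bdd_aboveI2[of _ _ "L * \<bar>s - t\<bar>"])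

lemma \<rho>_least: "(\<And>\<phi>. \<phi> \<in> \<Phi> \<Longrightarrow> \<bar>\<phi> s - \<phi> t\<bar> \<le> b) \<Longrightarrow> \<rho> s t \<le> b"
  unfolding \<rho>_def by (rule cSUP_least[OF \<Phi>_ne])

lemma \<rho>_G: assumes x: "x \<in> F" and y: "y \<in> F" shows "\<rho> (G x) (G y) = dist x y"
proof (rule antisym)
  show "\<rho> (G x) (G y) \<le> dist x y" by (rule \<rho>_least) (use x y in \<open>auto simp: \<Phi>_def\<close>)
  define f where "f = inv_into F G"
  have f: "f (G z) = z" if "z \<in> F" for z using that by (simp add: f_def inv_into_f_f[OF inj])
  have "\<bar>dist (f s) x - dist (f t) x\<bar> \<le> L * dist s t" if st: "s \<in> G ` F" "t \<in> G ` F" for s t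
  proof -
    obtain a b where ab: "a \<in> F" "b \<in> F" "s = G a" "t = G b" using st by auto
    have "\<bar>dist a x - dist b x\<bar> \<le> dist a b" using dist_triangle[of a x b] dist_triangle[of b x a] by (simp add: dist_commute abs_le_iff)
    also have "\<dots> \<le> L * dist s t" using Ginv[OF ab(1,2)] ab by (simp add: dist_real_def)
    finally show ?thesis using ab f by simp
  qed
  then obtain \<phi> where \<phi>: "\<And>s. s \<in> G ` F \<Longrightarrow> \<phi> s = dist (f s) x" "\<And>s t. \<bar>\<phi> s - \<phi> t\<bar> \<le> L * dist s t"
    using mcshane_extension[of "G ` F" L "\<lambda>s. dist (f s) x"] Fne L by blast
  have val: "\<phi> (G z) = dist z x" if "z \<in> F" for z using \<phi>(1)[of "G z"] f that by simp
  have "\<phi> \<in> \<Phi>"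
    unfolding \<Phi>_def
  proof (intro CollectI conjI allI ballI)
    show "\<bar>\<phi> s - \<phi> t\<bar> \<le> L * \<bar>s - t\<bar>" for s t using \<phi>(2)[of s t] by (simp add: dist_real_def)
    fix a b assume "a \<in> F" "b \<in> F"
    then show "\<bar>\<phi> (G a) - \<phi> (G b)\<bar> \<le> dist a b"
      using dist_triangle[of a x b] dist_triangle[of b x a] by (simp add: val dist_commute abs_le_iff)
  qed
  from \<rho>_upper[OF this, of "G x" "G y"] show "dist x y \<le> \<rho> (G x) (G y)" using x y by (simp add: val dist_commute)
qed

sublocale R: line_pseudometric \<rho> L T
proof
  show "0 \<le> L" by (rule L)
  show "0 \<le> T" using GT Fne by force
  show nn: "0 \<le> \<rho> s t" for s t
  proof -
    obtain \<phi> where "\<phi> \<in> \<Phi>" using \<Phi>_ne by blast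
    from \<rho>_upper[OF this, of s t] show ?thesis by linarith
  qed
  show tri: "\<rho> s u \<le> \<rho> s t + \<rho> t u" for s t u
  proof (rule \<rho>_least)
    fix \<phi> assume \<phi>: "\<phi> \<in> \<Phi>"
    show "\<bar>\<phi> s - \<phi> u\<bar> \<le> \<rho> s t + \<rho> t u" using \<rho>_upper[OF \<phi>, of s t] \<rho>_upper[OF \<phi>, of t u] by linarith
  qed
  show lip: "\<rho> s t \<le> L * \<bar>s - t\<bar>" for s t by (rule \<rho>_least) (auto simp: \<Phi>_def)
  have four: "\<rho> s t \<le> \<rho> s' t' + L * dist s s' + L * dist t t'" for s t s' t'
    using tri[of s t s'] tri[of s' t t'] lip[of s s'] lip[of t' t] by (simp add: dist_real_def abs_minus_commute)
  have "(2 * L)-lipschitz_on UNIV (\<lambda>p. \<rho> (fst p) (snd p))"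
  proof (rule lipschitz_onI)
    fix p q :: "real \<times> real"
    have "\<bar>\<rho> (fst p) (snd p) - \<rho> (fst q) (snd q)\<bar> \<le> L * dist (fst p) (fst q) + L * dist (snd p) (snd q)"
      using four[of "fst p" "snd p" "fst q" "snd q"] four[of "fst q" "snd q" "fst p" "snd p"] by (simp add: dist_commute abs_le_iff)
    also have "\<dots> \<le> L * dist p q + L * dist p q" by (intro add_mono mult_left_mono dist_fst_le dist_snd_le L)
    finally show "dist (\<rho> (fst p) (snd p)) (\<rho> (fst q) (snd q)) \<le> 2 * L * dist p q" by (simp add: dist_real_def)
  qed (use L in simp)
  then show "continuous_on UNIV (\<lambda>p. \<rho> (fst p) (snd p))" by (rule lipschitz_on_continuous_on)
qed

text \<open>The minimum in the excess is bounded by the order in which \<open>y\<close> is in the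
  middle, and the diameter is at least \<open>(G z - G x) / c\<close>; hence the factor
  \<open>c ^ 3\<close>.\<close>

lemma crv_ordered_le:
  assumes F: "x \<in> F" "y \<in> F" "z \<in> F" and ord: "G x < G y" "G y < G z"
  shows "crv x y z \<le> ennreal (c ^ 3) * R.w (G x) (G y) (G z)"
proof -
  define N where "N = dist x y + dist y z - dist x z"
  have N: "0 \<le> N" "triangle_excess x y z \<le> N" using dist_triangle[of x z y] by (auto simp: N_def triangle_excess_eq dist_commute)
  have pos: "0 < (G z - G x) / c" using ord c by simp
  have "(G z - G x) / c \<le> dist x z" using Glip[of z x] ord c by (simp add: field_simps dist_commute)
  also have "\<dots> \<le> diameter {x, y, z}" by (simp add: diameter_triple)
  finally have d: "((G z - G x) / c) ^ 3 \<le> diameter {x, y, z} ^ 3" using pos by (intro power_mono) auto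
  have "triangle_excess x y z / diameter {x, y, z} ^ 3 \<le> N / ((G z - G x) / c) ^ 3"
    by (rule frac_le[OF N _ d]) (use pos in simp)
  also have "\<dots> = c ^ 3 * (N / (G z - G x) ^ 3)" by (simp add: power_divide)
  finally have "crv x y z \<le> ennreal (c ^ 3 * (N / (G z - G x) ^ 3))" unfolding crv_def by (rule ennreal_leI)
  also have "\<dots> = ennreal (c ^ 3) * ennreal (N / (G z - G x) ^ 3)" using c N(1) ord by (intro ennreal_mult) auto
  also have "ennreal (N / (G z - G x) ^ 3) = R.w (G x) (G y) (G z)"
    using ord GT[OF F(1)] GT[OF F(3)] by (simp add: R.w_def R.inside_def \<rho>_G F N_def abs_le_iff)
  finally show ?thesis .
qed

lemma crv_le:
  assumes F: "x \<in> F" "y \<in> F" "z \<in> F"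
  shows "crv x y z \<le> ennreal (c ^ 3) * (R.w (G x) (G y) (G z) + R.w (G x) (G z) (G y) + R.w (G y) (G x) (G z)
     + R.w (G y) (G z) (G x) + R.w (G z) (G x) (G y) + R.w (G z) (G y) (G x))"
proof (cases "x = y \<or> y = z \<or> x = z")
  case False
  then have "G x \<noteq> G y" "G y \<noteq> G z" "G x \<noteq> G z" using F inj by (auto dest: inj_onD)
  then consider "G x < G y" "G y < G z" | "G x < G z" "G z < G y" | "G y < G x" "G x < G z"
    | "G y < G z" "G z < G x" | "G z < G x" "G x < G y" | "G z < G y" "G y < G x" by linarith
  then show ?thesis
  proof cases
    case 1
    show ?thesis by (rule order_trans[OF crv_ordered_le[OF F 1]], rule mult_left_mono) (auto simp: add_increasing2 add_increasing)
  next
    case 2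
    have "crv x y z = crv x z y" by (rule crv_commute)
    also note crv_ordered_le[OF F(1,3,2) 2]
    finally show ?thesis by (rule order_trans, intro mult_left_mono) (auto simp: add_increasing2 add_increasing)
  next
    case 3
    have "crv x y z = crv y x z" by (rule crv_commute)
    also note crv_ordered_le[OF F(2,1,3) 3]
    finally show ?thesis by (rule order_trans, intro mult_left_mono) (auto simp: add_increasing2 add_increasing)
  next
    case 4
    have "crv x y z = crv y z x" by (metis crv_commute)
    also note crv_ordered_le[OF F(2,3,1) 4]
    finally show ?thesis by (rule order_trans, intro mult_left_mono) (auto simp: add_increasing2 add_increasing)
  next
    case 5
    have "crv x y z = crv z x y" by (metis crv_commute)
    also note crv_ordered_le[OF F(3,1,2) 5]
    finally show ?thesis by (rule order_trans, intro mult_left_mono) (auto simp: add_increasing2 add_increasing)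
  next
    case 6
    have "crv x y z = crv z y x" by (metis crv_commute)
    also note crv_ordered_le[OF F(3,2,1) 6]
    finally show ?thesis by (rule order_trans, intro mult_left_mono) (auto simp: add_increasing2 add_increasing)
  qed
qed auto

text \<open>\<open>crv\<close> is symmetric while \<open>R.w\<close> lives on ordered triples, hence
  six terms. On the line Tonelli applies, and all six integrals coincide.\<close>

theorem beta_finite: "beta F < \<infinity>"
proof -
  define \<Psi> where "\<Psi> s t u = ennreal (c ^ 3) * (R.w s t u + R.w s u t + R.w t s u + R.w t u s + R.w u s t + R.w u t s)" for s t u
  have [measurable (raw)]: "(\<lambda>x. \<Psi> (f x) (g x) (h x)) \<in> borel_measurable M"
    if [measurable]: "f \<in> borel_measurable M" "g \<in> borel_measurable M" "h \<in> borel_measurable M" for f g h :: "_ \<Rightarrow> real" and M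
    unfolding \<Psi>_def by measurable
  define I3 where "I3 s t = ennreal L * (\<integral>\<^sup>+u. \<Psi> s t u \<partial>lborel)" for s t
  define I2 where "I2 s = ennreal L * (\<integral>\<^sup>+t. I3 s t \<partial>lborel)" for s
  define J where "J = (\<integral>\<^sup>+s. \<integral>\<^sup>+t. \<integral>\<^sup>+u. R.w s t u \<partial>lborel \<partial>lborel \<partial>lborel)"
  have m3: "\<Psi> s t \<in> borel_measurable borel" for s t by measurable
  have m2: "I3 s \<in> borel_measurable borel" for s unfolding I3_def by measurable
  have m1: "I2 \<in> borel_measurable borel" unfolding I2_def I3_def by measurable
  have "beta F \<le> (\<integral>\<^sup>+x\<in>F. (\<integral>\<^sup>+y\<in>F. (\<integral>\<^sup>+z\<in>F. \<Psi> (G x) (G y) (G z) \<partial>hausdorff1) \<partial>hausdorff1) \<partial>hausdorff1)"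
  proof -
    have 1: "(\<integral>\<^sup>+z\<in>F. crv x y z \<partial>hausdorff1) \<le> (\<integral>\<^sup>+z\<in>F. \<Psi> (G x) (G y) (G z) \<partial>hausdorff1)" if "x \<in> F" "y \<in> F" for x y
      by (intro nn_integral_mono) (use crv_le that in \<open>auto simp: \<Psi>_def indicator_def\<close>)
    have 2: "(\<integral>\<^sup>+y\<in>F. (\<integral>\<^sup>+z\<in>F. crv x y z \<partial>hausdorff1) \<partial>hausdorff1) \<le> (\<integral>\<^sup>+y\<in>F. (\<integral>\<^sup>+z\<in>F. \<Psi> (G x) (G y) (G z) \<partial>hausdorff1) \<partial>hausdorff1)" if "x \<in> F" for x
      by (intro nn_integral_mono) (use 1 that in \<open>auto simp: indicator_def\<close>)
    show ?thesis unfolding beta_eq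
      by (intro nn_integral_mono) (use 2 in \<open>auto simp: indicator_def\<close>)
  qed
  also have "\<dots> \<le> (\<integral>\<^sup>+x\<in>F. (\<integral>\<^sup>+y\<in>F. I3 (G x) (G y) \<partial>hausdorff1) \<partial>hausdorff1)"
    unfolding I3_def by (intro nn_integral_mono mult_right_mono pushforward_le m3) simp_all
  also have "\<dots> \<le> (\<integral>\<^sup>+x\<in>F. I2 (G x) \<partial>hausdorff1)"
    unfolding I2_def by (intro nn_integral_mono mult_right_mono pushforward_le m2) simp_all
  also have "\<dots> \<le> ennreal L * (\<integral>\<^sup>+s. I2 s \<partial>lborel)"
    by (rule pushforward_le[OF m1])
  also have "(\<integral>\<^sup>+s. I2 s \<partial>lborel) = ennreal L * (ennreal L * (\<integral>\<^sup>+s. \<integral>\<^sup>+t. \<integral>\<^sup>+u. \<Psi> s t u \<partial>lborel \<partial>lborel \<partial>lborel))"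
    unfolding I2_def I3_def by (simp add: nn_integral_cmult)
  also have "(\<integral>\<^sup>+s. \<integral>\<^sup>+t. \<integral>\<^sup>+u. \<Psi> s t u \<partial>lborel \<partial>lborel \<partial>lborel) = ennreal (c ^ 3) * (J + J + J + J + J + J)"
    unfolding \<Psi>_def J_def by (simp add: nn_integral_cmult nn_integral_add R.permuted_integrals)
  also have "ennreal L * (ennreal L * (ennreal L * \<dots>)) < \<infinity>"
  proof -
    have "J < \<infinity>" unfolding J_def by (rule le_less_trans[OF R.excess_integral]) simp
    then show ?thesis by (simp add: ennreal_mult_less_top)
  qed
  finally show ?thesis .
qed

end

section \<open>Covering by sets of finite curvature\<close>

lemma beta_null:
  assumes "Z \<in> sets borel" "hausdorff1_outer Z = 0" shows "beta Z = 0"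
  unfolding beta_eq using assms by (intro nn_integral_null_set) (auto simp: null_sets_def emeasure_hausdorff1)

text \<open>\<open>A\<close> is arbitrary, so its image need not be Borel; the closure is. Both
  Lipschitz inequalities, written with an extension of the inverse to X, are closed conditions and
  persist on the closure.\<close>

lemma beta_closure_bilipschitz:
  fixes f :: "real \<Rightarrow> 'a::metric_space"
  assumes f: "L-lipschitz_on A f" and c: "0 < c" and inv: "\<And>x y. x \<in> A \<Longrightarrow> y \<in> A \<Longrightarrow> \<bar>x - y\<bar> \<le> c * dist (f x) (f y)"
    and T: "A \<subseteq> {-T..T}"
  shows "beta (closure (f ` A)) < \<infinity>"
proof (cases "A = {}")
  case True
  then show ?thesis by (simp add: beta_null)
next
  case False
  have inj: "inj_on f A" using inv by (intro inj_onI) fastforce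
  define g where "g = inv_into A f"
  have g: "g (f x) = x" if "x \<in> A" for x using that by (simp add: g_def inv_into_f_f[OF inj])
  have "\<bar>g u - g v\<bar> \<le> c * dist u v" if "u \<in> f ` A" "v \<in> f ` A" for u v
  proof -
    from that obtain x y where "x \<in> A" "y \<in> A" "u = f x" "v = f y" by auto
    then show ?thesis using g inv by simp
  qed
  then obtain G where G: "\<And>u. u \<in> f ` A \<Longrightarrow> G u = g u" "\<And>u v. \<bar>G u - G v\<bar> \<le> c * dist u v"
    using mcshane_extension[of "f ` A" c g] False c by (metis image_is_empty less_imp_le)
  have Gf: "G (f x) = x" if "x \<in> A" for x using G(1) g that by simp
  have cont: "continuous_on UNIV G"
    by (rule lipschitz_on_continuous_on[of c]) (use c G(2) in \<open>auto intro!: lipschitz_onI simp: dist_real_def\<close>)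
  have contc: "continuous_on S (\<lambda>x. G (h x))" if "continuous_on S h" for S and h :: "'c::topological_space \<Rightarrow> 'a"
    using continuous_on_compose2[OF cont that] by simp
  interpret chart "closure (f ` A)" G c L T
  proof
    show "closed (closure (f ` A))" by simp
    show "closure (f ` A) \<noteq> {}" using False by simp
    show "0 < c" by fact
    show "0 \<le> L" using f by (rule lipschitz_on_nonneg)
    show "\<bar>G x - G y\<bar> \<le> c * dist x y" for x y by (rule G)
    show "\<bar>G x\<bar> \<le> T" if "x \<in> closure (f ` A)" for x
    proof -
      have "closure (f ` A) \<subseteq> {x. \<bar>G x\<bar> \<le> T}"
        using T Gf by (intro closure_minimal closed_Collect_le continuous_intros contc) (force simp: abs_le_iff)
      then show ?thesis using that by blast
    qed
    show "dist x y \<le> L * \<bar>G x - G y\<bar>" if "x \<in> closure (f ` A)" "y \<in> closure (f ` A)" for x y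
    proof -
      have "closure (f ` A \<times> f ` A) \<subseteq> {p. dist (fst p) (snd p) \<le> L * \<bar>G (fst p) - G (snd p)\<bar>}"
      proof (rule closure_minimal)
        show "f ` A \<times> f ` A \<subseteq> {p. dist (fst p) (snd p) \<le> L * \<bar>G (fst p) - G (snd p)\<bar>}"
          using lipschitz_onD[OF f] Gf by (auto simp: dist_real_def)
        show "closed {p. dist (fst p) (snd p) \<le> L * \<bar>G (fst p) - G (snd p)\<bar>}"
          by (intro closed_Collect_le continuous_intros contc)
      qed
      then show ?thesis using that unfolding closure_Times by auto
    qed
  qed
  show ?thesis by (rule beta_finite)
qed

text \<open>A point outside every \<open>R n\<close> has, for each \<open>n\<close>, a partner in
  \<open>E\<close> closer than \<open>1 / (n + 1)\<close> at which the difference quotient is below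
  \<open>1 / (n + 1)\<close>. Such points have a null image by
  \<open>hausdorff1_stationary_null\<close>.\<close>

lemma bilipschitz_pieces:
  fixes f :: "real \<Rightarrow> 'a::metric_space"
  assumes f: "L-lipschitz_on E f" and E: "E \<subseteq> {-T..T}"
  obtains A :: "nat \<times> int \<Rightarrow> real set" where "\<And>i. A i \<subseteq> E"
    "\<And>n j x y. x \<in> A (n, j) \<Longrightarrow> y \<in> A (n, j) \<Longrightarrow> \<bar>x - y\<bar> \<le> (real n + 1) * dist (f x) (f y)"
    "hausdorff1_outer (f ` (E - (\<Union>i. A i))) = 0"
proof -
  define R where "R n = {x\<in>E. \<forall>y\<in>E. \<bar>x - y\<bar> < 1 / (real n + 1) \<longrightarrow> \<bar>x - y\<bar> \<le> (real n + 1) * dist (f x) (f y)}" for n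
  \<comment> \<open>Half-open cells of length \<open>1 / (n + 1)\<close>: two points of one cell are
    strictly closer than that, so the local estimate in \<open>R n\<close> applies to both.\<close>
  define A where "A i = {x \<in> R (fst i). of_int (snd i) \<le> (real (fst i) + 1) * x \<and> (real (fst i) + 1) * x < of_int (snd i) + 1}" for i :: "nat \<times> int"
  show thesis
  proof (rule that[of A])
    show "A i \<subseteq> E" for i by (auto simp: A_def R_def)
    fix n j x y assume xy: "x \<in> A (n, j)" "y \<in> A (n, j)"
    have "(real n + 1) * \<bar>x - y\<bar> = \<bar>(real n + 1) * x - (real n + 1) * y\<bar>"
      unfolding right_diff_distrib[symmetric] by (simp add: abs_mult)
    also have "\<dots> < 1" using xy by (auto simp: A_def abs_less_iff)
    finally have "\<bar>x - y\<bar> < 1 / (real n + 1)" by (simp add: field_simps)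
    then show "\<bar>x - y\<bar> \<le> (real n + 1) * dist (f x) (f y)" using xy by (simp add: A_def R_def)
  next
    show "hausdorff1_outer (f ` (E - (\<Union>i. A i))) = 0"
    proof (rule hausdorff1_stationary_null[OF f E])
      fix x e assume x: "x \<in> E - (\<Union>i. A i)" and e: "0 < (e::real)"
      obtain n where "inverse (real (Suc n)) < e" using reals_Archimedean[OF e] by blast
      then have n: "1 / (real n + 1) < e" by (simp add: inverse_eq_divide add.commute)
      have "x \<notin> R n"
      proof
        assume "x \<in> R n"
        then have "x \<in> A (n, \<lfloor>(real n + 1) * x\<rfloor>)" unfolding A_def by (simp add: floor_correct)
        then show False using x by blast
      qed
      then obtain y where y: "y \<in> E" "\<bar>x - y\<bar> < 1 / (real n + 1)" "(real n + 1) * dist (f x) (f y) < \<bar>x - y\<bar>"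
        using x by (auto simp: R_def not_le)
      have "dist (f x) (f y) \<le> 1 / (real n + 1) * \<bar>x - y\<bar>" using y(3) by (simp add: field_simps)
      also have "\<dots> \<le> e * \<bar>x - y\<bar>" using n by (intro mult_right_mono) auto
      finally have "dist (f x) (f y) \<le> e * \<bar>x - y\<bar>" .
      moreover have "y \<noteq> x" using y(3) by auto
      ultimately show "\<exists>y\<in>E. y \<noteq> x \<and> \<bar>x - y\<bar> < e \<and> dist (f x) (f y) \<le> e * \<bar>x - y\<bar>"
        using y(1,2) n by (intro bexI[of _ y]) auto
    qed blast
  qed
qed

text \<open>The domain is cut to bounded intervals first, since both the variation argument and the
  charts need a finite \<open>T\<close>. The complement of the countably many closures is Borel and
  null, so it is one more admissible set, with \<open>beta\<close> equal to 0.\<close>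

lemma rectifiable_beta_cover:
  assumes "rectifiable_space TYPE('a::metric_space)"
  shows "\<exists>X :: nat \<Rightarrow> 'a set. (\<Union>i. X i) = UNIV \<and> (\<forall>i. X i \<in> sets borel) \<and> (\<forall>i. beta (X i) < \<infinity>)"
proof -
  obtain E L and f :: "real \<Rightarrow> 'a" where f: "L-lipschitz_on E f" and null: "hausdorff1_outer (UNIV - f ` E) = 0"
    using assms unfolding rectifiable_space_def by blast
  define EN where "EN N = E \<inter> {- real N..real N}" for N :: nat
  have fN: "L-lipschitz_on (EN N) f" for N by (rule lipschitz_on_subset[OF f]) (simp add: EN_def)
  have "\<forall>N. \<exists>A :: nat \<times> int \<Rightarrow> real set. (\<forall>i. A i \<subseteq> EN N) \<and>
    (\<forall>n j. \<forall>x\<in>A (n, j). \<forall>y\<in>A (n, j). \<bar>x - y\<bar> \<le> (real n + 1) * dist (f x) (f y)) \<and>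
    hausdorff1_outer (f ` (EN N - (\<Union>i. A i))) = 0"
  proof
    fix N
    have sub: "EN N \<subseteq> {- real N..real N}" by (simp add: EN_def)
    show "\<exists>A :: nat \<times> int \<Rightarrow> real set. (\<forall>i. A i \<subseteq> EN N) \<and>
      (\<forall>n j. \<forall>x\<in>A (n, j). \<forall>y\<in>A (n, j). \<bar>x - y\<bar> \<le> (real n + 1) * dist (f x) (f y)) \<and>
      hausdorff1_outer (f ` (EN N - (\<Union>i. A i))) = 0"
      by (rule bilipschitz_pieces[OF fN sub]) blast
  qed
  from choice[OF this] obtain A :: "nat \<Rightarrow> nat \<times> int \<Rightarrow> real set" where A: "\<And>N i. A N i \<subseteq> EN N"
    "\<And>N n j x y. x \<in> A N (n, j) \<Longrightarrow> y \<in> A N (n, j) \<Longrightarrow> \<bar>x - y\<bar> \<le> (real n + 1) * dist (f x) (f y)"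
    "\<And>N. hausdorff1_outer (f ` (EN N - (\<Union>i. A N i))) = 0" by blast
  define Y where "Y k = (case k of (N, i) \<Rightarrow> closure (f ` A N i))" for k
  have Yb: "beta (Y k) < \<infinity>" for k
  proof -
    obtain N n j where k: "k = (N, n, j)" by (cases k) auto
    have "A N (n, j) \<subseteq> {- real N..real N}" using A(1) by (auto simp: EN_def)
    from beta_closure_bilipschitz[OF lipschitz_on_subset[OF fN A(1)] _ A(2) this]
    show ?thesis unfolding Y_def k prod.case by simp
  qed
  define Z where "Z = UNIV - (\<Union>k. Y k)"
  have Z: "Z \<in> sets borel" unfolding Z_def Y_def
    by (intro sets.Diff sets.countable_UN' borel_closed) (auto split: prod.split)
  have piece: "f ` EN N \<subseteq> f ` (EN N - (\<Union>i. A N i)) \<union> (\<Union>k. Y k)" for N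
  proof -
    have "f ` A N i \<subseteq> (\<Union>k. Y k)" for i
      using closure_subset[of "f ` A N i"] UN_upper[of "(N, i)" UNIV Y] by (auto simp: Y_def)
    then show ?thesis by blast
  qed
  have "Z \<subseteq> (UNIV - f ` E) \<union> (\<Union>N. f ` (EN N - (\<Union>i. A N i)))"
  proof
    fix y assume y: "y \<in> Z"
    show "y \<in> (UNIV - f ` E) \<union> (\<Union>N. f ` (EN N - (\<Union>i. A N i)))"
    proof (cases "y \<in> f ` E")
      case True
      then obtain x where x: "x \<in> E" "y = f x" by blast
      obtain N where "\<bar>x\<bar> \<le> real N" using real_arch_simple by blast
      then have "y \<in> f ` EN N" using x by (auto simp: EN_def abs_le_iff)
      then have "y \<in> f ` (EN N - (\<Union>i. A N i)) \<union> (\<Union>k. Y k)" by (rule subsetD[OF piece])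
      moreover have "y \<notin> (\<Union>k. Y k)" using y unfolding Z_def by simp
      ultimately show ?thesis by (intro UnI2 UN_I[of N]) simp_all
    qed simp
  qed
  then have "hausdorff1_outer Z \<le> hausdorff1_outer (UNIV - f ` E) + hausdorff1_outer (\<Union>N. f ` (EN N - (\<Union>i. A N i)))"
    by (rule order_trans[OF hausdorff1_outer_mono hausdorff1_outer_Un])
  also have "\<dots> \<le> 0 + (\<Sum>N. hausdorff1_outer (f ` (EN N - (\<Union>i. A N i))))"
    unfolding null by (intro add_left_mono hausdorff1_outer_subadditive)
  finally have "hausdorff1_outer Z = 0" using A(3) by simp
  then have Zb: "beta Z = 0" by (rule beta_null[OF Z])
  \<comment> \<open>The option type adds the null set to the countable index set of the
    pieces.\<close>
  define X where "X n = (case (from_nat n :: (nat \<times> nat \<times> int) option) of None \<Rightarrow> Z | Some k \<Rightarrow> Y k)" for n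
  have "(\<Union>n. X n) = UNIV"
  proof -
    have eq: "U = UNIV" if "S \<subseteq> U" "UNIV - S \<subseteq> U" for S U :: "'a set" using that by blast
    show ?thesis
    proof (rule eq)
      show "(\<Union>k. Y k) \<subseteq> (\<Union>n. X n)"
      proof (rule UN_least)
        show "Y k \<subseteq> (\<Union>n. X n)" for k using UN_upper[of "to_nat (Some k)" UNIV X] by (simp add: X_def)
      qed
      show "UNIV - (\<Union>k. Y k) \<subseteq> (\<Union>n. X n)"
        using UN_upper[of "to_nat (None :: (nat \<times> nat \<times> int) option)" UNIV X] by (simp add: X_def Z_def)
    qed
  qed
  moreover have "X n \<in> sets borel" for n using Z by (auto simp: X_def Y_def split: option.split prod.split)
  moreover have "beta (X n) < \<infinity>" for n using Zb Yb by (auto simp: X_def split: option.split)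
  ultimately show ?thesis by blast
qed

theorem corollary1p10:
  shows "rectifiable_space TYPE('a::metric_space) \<longleftrightarrow>
    (\<exists>X :: nat \<Rightarrow> 'a set. (\<Union>i. X i) = UNIV \<and> (\<forall>i. X i \<in> sets borel) \<and> (\<forall>i. beta (X i) < \<infinity>))"
proof
  assume "\<exists>X :: nat \<Rightarrow> 'a set. (\<Union>i. X i) = UNIV \<and> (\<forall>i. X i \<in> sets borel) \<and> (\<forall>i. beta (X i) < \<infinity>)"
  then obtain X :: "nat \<Rightarrow> 'a set" where X: "(\<Union>i. X i) = UNIV" "\<And>i. X i \<in> sets borel" "\<And>i. beta (X i) < \<infinity>" by blast
  have "lipschitz_covered (\<Union>i. X i)" by (intro lipschitz_covered_UN lipschitz_covered_beta X)
  then show "rectifiable_space TYPE('a)" unfolding X(1) by (rule rectifiable_spaceI)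
qed (rule rectifiable_beta_cover)

end
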